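(* Let $C$ be a left Artinian coalgebra over a field (equivalently, $C^*$ is a left Noetherian algebra). Then the category of Noetherian left $C^*$-modules (equivalently, of finitely generated left $C^*$-modules) and the category of Artinian left $C$-comodules (equivalently, of finitely cogenerated left $C$-comodules) are in duality, i.e. they are contravariantly equivalent.
   Context: $C^*$ is the dual algebra with convolution product $(c^*d^* )(c)=c^*(c_1)d^*(c_2)$. A coalgebra $C$ is left Artinian if it is Artinian (descending chain condition on subcomodules) as a left $C$-comodule; this holds if and only if $C^*$ is left Noetherian. A $C$-comodule is finitely cogenerated if it embeds in $C^n$ for some positive integer $n$. Both categories are full subcategories of the category of left $C^*$-modules and of the category of left $C$-comodules, respectively. *)

theory Defs
  imports "HOL-Algebra.Module" "HOL-Algebra.Free_Abelian_Groups"
begin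

section \<open>Linear maps and tensor products of vector spaces\<close>

text \<open>A vector space over a field \<open>K\<close> is a HOL-Algebra \<^locale>\<open>module\<close> over \<open>K\<close>.\<close>

definition linear_map ::
  "('k, 'x) ring_scheme \<Rightarrow> ('k, 'v, 'y) module_scheme \<Rightarrow> ('k, 'w, 'z) module_scheme
    \<Rightarrow> ('v \<Rightarrow> 'w) \<Rightarrow> bool"
  where "linear_map K V W f \<longleftrightarrow>
    f \<in> carrier V \<rightarrow> carrier W \<and>
    (\<forall>x\<in>carrier V. \<forall>y\<in>carrier V. f (x \<oplus>\<^bsub>V\<^esub> y) = f x \<oplus>\<^bsub>W\<^esub> f y) \<and>
    (\<forall>a\<in>carrier K. \<forall>x\<in>carrier V. f (a \<odot>\<^bsub>V\<^esub> x) = a \<odot>\<^bsub>W\<^esub> f x)"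

definition self_module :: "('r, 'x) ring_scheme \<Rightarrow> ('r, 'r) module"
  where "self_module R =
    \<lparr>carrier = carrier R, mult = mult R, one = one R,
     ring.zero = ring.zero R, add = add R, smult = mult R\<rparr>"

text \<open>
  The tensor product \<open>V \<otimes> W\<close> over \<open>K\<close> is the free abelian group on
  \<open>carrier V \<times> carrier W\<close> modulo the subgroup generated by the bilinearity relations; its
  elements are cosets, and scalars act through \<open>a (v \<otimes> w) = (a v) \<otimes> w\<close>.
\<close>

type_synonym ('v, 'w) tensor = "(('v \<times> 'w) \<Rightarrow>\<^sub>0 int) set"

definition tensor_relators ::
  "('k, 'x) ring_scheme \<Rightarrow> ('k, 'v, 'y) module_scheme \<Rightarrow> ('k, 'w, 'z) module_scheme
    \<Rightarrow> (('v \<times> 'w) \<Rightarrow>\<^sub>0 int) set"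
  where "tensor_relators K V W =
    {frag_of (v \<oplus>\<^bsub>V\<^esub> v', w) - frag_of (v, w) - frag_of (v', w) | v v' w.
       v \<in> carrier V \<and> v' \<in> carrier V \<and> w \<in> carrier W} \<union>
    {frag_of (v, w \<oplus>\<^bsub>W\<^esub> w') - frag_of (v, w) - frag_of (v, w') | v w w'.
       v \<in> carrier V \<and> w \<in> carrier W \<and> w' \<in> carrier W} \<union>
    {frag_of (a \<odot>\<^bsub>V\<^esub> v, w) - frag_of (v, a \<odot>\<^bsub>W\<^esub> w) | a v w.
       a \<in> carrier K \<and> v \<in> carrier V \<and> w \<in> carrier W}"

definition tensor_null ::
  "('k, 'x) ring_scheme \<Rightarrow> ('k, 'v, 'y) module_scheme \<Rightarrow> ('k, 'w, 'z) module_scheme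
    \<Rightarrow> ('v, 'w) tensor"
  where "tensor_null K V W =
    generate (free_Abelian_group (carrier V \<times> carrier W)) (tensor_relators K V W)"

definition tensor_class ::
  "('k, 'x) ring_scheme \<Rightarrow> ('k, 'v, 'y) module_scheme \<Rightarrow> ('k, 'w, 'z) module_scheme
    \<Rightarrow> (('v \<times> 'w) \<Rightarrow>\<^sub>0 int) \<Rightarrow> ('v, 'w) tensor"
  where "tensor_class K V W p =
    tensor_null K V W #>\<^bsub>free_Abelian_group (carrier V \<times> carrier W)\<^esub> p"

definition tensor_product ::
  "('k, 'x) ring_scheme \<Rightarrow> ('k, 'v, 'y) module_scheme \<Rightarrow> ('k, 'w, 'z) module_scheme
    \<Rightarrow> ('k, ('v, 'w) tensor) module"
  where "tensor_product K V W =
    (let Q = free_Abelian_group (carrier V \<times> carrier W) Mod tensor_null K V W in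
     \<lparr>carrier = carrier Q, mult = undefined, one = undefined,
      ring.zero = one Q, add = mult Q,
      smult = (\<lambda>a t. \<Union>p\<in>t. tensor_class K V W
        (frag_extend (\<lambda>(v, w). frag_of (a \<odot>\<^bsub>V\<^esub> v, w)) p))\<rparr>)"

definition pure_tensor ::
  "('k, 'x) ring_scheme \<Rightarrow> ('k, 'v, 'y) module_scheme \<Rightarrow> ('k, 'w, 'z) module_scheme
    \<Rightarrow> 'v \<Rightarrow> 'w \<Rightarrow> ('v, 'w) tensor"
  where "pure_tensor K V W v w = tensor_class K V W (frag_of (v, w))"

text \<open>The linear map on \<open>V \<otimes> W\<close> induced by a bilinear map \<open>\<beta>\<close> (universal property).\<close>

definition tensor_lift ::
  "('k, 'x) ring_scheme \<Rightarrow> ('k, 'v, 'y) module_scheme \<Rightarrow> ('k, 'w, 'z) module_scheme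
    \<Rightarrow> ('k, 'u, 'a) module_scheme \<Rightarrow> ('v \<Rightarrow> 'w \<Rightarrow> 'u) \<Rightarrow> ('v, 'w) tensor \<Rightarrow> 'u"
  where "tensor_lift K V W U \<beta> =
    (THE h. h \<in> extensional (carrier (tensor_product K V W)) \<and>
       linear_map K (tensor_product K V W) U h \<and>
       (\<forall>v\<in>carrier V. \<forall>w\<in>carrier W. h (pure_tensor K V W v w) = \<beta> v w))"

definition tensor_map ::
  "('k, 'x) ring_scheme \<Rightarrow> ('k, 'v, 'y) module_scheme \<Rightarrow> ('k, 'w, 'z) module_scheme
    \<Rightarrow> ('k, 'v2, 'y2) module_scheme \<Rightarrow> ('k, 'w2, 'z2) module_scheme
    \<Rightarrow> ('v \<Rightarrow> 'v2) \<Rightarrow> ('w \<Rightarrow> 'w2) \<Rightarrow> ('v, 'w) tensor \<Rightarrow> ('v2, 'w2) tensor"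
  where "tensor_map K V W V' W' f g =
    tensor_lift K V W (tensor_product K V' W') (\<lambda>v w. pure_tensor K V' W' (f v) (g w))"

text \<open>The associator \<open>(U \<otimes> V) \<otimes> W \<rightarrow> U \<otimes> (V \<otimes> W)\<close>.\<close>

definition tensor_assoc ::
  "('k, 'x) ring_scheme \<Rightarrow> ('k, 'u, 'a) module_scheme \<Rightarrow> ('k, 'v, 'y) module_scheme
    \<Rightarrow> ('k, 'w, 'z) module_scheme \<Rightarrow> (('u, 'v) tensor, 'w) tensor \<Rightarrow> ('u, ('v, 'w) tensor) tensor"
  where "tensor_assoc K U V W =
    (let T = tensor_product K U (tensor_product K V W) in
     tensor_lift K (tensor_product K U V) W T
       (\<lambda>t w. tensor_lift K U V T
          (\<lambda>u v. pure_tensor K U (tensor_product K V W) u (pure_tensor K V W v w)) t))"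


section \<open>Coalgebras and their dual algebras\<close>

record ('k, 'c) coalgebra = "('k, 'c) module" +
  comult :: "'c \<Rightarrow> ('c, 'c) tensor"
  counit :: "'c \<Rightarrow> 'k"

locale coalgebra =
  fixes K :: "('k, 'x) ring_scheme" and C :: "('k, 'c, 'y) coalgebra_scheme"
  assumes field: "field K"
    and vector_space: "module K C"
    and comult_linear: "linear_map K C (tensor_product K C C) (comult C)"
    and counit_linear: "linear_map K C (self_module K) (counit C)"
    and coassoc: "c \<in> carrier C \<Longrightarrow>
      tensor_assoc K C C C
        (tensor_map K C C (tensor_product K C C) C (comult C) (\<lambda>d. d) (comult C c)) =
      tensor_map K C C C (tensor_product K C C) (\<lambda>d. d) (comult C) (comult C c)"
    and counit_left: "c \<in> carrier C \<Longrightarrow>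
      tensor_lift K C C C (\<lambda>d e. counit C d \<odot>\<^bsub>C\<^esub> e) (comult C c) = c"
    and counit_right: "c \<in> carrier C \<Longrightarrow>
      tensor_lift K C C C (\<lambda>d e. counit C e \<odot>\<^bsub>C\<^esub> d) (comult C c) = c"

text \<open>
  \<open>C\<^sup>*\<close> with the convolution product \<open>(f * g)(c) = f(c\<^sub>1) g(c\<^sub>2)\<close>. Only its ring structure is
  recorded: scalars are the multiples of the unit, so left ideals, left modules and their
  homomorphisms are automatically \<open>K\<close>-linear.
\<close>

definition dual_algebra ::
  "('k, 'x) ring_scheme \<Rightarrow> ('k, 'c, 'y) coalgebra_scheme \<Rightarrow> ('c \<Rightarrow> 'k) ring"
  where "dual_algebra K C =
    \<lparr>carrier = {f \<in> extensional (carrier C). linear_map K C (self_module K) f},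
     mult = (\<lambda>f g. \<lambda>c\<in>carrier C.
       tensor_lift K C C (self_module K) (\<lambda>d e. f d \<otimes>\<^bsub>K\<^esub> g e) (comult C c)),
     one = (\<lambda>c\<in>carrier C. counit C c),
     ring.zero = (\<lambda>c\<in>carrier C. \<zero>\<^bsub>K\<^esub>),
     add = (\<lambda>f g. \<lambda>c\<in>carrier C. f c \<oplus>\<^bsub>K\<^esub> g c)\<rparr>"


section \<open>Left modules over a not necessarily commutative ring\<close>

text \<open>The library's \<^locale>\<open>module\<close> requires a commutative ring; its record type and
  \<^locale>\<open>submodule\<close> do not.\<close>

locale left_module = R?: ring + M?: abelian_group M for M (structure) +
  assumes smult_closed: "\<lbrakk>a \<in> carrier R; x \<in> carrier M\<rbrakk> \<Longrightarrow> a \<odot>\<^bsub>M\<^esub> x \<in> carrier M"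
    and smult_l_distr: "\<lbrakk>a \<in> carrier R; b \<in> carrier R; x \<in> carrier M\<rbrakk> \<Longrightarrow>
      (a \<oplus> b) \<odot>\<^bsub>M\<^esub> x = a \<odot>\<^bsub>M\<^esub> x \<oplus>\<^bsub>M\<^esub> b \<odot>\<^bsub>M\<^esub> x"
    and smult_r_distr: "\<lbrakk>a \<in> carrier R; x \<in> carrier M; y \<in> carrier M\<rbrakk> \<Longrightarrow>
      a \<odot>\<^bsub>M\<^esub> (x \<oplus>\<^bsub>M\<^esub> y) = a \<odot>\<^bsub>M\<^esub> x \<oplus>\<^bsub>M\<^esub> a \<odot>\<^bsub>M\<^esub> y"
    and smult_assoc1: "\<lbrakk>a \<in> carrier R; b \<in> carrier R; x \<in> carrier M\<rbrakk> \<Longrightarrow>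
      (a \<otimes> b) \<odot>\<^bsub>M\<^esub> x = a \<odot>\<^bsub>M\<^esub> (b \<odot>\<^bsub>M\<^esub> x)"
    and smult_one: "x \<in> carrier M \<Longrightarrow> \<one> \<odot>\<^bsub>M\<^esub> x = x"

definition noetherian_module :: "('r, 'x) ring_scheme \<Rightarrow> ('r, 'm, 'y) module_scheme \<Rightarrow> bool"
  where "noetherian_module R M \<longleftrightarrow>
    (\<forall>N :: nat \<Rightarrow> 'm set. (\<forall>i. submodule (N i) R M \<and> N i \<subseteq> N (Suc i)) \<longrightarrow>
      (\<exists>n. \<forall>i\<ge>n. N i = N n))"

definition fin_gen_module :: "('r, 'x) ring_scheme \<Rightarrow> ('r, 'm, 'y) module_scheme \<Rightarrow> bool"
  where "fin_gen_module R M \<longleftrightarrow>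
    (\<exists>A. finite A \<and> A \<subseteq> carrier M \<and>
      (\<forall>N. submodule N R M \<and> A \<subseteq> N \<longrightarrow> N = carrier M))"

definition left_noetherian_ring :: "('r, 'x) ring_scheme \<Rightarrow> bool"
  where "left_noetherian_ring R \<longleftrightarrow> noetherian_module R (self_module R)"


section \<open>Left comodules\<close>

record ('k, 'c, 'm) comodule = "('k, 'm) module" +
  coact :: "'m \<Rightarrow> ('c, 'm) tensor"

locale left_comodule =
  fixes K :: "('k, 'x) ring_scheme" and C :: "('k, 'c, 'y) coalgebra_scheme"
    and M :: "('k, 'c, 'm, 'z) comodule_scheme"
  assumes vector_space: "module K M"
    and coact_linear: "linear_map K M (tensor_product K C M) (coact M)"
    and coact_coassoc: "m \<in> carrier M \<Longrightarrow>
      tensor_assoc K C C M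
        (tensor_map K C M (tensor_product K C C) M (comult C) (\<lambda>x. x) (coact M m)) =
      tensor_map K C M C (tensor_product K C M) (\<lambda>c. c) (coact M) (coact M m)"
    and coact_counit: "m \<in> carrier M \<Longrightarrow>
      tensor_lift K C M M (\<lambda>c x. counit C c \<odot>\<^bsub>M\<^esub> x) (coact M m) = m"

definition comodule_map ::
  "('k, 'x) ring_scheme \<Rightarrow> ('k, 'c, 'y) coalgebra_scheme \<Rightarrow> ('k, 'c, 'm, 'z) comodule_scheme
    \<Rightarrow> ('k, 'c, 'n, 'w) comodule_scheme \<Rightarrow> ('m \<Rightarrow> 'n) \<Rightarrow> bool"
  where "comodule_map K C M N f \<longleftrightarrow> linear_map K M N f \<and>
    (\<forall>m\<in>carrier M. coact N (f m) = tensor_map K C M C N (\<lambda>c. c) f (coact M m))"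

text \<open>A subspace \<open>N\<close> is a subcomodule if the coaction maps it into the image of \<open>C \<otimes> N\<close>
  in \<open>C \<otimes> M\<close>.\<close>

definition subcomodule ::
  "'m set \<Rightarrow> ('k, 'x) ring_scheme \<Rightarrow> ('k, 'c, 'y) coalgebra_scheme
    \<Rightarrow> ('k, 'c, 'm, 'z) comodule_scheme \<Rightarrow> bool"
  where "subcomodule N K C M \<longleftrightarrow> submodule N K M \<and>
    coact M ` N \<subseteq> tensor_map K C (M\<lparr>carrier := N\<rparr>) C M (\<lambda>c. c) (\<lambda>x. x) `
      carrier (tensor_product K C (M\<lparr>carrier := N\<rparr>))"

definition artinian_comodule ::
  "('k, 'x) ring_scheme \<Rightarrow> ('k, 'c, 'y) coalgebra_scheme \<Rightarrow> ('k, 'c, 'm, 'z) comodule_scheme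
    \<Rightarrow> bool"
  where "artinian_comodule K C M \<longleftrightarrow>
    (\<forall>N :: nat \<Rightarrow> 'm set. (\<forall>i. subcomodule (N i) K C M \<and> N (Suc i) \<subseteq> N i) \<longrightarrow>
      (\<exists>n. \<forall>i\<ge>n. N i = N n))"

definition regular_comodule :: "('k, 'c, 'y) coalgebra_scheme \<Rightarrow> ('k, 'c, 'c) comodule"
  where "regular_comodule C =
    \<lparr>carrier = carrier C, mult = mult C, one = one C,
     ring.zero = ring.zero C, add = add C, smult = smult C, coact = comult C\<rparr>"

definition left_artinian_coalgebra ::
  "('k, 'x) ring_scheme \<Rightarrow> ('k, 'c, 'y) coalgebra_scheme \<Rightarrow> bool"
  where "left_artinian_coalgebra K C \<longleftrightarrow> artinian_comodule K C (regular_comodule C)"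

definition module_power :: "('k, 'v, 'y) module_scheme \<Rightarrow> nat \<Rightarrow> ('k, nat \<Rightarrow> 'v) module"
  where "module_power V n =
    \<lparr>carrier = (\<Pi>\<^sub>E i\<in>{..<n}. carrier V), mult = undefined, one = undefined,
     ring.zero = (\<lambda>i\<in>{..<n}. \<zero>\<^bsub>V\<^esub>),
     add = (\<lambda>x y. \<lambda>i\<in>{..<n}. x i \<oplus>\<^bsub>V\<^esub> y i),
     smult = (\<lambda>a x. \<lambda>i\<in>{..<n}. a \<odot>\<^bsub>V\<^esub> x i)\<rparr>"

definition power_incl :: "('k, 'v, 'y) module_scheme \<Rightarrow> nat \<Rightarrow> nat \<Rightarrow> 'v \<Rightarrow> nat \<Rightarrow> 'v"
  where "power_incl V n i v = (\<lambda>j\<in>{..<n}. if j = i then v else \<zero>\<^bsub>V\<^esub>)"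

text \<open>The direct sum \<open>C\<^sup>n\<close> of copies of the left comodule \<open>C\<close>, with coaction
  \<open>x \<mapsto> \<Sum>\<^sub>i (id \<otimes> \<iota>\<^sub>i) (\<Delta> x\<^sub>i)\<close>.\<close>

definition comodule_power ::
  "('k, 'x) ring_scheme \<Rightarrow> ('k, 'c, 'y) coalgebra_scheme \<Rightarrow> nat
    \<Rightarrow> ('k, 'c, nat \<Rightarrow> 'c) comodule"
  where "comodule_power K C n = module.extend (module_power C n)
    \<lparr>coact = (\<lambda>x. finsum (tensor_product K C (module_power C n))
       (\<lambda>i. tensor_map K C C C (module_power C n) (\<lambda>c. c) (power_incl C n i) (comult C (x i)))
       {..<n})\<rparr>"

definition fin_cogen_comodule ::
  "('k, 'x) ring_scheme \<Rightarrow> ('k, 'c, 'y) coalgebra_scheme \<Rightarrow> ('k, 'c, 'm, 'z) comodule_scheme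
    \<Rightarrow> bool"
  where "fin_cogen_comodule K C M \<longleftrightarrow>
    (\<exists>n>0. \<exists>f. comodule_map K C M (comodule_power K C n) f \<and> inj_on f (carrier M))"


section \<open>Categories and dualities\<close>

text \<open>An arrow need not determine its source and target, so composition and the action of a
  functor on arrows take the objects as arguments; \<open>Cmp A x y z g f\<close> is \<open>g \<circ> f\<close> for
  \<open>f : x \<rightarrow> y\<close> and \<open>g : y \<rightarrow> z\<close>.\<close>

record ('o, 'a) cat =
  Ob :: "'o set"
  Hom :: "'o \<Rightarrow> 'o \<Rightarrow> 'a set"
  Idn :: "'o \<Rightarrow> 'a"
  Cmp :: "'o \<Rightarrow> 'o \<Rightarrow> 'o \<Rightarrow> 'a \<Rightarrow> 'a \<Rightarrow> 'a"

definition category :: "('o, 'a) cat \<Rightarrow> bool"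
  where "category A \<longleftrightarrow>
    (\<forall>x\<in>Ob A. Idn A x \<in> Hom A x x) \<and>
    (\<forall>x\<in>Ob A. \<forall>y\<in>Ob A. \<forall>z\<in>Ob A. \<forall>f\<in>Hom A x y. \<forall>g\<in>Hom A y z.
      Cmp A x y z g f \<in> Hom A x z) \<and>
    (\<forall>x\<in>Ob A. \<forall>y\<in>Ob A. \<forall>f\<in>Hom A x y.
      Cmp A x x y f (Idn A x) = f \<and> Cmp A x y y (Idn A y) f = f) \<and>
    (\<forall>w\<in>Ob A. \<forall>x\<in>Ob A. \<forall>y\<in>Ob A. \<forall>z\<in>Ob A.
      \<forall>f\<in>Hom A w x. \<forall>g\<in>Hom A x y. \<forall>h\<in>Hom A y z.
      Cmp A w y z h (Cmp A w x y g f) = Cmp A w x z (Cmp A x y z h g) f)"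

definition op_cat :: "('o, 'a) cat \<Rightarrow> ('o, 'a) cat"
  where "op_cat A =
    \<lparr>Ob = Ob A, Hom = (\<lambda>x y. Hom A y x), Idn = Idn A,
     Cmp = (\<lambda>x y z g f. Cmp A z y x f g)\<rparr>"

record ('o, 'a, 'p, 'b) cat_functor =
  on_ob :: "'o \<Rightarrow> 'p"
  on_ar :: "'o \<Rightarrow> 'o \<Rightarrow> 'a \<Rightarrow> 'b"

definition is_functor ::
  "('o, 'a) cat \<Rightarrow> ('p, 'b) cat \<Rightarrow> ('o, 'a, 'p, 'b) cat_functor \<Rightarrow> bool"
  where "is_functor A B F \<longleftrightarrow>
    (\<forall>x\<in>Ob A. on_ob F x \<in> Ob B \<and> on_ar F x x (Idn A x) = Idn B (on_ob F x)) \<and>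
    (\<forall>x\<in>Ob A. \<forall>y\<in>Ob A. \<forall>f\<in>Hom A x y. on_ar F x y f \<in> Hom B (on_ob F x) (on_ob F y)) \<and>
    (\<forall>x\<in>Ob A. \<forall>y\<in>Ob A. \<forall>z\<in>Ob A. \<forall>f\<in>Hom A x y. \<forall>g\<in>Hom A y z.
      on_ar F x z (Cmp A x y z g f) =
      Cmp B (on_ob F x) (on_ob F y) (on_ob F z) (on_ar F y z g) (on_ar F x y f))"

definition id_functor :: "('o, 'a, 'o, 'a) cat_functor"
  where "id_functor = \<lparr>on_ob = (\<lambda>x. x), on_ar = (\<lambda>x y f. f)\<rparr>"

definition comp_functor ::
  "('p, 'b, 'q, 'c) cat_functor \<Rightarrow> ('o, 'a, 'p, 'b) cat_functor \<Rightarrow> ('o, 'a, 'q, 'c) cat_functor"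
  where "comp_functor G F =
    \<lparr>on_ob = (\<lambda>x. on_ob G (on_ob F x)),
     on_ar = (\<lambda>x y f. on_ar G (on_ob F x) (on_ob F y) (on_ar F x y f))\<rparr>"

definition iso_arrow :: "('o, 'a) cat \<Rightarrow> 'o \<Rightarrow> 'o \<Rightarrow> 'a \<Rightarrow> bool"
  where "iso_arrow A x y f \<longleftrightarrow> f \<in> Hom A x y \<and>
    (\<exists>g\<in>Hom A y x. Cmp A x y x g f = Idn A x \<and> Cmp A y x y f g = Idn A y)"

definition natural_iso ::
  "('o, 'a) cat \<Rightarrow> ('p, 'b) cat \<Rightarrow> ('o, 'a, 'p, 'b) cat_functor \<Rightarrow> ('o, 'a, 'p, 'b) cat_functor
    \<Rightarrow> ('o \<Rightarrow> 'b) \<Rightarrow> bool"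
  where "natural_iso A B F G \<eta> \<longleftrightarrow>
    (\<forall>x\<in>Ob A. iso_arrow B (on_ob F x) (on_ob G x) (\<eta> x)) \<and>
    (\<forall>x\<in>Ob A. \<forall>y\<in>Ob A. \<forall>f\<in>Hom A x y.
      Cmp B (on_ob F x) (on_ob F y) (on_ob G y) (\<eta> y) (on_ar F x y f) =
      Cmp B (on_ob F x) (on_ob G x) (on_ob G y) (on_ar G x y f) (\<eta> x))"

definition equivalent_categories :: "('o, 'a) cat \<Rightarrow> ('p, 'b) cat \<Rightarrow> bool"
  where "equivalent_categories A B \<longleftrightarrow> category A \<and> category B \<and>
    (\<exists>F G \<eta> \<theta>. is_functor A B F \<and> is_functor B A G \<and>
      natural_iso A A id_functor (comp_functor G F) \<eta> \<and>
      natural_iso B B (comp_functor F G) id_functor \<theta>)"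

definition dual_categories :: "('o, 'a) cat \<Rightarrow> ('p, 'b) cat \<Rightarrow> bool"
  where "dual_categories A B \<longleftrightarrow> equivalent_categories A (op_cat B)"

text \<open>The full subcategories of left \<open>R\<close>-modules, resp. left \<open>C\<close>-comodules, on the objects
  satisfying \<open>P\<close>. The type of the carrier elements plays the role of the universe;
  if it admits an injection of \<open>lists (carrier R)\<close>, resp. \<open>lists (carrier C)\<close>, it carries up
  to isomorphism every finitely generated module (a quotient of some \<open>R\<^sup>n\<close>), resp. every
  finitely cogenerated comodule (a subcomodule of some \<open>C\<^sup>n\<close>). Arrows are
  functions that are undefined outside the carrier of their source, so that equality of arrows
  is equality on that carrier.\<close>

definition left_module_cat ::
  "('r, 'x) ring_scheme \<Rightarrow> (('r, 'm) module \<Rightarrow> bool) \<Rightarrow> (('r, 'm) module, 'm \<Rightarrow> 'm) cat"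
  where "left_module_cat R P =
    \<lparr>Ob = {M. left_module R M \<and> P M},
     Hom = (\<lambda>M N. {f \<in> extensional (carrier M). linear_map R M N f}),
     Idn = (\<lambda>M. \<lambda>x\<in>carrier M. x),
     Cmp = (\<lambda>L M N g f. compose (carrier L) g f)\<rparr>"

definition left_comodule_cat ::
  "('k, 'x) ring_scheme \<Rightarrow> ('k, 'c, 'y) coalgebra_scheme \<Rightarrow> (('k, 'c, 'm) comodule \<Rightarrow> bool)
    \<Rightarrow> (('k, 'c, 'm) comodule, 'm \<Rightarrow> 'm) cat"
  where "left_comodule_cat K C P =
    \<lparr>Ob = {M. left_comodule K C M \<and> P M},
     Hom = (\<lambda>M N. {f \<in> extensional (carrier M). comodule_map K C M N f}),
     Idn = (\<lambda>M. \<lambda>x\<in>carrier M. x),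
     Cmp = (\<lambda>L M N g f. compose (carrier L) g f)\<rparr>"

end

theory Submission
  imports Defs
begin

text \<open>
  A left comodule \<open>M\<close> carries the right \<open>C\<^sup>*\<close>-action \<open>m f = f(m\<^sub>-\<^sub>1) m\<^sub>0\<close>, and over a field this action
  determines the coaction, because the contractions \<open>f \<otimes> id\<close> separate the points of \<open>C \<otimes> M\<close>. The
  full linear dual \<open>M\<^sup>*\<close> is then a left \<open>C\<^sup>*\<close>-module via \<open>(f \<phi>)(m) = \<phi>(m f)\<close>.
  The key point is that a finitely generated submodule \<open>C\<^sup>*\<phi>\<^sub>1 + \<dots> + C\<^sup>*\<phi>\<^sub>n\<close> of \<open>M\<^sup>*\<close> is closed, being
  the image of the transpose of the comodule map \<open>M \<rightarrow> C\<^sup>n\<close>, \<open>m \<mapsto> (m\<^sub>-\<^sub>1 \<phi>\<^sub>i(m\<^sub>0))\<^sub>i\<close>. Hence \<open>M\<close> is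
  Artinian iff \<open>M\<^sup>*\<close> is Noetherian, and \<open>M\<close> embeds in some \<open>C\<^sup>n\<close> iff \<open>M\<^sup>*\<close> is finitely generated.
  The duality sends \<open>M\<close> to \<open>M\<^sup>*\<close>: it is full because a homomorphism \<open>N\<^sup>* \<rightarrow> M\<^sup>*\<close> is determined by
  the images of the coordinates of \<open>N \<subseteq> C\<^sup>n\<close>, which define a comodule map \<open>M \<rightarrow> C\<^sup>n\<close> with image in
  \<open>N\<close>; and a module \<open>(C\<^sup>*)\<^sup>n / L\<close> is the dual of the annihilator of \<open>L\<close> in \<open>C\<^sup>n\<close>, since \<open>L\<close> is closed.
\<close>

section \<open>Tensor products\<close>

text \<open>The obstacle is that comodule axioms are equations between cosets in iterated tensor
  products. Contracting the left factors with functionals moves each equation into \<open>M\<close>;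
  after \<open>left_comodule_iff\<close>, \<open>comodule_map_iff\<close> and
  \<open>subcomodule_iff\<close> the arguments work almost entirely with the action
  \<open>ract\<close>. The convolution order f(c_1) g(c_2) fixes the sides: a left coaction becomes
  a right action, and its dual a left module. Passing to the dual of an infinite-dimensional space
  could lose information only through submodules that are not closed. For finitely many generators
  closedness is linear algebra: a functional that vanishes on the kernel of a linear map factors
  through it. For arbitrary submodules a chain condition on the comodule reduces to finitely many
  functionals. A second obstacle is size: the dual of a comodule lives on a type of functions, while
  each category here has one fixed carrier type. Duals are therefore relocated along injections that
  code elements by lists: coefficients for modules, entries for subcomodules of a power. Only the
  functor from comodules to modules is written down; its quasi-inverse comes from choice.\<close>

lemma linear_map_closed: "linear_map K V W f \<Longrightarrow> x \<in> carrier V \<Longrightarrow> f x \<in> carrier W"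
  by (auto simp: linear_map_def)

lemma linear_map_add:
  "linear_map K V W f \<Longrightarrow> x \<in> carrier V \<Longrightarrow> y \<in> carrier V \<Longrightarrow> f (x \<oplus>\<^bsub>V\<^esub> y) = f x \<oplus>\<^bsub>W\<^esub> f y"
  by (auto simp: linear_map_def)

lemma linear_map_smult:
  "linear_map K V W f \<Longrightarrow> a \<in> carrier K \<Longrightarrow> x \<in> carrier V \<Longrightarrow> f (a \<odot>\<^bsub>V\<^esub> x) = a \<odot>\<^bsub>W\<^esub> f x"
  by (auto simp: linear_map_def)

lemma linear_mapI:
  assumes "\<And>x. x \<in> carrier V \<Longrightarrow> f x \<in> carrier W"
    and "\<And>x y. x \<in> carrier V \<Longrightarrow> y \<in> carrier V \<Longrightarrow> f (x \<oplus>\<^bsub>V\<^esub> y) = f x \<oplus>\<^bsub>W\<^esub> f y"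
    and "\<And>a x. a \<in> carrier K \<Longrightarrow> x \<in> carrier V \<Longrightarrow> f (a \<odot>\<^bsub>V\<^esub> x) = a \<odot>\<^bsub>W\<^esub> f x"
  shows "linear_map K V W f"
  using assms by (auto simp: linear_map_def)

lemma linear_map_zero:
  assumes "abelian_group V" "abelian_group W" "linear_map K V W f"
  shows "f \<zero>\<^bsub>V\<^esub> = \<zero>\<^bsub>W\<^esub>"
proof -
  interpret V: abelian_group V by fact
  interpret W: abelian_group W by fact
  have "f \<zero>\<^bsub>V\<^esub> \<in> carrier W" using linear_map_closed[OF assms(3)] by simp
  moreover have "f \<zero>\<^bsub>V\<^esub> \<oplus>\<^bsub>W\<^esub> f \<zero>\<^bsub>V\<^esub> = f \<zero>\<^bsub>V\<^esub>"
    using linear_map_add[OF assms(3), of "\<zero>\<^bsub>V\<^esub>" "\<zero>\<^bsub>V\<^esub>"] by simp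
  ultimately show ?thesis by (metis W.add.r_cancel_one')
qed

lemma linear_map_minus:
  assumes "abelian_group V" "abelian_group W" "linear_map K V W f" "x \<in> carrier V"
  shows "f (\<ominus>\<^bsub>V\<^esub> x) = \<ominus>\<^bsub>W\<^esub> f x"
proof -
  interpret V: abelian_group V by fact
  interpret W: abelian_group W by fact
  have "f (\<ominus>\<^bsub>V\<^esub> x) \<oplus>\<^bsub>W\<^esub> f x = f (\<ominus>\<^bsub>V\<^esub> x \<oplus>\<^bsub>V\<^esub> x)"
    using assms linear_map_add[OF assms(3), of "\<ominus>\<^bsub>V\<^esub> x" x] by simp
  also have "\<dots> = \<zero>\<^bsub>W\<^esub>"
    using assms linear_map_zero[OF assms(1-3)] by (simp add: V.l_neg)
  finally show ?thesis
    using W.minus_equality[of "f (\<ominus>\<^bsub>V\<^esub> x)" "f x"] linear_map_closed[OF assms(3)] assms(4) by simp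
qed

lemma linear_map_compose:
  "linear_map K U V f \<Longrightarrow> linear_map K V W g \<Longrightarrow> linear_map K U W (\<lambda>x. g (f x))"
  by (auto simp: linear_map_def Pi_iff)

lemma linear_map_restrict:
  assumes "linear_map K V W f" "abelian_group V"
    and "\<And>a x. a \<in> carrier K \<Longrightarrow> x \<in> carrier V \<Longrightarrow> a \<odot>\<^bsub>V\<^esub> x \<in> carrier V"
  shows "linear_map K V W (restrict f (carrier V))"
proof -
  interpret V: abelian_group V by fact
  show ?thesis using assms by (auto simp: linear_map_def)
qed

definition bilinear_map ::
  "('k, 'x) ring_scheme \<Rightarrow> ('k, 'v, 'y) module_scheme \<Rightarrow> ('k, 'w, 'z) module_scheme
    \<Rightarrow> ('k, 'u, 'a) module_scheme \<Rightarrow> ('v \<Rightarrow> 'w \<Rightarrow> 'u) \<Rightarrow> bool"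
  where "bilinear_map K V W U \<beta> \<longleftrightarrow>
    (\<forall>v\<in>carrier V. linear_map K W U (\<beta> v)) \<and>
    (\<forall>w\<in>carrier W. linear_map K V U (\<lambda>v. \<beta> v w))"

lemma bilinear_mapI:
  assumes "\<And>v. v \<in> carrier V \<Longrightarrow> linear_map K W U (\<beta> v)"
    and "\<And>w. w \<in> carrier W \<Longrightarrow> linear_map K V U (\<lambda>v. \<beta> v w)"
  shows "bilinear_map K V W U \<beta>"
  using assms by (auto simp: bilinear_map_def)

section \<open>The module structure on the quotient of the free abelian group\<close>

locale two_modules = V: module K V + W: module K W
  for K (structure) and V :: "('k, 'v, 'y) module_scheme" and W :: "('k, 'w, 'z) module_scheme"
begin

abbreviation "F \<equiv> free_Abelian_group (carrier V \<times> carrier W)"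
abbreviation "N \<equiv> tensor_null K V W"
abbreviation "T \<equiv> tensor_product K V W"
abbreviation "cls \<equiv> tensor_class K V W"
abbreviation "pure \<equiv> pure_tensor K V W"
abbreviation "act a \<equiv> frag_extend (\<lambda>(v, w). frag_of (a \<odot>\<^bsub>V\<^esub> v, w))"

lemma keys_diff_sub: "Poly_Mapping.keys x \<subseteq> S \<Longrightarrow> Poly_Mapping.keys y \<subseteq> S \<Longrightarrow>
    Poly_Mapping.keys (x - y) \<subseteq> S" for x y :: "'b \<Rightarrow>\<^sub>0 int"
  using keys_diff[of x y] by blast

lemma keys_add_sub: "Poly_Mapping.keys x \<subseteq> S \<Longrightarrow> Poly_Mapping.keys y \<subseteq> S \<Longrightarrow>
    Poly_Mapping.keys (x + y) \<subseteq> S" for x y :: "'b \<Rightarrow>\<^sub>0 int"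
  using keys_add[of x y] by blast

lemma tensor_relatorsI:
  "v \<in> carrier V \<Longrightarrow> v' \<in> carrier V \<Longrightarrow> w \<in> carrier W \<Longrightarrow>
    frag_of (v \<oplus>\<^bsub>V\<^esub> v', w) - frag_of (v, w) - frag_of (v', w) \<in> tensor_relators K V W"
  "v \<in> carrier V \<Longrightarrow> w \<in> carrier W \<Longrightarrow> w' \<in> carrier W \<Longrightarrow>
    frag_of (v, w \<oplus>\<^bsub>W\<^esub> w') - frag_of (v, w) - frag_of (v, w') \<in> tensor_relators K V W"
  "a \<in> carrier K \<Longrightarrow> v \<in> carrier V \<Longrightarrow> w \<in> carrier W \<Longrightarrow>
    frag_of (a \<odot>\<^bsub>V\<^esub> v, w) - frag_of (v, a \<odot>\<^bsub>W\<^esub> w) \<in> tensor_relators K V W"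
  unfolding tensor_relators_def by blast+

lemma tensor_relatorsE [consumes 1, case_names left right scalar]:
  assumes "r \<in> tensor_relators K V W"
  obtains v v' w where "v \<in> carrier V" "v' \<in> carrier V" "w \<in> carrier W"
      "r = frag_of (v \<oplus>\<^bsub>V\<^esub> v', w) - frag_of (v, w) - frag_of (v', w)"
    | v w w' where "v \<in> carrier V" "w \<in> carrier W" "w' \<in> carrier W"
      "r = frag_of (v, w \<oplus>\<^bsub>W\<^esub> w') - frag_of (v, w) - frag_of (v, w')"
    | a v w where "a \<in> carrier K" "v \<in> carrier V" "w \<in> carrier W"
      "r = frag_of (a \<odot>\<^bsub>V\<^esub> v, w) - frag_of (v, a \<odot>\<^bsub>W\<^esub> w)"
  using assms unfolding tensor_relators_def by (elim UnE CollectE exE conjE) metis+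

lemma relators_closed: "tensor_relators K V W \<subseteq> carrier F"
  unfolding tensor_relators_def
  by (intro subsetI, elim UnE CollectE exE conjE) (simp_all add: keys_diff_sub)

lemma relator_keys: "r \<in> tensor_relators K V W \<Longrightarrow> Poly_Mapping.keys r \<subseteq> carrier V \<times> carrier W"
  by (rule carrier_free_Abelian_group_iff[THEN iffD1, OF subsetD[OF relators_closed]])

lemma F_induct [consumes 1, case_names zero diff single]:
  assumes "Poly_Mapping.keys p \<subseteq> carrier V \<times> carrier W"
    and "P 0"
    and "\<And>x y. Poly_Mapping.keys x \<subseteq> carrier V \<times> carrier W \<Longrightarrow>
      Poly_Mapping.keys y \<subseteq> carrier V \<times> carrier W \<Longrightarrow> P x \<Longrightarrow> P y \<Longrightarrow> P (x - y)"
    and "\<And>v w. v \<in> carrier V \<Longrightarrow> w \<in> carrier W \<Longrightarrow> P (frag_of (v, w))"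
  shows "P p"
  by (rule free_Abelian_group_induct[OF assms(1)]) (use assms in auto)

lemma null_subgroup: "subgroup N F"
  unfolding tensor_null_def
  by (rule group.generate_is_subgroup[OF group_free_Abelian_group relators_closed])

lemma null_normal: "N \<lhd> F"
  by (rule comm_group.subgroup_imp_normal[OF abelian_free_Abelian_group null_subgroup])

lemma null_sub: "n \<in> N \<Longrightarrow> Poly_Mapping.keys n \<subseteq> carrier V \<times> carrier W"
  by (rule carrier_free_Abelian_group_iff[THEN iffD1, OF subsetD[OF subgroup.subset[OF null_subgroup]]])

lemma null_zero: "0 \<in> N"
  using subgroup.one_closed[OF null_subgroup] by simp

lemma null_add: "a \<in> N \<Longrightarrow> b \<in> N \<Longrightarrow> a + b \<in> N"
  using subgroup.m_closed[OF null_subgroup] by simp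

lemma null_uminus: "a \<in> N \<Longrightarrow> - a \<in> N"
  using subgroup.m_inv_closed[OF null_subgroup, of a] null_sub[of a] by simp

lemma null_diff: "a \<in> N \<Longrightarrow> b \<in> N \<Longrightarrow> a - b \<in> N"
  using null_add[of a "- b"] null_uminus by simp

lemma null_relator: "r \<in> tensor_relators K V W \<Longrightarrow> r \<in> N"
  unfolding tensor_null_def by (rule generate.incl)

lemma class_mem: "q \<in> cls p \<longleftrightarrow> q - p \<in> N"
  unfolding tensor_class_def r_coset_def
  by (auto) (metis diff_add_cancel)

lemma class_eq: "cls p = cls q \<longleftrightarrow> p - q \<in> N"
proof
  assume "cls p = cls q"
  moreover have "p \<in> cls p" by (simp add: class_mem null_zero)
  ultimately show "p - q \<in> N" by (simp add: class_mem)
next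
  assume pq: "p - q \<in> N"
  have "x - p \<in> N \<longleftrightarrow> x - q \<in> N" for x
    using null_add[of "x - p" "p - q"] null_diff[of "x - q" "p - q"] pq by auto
  then show "cls p = cls q" by (auto simp: class_mem)
qed

lemma carrier_tensor: "carrier T = cls ` carrier F"
  by (simp add: tensor_product_def Let_def carrier_FactGroup tensor_class_def)

lemma class_closed: "Poly_Mapping.keys p \<subseteq> carrier V \<times> carrier W \<Longrightarrow> cls p \<in> carrier T"
  by (simp add: carrier_tensor)

lemma tensor_add:
  "Poly_Mapping.keys p \<subseteq> carrier V \<times> carrier W \<Longrightarrow>
   Poly_Mapping.keys q \<subseteq> carrier V \<times> carrier W \<Longrightarrow> cls p \<oplus>\<^bsub>T\<^esub> cls q = cls (p + q)"
  using normal.rcos_sum[OF null_normal, of p q]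
  by (simp add: tensor_product_def Let_def tensor_class_def)

lemma tensor_zero: "\<zero>\<^bsub>T\<^esub> = cls 0"
  using group.coset_mult_one[OF group_free_Abelian_group subgroup.subset[OF null_subgroup]]
  by (simp add: tensor_product_def Let_def tensor_class_def)

lemma act_closed:
  assumes "a \<in> carrier K" "Poly_Mapping.keys p \<subseteq> carrier V \<times> carrier W"
  shows "Poly_Mapping.keys (act a p) \<subseteq> carrier V \<times> carrier W"
  using assms(2)
proof (induct rule: F_induct)
  case (diff x y) then show ?case by (simp add: frag_extend_diff keys_diff_sub)
next
  case (single v w) then show ?case using assms(1) by simp
qed auto

text \<open>Each of the three kinds of relator goes to a relator of the same kind, the scalar kind
  because \<open>K\<close> is commutative. Hence \<open>act a\<close> preserves the null subgroup
  and descends to cosets.\<close>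

lemma act_relator:
  assumes a: "a \<in> carrier K" and r: "r \<in> tensor_relators K V W"
  shows "act a r \<in> tensor_relators K V W"
  using r
proof (cases rule: tensor_relatorsE)
  case (left v v' w)
  then show ?thesis
    using a tensor_relatorsI(1)[of "a \<odot>\<^bsub>V\<^esub> v" "a \<odot>\<^bsub>V\<^esub> v'" w] by (simp add: frag_extend_diff V.smult_r_distr)
next
  case (right v w w')
  then show ?thesis using a tensor_relatorsI(2)[of "a \<odot>\<^bsub>V\<^esub> v" w w'] by (simp add: frag_extend_diff)
next
  case (scalar b v w)
  have "a \<odot>\<^bsub>V\<^esub> (b \<odot>\<^bsub>V\<^esub> v) = b \<odot>\<^bsub>V\<^esub> (a \<odot>\<^bsub>V\<^esub> v)"
    using scalar a V.smult_assoc1[of a b v] V.smult_assoc1[of b a v] by (simp add: V.R.m_comm)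
  then show ?thesis using scalar a tensor_relatorsI(3)[of b "a \<odot>\<^bsub>V\<^esub> v" w] by (simp add: frag_extend_diff)
qed

lemma act_null:
  assumes "a \<in> carrier K" "n \<in> N"
  shows "act a n \<in> N"
proof -
  have "n \<in> generate F (tensor_relators K V W)" using assms(2) by (simp add: tensor_null_def)
  then show ?thesis
  proof (induct rule: generate.induct)
    case one show ?case by (simp add: null_zero)
  next
    case (incl h) then show ?case by (intro null_relator act_relator assms(1))
  next
    case (inv h)
    then have "inv\<^bsub>F\<^esub> h = - h"
      by (intro inv_free_Abelian_group relator_keys)
    then show ?case
      using null_uminus[OF null_relator[OF act_relator[OF assms(1) inv]]] by (simp add: frag_extend_minus)
  next
    case (eng h1 h2) then show ?case by (simp add: frag_extend_add null_add)
  qed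
qed

text \<open>The union over representatives in the definition of the scalar action is a union of
  equal cosets, because two representatives differ by an element of \<open>N\<close> and
  \<open>act a\<close> preserves \<open>N\<close>.\<close>

lemma tensor_smult:
  assumes "a \<in> carrier K" "Poly_Mapping.keys p \<subseteq> carrier V \<times> carrier W"
  shows "a \<odot>\<^bsub>T\<^esub> cls p = cls (act a p)"
proof -
  have "cls (act a q) = cls (act a p)" if "q \<in> cls p" for q
    using that act_null[OF assms(1)] by (simp add: class_eq class_mem flip: frag_extend_diff)
  moreover have "p \<in> cls p" by (simp add: class_mem null_zero)
  ultimately have "(\<Union>q\<in>cls p. cls (act a q)) = cls (act a p)" by blast
  then show ?thesis by (simp add: tensor_product_def Let_def)
qed

text \<open>On representatives additivity in the scalar holds only up to a relator, since the
  generator for (a + b) v does not split in the free group. Multiplicativity and the unit law hold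
  on the nose.\<close>

lemma act_add:
  assumes ab: "a \<in> carrier K" "b \<in> carrier K" and p: "Poly_Mapping.keys p \<subseteq> carrier V \<times> carrier W"
  shows "act (a \<oplus> b) p - (act a p + act b p) \<in> N"
  using p
proof (induct p rule: F_induct)
  case zero then show ?case by (simp add: null_zero)
next
  case (diff x y)
  have "act (a \<oplus> b) (x - y) - (act a (x - y) + act b (x - y)) =
    (act (a \<oplus> b) x - (act a x + act b x)) - (act (a \<oplus> b) y - (act a y + act b y))"
    by (simp add: frag_extend_diff)
  then show ?case using diff null_diff by simp
next
  case (single v w)
  then have c: "v \<in> carrier V" "w \<in> carrier W" by auto
  have "act (a \<oplus> b) (frag_of (v, w)) - (act a (frag_of (v, w)) + act b (frag_of (v, w))) =
     frag_of (a \<odot>\<^bsub>V\<^esub> v \<oplus>\<^bsub>V\<^esub> b \<odot>\<^bsub>V\<^esub> v, w) - frag_of (a \<odot>\<^bsub>V\<^esub> v, w) - frag_of (b \<odot>\<^bsub>V\<^esub> v, w)"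
    using single ab by (simp add: V.smult_l_distr)
  also have "\<dots> \<in> tensor_relators K V W" using single ab by (intro tensor_relatorsI) simp_all
  finally show ?case by (rule null_relator)
qed

lemma act_mult:
  assumes ab: "a \<in> carrier K" "b \<in> carrier K" and p: "Poly_Mapping.keys p \<subseteq> carrier V \<times> carrier W"
  shows "act (a \<otimes> b) p = act a (act b p)"
  using p
proof (induct p rule: F_induct)
  case (diff x y) then show ?case by (simp add: frag_extend_diff)
next
  case (single v w) then show ?case using ab by (simp add: V.smult_assoc1)
qed auto

lemma act_one: "Poly_Mapping.keys p \<subseteq> carrier V \<times> carrier W \<Longrightarrow> act \<one> p = p"
proof (induct p rule: F_induct)
  case (diff x y) then show ?case by (simp add: frag_extend_diff)
next
  case (single v w) then show ?case by simp
qed auto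

lemma carrier_tensorE:
  assumes "t \<in> carrier T"
  obtains p where "t = cls p" "Poly_Mapping.keys p \<subseteq> carrier V \<times> carrier W"
proof -
  obtain p where "p \<in> carrier F" "t = cls p"
    using assms unfolding carrier_tensor by (elim imageE)
  then show thesis using that by simp
qed

lemma tensor_abelian_group: "abelian_group T"
proof (rule abelian_groupI)
  show "\<zero>\<^bsub>T\<^esub> \<in> carrier T" by (simp add: tensor_zero class_closed)
  fix x assume "x \<in> carrier T"
  then obtain p where p: "x = cls p" "Poly_Mapping.keys p \<subseteq> carrier V \<times> carrier W"
    by (rule carrier_tensorE)
  show "\<zero>\<^bsub>T\<^esub> \<oplus>\<^bsub>T\<^esub> x = x" using p by (simp add: tensor_zero tensor_add)
  show "\<exists>y\<in>carrier T. y \<oplus>\<^bsub>T\<^esub> x = \<zero>\<^bsub>T\<^esub>"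
    using p by (intro bexI[of _ "cls (- p)"]) (simp_all add: tensor_zero tensor_add class_closed)
  fix y assume "y \<in> carrier T"
  then obtain q where q: "y = cls q" "Poly_Mapping.keys q \<subseteq> carrier V \<times> carrier W"
    by (rule carrier_tensorE)
  show "x \<oplus>\<^bsub>T\<^esub> y \<in> carrier T" using p q by (simp add: tensor_add class_closed keys_add_sub)
  show "x \<oplus>\<^bsub>T\<^esub> y = y \<oplus>\<^bsub>T\<^esub> x" using p q by (simp add: tensor_add Groups.add_ac(2))
  fix z assume "z \<in> carrier T"
  then obtain r where r: "z = cls r" "Poly_Mapping.keys r \<subseteq> carrier V \<times> carrier W"
    by (rule carrier_tensorE)
  show "(x \<oplus>\<^bsub>T\<^esub> y) \<oplus>\<^bsub>T\<^esub> z = x \<oplus>\<^bsub>T\<^esub> (y \<oplus>\<^bsub>T\<^esub> z)"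
    using p q r by (simp add: tensor_add keys_add_sub Groups.add_ac(1))
qed

lemma tensor_module: "module K T"
proof (rule moduleI)
  show "cring K" by (rule V.is_cring)
  show "abelian_group T" by (rule tensor_abelian_group)
next
  fix a t assume "a \<in> carrier K" "t \<in> carrier T"
  then show "a \<odot>\<^bsub>T\<^esub> t \<in> carrier T"
    by (elim carrier_tensorE) (simp add: tensor_smult act_closed class_closed)
next
  fix a b t assume "a \<in> carrier K" "b \<in> carrier K" "t \<in> carrier T"
  then show "(a \<oplus> b) \<odot>\<^bsub>T\<^esub> t = a \<odot>\<^bsub>T\<^esub> t \<oplus>\<^bsub>T\<^esub> b \<odot>\<^bsub>T\<^esub> t"
    by (elim carrier_tensorE) (simp add: tensor_smult tensor_add act_closed class_eq act_add)
next
  fix a s t assume "a \<in> carrier K" "s \<in> carrier T" "t \<in> carrier T"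
  then show "a \<odot>\<^bsub>T\<^esub> (s \<oplus>\<^bsub>T\<^esub> t) = a \<odot>\<^bsub>T\<^esub> s \<oplus>\<^bsub>T\<^esub> a \<odot>\<^bsub>T\<^esub> t"
    by (elim carrier_tensorE) (simp add: tensor_smult tensor_add act_closed keys_add_sub frag_extend_add)
next
  fix a b t assume "a \<in> carrier K" "b \<in> carrier K" "t \<in> carrier T"
  then show "(a \<otimes> b) \<odot>\<^bsub>T\<^esub> t = a \<odot>\<^bsub>T\<^esub> (b \<odot>\<^bsub>T\<^esub> t)"
    by (elim carrier_tensorE) (simp add: tensor_smult act_closed act_mult)
next
  fix t assume "t \<in> carrier T"
  then show "\<one> \<odot>\<^bsub>T\<^esub> t = t"
    by (elim carrier_tensorE) (simp add: tensor_smult act_one)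
qed

section \<open>Pure tensors and the universal property\<close>

lemma pure_closed: "v \<in> carrier V \<Longrightarrow> w \<in> carrier W \<Longrightarrow> pure v w \<in> carrier T"
  by (simp add: pure_tensor_def class_closed)

lemma pure_bilinear: "bilinear_map K V W T pure"
proof (intro bilinear_mapI linear_mapI)
  fix v w a
  assume c: "v \<in> carrier V" "w \<in> carrier W"
  show "pure v w \<in> carrier T" "pure v w \<in> carrier T" using c by (simp_all add: pure_closed)
  assume a: "a \<in> carrier K"
  show "pure (a \<odot>\<^bsub>V\<^esub> v) w = a \<odot>\<^bsub>T\<^esub> pure v w"
    using c a by (simp add: pure_tensor_def tensor_smult)
  have "frag_of (a \<odot>\<^bsub>V\<^esub> v, w) - frag_of (v, a \<odot>\<^bsub>W\<^esub> w) \<in> tensor_relators K V W"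
    by (rule tensor_relatorsI(3)[OF a c])
  then have "pure (a \<odot>\<^bsub>V\<^esub> v) w = pure v (a \<odot>\<^bsub>W\<^esub> w)"
    by (simp add: pure_tensor_def class_eq null_relator)
  then show "pure v (a \<odot>\<^bsub>W\<^esub> w) = a \<odot>\<^bsub>T\<^esub> pure v w"
    using c a by (simp add: pure_tensor_def tensor_smult)
next
  fix v v' w
  assume c: "v \<in> carrier V" "v' \<in> carrier V" "w \<in> carrier W"
  have "frag_of (v \<oplus>\<^bsub>V\<^esub> v', w) - frag_of (v, w) - frag_of (v', w) \<in> tensor_relators K V W"
    by (rule tensor_relatorsI(1)[OF c])
  then show "pure (v \<oplus>\<^bsub>V\<^esub> v') w = pure v w \<oplus>\<^bsub>T\<^esub> pure v' w"
    using c null_relator by (simp add: pure_tensor_def tensor_add class_eq diff_diff_eq)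
next
  fix v w w'
  assume c: "v \<in> carrier V" "w \<in> carrier W" "w' \<in> carrier W"
  have "frag_of (v, w \<oplus>\<^bsub>W\<^esub> w') - frag_of (v, w) - frag_of (v, w') \<in> tensor_relators K V W"
    by (rule tensor_relatorsI(2)[OF c])
  then show "pure v (w \<oplus>\<^bsub>W\<^esub> w') = pure v w \<oplus>\<^bsub>T\<^esub> pure v w'"
    using c null_relator by (simp add: pure_tensor_def tensor_add class_eq diff_diff_eq)
qed

lemma pure_add_l: "v \<in> carrier V \<Longrightarrow> v' \<in> carrier V \<Longrightarrow> w \<in> carrier W \<Longrightarrow>
    pure (v \<oplus>\<^bsub>V\<^esub> v') w = pure v w \<oplus>\<^bsub>T\<^esub> pure v' w"
  and pure_add_r: "v \<in> carrier V \<Longrightarrow> w \<in> carrier W \<Longrightarrow> w' \<in> carrier W \<Longrightarrow>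
    pure v (w \<oplus>\<^bsub>W\<^esub> w') = pure v w \<oplus>\<^bsub>T\<^esub> pure v w'"
  and pure_smult_l: "a \<in> carrier K \<Longrightarrow> v \<in> carrier V \<Longrightarrow> w \<in> carrier W \<Longrightarrow>
    pure (a \<odot>\<^bsub>V\<^esub> v) w = a \<odot>\<^bsub>T\<^esub> pure v w"
  and pure_smult_r: "a \<in> carrier K \<Longrightarrow> v \<in> carrier V \<Longrightarrow> w \<in> carrier W \<Longrightarrow>
    pure v (a \<odot>\<^bsub>W\<^esub> w) = a \<odot>\<^bsub>T\<^esub> pure v w"
  using pure_bilinear by (auto simp: bilinear_map_def linear_map_def)

text \<open>Negatives of pure tensors are again pure, namely (-1) v \<otimes> w, so sums of pure
  tensors exhaust the tensor product.\<close>

lemma tensor_induct [consumes 1, case_names zero pure add]: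
  assumes "t \<in> carrier T"
    and "P \<zero>\<^bsub>T\<^esub>"
    and "\<And>v w. v \<in> carrier V \<Longrightarrow> w \<in> carrier W \<Longrightarrow> P (pure v w)"
    and add: "\<And>s t. s \<in> carrier T \<Longrightarrow> t \<in> carrier T \<Longrightarrow> P s \<Longrightarrow> P t \<Longrightarrow> P (s \<oplus>\<^bsub>T\<^esub> t)"
  shows "P t"
proof -
  interpret T: module K T by (rule tensor_module)
  \<comment> \<open>Induction on the free group proceeds by differences, so the claim for
    \<open>p\<close> must be carried together with the claim for \<open>- p\<close>.\<close>
  have "P (cls p) \<and> P (cls (- p))" if "Poly_Mapping.keys p \<subseteq> carrier V \<times> carrier W" for p
    using that
  proof (induct p rule: F_induct)
    case zero then show ?case using assms(2) by (simp add: tensor_zero)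
  next
    case (diff x y)
    then have "cls (x - y) = cls x \<oplus>\<^bsub>T\<^esub> cls (- y)" "cls (- (x - y)) = cls y \<oplus>\<^bsub>T\<^esub> cls (- x)"
      by (simp_all add: tensor_add keys_minus)
    then show ?case using diff add by (simp add: class_closed keys_minus)
  next
    case (single v w)
    define x where x: "x = (v, w)"
    note c = single
    have k: "Poly_Mapping.keys (frag_of x) \<subseteq> carrier V \<times> carrier W" using c by (simp add: x)
    have cl: "cls (- frag_of x) \<in> carrier T" "cls (frag_of x) \<in> carrier T"
      using k by (simp_all add: class_closed)
    have "cls (- frag_of x) \<oplus>\<^bsub>T\<^esub> cls (frag_of x) = \<zero>\<^bsub>T\<^esub>"
      using k by (simp add: tensor_add tensor_zero)
    then have "cls (- frag_of x) = \<ominus>\<^bsub>T\<^esub> (cls (frag_of x))"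
      using cl by (metis T.minus_equality)
    also have "\<dots> = \<ominus>\<^bsub>T\<^esub> (\<one> \<odot>\<^bsub>T\<^esub> cls (frag_of x))"
      using cl by simp
    also have "\<dots> = (\<ominus> \<one>) \<odot>\<^bsub>T\<^esub> cls (frag_of x)"
      using cl by (simp only: T.smult_l_minus V.R.one_closed)
    also have "\<dots> = pure ((\<ominus> \<one>) \<odot>\<^bsub>V\<^esub> v) w"
      using c by (simp add: x pure_tensor_def tensor_smult)
    finally have "cls (- frag_of x) = pure ((\<ominus> \<one>) \<odot>\<^bsub>V\<^esub> v) w" .
    moreover have "cls (frag_of x) = pure v w" by (simp add: x pure_tensor_def)
    ultimately show ?case using c assms(3) by (simp add: x)
  qed
  then show ?thesis using assms(1) by (auto elim: carrier_tensorE)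
qed

lemma tensor_linear_eqI:
  assumes "module K U" "linear_map K T U f" "linear_map K T U g"
    and "\<And>v w. v \<in> carrier V \<Longrightarrow> w \<in> carrier W \<Longrightarrow> f (pure v w) = g (pure v w)"
    and "t \<in> carrier T"
  shows "f t = g t"
  using assms(5)
proof (induct rule: tensor_induct)
  case zero
  interpret U: module K U by fact
  show ?case
    using linear_map_zero[OF tensor_abelian_group U.abelian_group_axioms] assms(2,3) by metis
next
  case (pure v w) then show ?case by (rule assms(4))
next
  case (add s t) then show ?case using linear_map_add[OF assms(2)] linear_map_add[OF assms(3)] by metis
qed

text \<open>The free abelian group gives an additive \<open>h\<close> with the right values on
  generators; bilinearity of \<beta> makes \<open>h\<close> vanish on the relators, so
  \<open>h\<close> factors through the quotient.\<close>

lemma tensor_universal: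
  assumes "module K U" "bilinear_map K V W U \<beta>"
  obtains h where "linear_map K T U h"
    "\<And>v w. v \<in> carrier V \<Longrightarrow> w \<in> carrier W \<Longrightarrow> h (pure v w) = \<beta> v w"
proof -
  interpret U: module K U by fact
  have \<beta>: "v \<in> carrier V \<Longrightarrow> linear_map K W U (\<beta> v)" "w \<in> carrier W \<Longrightarrow> linear_map K V U (\<lambda>v. \<beta> v w)" for v w
    using assms(2) by (auto simp: bilinear_map_def)
  have \<beta>c: "v \<in> carrier V \<Longrightarrow> w \<in> carrier W \<Longrightarrow> \<beta> v w \<in> carrier U" for v w
    using linear_map_closed[OF \<beta>(1)] by blast
  have cg: "comm_group (add_monoid U)" by (rule U.a_comm_group)
  have "(\<lambda>(v, w). \<beta> v w) ` (carrier V \<times> carrier W) \<subseteq> carrier (add_monoid U)"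
    using \<beta>c by auto
  then obtain h where h: "h \<in> hom F (add_monoid U)"
    and hof: "\<And>x. x \<in> carrier V \<times> carrier W \<Longrightarrow> h (frag_of x) = (\<lambda>(v, w). \<beta> v w) x"
    using comm_group.free_Abelian_group_universal[OF cg, of "\<lambda>(v, w). \<beta> v w" "carrier V \<times> carrier W"] by metis
  interpret gh: group_hom F "add_monoid U" h
    using h U.a_group by (simp add: group_hom_def group_hom_axioms_def)
  have hc: "Poly_Mapping.keys p \<subseteq> carrier V \<times> carrier W \<Longrightarrow> h p \<in> carrier U" for p
    using gh.hom_closed[of p] by simp
  have hadd: "Poly_Mapping.keys p \<subseteq> carrier V \<times> carrier W \<Longrightarrow> Poly_Mapping.keys q \<subseteq> carrier V \<times> carrier W \<Longrightarrow>
     h (p + q) = h p \<oplus>\<^bsub>U\<^esub> h q" for p q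
    using gh.hom_mult[of p q] by simp
  have hneg: "Poly_Mapping.keys p \<subseteq> carrier V \<times> carrier W \<Longrightarrow> h (- p) = \<ominus>\<^bsub>U\<^esub> h p" for p
    using gh.hom_inv[of p] by (simp add: a_inv_def)
  have hdiff: "Poly_Mapping.keys p \<subseteq> carrier V \<times> carrier W \<Longrightarrow> Poly_Mapping.keys q \<subseteq> carrier V \<times> carrier W \<Longrightarrow>
     h (p - q) = h p \<ominus>\<^bsub>U\<^esub> h q" for p q
    using hadd[of p "- q"] hneg[of q] by (simp add: keys_minus a_minus_def)
  have rel: "h r = \<zero>\<^bsub>U\<^esub>" if "r \<in> tensor_relators K V W" for r
    using that
  proof (cases rule: tensor_relatorsE)
    case (left v v' w)
    note c = left(1-3)
    have "h r = \<beta> (v \<oplus>\<^bsub>V\<^esub> v') w \<ominus>\<^bsub>U\<^esub> \<beta> v w \<ominus>\<^bsub>U\<^esub> \<beta> v' w"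
      using c by (simp add: left(4) hdiff hof keys_diff_sub)
    also have "\<dots> = \<zero>\<^bsub>U\<^esub>"
      using c \<beta>c linear_map_add[OF \<beta>(2), of w v v']
      by (simp add: a_minus_def U.add.inv_solve_right' U.a_ac U.r_neg1 U.r_neg)
    finally show ?thesis .
  next
    case (right v w w')
    note c = right(1-3)
    have "h r = \<beta> v (w \<oplus>\<^bsub>W\<^esub> w') \<ominus>\<^bsub>U\<^esub> \<beta> v w \<ominus>\<^bsub>U\<^esub> \<beta> v w'"
      using c by (simp add: right(4) hdiff hof keys_diff_sub)
    also have "\<dots> = \<zero>\<^bsub>U\<^esub>"
      using c \<beta>c linear_map_add[OF \<beta>(1), of v w w']
      by (simp add: a_minus_def U.add.inv_solve_right' U.a_ac U.r_neg1 U.r_neg)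
    finally show ?thesis .
  next
    case (scalar b v w)
    note c = scalar(1-3)
    have "h r = \<beta> (b \<odot>\<^bsub>V\<^esub> v) w \<ominus>\<^bsub>U\<^esub> \<beta> v (b \<odot>\<^bsub>W\<^esub> w)"
      using c by (simp add: scalar(4) hdiff hof keys_diff_sub)
    also have "\<dots> = \<zero>\<^bsub>U\<^esub>"
      using c \<beta>c linear_map_smult[OF \<beta>(1), of v b w] linear_map_smult[OF \<beta>(2), of w b v]
      by (simp add: a_minus_def U.r_neg)
    finally show ?thesis .
  qed
  have "N \<subseteq> kernel F (add_monoid U) h"
  proof
    fix n assume n: "n \<in> N"
    then have "n \<in> generate F (tensor_relators K V W)" by (simp add: tensor_null_def)
    then have "n \<in> carrier F \<and> h n = \<zero>\<^bsub>U\<^esub>"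
    proof (induct rule: generate.induct)
      case one show ?case using gh.hom_one by simp
    next
      case (incl r) then show ?case by (simp add: rel relator_keys)
    next
      case (inv r)
      then have "Poly_Mapping.keys r \<subseteq> carrier V \<times> carrier W" by (rule relator_keys)
      then show ?case using rel[OF inv] by (simp add: hneg keys_minus)
    next
      case (eng h1 h2) then show ?case by (simp add: hadd keys_add_sub)
    qed
    then show "n \<in> kernel F (add_monoid U) h" by (simp add: kernel_def)
  qed
  then obtain g where g: "g \<in> hom (F Mod N) (add_monoid U)"
    and gh: "\<And>x. x \<in> carrier F \<Longrightarrow> g (N #>\<^bsub>F\<^esub> x) = h x"
    using gh.FactGroup_universal_kernel[OF null_normal] by metis
  have gcls: "Poly_Mapping.keys p \<subseteq> carrier V \<times> carrier W \<Longrightarrow> g (cls p) = h p" for p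
    using gh[of p] by (simp add: tensor_class_def)
  \<comment> \<open>The factored map is so far only additive; this commutation with
    \<open>act a\<close> on representatives gives linearity.\<close>
  have hact: "h (act a p) = a \<odot>\<^bsub>U\<^esub> h p"
    if "a \<in> carrier K" "Poly_Mapping.keys p \<subseteq> carrier V \<times> carrier W" for a p
    using that(2)
  proof (induct p rule: F_induct)
    case zero then show ?case using that(1) gh.hom_one by simp
  next
    case (diff x y) then show ?case using that(1)
      by (simp add: frag_extend_diff hdiff act_closed a_minus_def U.smult_r_distr U.smult_r_minus hc)
  next
    case (single v w)
    then show ?case using that(1) linear_map_smult[OF \<beta>(2)] by (simp add: hof)
  qed
  have "linear_map K T U g"
  proof (rule linear_mapI)
    fix t assume "t \<in> carrier T" then show "g t \<in> carrier U"
      by (elim carrier_tensorE) (simp add: gcls hc)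
  next
    fix s t assume "s \<in> carrier T" "t \<in> carrier T"
    then show "g (s \<oplus>\<^bsub>T\<^esub> t) = g s \<oplus>\<^bsub>U\<^esub> g t"
      by (elim carrier_tensorE) (simp add: tensor_add gcls keys_add_sub hadd)
  next
    fix a t assume "a \<in> carrier K" "t \<in> carrier T"
    then show "g (a \<odot>\<^bsub>T\<^esub> t) = a \<odot>\<^bsub>U\<^esub> g t"
      by (elim carrier_tensorE) (simp add: tensor_smult gcls act_closed hact)
  qed
  moreover have "g (pure v w) = \<beta> v w" if "v \<in> carrier V" "w \<in> carrier W" for v w
    using that by (simp add: pure_tensor_def gcls hof)
  ultimately show ?thesis using that by blast
qed

text \<open>The definite description in \<open>tensor_lift\<close> is met: existence by the
  universal property, uniqueness because values on pure tensors fix the map on the carrier and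
  extensionality fixes it elsewhere.\<close>

lemma tensor_lift_spec:
  assumes "module K U" "bilinear_map K V W U \<beta>"
  shows "tensor_lift K V W U \<beta> \<in> extensional (carrier T) \<and>
    linear_map K T U (tensor_lift K V W U \<beta>) \<and>
    (\<forall>v\<in>carrier V. \<forall>w\<in>carrier W. tensor_lift K V W U \<beta> (pure v w) = \<beta> v w)"
proof -
  interpret T: module K T by (rule tensor_module)
  obtain h where h: "linear_map K T U h"
    "\<And>v w. v \<in> carrier V \<Longrightarrow> w \<in> carrier W \<Longrightarrow> h (pure v w) = \<beta> v w"
    using tensor_universal[OF assms] by metis
  show ?thesis unfolding tensor_lift_def
  proof (rule theI[of _ "restrict h (carrier T)"], intro conjI ballI)
    show "restrict h (carrier T) \<in> extensional (carrier T)" by simp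
    show "linear_map K T U (restrict h (carrier T))"
      using h(1) by (intro linear_map_restrict T.abelian_group_axioms) auto
    show "\<And>v w. v \<in> carrier V \<Longrightarrow> w \<in> carrier W \<Longrightarrow> restrict h (carrier T) (pure v w) = \<beta> v w"
      using h(2) by (simp add: pure_closed)
  next
    fix g assume g: "g \<in> extensional (carrier T) \<and> linear_map K T U g \<and>
      (\<forall>v\<in>carrier V. \<forall>w\<in>carrier W. g (pure v w) = \<beta> v w)"
    show "g = restrict h (carrier T)"
    proof (rule extensionalityI[of _ "carrier T"])
      fix t assume t: "t \<in> carrier T"
      have "g t = h t"
        by (rule tensor_linear_eqI[OF assms(1) _ h(1) _ t]) (use g h(2) in auto)
      then show "g t = restrict h (carrier T) t" using t by simp
    qed (use g in auto)
  qed
qed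

lemma tensor_lift_linear:
  "module K U \<Longrightarrow> bilinear_map K V W U \<beta> \<Longrightarrow> linear_map K T U (tensor_lift K V W U \<beta>)"
  and tensor_lift_pure:
  "module K U \<Longrightarrow> bilinear_map K V W U \<beta> \<Longrightarrow> v \<in> carrier V \<Longrightarrow> w \<in> carrier W \<Longrightarrow>
    tensor_lift K V W U \<beta> (pure v w) = \<beta> v w"
  using tensor_lift_spec by blast+

end

section \<open>Linear algebra\<close>

lemma (in abelian_group) eq_if_diff_zero:
  assumes "x \<in> carrier G" "y \<in> carrier G" "x \<oplus> \<ominus> y = \<zero>"
  shows "x = y"
  using minus_equality[of x "\<ominus> y"] assms by simp

lemma (in abelian_group) add_eq_add_imp_diff_eq:
  assumes c: "a \<in> carrier G" "b \<in> carrier G" "c \<in> carrier G" "d \<in> carrier G" and "a \<oplus> b = c \<oplus> d"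
  shows "a \<oplus> \<ominus> c = d \<oplus> \<ominus> b"
proof -
  have "a \<oplus> \<ominus> c = (a \<oplus> (b \<oplus> \<ominus> b)) \<oplus> \<ominus> c" using c by (simp add: r_neg)
  also have "\<dots> = (a \<oplus> b) \<oplus> (\<ominus> b \<oplus> \<ominus> c)" using c by (simp add: a_assoc)
  also have "\<dots> = (c \<oplus> \<ominus> c) \<oplus> (d \<oplus> \<ominus> b)" unfolding assms(5) using c by (simp add: a_ac)
  also have "\<dots> = d \<oplus> \<ominus> b" using c by (simp add: r_neg)
  finally show ?thesis .
qed

lemma submoduleD:
  assumes "submodule N R M"
  shows "x \<in> N \<Longrightarrow> x \<in> carrier M" "\<zero>\<^bsub>M\<^esub> \<in> N"
    "x \<in> N \<Longrightarrow> y \<in> N \<Longrightarrow> x \<oplus>\<^bsub>M\<^esub> y \<in> N" "x \<in> N \<Longrightarrow> \<ominus>\<^bsub>M\<^esub> x \<in> N"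
    "a \<in> carrier R \<Longrightarrow> x \<in> N \<Longrightarrow> a \<odot>\<^bsub>M\<^esub> x \<in> N"
proof -
  interpret submodule N R M by fact
  show "x \<in> N \<Longrightarrow> x \<in> carrier M" "\<zero>\<^bsub>M\<^esub> \<in> N"
    "x \<in> N \<Longrightarrow> y \<in> N \<Longrightarrow> x \<oplus>\<^bsub>M\<^esub> y \<in> N" "x \<in> N \<Longrightarrow> \<ominus>\<^bsub>M\<^esub> x \<in> N"
    "a \<in> carrier R \<Longrightarrow> x \<in> N \<Longrightarrow> a \<odot>\<^bsub>M\<^esub> x \<in> N"
    using subset one_closed m_closed m_inv_closed smult_closed by (auto simp: a_inv_def)
qed

lemma (in left_module) smult_l_null: "x \<in> carrier M \<Longrightarrow> \<zero> \<odot>\<^bsub>M\<^esub> x = \<zero>\<^bsub>M\<^esub>"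
proof -
  assume x: "x \<in> carrier M"
  have "\<zero> \<odot>\<^bsub>M\<^esub> x \<oplus>\<^bsub>M\<^esub> \<zero> \<odot>\<^bsub>M\<^esub> x = \<zero> \<odot>\<^bsub>M\<^esub> x"
    using smult_l_distr[of \<zero> \<zero> x] x by simp
  moreover have "\<zero> \<odot>\<^bsub>M\<^esub> x \<in> carrier M" using x by (simp add: smult_closed)
  ultimately show ?thesis by (metis M.add.r_cancel_one')
qed

lemma (in left_module) smult_r_null: "a \<in> carrier R \<Longrightarrow> a \<odot>\<^bsub>M\<^esub> \<zero>\<^bsub>M\<^esub> = \<zero>\<^bsub>M\<^esub>"
proof -
  assume a: "a \<in> carrier R"
  have "a \<odot>\<^bsub>M\<^esub> \<zero>\<^bsub>M\<^esub> \<oplus>\<^bsub>M\<^esub> a \<odot>\<^bsub>M\<^esub> \<zero>\<^bsub>M\<^esub> = a \<odot>\<^bsub>M\<^esub> \<zero>\<^bsub>M\<^esub>"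
    using smult_r_distr[of a "\<zero>\<^bsub>M\<^esub>" "\<zero>\<^bsub>M\<^esub>"] a by simp
  moreover have "a \<odot>\<^bsub>M\<^esub> \<zero>\<^bsub>M\<^esub> \<in> carrier M" using a by (simp add: smult_closed)
  ultimately show ?thesis by (metis M.add.r_cancel_one')
qed

lemma (in left_module) smult_minus_one: "x \<in> carrier M \<Longrightarrow> (\<ominus> \<one>) \<odot>\<^bsub>M\<^esub> x = \<ominus>\<^bsub>M\<^esub> x"
proof -
  assume x: "x \<in> carrier M"
  have "(\<ominus> \<one>) \<odot>\<^bsub>M\<^esub> x \<oplus>\<^bsub>M\<^esub> x = (\<ominus> \<one> \<oplus> \<one>) \<odot>\<^bsub>M\<^esub> x"
    using smult_l_distr[of "\<ominus> \<one>" \<one> x] x by (simp add: smult_one)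
  also have "\<dots> = \<zero>\<^bsub>M\<^esub>" using x by (simp add: R.l_neg smult_l_null)
  finally show ?thesis using x M.minus_equality[of "(\<ominus> \<one>) \<odot>\<^bsub>M\<^esub> x" x] by (simp add: smult_closed)
qed

text \<open>The definition of \<open>submodule\<close> also asks for negatives; these come from -x =
  (-1) x.\<close>

lemma (in left_module) submodule_iff:
  "submodule N R M \<longleftrightarrow> N \<subseteq> carrier M \<and> \<zero>\<^bsub>M\<^esub> \<in> N \<and> (\<forall>x\<in>N. \<forall>y\<in>N. x \<oplus>\<^bsub>M\<^esub> y \<in> N) \<and>
    (\<forall>a\<in>carrier R. \<forall>x\<in>N. a \<odot>\<^bsub>M\<^esub> x \<in> N)"
proof
  assume "submodule N R M"
  then interpret submodule N R M .
  show "N \<subseteq> carrier M \<and> \<zero>\<^bsub>M\<^esub> \<in> N \<and> (\<forall>x\<in>N. \<forall>y\<in>N. x \<oplus>\<^bsub>M\<^esub> y \<in> N) \<and>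
    (\<forall>a\<in>carrier R. \<forall>x\<in>N. a \<odot>\<^bsub>M\<^esub> x \<in> N)"
    using subset one_closed m_closed smult_closed by auto
next
  assume N: "N \<subseteq> carrier M \<and> \<zero>\<^bsub>M\<^esub> \<in> N \<and> (\<forall>x\<in>N. \<forall>y\<in>N. x \<oplus>\<^bsub>M\<^esub> y \<in> N) \<and>
    (\<forall>a\<in>carrier R. \<forall>x\<in>N. a \<odot>\<^bsub>M\<^esub> x \<in> N)"
  have inv: "\<ominus>\<^bsub>M\<^esub> x \<in> N" if "x \<in> N" for x
  proof -
    have "(\<ominus> \<one>) \<odot>\<^bsub>M\<^esub> x \<in> N" using N that by simp
    moreover have "x \<in> carrier M" using N that by blast
    ultimately show ?thesis by (simp add: smult_minus_one)
  qed
  show "submodule N R M"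
    by (intro submodule.intro subgroup.intro submodule_axioms.intro)
      (use N inv in \<open>auto simp: a_inv_def\<close>)
qed

lemma module_imp_left_module: "module K V \<Longrightarrow> left_module K V"
  by (auto simp: module_def left_module_def module_axioms_def left_module_axioms_def cring_def)

lemma module_submodule_iff:
  assumes "module K V"
  shows "submodule N K V \<longleftrightarrow> N \<subseteq> carrier V \<and> \<zero>\<^bsub>V\<^esub> \<in> N \<and> (\<forall>x\<in>N. \<forall>y\<in>N. x \<oplus>\<^bsub>V\<^esub> y \<in> N) \<and>
    (\<forall>a\<in>carrier K. \<forall>x\<in>N. a \<odot>\<^bsub>V\<^esub> x \<in> N)"
  by (rule left_module.submodule_iff[OF module_imp_left_module[OF assms]])

lemma self_module_sel [simp]:
  "carrier (self_module R) = carrier R" "add (self_module R) = add R"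
  "smult (self_module R) = mult R" "ring.zero (self_module R) = ring.zero R"
  by (simp_all add: self_module_def)

lemma self_left_module: "ring R \<Longrightarrow> left_module R (self_module R)"
proof -
  assume "ring R"
  then interpret ring R .
  have "abelian_group (self_module R)"
    by (rule abelian_groupI) (auto simp: a_ac intro: l_neg)
  then show ?thesis
    by (auto simp: left_module_def left_module_axioms_def ring_axioms l_distr r_distr m_assoc)
qed

lemma self_module_module: "cring K \<Longrightarrow> module K (self_module K)"
  using self_left_module[of K] unfolding module_def left_module_def module_axioms_def left_module_axioms_def
  by (auto simp: cring_def)

text \<open>Functionals are cut off outside the carrier, so that two of them are equal as functions
  as soon as they agree on \<open>V\<close>.\<close>

definition dual_space :: "('k, 'x) ring_scheme \<Rightarrow> ('k, 'v, 'y) module_scheme \<Rightarrow> ('v \<Rightarrow> 'k) set"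
  where "dual_space K V = {f \<in> extensional (carrier V). linear_map K V (self_module K) f}"

section \<open>Complements, projections and separating functionals over a field\<close>

locale vec = V: module K V for K (structure) and V :: "('k, 'v, 'y) module_scheme" +
  assumes field: "field K"

context vec
begin

lemma one_not_zero: "\<one> \<noteq> \<zero>"
  using domain.one_not_zero[OF field.axioms(1)[OF field]] .

lemma field_inverse: "a \<in> carrier K \<Longrightarrow> a \<noteq> \<zero> \<Longrightarrow> \<exists>b\<in>carrier K. b \<otimes> a = \<one>"
  using field.field_Units[OF field] monoid.Units_inv_closed[OF V.R.monoid_axioms, of a]
    monoid.Units_l_inv[OF V.R.monoid_axioms, of a] by blast

abbreviation "K1 \<equiv> self_module K"

lemma K1_module: "module K K1"
  by (rule self_module_module) (rule V.is_cring)

lemma dual_linear: "f \<in> dual_space K V \<Longrightarrow> linear_map K V K1 f"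
  by (simp add: dual_space_def)

lemma dual_closed: "f \<in> dual_space K V \<Longrightarrow> x \<in> carrier V \<Longrightarrow> f x \<in> carrier K"
  using linear_map_closed[OF dual_linear] by fastforce

lemma dual_add: "f \<in> dual_space K V \<Longrightarrow> x \<in> carrier V \<Longrightarrow> y \<in> carrier V \<Longrightarrow> f (x \<oplus>\<^bsub>V\<^esub> y) = f x \<oplus> f y"
  using linear_map_add[OF dual_linear] by fastforce

lemma dual_smult: "f \<in> dual_space K V \<Longrightarrow> a \<in> carrier K \<Longrightarrow> x \<in> carrier V \<Longrightarrow> f (a \<odot>\<^bsub>V\<^esub> x) = a \<otimes> f x"
  using linear_map_smult[OF dual_linear] by fastforce

lemma dual_zero: "f \<in> dual_space K V \<Longrightarrow> f \<zero>\<^bsub>V\<^esub> = \<zero>"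
  using linear_map_zero[OF V.abelian_group_axioms module.axioms(2)[OF K1_module] dual_linear] by simp

lemma dual_minus: "f \<in> dual_space K V \<Longrightarrow> x \<in> carrier V \<Longrightarrow> f (\<ominus>\<^bsub>V\<^esub> x) = \<ominus> f x"
  using dual_smult[of f "\<ominus> \<one>" x] dual_closed[of f x]
  by (simp add: V.smult_l_minus V.R.l_minus)

lemma dual_restrict:
  assumes "linear_map K V K1 f"
  shows "restrict f (carrier V) \<in> dual_space K V"
  using linear_map_restrict[OF assms V.abelian_group_axioms] by (simp add: dual_space_def)

lemma dualI:
  assumes "\<And>x. x \<in> carrier V \<Longrightarrow> f x \<in> carrier K"
    and "\<And>x y. x \<in> carrier V \<Longrightarrow> y \<in> carrier V \<Longrightarrow> f (x \<oplus>\<^bsub>V\<^esub> y) = f x \<oplus> f y"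
    and "\<And>a x. a \<in> carrier K \<Longrightarrow> x \<in> carrier V \<Longrightarrow> f (a \<odot>\<^bsub>V\<^esub> x) = a \<otimes> f x"
  shows "restrict f (carrier V) \<in> dual_space K V"
  by (rule dual_restrict, rule linear_mapI) (use assms in auto)

text \<open>Zorn's lemma for the subspaces that contain \<open>A\<close> and meet \<open>N\<close>
  only in zero. A maximal \<open>L\<close> is a complement: for x outside N + L, the space L + Kx
  would still meet \<open>N\<close> trivially.\<close>

lemma complement:
  assumes N: "submodule N K V" and A: "submodule A K V" and NA: "N \<inter> A = {\<zero>\<^bsub>V\<^esub>}"
  shows "\<exists>L. submodule L K V \<and> A \<subseteq> L \<and> N \<inter> L = {\<zero>\<^bsub>V\<^esub>} \<and>
    (\<forall>x\<in>carrier V. \<exists>n\<in>N. \<exists>l\<in>L. x = n \<oplus>\<^bsub>V\<^esub> l)"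
proof -
  note sub = module_submodule_iff[OF V.module_axioms]
  define \<A> where "\<A> = {L. submodule L K V \<and> A \<subseteq> L \<and> N \<inter> L = {\<zero>\<^bsub>V\<^esub>}}"
  have "A \<in> \<A>" using A NA by (simp add: \<A>_def)
  moreover have "\<Union>C \<in> \<A>" if C: "C \<noteq> {}" "subset.chain \<A> C" for C
  proof -
    have mem: "L \<in> C \<Longrightarrow> submodule L K V \<and> A \<subseteq> L \<and> N \<inter> L = {\<zero>\<^bsub>V\<^esub>}" for L
      using C(2) by (auto simp: subset.chain_def \<A>_def)
    have tot: "L \<in> C \<Longrightarrow> L' \<in> C \<Longrightarrow> L \<subseteq> L' \<or> L' \<subseteq> L" for L L'
      using C(2) by (auto simp: subset.chain_def)
    obtain L0 where L0: "L0 \<in> C" using C(1) by blast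
    have memD: "L \<in> C \<Longrightarrow> submodule L K V" for L using mem by blast
    have "submodule (\<Union>C) K V"
      unfolding sub
    proof (intro conjI ballI)
      show "\<Union>C \<subseteq> carrier V" using submoduleD(1)[OF memD] by (intro Union_least subsetI)
      show "\<zero>\<^bsub>V\<^esub> \<in> \<Union>C" using submoduleD(2)[OF memD[OF L0]] L0 by (rule_tac UnionI)
    next
      fix x y assume "x \<in> \<Union>C" "y \<in> \<Union>C"
      then obtain L L' where L: "L \<in> C" "x \<in> L" "L' \<in> C" "y \<in> L'" by (elim UnionE)
      from tot[OF L(1,3)] show "x \<oplus>\<^bsub>V\<^esub> y \<in> \<Union>C"
      proof
        assume "L \<subseteq> L'"
        then have "x \<in> L'" using L(2) by (rule subsetD)
        then show ?thesis using submoduleD(3)[OF memD[OF L(3)] _ L(4)] L(3) by (intro UnionI)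
      next
        assume "L' \<subseteq> L"
        then have "y \<in> L" using L(4) by (rule subsetD)
        then show ?thesis using submoduleD(3)[OF memD[OF L(1)] L(2)] L(1) by (intro UnionI)
      qed
    next
      fix a x assume a: "a \<in> carrier K" and "x \<in> \<Union>C"
      then obtain L where L: "L \<in> C" "x \<in> L" by (elim UnionE)
      then show "a \<odot>\<^bsub>V\<^esub> x \<in> \<Union>C" using submoduleD(5)[OF memD a] by (intro UnionI)
    qed
    moreover have "A \<subseteq> \<Union>C" using mem[OF L0] L0 by blast
    moreover have "N \<inter> \<Union>C = {\<zero>\<^bsub>V\<^esub>}" using mem L0 by blast
    ultimately show ?thesis by (simp add: \<A>_def)
  qed
  ultimately obtain L where L: "L \<in> \<A>" and max: "\<And>X. X \<in> \<A> \<Longrightarrow> L \<subseteq> X \<Longrightarrow> X = L"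
    using subset_Zorn_nonempty[of \<A>] by blast
  have Ls: "submodule L K V" "A \<subseteq> L" "N \<inter> L = {\<zero>\<^bsub>V\<^esub>}" using L by (auto simp: \<A>_def)
  note N' = N[unfolded sub] and L' = Ls(1)[unfolded sub]
  have "\<exists>n\<in>N. \<exists>l\<in>L. x = n \<oplus>\<^bsub>V\<^esub> l" if x: "x \<in> carrier V" for x
  proof (rule ccontr)
    assume neg: "\<not> (\<exists>n\<in>N. \<exists>l\<in>L. x = n \<oplus>\<^bsub>V\<^esub> l)"
    \<comment> \<open>The one-step extension L + Kx, which will contradict maximality.\<close>
    define X where "X = {l \<oplus>\<^bsub>V\<^esub> a \<odot>\<^bsub>V\<^esub> x | l a. l \<in> L \<and> a \<in> carrier K}"
    have XI: "l \<in> L \<Longrightarrow> a \<in> carrier K \<Longrightarrow> l \<oplus>\<^bsub>V\<^esub> a \<odot>\<^bsub>V\<^esub> x \<in> X" for l a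
      by (auto simp: X_def)
    have LX: "L \<subseteq> X"
    proof
      fix l assume l: "l \<in> L"
      then have "l \<oplus>\<^bsub>V\<^esub> \<zero> \<odot>\<^bsub>V\<^esub> x = l" using L' x by (simp add: subset_iff)
      then show "l \<in> X" using XI[OF l, of \<zero>] by simp
    qed
    have "x \<in> X" using XI[of "\<zero>\<^bsub>V\<^esub>" \<one>] L' x by simp
    moreover have "x \<notin> L" using neg submoduleD(2)[OF N] V.M.l_zero[OF x] by force
    ultimately have ne: "X \<noteq> L" by blast
    have "submodule X K V"
      unfolding sub
    proof (intro conjI ballI)
      show "X \<subseteq> carrier V" using L' x by (auto simp: X_def subset_iff)
      show "\<zero>\<^bsub>V\<^esub> \<in> X" using LX L' by blast
    next
      fix y z assume "y \<in> X" "z \<in> X"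
      then obtain l a l' a' where y: "y = l \<oplus>\<^bsub>V\<^esub> a \<odot>\<^bsub>V\<^esub> x" "z = l' \<oplus>\<^bsub>V\<^esub> a' \<odot>\<^bsub>V\<^esub> x"
        and c: "l \<in> L" "l' \<in> L" "a \<in> carrier K" "a' \<in> carrier K" by (auto simp: X_def)
      have cV: "l \<in> carrier V" "l' \<in> carrier V" using c L' by auto
      have "y \<oplus>\<^bsub>V\<^esub> z = (l \<oplus>\<^bsub>V\<^esub> l') \<oplus>\<^bsub>V\<^esub> (a \<oplus> a') \<odot>\<^bsub>V\<^esub> x"
        using c cV x by (simp add: y V.smult_l_distr V.M.a_ac)
      then show "y \<oplus>\<^bsub>V\<^esub> z \<in> X" using XI[of "l \<oplus>\<^bsub>V\<^esub> l'" "a \<oplus> a'"] c L' by simp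
    next
      fix b y assume b: "b \<in> carrier K" and "y \<in> X"
      then obtain l a where y: "y = l \<oplus>\<^bsub>V\<^esub> a \<odot>\<^bsub>V\<^esub> x" and c: "l \<in> L" "a \<in> carrier K"
        by (auto simp: X_def)
      have "l \<in> carrier V" using c L' by auto
      then have "b \<odot>\<^bsub>V\<^esub> y = b \<odot>\<^bsub>V\<^esub> l \<oplus>\<^bsub>V\<^esub> (b \<otimes> a) \<odot>\<^bsub>V\<^esub> x"
        using c x b by (simp add: y V.smult_r_distr V.smult_assoc1)
      then show "b \<odot>\<^bsub>V\<^esub> y \<in> X" using XI[of "b \<odot>\<^bsub>V\<^esub> l" "b \<otimes> a"] c L' b by simp
    qed
    moreover have "N \<inter> X = {\<zero>\<^bsub>V\<^esub>}"
    proof (intro equalityI subsetI)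
      fix y assume "y \<in> N \<inter> X"
      then obtain l a where yN: "y \<in> N" and y: "y = l \<oplus>\<^bsub>V\<^esub> a \<odot>\<^bsub>V\<^esub> x" and c: "l \<in> L" "a \<in> carrier K"
        by (auto simp: X_def)
      have cV: "l \<in> carrier V" "y \<in> carrier V" using c L' N' yN by auto
      \<comment> \<open>A nonzero coefficient could be inverted, which would express
        \<open>x\<close> as an element of N + L.\<close>
      have "a = \<zero>"
      proof (rule ccontr)
        assume "a \<noteq> \<zero>"
        then obtain b where u: "b \<in> carrier K" "b \<otimes> a = \<one>"
          using field_inverse[OF c(2)] by blast
        have "x = b \<odot>\<^bsub>V\<^esub> (a \<odot>\<^bsub>V\<^esub> x)" using u c x by (simp flip: V.smult_assoc1)
        also have "a \<odot>\<^bsub>V\<^esub> x = y \<oplus>\<^bsub>V\<^esub> (\<ominus>\<^bsub>V\<^esub> l)"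
          using cV c x by (simp add: y V.M.a_ac V.M.r_neg1 V.M.r_neg V.M.r_neg2)
        also have "b \<odot>\<^bsub>V\<^esub> \<dots> = b \<odot>\<^bsub>V\<^esub> y \<oplus>\<^bsub>V\<^esub> ((\<ominus> b) \<odot>\<^bsub>V\<^esub> l)"
          using u cV by (simp add: V.smult_r_distr V.smult_r_minus V.smult_l_minus)
        finally have "x = b \<odot>\<^bsub>V\<^esub> y \<oplus>\<^bsub>V\<^esub> ((\<ominus> b) \<odot>\<^bsub>V\<^esub> l)" .
        moreover have "b \<odot>\<^bsub>V\<^esub> y \<in> N" "(\<ominus> b) \<odot>\<^bsub>V\<^esub> l \<in> L"
          using N' L' yN c u by auto
        ultimately show False using neg by blast
      qed
      then have "y = l" using y x cV by simp
      then show "y \<in> {\<zero>\<^bsub>V\<^esub>}" using yN c Ls(3) by blast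
    next
      fix y assume "y \<in> {\<zero>\<^bsub>V\<^esub>}" then show "y \<in> N \<inter> X" using N' LX L' by blast
    qed
    ultimately have "X \<in> \<A>" using LX Ls(2) by (auto simp: \<A>_def)
    then show False using max LX ne by blast
  qed
  then show ?thesis using Ls by blast
qed

text \<open>The extra subspace \<open>A\<close> lets the projection onto \<open>N\<close> kill a
  prescribed part; \<open>separation\<close> uses this with \<open>N\<close> a line. The
  \<open>N\<close>-component is unique because the complement meets \<open>N\<close> trivially, and
  uniqueness makes \<open>P\<close> linear.\<close>

lemma projection:
  assumes N: "submodule N K V" and A: "submodule A K V" and NA: "N \<inter> A = {\<zero>\<^bsub>V\<^esub>}"
  shows "\<exists>P. linear_map K V V P \<and> (\<forall>x\<in>carrier V. P x \<in> N) \<and> (\<forall>x\<in>N. P x = x) \<and>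
    (\<forall>x\<in>A. P x = \<zero>\<^bsub>V\<^esub>)"
proof -
  note sub = module_submodule_iff[OF V.module_axioms]
  obtain L where L: "submodule L K V" "A \<subseteq> L" "N \<inter> L = {\<zero>\<^bsub>V\<^esub>}"
    and "\<forall>x\<in>carrier V. \<exists>n\<in>N. \<exists>l\<in>L. x = n \<oplus>\<^bsub>V\<^esub> l"
    using complement[OF assms] by blast
  note dec = this(4)[rule_format]
  note N' = N[unfolded sub] and L' = L(1)[unfolded sub]
  define P where "P x = (SOME n. n \<in> N \<and> (\<exists>l\<in>L. x = n \<oplus>\<^bsub>V\<^esub> l))" for x
  have uniq: "n = n'" if "n \<in> N" "n' \<in> N" "l \<in> L" "l' \<in> L" "n \<oplus>\<^bsub>V\<^esub> l = n' \<oplus>\<^bsub>V\<^esub> l'" for n n' l l'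
  proof -
    have c: "n \<in> carrier V" "n' \<in> carrier V" "l \<in> carrier V" "l' \<in> carrier V"
      using that N' L' by auto
    have eq: "n \<oplus>\<^bsub>V\<^esub> (\<ominus>\<^bsub>V\<^esub> n') = l' \<oplus>\<^bsub>V\<^esub> (\<ominus>\<^bsub>V\<^esub> l)"
      by (rule V.M.add_eq_add_imp_diff_eq) (use c that(5) in auto)
    have "n \<oplus>\<^bsub>V\<^esub> (\<ominus>\<^bsub>V\<^esub> n') \<in> N" using that by (simp add: submoduleD[OF N])
    moreover have "l' \<oplus>\<^bsub>V\<^esub> (\<ominus>\<^bsub>V\<^esub> l) \<in> L" using that by (simp add: submoduleD[OF L(1)])
    ultimately have "n \<oplus>\<^bsub>V\<^esub> (\<ominus>\<^bsub>V\<^esub> n') \<in> N \<inter> L" unfolding eq by simp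
    then have "n \<oplus>\<^bsub>V\<^esub> (\<ominus>\<^bsub>V\<^esub> n') = \<zero>\<^bsub>V\<^esub>" unfolding L(3) by simp
    then show ?thesis using c by (rule_tac V.M.eq_if_diff_zero) auto
  qed
  have ex: "P x \<in> N \<and> (\<exists>l\<in>L. x = P x \<oplus>\<^bsub>V\<^esub> l)" if "x \<in> carrier V" for x
    unfolding P_def by (rule someI_ex) (use dec[OF that] in blast)
  have Peq: "P (n \<oplus>\<^bsub>V\<^esub> l) = n" if "n \<in> N" "l \<in> L" for n l
  proof -
    have "n \<oplus>\<^bsub>V\<^esub> l \<in> carrier V" using that N' L' by auto
    then obtain l' where "l' \<in> L" "n \<oplus>\<^bsub>V\<^esub> l = P (n \<oplus>\<^bsub>V\<^esub> l) \<oplus>\<^bsub>V\<^esub> l'" "P (n \<oplus>\<^bsub>V\<^esub> l) \<in> N"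
      using ex by blast
    then show ?thesis using uniq[of "P (n \<oplus>\<^bsub>V\<^esub> l)" n l' l] that by simp
  qed
  have "linear_map K V V P"
  proof (rule linear_mapI)
    fix x assume "x \<in> carrier V" then show "P x \<in> carrier V" using ex N' by blast
  next
    fix x y assume xy: "x \<in> carrier V" "y \<in> carrier V"
    obtain l l' where l: "l \<in> L" "x = P x \<oplus>\<^bsub>V\<^esub> l" "l' \<in> L" "y = P y \<oplus>\<^bsub>V\<^esub> l'"
      using ex[OF xy(1)] ex[OF xy(2)] by blast
    have c: "P x \<in> carrier V" "P y \<in> carrier V" "l \<in> carrier V" "l' \<in> carrier V" "P x \<in> N" "P y \<in> N"
      using ex xy N' L' l by auto
    have "x \<oplus>\<^bsub>V\<^esub> y = (P x \<oplus>\<^bsub>V\<^esub> P y) \<oplus>\<^bsub>V\<^esub> (l \<oplus>\<^bsub>V\<^esub> l')"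
      using c by (subst l(2), subst l(4)) (simp add: V.M.a_ac)
    then show "P (x \<oplus>\<^bsub>V\<^esub> y) = P x \<oplus>\<^bsub>V\<^esub> P y"
      using Peq[of "P x \<oplus>\<^bsub>V\<^esub> P y" "l \<oplus>\<^bsub>V\<^esub> l'"] c l N' L' by simp
  next
    fix a x assume xy: "a \<in> carrier K" "x \<in> carrier V"
    obtain l where l: "l \<in> L" "x = P x \<oplus>\<^bsub>V\<^esub> l" using ex[OF xy(2)] by blast
    have c: "P x \<in> carrier V" "l \<in> carrier V" "P x \<in> N" using ex xy N' L' l by auto
    have "a \<odot>\<^bsub>V\<^esub> x = a \<odot>\<^bsub>V\<^esub> P x \<oplus>\<^bsub>V\<^esub> a \<odot>\<^bsub>V\<^esub> l"
      using c xy by (subst l(2)) (simp add: V.smult_r_distr)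
    then show "P (a \<odot>\<^bsub>V\<^esub> x) = a \<odot>\<^bsub>V\<^esub> P x"
      using Peq[of "a \<odot>\<^bsub>V\<^esub> P x" "a \<odot>\<^bsub>V\<^esub> l"] c l xy N' L' by simp
  qed
  moreover have "P x = x" if "x \<in> N" for x
    using Peq[OF that submoduleD(2)[OF L(1)]] submoduleD(1)[OF N that] by simp
  moreover have "P x = \<zero>\<^bsub>V\<^esub>" if "x \<in> A" for x
    using Peq[OF submoduleD(2)[OF N], of x] L(2) submoduleD(1)[OF A that] that by auto
  ultimately show ?thesis using ex by (intro exI[of _ P]) simp
qed

lemma zero_submodule: "submodule {\<zero>\<^bsub>V\<^esub>} K V"
  by (simp add: module_submodule_iff[OF V.module_axioms])

lemma projection0:
  assumes N: "submodule N K V"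
  shows "\<exists>P. linear_map K V V P \<and> (\<forall>x\<in>carrier V. P x \<in> N) \<and> (\<forall>x\<in>N. P x = x)"
proof -
  have "N \<inter> {\<zero>\<^bsub>V\<^esub>} = {\<zero>\<^bsub>V\<^esub>}" using submoduleD(2)[OF N] by blast
  from projection[OF N zero_submodule this] show ?thesis by blast
qed

text \<open>Project onto the line Kx along \<open>N\<close> and read off the coefficient of
  \<open>x\<close>; the coefficient is well defined because no nonzero multiple of \<open>x\<close>
  lies in \<open>N\<close>.\<close>

lemma separation:
  assumes N: "submodule N K V" and x: "x \<in> carrier V" "x \<notin> N"
  shows "\<exists>f\<in>dual_space K V. (\<forall>y\<in>N. f y = \<zero>) \<and> f x = \<one>"
proof -
  note sub = module_submodule_iff[OF V.module_axioms]
  note N' = N[unfolded sub]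
  define X where "X = {a \<odot>\<^bsub>V\<^esub> x | a. a \<in> carrier K}"
  have canc: "a = \<zero>" if a: "a \<in> carrier K" "a \<odot>\<^bsub>V\<^esub> x \<in> N" for a
  proof (rule ccontr)
    assume "a \<noteq> \<zero>"
    then obtain b where u: "b \<in> carrier K" "b \<otimes> a = \<one>"
      using field_inverse[OF a(1)] by blast
    have "x = b \<odot>\<^bsub>V\<^esub> (a \<odot>\<^bsub>V\<^esub> x)" using u a x by (simp flip: V.smult_assoc1)
    also have "\<dots> \<in> N" using u(1) a(2) by (rule submoduleD(5)[OF N])
    finally show False using x(2) by simp
  qed
  have inj: "a = b" if "a \<in> carrier K" "b \<in> carrier K" "a \<odot>\<^bsub>V\<^esub> x = b \<odot>\<^bsub>V\<^esub> x" for a b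
  proof -
    have "(a \<oplus> (\<ominus> b)) \<odot>\<^bsub>V\<^esub> x = \<zero>\<^bsub>V\<^esub>"
      using that x by (simp add: V.smult_l_distr V.smult_l_minus V.M.r_neg)
    then have "a \<oplus> (\<ominus> b) = \<zero>" using canc[of "a \<oplus> (\<ominus> b)"] that N' by simp
    then show ?thesis using that by (rule_tac V.R.eq_if_diff_zero) auto
  qed
  have Xs: "submodule X K V"
    unfolding sub
  proof (intro conjI ballI)
    show "X \<subseteq> carrier V" using x by (auto simp: X_def)
    have "\<zero>\<^bsub>V\<^esub> = \<zero> \<odot>\<^bsub>V\<^esub> x" using x by simp
    then show "\<zero>\<^bsub>V\<^esub> \<in> X" unfolding X_def by blast
  next
    fix y z assume "y \<in> X" "z \<in> X"
    then obtain a b where "y = a \<odot>\<^bsub>V\<^esub> x" "z = b \<odot>\<^bsub>V\<^esub> x" "a \<in> carrier K" "b \<in> carrier K"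
      by (auto simp: X_def)
    then have "y \<oplus>\<^bsub>V\<^esub> z = (a \<oplus> b) \<odot>\<^bsub>V\<^esub> x" "a \<oplus> b \<in> carrier K" using x by (simp_all add: V.smult_l_distr)
    then show "y \<oplus>\<^bsub>V\<^esub> z \<in> X" unfolding X_def by blast
  next
    fix b y assume "b \<in> carrier K" "y \<in> X"
    then obtain a where "y = a \<odot>\<^bsub>V\<^esub> x" "a \<in> carrier K" "b \<in> carrier K" by (auto simp: X_def)
    then have "b \<odot>\<^bsub>V\<^esub> y = (b \<otimes> a) \<odot>\<^bsub>V\<^esub> x" "b \<otimes> a \<in> carrier K" using x by (simp_all add: V.smult_assoc1)
    then show "b \<odot>\<^bsub>V\<^esub> y \<in> X" unfolding X_def by blast
  qed
  have "X \<inter> N = {\<zero>\<^bsub>V\<^esub>}"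
  proof (intro equalityI subsetI)
    fix y assume "y \<in> X \<inter> N"
    then obtain a where "y = a \<odot>\<^bsub>V\<^esub> x" "a \<in> carrier K" "y \<in> N" by (auto simp: X_def)
    then show "y \<in> {\<zero>\<^bsub>V\<^esub>}" using canc[of a] x by simp
  qed (use submoduleD(2)[OF N] submoduleD(2)[OF Xs] in simp)
  from projection[OF Xs N this] obtain P where "linear_map K V V P" "\<forall>y\<in>carrier V. P y \<in> X"
    "\<forall>y\<in>X. P y = y" "\<forall>y\<in>N. P y = \<zero>\<^bsub>V\<^esub>" by blast
  note P = this[rule_format]
  define f where "f y = (SOME a. a \<in> carrier K \<and> P y = a \<odot>\<^bsub>V\<^esub> x)" for y
  have f: "f y \<in> carrier K \<and> P y = f y \<odot>\<^bsub>V\<^esub> x" if "y \<in> carrier V" for y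
    unfolding f_def by (rule someI_ex) (use P(2)[OF that] in \<open>auto simp: X_def\<close>)
  have feq: "f y = a" if "y \<in> carrier V" "a \<in> carrier K" "P y = a \<odot>\<^bsub>V\<^esub> x" for y a
  proof (rule inj)
    show "f y \<odot>\<^bsub>V\<^esub> x = a \<odot>\<^bsub>V\<^esub> x" by (rule trans[OF conjunct2[OF f[OF that(1)], symmetric] that(3)])
  qed (use f[OF that(1)] that(2) in blast)+
  have "restrict f (carrier V) \<in> dual_space K V"
  proof (rule dualI)
    fix y z assume "y \<in> carrier V" "z \<in> carrier V"
    then show "f (y \<oplus>\<^bsub>V\<^esub> z) = f y \<oplus> f z"
      using f x linear_map_add[OF P(1), of y z] by (intro feq) (simp_all add: V.smult_l_distr)
  next
    fix a y assume "a \<in> carrier K" "y \<in> carrier V"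
    then show "f (a \<odot>\<^bsub>V\<^esub> y) = a \<otimes> f y"
      using f x linear_map_smult[OF P(1), of a y] by (intro feq) (simp_all add: V.smult_assoc1)
  qed (use f in blast)
  moreover have "f y = \<zero>" if "y \<in> N" for y
    using that N' P(4)[OF that] x by (intro feq) auto
  moreover have "f x = \<one>"
  proof (rule feq)
    have "x = \<one> \<odot>\<^bsub>V\<^esub> x" using x by simp
    then have "x \<in> X" unfolding X_def using V.R.one_closed by blast
    then show "P x = \<one> \<odot>\<^bsub>V\<^esub> x" using P(3) x by simp
  qed (use x in auto)
  ultimately show ?thesis using N' x by (intro bexI[of _ "restrict f (carrier V)"]) (auto simp: subset_iff)
qed

lemma dual_separates:
  assumes "x \<in> carrier V" "y \<in> carrier V" "\<And>f. f \<in> dual_space K V \<Longrightarrow> f x = f y"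
  shows "x = y"
proof (rule ccontr)
  assume ne: "x \<noteq> y"
  have "x \<oplus>\<^bsub>V\<^esub> (\<ominus>\<^bsub>V\<^esub> y) \<noteq> \<zero>\<^bsub>V\<^esub>"
    using ne V.M.eq_if_diff_zero[OF assms(1,2)] by blast
  then obtain f where f: "f \<in> dual_space K V" "f (x \<oplus>\<^bsub>V\<^esub> (\<ominus>\<^bsub>V\<^esub> y)) = \<one>"
    using separation[OF zero_submodule, of "x \<oplus>\<^bsub>V\<^esub> (\<ominus>\<^bsub>V\<^esub> y)"] assms(1,2) by auto
  have "f (x \<oplus>\<^bsub>V\<^esub> (\<ominus>\<^bsub>V\<^esub> y)) = f y \<oplus> (\<ominus> f y)"
    using f(1) assms(1,2) assms(3)[OF f(1)] by (simp add: dual_add dual_minus)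
  also have "\<dots> = \<zero>" using dual_closed[OF f(1) assms(2)] by (rule V.R.r_neg)
  finally show False using f(2) one_not_zero by simp
qed

end

lemma linear_image_submodule:
  assumes "module K V" "module K W" "submodule N K V" "linear_map K V W u"
  shows "submodule (u ` N) K W"
  unfolding module_submodule_iff[OF assms(2)]
proof (intro conjI ballI)
  interpret V: module K V by fact
  interpret W: module K W by fact
  note u = linear_map_closed[OF assms(4)] linear_map_add[OF assms(4)] linear_map_smult[OF assms(4)]
  show "u ` N \<subseteq> carrier W" using u(1) submoduleD(1)[OF assms(3)] by auto
  have "u \<zero>\<^bsub>V\<^esub> = \<zero>\<^bsub>W\<^esub>"
    by (rule linear_map_zero[OF V.abelian_group_axioms W.abelian_group_axioms assms(4)])
  then show "\<zero>\<^bsub>W\<^esub> \<in> u ` N" using imageI[OF submoduleD(2)[OF assms(3)], of u] by simp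
next
  note u = linear_map_add[OF assms(4)]
  fix x y assume "x \<in> u ` N" "y \<in> u ` N"
  then obtain m n where mn: "m \<in> N" "n \<in> N" "x = u m" "y = u n" by blast
  have "x \<oplus>\<^bsub>W\<^esub> y = u (m \<oplus>\<^bsub>V\<^esub> n)"
    unfolding mn using u[of m n] submoduleD(1)[OF assms(3)] mn by simp
  then show "x \<oplus>\<^bsub>W\<^esub> y \<in> u ` N" using submoduleD(3)[OF assms(3)] mn by blast
next
  note u = linear_map_smult[OF assms(4)]
  fix a y assume a: "a \<in> carrier K" and "y \<in> u ` N"
  then obtain n where mn: "n \<in> N" "y = u n" by blast
  have "a \<odot>\<^bsub>W\<^esub> y = u (a \<odot>\<^bsub>V\<^esub> n)"
    unfolding mn using u[of a n] a submoduleD(1)[OF assms(3)] mn by simp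
  then show "a \<odot>\<^bsub>W\<^esub> y \<in> u ` N" using submoduleD(5)[OF assms(3) a] mn by blast
qed

text \<open>Project \<open>W\<close> onto u(N), lift to any preimage in \<open>N\<close>, and apply
  \<psi>. The chosen preimages need not depend linearly on the argument; the vanishing condition
  makes \<psi> constant on the fibres of \<open>u\<close> in \<open>N\<close>, and this restores
  linearity.\<close>

lemma functional_factor:
  assumes "vec K V" "vec K W" "submodule N K V" "linear_map K V W u" "\<psi> \<in> dual_space K V"
    and van: "\<And>n. n \<in> N \<Longrightarrow> u n = \<zero>\<^bsub>W\<^esub> \<Longrightarrow> \<psi> n = \<zero>\<^bsub>K\<^esub>"
  shows "\<exists>\<chi>\<in>dual_space K W. \<forall>n\<in>N. \<psi> n = \<chi> (u n)"
proof -
  interpret V: vec K V by fact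
  interpret W: vec K W by fact
  note N' = assms(3)[unfolded module_submodule_iff[OF V.V.module_axioms]]
  note u = linear_map_closed[OF assms(4)] linear_map_add[OF assms(4)] linear_map_smult[OF assms(4)]
  have "submodule (u ` N) K W"
    by (rule linear_image_submodule[OF V.V.module_axioms W.V.module_axioms assms(3,4)])
  from W.projection0[OF this] obtain P where "linear_map K W W P" "\<forall>x\<in>carrier W. P x \<in> u ` N"
    "\<forall>x\<in>u ` N. P x = x" by blast
  note P = this[rule_format]
  define s where "s w = (SOME n. n \<in> N \<and> u n = w)" for w
  have s: "s w \<in> N \<and> u (s w) = w" if "w \<in> u ` N" for w
    unfolding s_def by (rule someI_ex) (use that in blast)
  have eq: "\<psi> m = \<psi> n" if "m \<in> N" "n \<in> N" "u m = u n" for m n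
  proof -
    have c: "m \<in> carrier V" "n \<in> carrier V" using that N' by auto
    have mN: "m \<oplus>\<^bsub>V\<^esub> (\<ominus>\<^bsub>V\<^esub> n) \<in> N" using that by (simp add: submoduleD[OF assms(3)])
    have "u (m \<oplus>\<^bsub>V\<^esub> (\<ominus>\<^bsub>V\<^esub> n)) = \<zero>\<^bsub>W\<^esub>"
      using c that u(1)[of n] u(2)[of m "\<ominus>\<^bsub>V\<^esub> n"]
        linear_map_minus[OF V.V.abelian_group_axioms W.V.abelian_group_axioms assms(4), of n]
      by (simp add: W.V.M.r_neg)
    then have "\<psi> m \<oplus>\<^bsub>K\<^esub> (\<ominus>\<^bsub>K\<^esub> \<psi> n) = \<zero>\<^bsub>K\<^esub>"
      using van[OF mN] assms(5) c by (simp add: V.dual_add V.dual_minus)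
    then show ?thesis using V.dual_closed[OF assms(5)] c
      by (rule_tac V.V.R.eq_if_diff_zero) auto
  qed
  define \<chi> where "\<chi> w = \<psi> (s (P w))" for w
  have sP: "s (P w) \<in> N" "u (s (P w)) = P w" "s (P w) \<in> carrier V" if "w \<in> carrier W" for w
    using s[OF P(2)[OF that]] N' by auto
  have "restrict \<chi> (carrier W) \<in> dual_space K W"
  proof (rule W.dualI)
    fix x assume "x \<in> carrier W"
    then show "\<chi> x \<in> carrier K" unfolding \<chi>_def using sP V.dual_closed[OF assms(5)] by blast
  next
    fix x y assume xy: "x \<in> carrier W" "y \<in> carrier W"
    have "\<chi> (x \<oplus>\<^bsub>W\<^esub> y) = \<psi> (s (P x) \<oplus>\<^bsub>V\<^esub> s (P y))"
      unfolding \<chi>_def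
      using xy sP[of "x \<oplus>\<^bsub>W\<^esub> y"] sP[of x] sP[of y] N' u(2)[of "s (P x)" "s (P y)"] linear_map_add[OF P(1) xy]
      by (intro eq) simp_all
    then show "\<chi> (x \<oplus>\<^bsub>W\<^esub> y) = \<chi> x \<oplus>\<^bsub>K\<^esub> \<chi> y"
      using sP[of x] sP[of y] xy assms(5) by (simp add: \<chi>_def V.dual_add)
  next
    fix a x assume xy: "a \<in> carrier K" "x \<in> carrier W"
    have "\<chi> (a \<odot>\<^bsub>W\<^esub> x) = \<psi> (a \<odot>\<^bsub>V\<^esub> s (P x))"
      unfolding \<chi>_def
      using xy sP[of "a \<odot>\<^bsub>W\<^esub> x"] sP[of x] N' u(3)[of a "s (P x)"] linear_map_smult[OF P(1) xy]
      by (intro eq) simp_all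
    then show "\<chi> (a \<odot>\<^bsub>W\<^esub> x) = a \<otimes>\<^bsub>K\<^esub> \<chi> x"
      using sP[of x] xy assms(5) by (simp add: \<chi>_def V.dual_smult)
  qed
  moreover have "\<psi> n = restrict \<chi> (carrier W) (u n)" if n: "n \<in> N" for n
  proof -
    have c: "u n \<in> carrier W" using n N' u(1) by auto
    have "P (u n) = u n" using P(3) n by blast
    then have "\<psi> n = \<chi> (u n)" unfolding \<chi>_def using sP[OF c] n by (intro eq) simp_all
    then show ?thesis using c by simp
  qed
  ultimately show ?thesis by (intro bexI[of _ "restrict \<chi> (carrier W)"] ballI)
qed

section \<open>Contractions by functionals and the separation of tensors\<close>

locale two_vecs = VV: vec K V + WW: vec K W
  for K (structure) and V :: "('k, 'v, 'y) module_scheme" and W :: "('k, 'w, 'z) module_scheme"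

sublocale two_vecs \<subseteq> two_modules K V W
  by (rule two_modules.intro[OF VV.V.module_axioms WW.V.module_axioms])

text \<open>This is \<open>f \<otimes> id\<close> followed by the identification of K \<otimes> W
  with \<open>W\<close>.\<close>

definition contract where
  "contract K V W f = tensor_lift K V W W (\<lambda>v w. f v \<odot>\<^bsub>W\<^esub> w)"

context two_vecs
begin

lemma contract_bilinear:
  assumes f: "f \<in> dual_space K V"
  shows "bilinear_map K V W W (\<lambda>v w. f v \<odot>\<^bsub>W\<^esub> w)"
proof (intro bilinear_mapI linear_mapI)
  fix v w a assume v: "v \<in> carrier V" and w: "w \<in> carrier W"
  note c = VV.dual_closed[OF f v]
  show "f v \<odot>\<^bsub>W\<^esub> w \<in> carrier W" "f v \<odot>\<^bsub>W\<^esub> w \<in> carrier W" using c w by simp_all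
  assume a: "a \<in> carrier K"
  show "f (a \<odot>\<^bsub>V\<^esub> v) \<odot>\<^bsub>W\<^esub> w = a \<odot>\<^bsub>W\<^esub> (f v \<odot>\<^bsub>W\<^esub> w)"
    using a c v w f by (simp add: VV.dual_smult WW.V.smult_assoc1)
  show "f v \<odot>\<^bsub>W\<^esub> (a \<odot>\<^bsub>W\<^esub> w) = a \<odot>\<^bsub>W\<^esub> (f v \<odot>\<^bsub>W\<^esub> w)"
    using a c w by (simp add: VV.V.m_comm flip: WW.V.smult_assoc1)
next
  fix v v' w assume "v \<in> carrier V" "v' \<in> carrier V" "w \<in> carrier W"
  then show "f (v \<oplus>\<^bsub>V\<^esub> v') \<odot>\<^bsub>W\<^esub> w = f v \<odot>\<^bsub>W\<^esub> w \<oplus>\<^bsub>W\<^esub> f v' \<odot>\<^bsub>W\<^esub> w"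
    using f VV.dual_closed[OF f] by (simp add: VV.dual_add WW.V.smult_l_distr)
next
  fix v w w' assume "v \<in> carrier V" "w \<in> carrier W" "w' \<in> carrier W"
  then show "f v \<odot>\<^bsub>W\<^esub> (w \<oplus>\<^bsub>W\<^esub> w') = f v \<odot>\<^bsub>W\<^esub> w \<oplus>\<^bsub>W\<^esub> f v \<odot>\<^bsub>W\<^esub> w'"
    using f VV.dual_closed[OF f] by (simp add: WW.V.smult_r_distr)
qed

lemma contract_linear: "f \<in> dual_space K V \<Longrightarrow> linear_map K T W (contract K V W f)"
  unfolding contract_def by (rule tensor_lift_linear[OF WW.V.module_axioms contract_bilinear])

lemma contract_pure: "f \<in> dual_space K V \<Longrightarrow> v \<in> carrier V \<Longrightarrow> w \<in> carrier W \<Longrightarrow>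
    contract K V W f (pure v w) = f v \<odot>\<^bsub>W\<^esub> w"
  unfolding contract_def by (rule tensor_lift_pure[OF WW.V.module_axioms contract_bilinear])

text \<open>Spans of lists stand in for a basis: every tensor lies in some \<open>tspan vs\<close>,
  and the recursion on the list lets vectors be eliminated one at a time.\<close>

primrec lspan :: "'v list \<Rightarrow> 'v set" where
  "lspan [] = {\<zero>\<^bsub>V\<^esub>}"
| "lspan (v # vs) = {a \<odot>\<^bsub>V\<^esub> v \<oplus>\<^bsub>V\<^esub> x | a x. a \<in> carrier K \<and> x \<in> lspan vs}"

primrec tspan :: "'v list \<Rightarrow> ('v, 'w) tensor set" where
  "tspan [] = {\<zero>\<^bsub>T\<^esub>}"
| "tspan (v # vs) = {pure v w \<oplus>\<^bsub>T\<^esub> t | w t. w \<in> carrier W \<and> t \<in> tspan vs}"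

lemma lspan_ConsI: "a \<in> carrier K \<Longrightarrow> x \<in> lspan vs \<Longrightarrow> a \<odot>\<^bsub>V\<^esub> v \<oplus>\<^bsub>V\<^esub> x \<in> lspan (v # vs)"
  by (simp only: lspan.simps) blast

lemma tspan_ConsI: "w \<in> carrier W \<Longrightarrow> t \<in> tspan vs \<Longrightarrow> pure v w \<oplus>\<^bsub>T\<^esub> t \<in> tspan (v # vs)"
  by (simp only: tspan.simps) blast

lemma lspan_submodule: "set vs \<subseteq> carrier V \<Longrightarrow> submodule (lspan vs) K V"
proof (induct vs)
  case Nil then show ?case by (simp add: VV.zero_submodule)
next
  case (Cons v vs)
  note sub = module_submodule_iff[OF VV.V.module_axioms]
  have v: "v \<in> carrier V" using Cons by simp
  have L: "lspan vs \<subseteq> carrier V" "\<zero>\<^bsub>V\<^esub> \<in> lspan vs"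
    "\<And>x y. x \<in> lspan vs \<Longrightarrow> y \<in> lspan vs \<Longrightarrow> x \<oplus>\<^bsub>V\<^esub> y \<in> lspan vs"
    "\<And>a x. a \<in> carrier K \<Longrightarrow> x \<in> lspan vs \<Longrightarrow> a \<odot>\<^bsub>V\<^esub> x \<in> lspan vs"
    using Cons(1)[unfolded sub] Cons(2) by auto
  show ?case unfolding sub
  proof (intro conjI ballI)
    show "lspan (v # vs) \<subseteq> carrier V" using L v by (auto simp: subset_iff)
    have "\<zero>\<^bsub>V\<^esub> = \<zero> \<odot>\<^bsub>V\<^esub> v \<oplus>\<^bsub>V\<^esub> \<zero>\<^bsub>V\<^esub>" using v by simp
    then show "\<zero>\<^bsub>V\<^esub> \<in> lspan (v # vs)" using lspan_ConsI[OF VV.V.R.zero_closed L(2), of v] by simp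
  next
    fix x y assume "x \<in> lspan (v # vs)" "y \<in> lspan (v # vs)"
    then obtain a x' b y' where xy: "x = a \<odot>\<^bsub>V\<^esub> v \<oplus>\<^bsub>V\<^esub> x'" "y = b \<odot>\<^bsub>V\<^esub> v \<oplus>\<^bsub>V\<^esub> y'"
      and c: "a \<in> carrier K" "b \<in> carrier K" "x' \<in> lspan vs" "y' \<in> lspan vs" by auto
    have "x' \<in> carrier V" "y' \<in> carrier V" using c L by auto
    then have "x \<oplus>\<^bsub>V\<^esub> y = (a \<oplus> b) \<odot>\<^bsub>V\<^esub> v \<oplus>\<^bsub>V\<^esub> (x' \<oplus>\<^bsub>V\<^esub> y')"
      using c v by (simp add: xy VV.V.smult_l_distr VV.V.M.a_ac)
    then show "x \<oplus>\<^bsub>V\<^esub> y \<in> lspan (v # vs)"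
      using lspan_ConsI[of "a \<oplus> b" "x' \<oplus>\<^bsub>V\<^esub> y'" vs v] c L(3) by (simp del: lspan.simps)
  next
    fix b x assume b: "b \<in> carrier K" and "x \<in> lspan (v # vs)"
    then obtain a x' where xy: "x = a \<odot>\<^bsub>V\<^esub> v \<oplus>\<^bsub>V\<^esub> x'" and c: "a \<in> carrier K" "x' \<in> lspan vs" by auto
    have "x' \<in> carrier V" using c L by auto
    then have "b \<odot>\<^bsub>V\<^esub> x = (b \<otimes> a) \<odot>\<^bsub>V\<^esub> v \<oplus>\<^bsub>V\<^esub> (b \<odot>\<^bsub>V\<^esub> x')"
      using c v b by (simp add: xy VV.V.smult_r_distr VV.V.smult_assoc1)
    then show "b \<odot>\<^bsub>V\<^esub> x \<in> lspan (v # vs)"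
      using lspan_ConsI[of "b \<otimes> a" "b \<odot>\<^bsub>V\<^esub> x'" vs v] c b L(4) by (simp del: lspan.simps)
  qed
qed

lemma tspan_closed: "set vs \<subseteq> carrier V \<Longrightarrow> t \<in> tspan vs \<Longrightarrow> t \<in> carrier T"
proof (induct vs arbitrary: t)
  interpret T: module K T by (rule tensor_module)
  case Nil then show ?case by simp
next
  interpret T: module K T by (rule tensor_module)
  case (Cons v vs) then show ?case by (auto simp: pure_closed)
qed

lemma tspan_add: "set vs \<subseteq> carrier V \<Longrightarrow> s \<in> tspan vs \<Longrightarrow> t \<in> tspan vs \<Longrightarrow> s \<oplus>\<^bsub>T\<^esub> t \<in> tspan vs"
proof (induct vs arbitrary: s t)
  interpret T: module K T by (rule tensor_module)
  case Nil then show ?case by simp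
next
  interpret T: module K T by (rule tensor_module)
  case (Cons v vs)
  then obtain w s' w' t' where st: "s = pure v w \<oplus>\<^bsub>T\<^esub> s'" "t = pure v w' \<oplus>\<^bsub>T\<^esub> t'"
    and c: "w \<in> carrier W" "w' \<in> carrier W" "s' \<in> tspan vs" "t' \<in> tspan vs" by auto
  have "s' \<in> carrier T" "t' \<in> carrier T" "v \<in> carrier V" using c Cons(2) tspan_closed by auto
  then have "s \<oplus>\<^bsub>T\<^esub> t = pure v (w \<oplus>\<^bsub>W\<^esub> w') \<oplus>\<^bsub>T\<^esub> (s' \<oplus>\<^bsub>T\<^esub> t')"
    using c by (simp add: st pure_add_r pure_closed T.M.a_ac)
  moreover have "s' \<oplus>\<^bsub>T\<^esub> t' \<in> tspan vs" using Cons(1)[of s' t'] Cons(2) c by simp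
  ultimately show ?case using c tspan_ConsI[of "w \<oplus>\<^bsub>W\<^esub> w'"] by (simp del: tspan.simps)
qed

lemma tspan_pure: "set vs \<subseteq> carrier V \<Longrightarrow> v \<in> lspan vs \<Longrightarrow> w \<in> carrier W \<Longrightarrow> pure v w \<in> tspan vs"
proof (induct vs arbitrary: v)
  case Nil
  interpret T: module K T by (rule tensor_module)
  have "pure \<zero>\<^bsub>V\<^esub> w = pure (\<zero> \<odot>\<^bsub>V\<^esub> \<zero>\<^bsub>V\<^esub>) w" by simp
  also have "\<dots> = \<zero>\<^bsub>T\<^esub>" using Nil pure_closed[of "\<zero>\<^bsub>V\<^esub>" w] by (subst pure_smult_l) auto
  finally show ?case using Nil by simp
next
  case (Cons u vs)
  then obtain a x where v: "v = a \<odot>\<^bsub>V\<^esub> u \<oplus>\<^bsub>V\<^esub> x" and c: "a \<in> carrier K" "x \<in> lspan vs" by auto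
  have "x \<in> carrier V" "u \<in> carrier V"
    using c Cons(2) lspan_submodule[of vs] module_submodule_iff[OF VV.V.module_axioms, of "lspan vs"] by auto
  then have "pure v w = pure u (a \<odot>\<^bsub>W\<^esub> w) \<oplus>\<^bsub>T\<^esub> pure x w"
    using c Cons(4) by (simp add: v pure_add_l pure_smult_l pure_smult_r)
  moreover have "pure x w \<in> tspan vs" using Cons(1)[of x] Cons(2,4) c by simp
  ultimately show ?case using c Cons(4) tspan_ConsI[of "a \<odot>\<^bsub>W\<^esub> w"] by (simp del: tspan.simps)
qed

lemma tspan_contract: "set vs \<subseteq> carrier V \<Longrightarrow> t \<in> tspan vs \<Longrightarrow> f \<in> dual_space K V \<Longrightarrow>
   (\<And>v. v \<in> lspan vs \<Longrightarrow> f v = \<zero>) \<Longrightarrow> contract K V W f t = \<zero>\<^bsub>W\<^esub>"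
proof (induct vs arbitrary: t)
  case Nil
  then show ?case
    using linear_map_zero[OF tensor_abelian_group WW.V.abelian_group_axioms contract_linear[OF Nil(3)]] by simp
next
  case (Cons u vs)
  then obtain w s where t: "t = pure u w \<oplus>\<^bsub>T\<^esub> s" and c: "w \<in> carrier W" "s \<in> tspan vs" by auto
  have u: "u \<in> carrier V" using Cons(2) by simp
  note L = lspan_submodule[of vs, unfolded module_submodule_iff[OF VV.V.module_axioms]]
  have "\<one> \<odot>\<^bsub>V\<^esub> u \<oplus>\<^bsub>V\<^esub> \<zero>\<^bsub>V\<^esub> \<in> lspan (u # vs)" using L Cons(2) by (intro lspan_ConsI) auto
  then have fu: "f u = \<zero>" using Cons(5) u by simp
  have "f v = \<zero>" if "v \<in> lspan vs" for v
  proof -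
    have "\<zero> \<odot>\<^bsub>V\<^esub> u \<oplus>\<^bsub>V\<^esub> v \<in> lspan (u # vs)" using that by (intro lspan_ConsI) auto
    moreover have "\<zero> \<odot>\<^bsub>V\<^esub> u \<oplus>\<^bsub>V\<^esub> v = v" using u that L Cons(2) by auto
    ultimately show ?thesis using Cons(5)[of v] by simp
  qed
  then have "contract K V W f s = \<zero>\<^bsub>W\<^esub>" using Cons(1)[of s] c Cons(2,4) by simp
  moreover have "s \<in> carrier T" using tspan_closed[OF _ c(2)] Cons(2) by simp
  ultimately have "contract K V W f t = contract K V W f (pure u w) \<oplus>\<^bsub>W\<^esub> \<zero>\<^bsub>W\<^esub>"
    using linear_map_add[OF contract_linear[OF Cons(4)], of "pure u w" s] pure_closed[OF u c(1)] t by simp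
  then show ?case by (simp add: contract_pure[OF Cons(4) u c(1)] fu c(1))
qed

text \<open>Drop the head \<open>u\<close> of the list. If \<open>u\<close> depends on the rest, its
  term is absorbed. Otherwise some functional kills the rest and is one at \<open>u\<close>;
  contracting with it leaves \<open>w\<close>, so \<open>w\<close> is zero and the term
  vanishes.\<close>

lemma tspan_separation: "set vs \<subseteq> carrier V \<Longrightarrow> t \<in> tspan vs \<Longrightarrow>
   (\<And>f. f \<in> dual_space K V \<Longrightarrow> contract K V W f t = \<zero>\<^bsub>W\<^esub>) \<Longrightarrow> t = \<zero>\<^bsub>T\<^esub>"
proof (induct vs arbitrary: t)
  case Nil from Nil(2) show ?case by simp
next
  case (Cons u vs)
  interpret T: module K T by (rule tensor_module)
  obtain w s where t: "t = pure u w \<oplus>\<^bsub>T\<^esub> s" and c: "w \<in> carrier W" "s \<in> tspan vs" using Cons(3) by auto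
  have u: "u \<in> carrier V" and vs: "set vs \<subseteq> carrier V" using Cons(2) by auto
  have sT: "s \<in> carrier T" using tspan_closed vs c by blast
  have "t \<in> tspan vs"
  proof (cases "u \<in> lspan vs")
    case True then show ?thesis unfolding t using vs c by (intro tspan_add tspan_pure)
  next
    case False
    from VV.separation[OF lspan_submodule[OF vs] u this]
    obtain f where "f \<in> dual_space K V" "\<forall>y\<in>lspan vs. f y = \<zero>" "f u = \<one>" by blast
    note f = this[rule_format]
    have "contract K V W f s = \<zero>\<^bsub>W\<^esub>" by (rule tspan_contract[OF vs c(2) f(1,2)])
    then have "contract K V W f t = contract K V W f (pure u w) \<oplus>\<^bsub>W\<^esub> \<zero>\<^bsub>W\<^esub>"
      using linear_map_add[OF contract_linear[OF f(1)], of "pure u w" s] pure_closed[OF u c(1)] t sT by simp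
    also have "\<dots> = w" by (simp add: contract_pure[OF f(1) u c(1)] f(3) c(1))
    finally have w0: "w = \<zero>\<^bsub>W\<^esub>" using Cons(4)[OF f(1)] by simp
    have "pure u w = pure u (\<zero> \<odot>\<^bsub>W\<^esub> \<zero>\<^bsub>W\<^esub>)" by (simp add: w0)
    also have "\<dots> = \<zero>\<^bsub>T\<^esub>" using u pure_closed[of u "\<zero>\<^bsub>W\<^esub>"] by (subst pure_smult_r) auto
    finally show ?thesis using t c sT by simp
  qed
  from Cons(1)[OF vs this Cons(4)] show ?case .
qed

lemma tspan_append: "set vs \<subseteq> carrier V \<Longrightarrow> set us \<subseteq> carrier V \<Longrightarrow> s \<in> tspan vs \<Longrightarrow> t \<in> tspan us \<Longrightarrow>
    s \<oplus>\<^bsub>T\<^esub> t \<in> tspan (vs @ us)"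
proof (induct vs arbitrary: s)
  interpret T: module K T by (rule tensor_module)
  case Nil
  have "t \<in> carrier T" by (rule tspan_closed[OF Nil(2,4)])
  then show ?case using Nil(3,4) by simp
next
  interpret T: module K T by (rule tensor_module)
  case (Cons v vs)
  then obtain w s' where s: "s = pure v w \<oplus>\<^bsub>T\<^esub> s'" and c: "w \<in> carrier W" "s' \<in> tspan vs" by auto
  have "s' \<in> carrier T" "t \<in> carrier T" "v \<in> carrier V"
    using c Cons(2,3,5) tspan_closed[of vs s'] tspan_closed[of us t] by auto
  then have "s \<oplus>\<^bsub>T\<^esub> t = pure v w \<oplus>\<^bsub>T\<^esub> (s' \<oplus>\<^bsub>T\<^esub> t)" using c by (simp add: s pure_closed T.M.a_assoc)
  moreover have "s' \<oplus>\<^bsub>T\<^esub> t \<in> tspan (vs @ us)" using Cons(1)[of s'] Cons(2-5) c by simp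
  ultimately show ?case using c tspan_ConsI[of w "s' \<oplus>\<^bsub>T\<^esub> t" "vs @ us" v] by (simp del: tspan.simps)
qed

lemma tspan_exhaust:
  assumes "t \<in> carrier T"
  shows "\<exists>vs. set vs \<subseteq> carrier V \<and> t \<in> tspan vs"
  using assms
proof (induct rule: tensor_induct)
  case zero show ?case by (intro exI[of _ "[]"]) simp
next
  case (pure v w)
  interpret T: module K T by (rule tensor_module)
  have "pure v w \<oplus>\<^bsub>T\<^esub> \<zero>\<^bsub>T\<^esub> = pure v w" using pure by (simp add: pure_closed)
  then have "pure v w \<in> tspan [v]" using tspan_ConsI[OF pure(2), of "\<zero>\<^bsub>T\<^esub>" "[]" v] by (simp del: tspan.simps(2))
  then show ?case using pure by (intro exI[of _ "[v]"]) simp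
next
  case (add s t)
  then obtain vs us where "set vs \<subseteq> carrier V" "s \<in> tspan vs" "set us \<subseteq> carrier V" "t \<in> tspan us" by blast
  then show ?case using tspan_append[of vs us s t] by (intro exI[of _ "vs @ us"]) simp
qed

text \<open>Contractions separate points because the difference of two tensors lies in a finite
  span, where \<open>tspan_separation\<close> applies. Over a field this turns an equation in V
  \<otimes> W into a family of equations in \<open>W\<close>.\<close>

lemma tensor_eqI:
  assumes "s \<in> carrier T" "t \<in> carrier T"
    and "\<And>f. f \<in> dual_space K V \<Longrightarrow> contract K V W f s = contract K V W f t"
  shows "s = t"
proof -
  interpret T: module K T by (rule tensor_module)
  have c: "s \<oplus>\<^bsub>T\<^esub> (\<ominus>\<^bsub>T\<^esub> t) \<in> carrier T" using assms by simp
  obtain vs where vs: "set vs \<subseteq> carrier V" "s \<oplus>\<^bsub>T\<^esub> (\<ominus>\<^bsub>T\<^esub> t) \<in> tspan vs"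
    using tspan_exhaust[OF c] by blast
  have "contract K V W f (s \<oplus>\<^bsub>T\<^esub> (\<ominus>\<^bsub>T\<^esub> t)) = \<zero>\<^bsub>W\<^esub>" if f: "f \<in> dual_space K V" for f
  proof -
    note lin = contract_linear[OF f]
    have "contract K V W f (s \<oplus>\<^bsub>T\<^esub> (\<ominus>\<^bsub>T\<^esub> t)) = contract K V W f t \<oplus>\<^bsub>W\<^esub> (\<ominus>\<^bsub>W\<^esub> contract K V W f t)"
      using assms(1,2) linear_map_add[OF lin, of s "\<ominus>\<^bsub>T\<^esub> t"] assms(3)[OF f]
        linear_map_minus[OF tensor_abelian_group WW.V.abelian_group_axioms lin, of t] by simp
    then show ?thesis using linear_map_closed[OF lin assms(2)] by (simp add: WW.V.M.r_neg)
  qed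
  then have "s \<oplus>\<^bsub>T\<^esub> (\<ominus>\<^bsub>T\<^esub> t) = \<zero>\<^bsub>T\<^esub>" using tspan_separation[OF vs] by blast
  then show ?thesis using assms(1,2) by (rule_tac T.M.eq_if_diff_zero) auto
qed

end

section \<open>Contractions of tensor maps\<close>

lemma vec_module: "vec K V \<Longrightarrow> module K V"
  by (simp add: vec_def)

lemma vec_abelian: "vec K V \<Longrightarrow> abelian_group V"
  by (rule module.axioms(2)[OF vec_module])

lemma vecI: "field K \<Longrightarrow> module K V \<Longrightarrow> vec K V"
  by (simp add: vec_def vec_axioms_def)

lemma vec_field: "vec K V \<Longrightarrow> field K"
  by (rule vec.field)

lemma two_vecsI: "vec K V \<Longrightarrow> vec K W \<Longrightarrow> two_vecs K V W"
  by (simp add: two_vecs_def)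

lemma two_modulesI: "vec K V \<Longrightarrow> vec K W \<Longrightarrow> two_modules K V W"
  by (simp add: two_modules_def vec_module)

lemma vec_tensor: "vec K V \<Longrightarrow> vec K W \<Longrightarrow> vec K (tensor_product K V W)"
  by (rule vecI[OF vec_field two_modules.tensor_module[OF two_modulesI]])

lemma vec_self: "vec K V \<Longrightarrow> vec K (self_module K)"
  by (rule vecI[OF vec_field self_module_module[OF module.axioms(1)[OF vec_module]]])

lemma linear_map_plus:
  assumes "vec K V" "vec K W" "linear_map K V W f" "linear_map K V W g"
  shows "linear_map K V W (\<lambda>x. f x \<oplus>\<^bsub>W\<^esub> g x)"
proof -
  interpret W: module K W by (rule vec_module[OF assms(2)])
  note f = linear_map_closed[OF assms(3)] linear_map_add[OF assms(3)] linear_map_smult[OF assms(3)]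
  note g = linear_map_closed[OF assms(4)] linear_map_add[OF assms(4)] linear_map_smult[OF assms(4)]
  show ?thesis
    by (rule linear_mapI) (simp_all add: f g W.smult_r_distr W.M.a_ac)
qed

lemma linear_map_scale:
  assumes "vec K V" "vec K W" "linear_map K V W f" "a \<in> carrier K"
  shows "linear_map K V W (\<lambda>x. a \<odot>\<^bsub>W\<^esub> f x)"
proof -
  interpret W: module K W by (rule vec_module[OF assms(2)])
  note f = linear_map_closed[OF assms(3)] linear_map_add[OF assms(3)] linear_map_smult[OF assms(3)]
  show ?thesis
  proof (rule linear_mapI)
    fix b x assume b: "b \<in> carrier K" and x: "x \<in> carrier V"
    have "a \<odot>\<^bsub>W\<^esub> (b \<odot>\<^bsub>W\<^esub> f x) = b \<odot>\<^bsub>W\<^esub> (a \<odot>\<^bsub>W\<^esub> f x)"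
      using W.smult_assoc1[OF assms(4) b f(1)[OF x]] W.smult_assoc1[OF b assms(4) f(1)[OF x]]
        W.R.m_comm[OF assms(4) b] by simp
    then show "a \<odot>\<^bsub>W\<^esub> f (b \<odot>\<^bsub>V\<^esub> x) = b \<odot>\<^bsub>W\<^esub> (a \<odot>\<^bsub>W\<^esub> f x)" by (simp add: f b x)
  qed (simp_all add: f assms(4) W.smult_r_distr)
qed

lemma linear_map_id: "linear_map K V V (\<lambda>x. x)"
  by (simp add: linear_map_def)

lemma tensor_map_bilinear:
  assumes "vec K V" "vec K W" "vec K V'" "vec K W'" "linear_map K V V' f" "linear_map K W W' g"
  shows "bilinear_map K V W (tensor_product K V' W') (\<lambda>v w. pure_tensor K V' W' (f v) (g w))"
proof -
  interpret T': two_modules K V' W' by (rule two_modulesI[OF assms(3,4)])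
  have b1: "v \<in> carrier V' \<Longrightarrow> linear_map K W' (tensor_product K V' W') (pure_tensor K V' W' v)"
    and b2: "w \<in> carrier W' \<Longrightarrow> linear_map K V' (tensor_product K V' W') (\<lambda>v. pure_tensor K V' W' v w)" for v w
    using T'.pure_bilinear by (simp_all add: bilinear_map_def)
  show ?thesis
    by (rule bilinear_mapI)
      (rule linear_map_compose[OF assms(6) b1[OF linear_map_closed[OF assms(5)]]]
        linear_map_compose[OF assms(5) b2[OF linear_map_closed[OF assms(6)]]], assumption)+
qed

lemma tensor_map_linear:
  assumes "vec K V" "vec K W" "vec K V'" "vec K W'" "linear_map K V V' f" "linear_map K W W' g"
  shows "linear_map K (tensor_product K V W) (tensor_product K V' W') (tensor_map K V W V' W' f g)"
  unfolding tensor_map_def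
  by (rule two_modules.tensor_lift_linear[OF two_modulesI[OF assms(1,2)]
        vec_module[OF vec_tensor[OF assms(3,4)]] tensor_map_bilinear[OF assms]])

lemma tensor_map_pure:
  assumes "vec K V" "vec K W" "vec K V'" "vec K W'" "linear_map K V V' f" "linear_map K W W' g"
    and "v \<in> carrier V" "w \<in> carrier W"
  shows "tensor_map K V W V' W' f g (pure_tensor K V W v w) = pure_tensor K V' W' (f v) (g w)"
  unfolding tensor_map_def
  by (rule two_modules.tensor_lift_pure[OF two_modulesI[OF assms(1,2)]
        vec_module[OF vec_tensor[OF assms(3,4)]] tensor_map_bilinear[OF assms(1-6)] assms(7,8)])

lemma dual_compose:
  assumes "vec K V" "vec K W" "linear_map K V W g" "f \<in> dual_space K W"
  shows "(\<lambda>v\<in>carrier V. f (g v)) \<in> dual_space K V"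
  by (rule vec.dual_restrict[OF assms(1) linear_map_compose[OF assms(3) vec.dual_linear[OF assms(2,4)]]])

text \<open>Naturality of contraction: f(F v) G w = G (f(F v) w), checked on pure tensors.\<close>

lemma contract_tensor_map:
  assumes v: "vec K V" "vec K W" "vec K V'" "vec K W'" "linear_map K V V' F" "linear_map K W W' G"
    and f: "f \<in> dual_space K V'" and t: "t \<in> carrier (tensor_product K V W)"
  shows "contract K V' W' f (tensor_map K V W V' W' F G t) = G (contract K V W (\<lambda>v\<in>carrier V. f (F v)) t)"
proof -
  interpret T: two_vecs K V W by (rule two_vecsI[OF v(1,2)])
  interpret T': two_vecs K V' W' by (rule two_vecsI[OF v(3,4)])
  note g = dual_compose[OF v(1,3,5) f]
  show ?thesis
  proof (rule T.tensor_linear_eqI[OF vec_module[OF v(4)] linear_map_compose[OF tensor_map_linear[OF v] T'.contract_linear[OF f]]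
          linear_map_compose[OF T.contract_linear[OF g] v(6)] _ t])
    fix x y assume x: "x \<in> carrier V" and y: "y \<in> carrier W"
    have fx: "f (F x) \<in> carrier K" by (rule vec.dual_closed[OF v(3) f linear_map_closed[OF v(5) x]])
    show "contract K V' W' f (tensor_map K V W V' W' F G (pure_tensor K V W x y)) =
        G (contract K V W (\<lambda>v\<in>carrier V. f (F v)) (pure_tensor K V W x y))"
      by (simp add: tensor_map_pure[OF v x y] T.contract_pure[OF g x y] x
          T'.contract_pure[OF f linear_map_closed[OF v(5) x] linear_map_closed[OF v(6) y]]
          linear_map_smult[OF v(6) fx y])
  qed
qed

lemma contract_tensor_map_id:
  assumes v: "vec K V" "vec K W" "vec K W'" "linear_map K W W' G"
    and f: "f \<in> dual_space K V" and t: "t \<in> carrier (tensor_product K V W)"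
  shows "contract K V W' f (tensor_map K V W V W' (\<lambda>x. x) G t) = G (contract K V W f t)"
proof -
  have "(\<lambda>v\<in>carrier V. f v) = f" using f by (simp add: dual_space_def extensional_restrict)
  then show ?thesis
    using contract_tensor_map[OF v(1,2,1,3) linear_map_id v(4) f t] by simp
qed

text \<open>The functional \<open>f \<otimes> g\<close>, with K \<otimes> K identified with
  \<open>K\<close>. Composed with the comultiplication it is the convolution product.\<close>

definition ev where
  "ev K V W f g = tensor_lift K V W (self_module K) (\<lambda>v w. f v \<otimes>\<^bsub>K\<^esub> g w)"

lemma ev_bilinear:
  assumes "vec K V" "vec K W" "f \<in> dual_space K V" "g \<in> dual_space K W"
  shows "bilinear_map K V W (self_module K) (\<lambda>v w. f v \<otimes>\<^bsub>K\<^esub> g w)"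
proof -
  interpret V: vec K V by fact
  interpret W: vec K W by fact
  note f = V.dual_closed[OF assms(3)] V.dual_add[OF assms(3)] V.dual_smult[OF assms(3)]
  note g = W.dual_closed[OF assms(4)] W.dual_add[OF assms(4)] W.dual_smult[OF assms(4)]
  show ?thesis
    by (intro bilinear_mapI linear_mapI)
      (simp_all add: f g V.V.R.l_distr V.V.R.r_distr V.V.R.m_ac)
qed

lemma ev_dual:
  assumes "vec K V" "vec K W" "f \<in> dual_space K V" "g \<in> dual_space K W"
  shows "ev K V W f g \<in> dual_space K (tensor_product K V W)"
  using two_modules.tensor_lift_spec[OF two_modulesI[OF assms(1,2)] vec_module[OF vec_self[OF assms(1)]]
      ev_bilinear[OF assms]]
  by (simp add: dual_space_def ev_def)

lemma ev_pure:
  assumes "vec K V" "vec K W" "f \<in> dual_space K V" "g \<in> dual_space K W" "v \<in> carrier V" "w \<in> carrier W"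
  shows "ev K V W f g (pure_tensor K V W v w) = f v \<otimes>\<^bsub>K\<^esub> g w"
  unfolding ev_def
  by (rule two_modules.tensor_lift_pure[OF two_modulesI[OF assms(1,2)] vec_module[OF vec_self[OF assms(1)]]
      ev_bilinear[OF assms(1-4)] assms(5,6)])

lemma ev_contract:
  assumes "vec K V" "vec K W" "f \<in> dual_space K V" "g \<in> dual_space K W"
    and t: "t \<in> carrier (tensor_product K V W)"
  shows "ev K V W f g t = g (contract K V W f t)"
proof -
  interpret T: two_vecs K V W by (rule two_vecsI[OF assms(1,2)])
  show ?thesis
    by (rule T.tensor_linear_eqI[OF T.VV.K1_module vec.dual_linear[OF vec_tensor[OF assms(1,2)] ev_dual[OF assms(1-4)]]
        linear_map_compose[OF T.contract_linear[OF assms(3)] T.WW.dual_linear[OF assms(4)]] _ t])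
      (simp add: ev_pure[OF assms(1-4)] T.contract_pure[OF assms(3)] T.WW.dual_smult[OF assms(4)]
        T.VV.dual_closed[OF assms(3)])
qed

text \<open>The mirror image of \<open>contract\<close>, namely \<open>id \<otimes> g\<close>. It
  takes values in the left factor, which for a coaction is the coalgebra.\<close>

definition contract_right where
  "contract_right K V W g = tensor_lift K V W V (\<lambda>v w. g w \<odot>\<^bsub>V\<^esub> v)"

lemma contract_right_bilinear:
  assumes "vec K V" "vec K W" "g \<in> dual_space K W"
  shows "bilinear_map K V W V (\<lambda>v w. g w \<odot>\<^bsub>V\<^esub> v)"
proof -
  interpret V: vec K V by fact
  interpret W: vec K W by fact
  note g = W.dual_closed[OF assms(3)] W.dual_add[OF assms(3)] W.dual_smult[OF assms(3)]
  have "g w \<odot>\<^bsub>V\<^esub> (a \<odot>\<^bsub>V\<^esub> x) = a \<odot>\<^bsub>V\<^esub> (g w \<odot>\<^bsub>V\<^esub> x)"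
    if "w \<in> carrier W" "a \<in> carrier K" "x \<in> carrier V" for w a x
    using V.V.smult_assoc1[OF that(2) g(1)[OF that(1)] that(3)] V.V.smult_assoc1[OF g(1)[OF that(1)] that(2,3)]
      V.V.R.m_comm[OF that(2) g(1)[OF that(1)]] by simp
  then show ?thesis
    by (intro bilinear_mapI linear_mapI)
      (simp_all add: g V.V.smult_l_distr V.V.smult_r_distr V.V.smult_assoc1)
qed

lemma contract_right_linear:
  assumes "vec K V" "vec K W" "g \<in> dual_space K W"
  shows "linear_map K (tensor_product K V W) V (contract_right K V W g)"
  unfolding contract_right_def
  by (rule two_modules.tensor_lift_linear[OF two_modulesI[OF assms(1,2)] vec_module[OF assms(1)] contract_right_bilinear[OF assms]])

lemma ev_contract_right:
  assumes "vec K V" "vec K W" "f \<in> dual_space K V" "g \<in> dual_space K W"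
    and t: "t \<in> carrier (tensor_product K V W)"
  shows "f (contract_right K V W g t) = ev K V W f g t"
proof -
  interpret T: two_vecs K V W by (rule two_vecsI[OF assms(1,2)])
  note b = contract_right_bilinear[OF assms(1,2,4)]
  show ?thesis
    by (rule T.tensor_linear_eqI[OF T.VV.K1_module
        linear_map_compose[OF contract_right_linear[OF assms(1,2,4)] T.VV.dual_linear[OF assms(3)]]
        vec.dual_linear[OF vec_tensor[OF assms(1,2)] ev_dual[OF assms(1-4)]] _ t])
      (simp add: ev_pure[OF assms(1-4)] contract_right_def T.tensor_lift_pure[OF vec_module[OF assms(1)] b]
        T.VV.dual_smult[OF assms(3)] T.WW.dual_closed[OF assms(4)] T.VV.dual_closed[OF assms(3)] T.VV.V.R.m_comm)
qed

lemma assoc_inner: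
  assumes v: "vec K U" "vec K V" "vec K W" and w: "w \<in> carrier W"
  shows "bilinear_map K U V (tensor_product K U (tensor_product K V W))
     (\<lambda>u v. pure_tensor K U (tensor_product K V W) u (pure_tensor K V W v w))"
proof -
  interpret VW: two_modules K V W by (rule two_modulesI[OF v(2,3)])
  have "linear_map K V (tensor_product K V W) (\<lambda>v. pure_tensor K V W v w)"
    using VW.pure_bilinear w by (simp add: bilinear_map_def)
  from tensor_map_bilinear[OF v(1,2) v(1) vec_tensor[OF v(2,3)] linear_map_id this]
  show ?thesis .
qed

text \<open>Linearity in \<open>w\<close> concerns the inner lift as a whole, so it is checked as an
  identity of linear maps in \<open>t\<close>, on pure tensors.\<close>

lemma assoc_outer:
  assumes v: "vec K U" "vec K V" "vec K W"
  shows "bilinear_map K (tensor_product K U V) W (tensor_product K U (tensor_product K V W))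
     (\<lambda>t w. tensor_lift K U V (tensor_product K U (tensor_product K V W))
       (\<lambda>u v. pure_tensor K U (tensor_product K V W) u (pure_tensor K V W v w)) t)" (is "bilinear_map K ?UV W ?T ?\<beta>")
proof (rule bilinear_mapI)
  interpret UV: two_modules K U V by (rule two_modulesI[OF v(1,2)])
  interpret VW: two_modules K V W by (rule two_modulesI[OF v(2,3)])
  interpret UVW: two_modules K U "tensor_product K V W" by (rule two_modulesI[OF v(1) vec_tensor[OF v(2,3)]])
  note T = vec_tensor[OF v(1) vec_tensor[OF v(2,3)]]
  note i = assoc_inner[OF v]
  note lift = UV.tensor_lift_linear[OF vec_module[OF T] i] and liftp = UV.tensor_lift_pure[OF vec_module[OF T] i]
  show "linear_map K ?UV ?T (\<lambda>t. ?\<beta> t w)" if w: "w \<in> carrier W" for w by (rule lift[OF w])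
  fix t assume t: "t \<in> carrier ?UV"
  show "linear_map K W ?T (?\<beta> t)"
  proof (rule linear_mapI)
    fix w assume "w \<in> carrier W" then show "?\<beta> t w \<in> carrier ?T" by (rule linear_map_closed[OF lift t])
  next
    fix w w' assume w: "w \<in> carrier W" "w' \<in> carrier W"
    then have ww: "w \<oplus>\<^bsub>W\<^esub> w' \<in> carrier W" by (rule VW.W.M.a_closed)
    show "?\<beta> t (w \<oplus>\<^bsub>W\<^esub> w') = ?\<beta> t w \<oplus>\<^bsub>?T\<^esub> ?\<beta> t w'"
      by (rule UV.tensor_linear_eqI[OF vec_module[OF T] lift[OF ww]
            linear_map_plus[OF vec_tensor[OF v(1,2)] T lift[OF w(1)] lift[OF w(2)]] _ t])
        (simp add: liftp[OF ww] liftp[OF w(1)] liftp[OF w(2)] VW.pure_add_r[OF _ w]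
          UVW.pure_add_r VW.pure_closed w)
  next
    fix a w assume a: "a \<in> carrier K" and w: "w \<in> carrier W"
    then have ww: "a \<odot>\<^bsub>W\<^esub> w \<in> carrier W" by (rule VW.W.smult_closed)
    show "?\<beta> t (a \<odot>\<^bsub>W\<^esub> w) = a \<odot>\<^bsub>?T\<^esub> ?\<beta> t w"
      by (rule UV.tensor_linear_eqI[OF vec_module[OF T] lift[OF ww]
            linear_map_scale[OF vec_tensor[OF v(1,2)] T lift[OF w] a] _ t])
        (simp add: liftp[OF ww] liftp[OF w] VW.pure_smult_r[OF a _ w]
          UVW.pure_smult_r VW.pure_closed w a)
  qed
qed

lemma tensor_assoc_linear:
  assumes v: "vec K U" "vec K V" "vec K W"
  shows "linear_map K (tensor_product K (tensor_product K U V) W) (tensor_product K U (tensor_product K V W))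
    (tensor_assoc K U V W)"
  unfolding tensor_assoc_def Let_def
  by (rule two_modules.tensor_lift_linear[OF two_modulesI[OF vec_tensor[OF v(1,2)] v(3)]
        vec_module[OF vec_tensor[OF v(1) vec_tensor[OF v(2,3)]]] assoc_outer[OF v]])

text \<open>Both sides send (u \<otimes> v) \<otimes> w to f(u) g(v) w. Apart from linearity, this
  is the fact about the associator on which the coassociativity arguments rest.\<close>

lemma contract_assoc:
  assumes v: "vec K U" "vec K V" "vec K W" and f: "f \<in> dual_space K U" and g: "g \<in> dual_space K V"
    and z: "z \<in> carrier (tensor_product K (tensor_product K U V) W)"
  shows "contract K V W g (contract K U (tensor_product K V W) f (tensor_assoc K U V W z)) =
    contract K (tensor_product K U V) W (ev K U V f g) z"
proof -
  let ?UV = "tensor_product K U V" and ?VW = "tensor_product K V W"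
  let ?T = "tensor_product K U ?VW"
  note vUV = vec_tensor[OF v(1,2)] and vVW = vec_tensor[OF v(2,3)]
  note T = vec_tensor[OF v(1) vVW]
  interpret UV: two_vecs K U V by (rule two_vecsI[OF v(1,2)])
  interpret VW: two_vecs K V W by (rule two_vecsI[OF v(2,3)])
  interpret UVW: two_vecs K U ?VW by (rule two_vecsI[OF v(1) vVW])
  interpret Z: two_vecs K ?UV W by (rule two_vecsI[OF vUV v(3)])
  note e = ev_dual[OF v(1,2) f g]
  note lin = linear_map_compose[OF UVW.contract_linear[OF f] VW.contract_linear[OF g]]
  show ?thesis
  proof (rule Z.tensor_linear_eqI[OF vec_module[OF v(3)] linear_map_compose[OF tensor_assoc_linear[OF v] lin]
        Z.contract_linear[OF e] _ z])
    fix t w assume t: "t \<in> carrier ?UV" and w: "w \<in> carrier W"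
    note i = assoc_inner[OF v w]
    note lift = UV.tensor_lift_linear[OF vec_module[OF T] i] and liftp = UV.tensor_lift_pure[OF vec_module[OF T] i]
    have el: "linear_map K ?UV W (\<lambda>s. ev K U V f g s \<odot>\<^bsub>W\<^esub> w)"
      using Z.contract_bilinear[OF e] w by (simp add: bilinear_map_def)
    have "contract K V W g (contract K U ?VW f (tensor_lift K U V ?T
       (\<lambda>u v. pure_tensor K U ?VW u (pure_tensor K V W v w)) t)) = ev K U V f g t \<odot>\<^bsub>W\<^esub> w"
    proof (rule UV.tensor_linear_eqI[OF vec_module[OF v(3)] linear_map_compose[OF lift lin] el _ t])
      fix x y assume x: "x \<in> carrier U" and y: "y \<in> carrier V"
      have fx: "f x \<in> carrier K" by (rule UV.VV.dual_closed[OF f x])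
      have gy: "g y \<in> carrier K" by (rule UV.WW.dual_closed[OF g y])
      note p = VW.pure_closed[OF y w]
      show "contract K V W g (contract K U ?VW f (tensor_lift K U V ?T
         (\<lambda>u v. pure_tensor K U ?VW u (pure_tensor K V W v w)) (pure_tensor K U V x y)))
         = ev K U V f g (pure_tensor K U V x y) \<odot>\<^bsub>W\<^esub> w"
        by (simp add: liftp[OF x y] UVW.contract_pure[OF f x p] linear_map_smult[OF VW.contract_linear[OF g] fx p]
            VW.contract_pure[OF g y w] ev_pure[OF v(1,2) f g x y] VW.WW.V.smult_assoc1[OF fx gy w])
    qed
    then show "contract K V W g (contract K U ?VW f (tensor_assoc K U V W (pure_tensor K ?UV W t w))) =
       contract K ?UV W (ev K U V f g) (pure_tensor K ?UV W t w)"
      unfolding tensor_assoc_def Let_def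
      by (simp add: Z.contract_pure[OF e t w] Z.tensor_lift_pure[OF vec_module[OF T] assoc_outer[OF v] t w])
  qed
qed

lemma contract_add_functional:
  assumes v: "vec K V" "vec K W" and f: "f \<in> dual_space K V" "g \<in> dual_space K V" "h \<in> dual_space K V"
    and h: "\<And>x. x \<in> carrier V \<Longrightarrow> h x = f x \<oplus>\<^bsub>K\<^esub> g x"
    and t: "t \<in> carrier (tensor_product K V W)"
  shows "contract K V W h t = contract K V W f t \<oplus>\<^bsub>W\<^esub> contract K V W g t"
proof -
  interpret T: two_vecs K V W by (rule two_vecsI[OF v])
  show ?thesis
    by (rule T.tensor_linear_eqI[OF vec_module[OF v(2)] T.contract_linear[OF f(3)]
          linear_map_plus[OF vec_tensor[OF v] v(2) T.contract_linear[OF f(1)] T.contract_linear[OF f(2)]] _ t])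
      (simp add: T.contract_pure[OF f(1)] T.contract_pure[OF f(2)] T.contract_pure[OF f(3)] h
        T.WW.V.smult_l_distr T.VV.dual_closed[OF f(1)] T.VV.dual_closed[OF f(2)])
qed

section \<open>Comodules as modules over the dual algebra\<close>

lemma dual_algebra_sel [simp]:
  "carrier (dual_algebra K C) = dual_space K C"
  "one (dual_algebra K C) = (\<lambda>c\<in>carrier C. counit C c)"
  "ring.zero (dual_algebra K C) = (\<lambda>c\<in>carrier C. \<zero>\<^bsub>K\<^esub>)"
  "f \<oplus>\<^bsub>dual_algebra K C\<^esub> g = (\<lambda>c\<in>carrier C. f c \<oplus>\<^bsub>K\<^esub> g c)"
  by (simp_all add: dual_algebra_def dual_space_def)

lemma dual_algebra_mult:
  "f \<otimes>\<^bsub>dual_algebra K C\<^esub> g = (\<lambda>c\<in>carrier C. ev K C C f g (comult C c))"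
  by (simp add: dual_algebra_def ev_def)

text \<open>In Sweedler notation, \<open>ract K C M m f = f(m\<^sub>-\<^sub>1) m\<^sub>0\<close>.\<close>

definition ract where
  "ract K C M m f = contract K C M f (coact M m)"

lemma (in coalgebra) vec_C: "vec K C"
  by (rule vecI[OF field vector_space])

lemma (in coalgebra) counit_dual: "(\<lambda>c\<in>carrier C. counit C c) \<in> dual_space K C"
  by (rule vec.dual_restrict[OF vec_C counit_linear])

lemma (in coalgebra) dual_mult_closed:
  assumes "f \<in> dual_space K C" "g \<in> dual_space K C"
  shows "f \<otimes>\<^bsub>dual_algebra K C\<^esub> g \<in> dual_space K C"
  unfolding dual_algebra_mult
  by (rule dual_compose[OF vec_C vec_tensor[OF vec_C vec_C] comult_linear ev_dual[OF vec_C vec_C assms]])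

text \<open>A coaction without its axioms. The criterion \<open>left_comodule_iff\<close> can then
  be applied to powers and transported structures whose axioms are still to be proved.\<close>

locale comodule_data = coalgebra K C for K :: "('k, 'x) ring_scheme" and C :: "('k, 'c, 'y) coalgebra_scheme" +
  fixes M :: "('k, 'c, 'm, 'z) comodule_scheme"
  assumes M_module: "module K M"
    and M_coact: "linear_map K M (tensor_product K C M) (coact M)"
begin

lemma vec_M: "vec K M"
  by (rule vecI[OF field M_module])

sublocale CM: two_vecs K C M
  by (rule two_vecsI[OF vec_C vec_M])

lemma ract_linear: "f \<in> dual_space K C \<Longrightarrow> linear_map K M M (\<lambda>m. ract K C M m f)"
  unfolding ract_def by (rule linear_map_compose[OF M_coact CM.contract_linear])

lemma ract_closed: "f \<in> dual_space K C \<Longrightarrow> m \<in> carrier M \<Longrightarrow> ract K C M m f \<in> carrier M"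
  by (rule linear_map_closed[OF ract_linear])

text \<open>Contracted first by \<open>f\<close> and then by \<open>g\<close>, this side of
  coassociativity becomes the action of the product f g; \<open>contract_coassoc_right\<close> turns
  the other side into the iterated action.\<close>

lemma contract_coassoc_left:
  assumes m: "m \<in> carrier M" and f: "f \<in> dual_space K C" and g: "g \<in> dual_space K C"
  shows "contract K C M g (contract K C (tensor_product K C M) f (tensor_assoc K C C M
        (tensor_map K C M (tensor_product K C C) M (comult C) (\<lambda>x. x) (coact M m)))) =
      ract K C M m (f \<otimes>\<^bsub>dual_algebra K C\<^esub> g)"
proof -
  note vCC = vec_tensor[OF vec_C vec_C]
  note c = linear_map_closed[OF M_coact m]
  have z: "tensor_map K C M (tensor_product K C C) M (comult C) (\<lambda>x. x) (coact M m)
    \<in> carrier (tensor_product K (tensor_product K C C) M)"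
    by (rule linear_map_closed[OF tensor_map_linear[OF vec_C vec_M vCC vec_M comult_linear linear_map_id] c])
  show ?thesis
    unfolding contract_assoc[OF vec_C vec_C vec_M f g z]
      contract_tensor_map[OF vec_C vec_M vCC vec_M comult_linear linear_map_id ev_dual[OF vec_C vec_C f g] c]
    by (simp add: ract_def dual_algebra_mult)
qed

lemma contract_coassoc_right:
  assumes m: "m \<in> carrier M" and f: "f \<in> dual_space K C" and g: "g \<in> dual_space K C"
  shows "contract K C M g (contract K C (tensor_product K C M) f
        (tensor_map K C M C (tensor_product K C M) (\<lambda>c. c) (coact M) (coact M m))) =
      ract K C M (ract K C M m f) g"
  using contract_tensor_map_id[OF vec_C vec_M vec_tensor[OF vec_C vec_M] M_coact f linear_map_closed[OF M_coact m]]
  by (simp add: ract_def)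

text \<open>The axiom uses the bare \<open>counit C\<close>, the unit of the dual algebra its
  restriction to the carrier. The two lifts agree because they agree on pure tensors.\<close>

lemma contract_counit:
  assumes m: "m \<in> carrier M"
  shows "tensor_lift K C M M (\<lambda>c x. counit C c \<odot>\<^bsub>M\<^esub> x) (coact M m) =
    ract K C M m (\<lambda>c\<in>carrier C. counit C c)"
proof -
  have b: "bilinear_map K C M M (\<lambda>c x. counit C c \<odot>\<^bsub>M\<^esub> x)"
    using CM.contract_bilinear[OF counit_dual]
      CM.VV.V.M.a_closed CM.VV.V.smult_closed by (auto simp: bilinear_map_def linear_map_def)
  show ?thesis
    unfolding ract_def
    by (rule CM.tensor_linear_eqI[OF M_module CM.tensor_lift_linear[OF M_module b]
          CM.contract_linear[OF counit_dual] _ linear_map_closed[OF M_coact m]])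
      (simp add: CM.tensor_lift_pure[OF M_module b] CM.contract_pure[OF counit_dual])
qed

text \<open>The comodule axioms become the axioms of a right module over the dual algebra. For the
  converse, coassociativity is an equation in C \<otimes> (C \<otimes> M), so contractions are
  separated twice, once for each factor \<open>C\<close>.\<close>

lemma left_comodule_iff:
  "left_comodule K C M \<longleftrightarrow>
    (\<forall>m\<in>carrier M. \<forall>f\<in>dual_space K C. \<forall>g\<in>dual_space K C.
      ract K C M (ract K C M m f) g = ract K C M m (f \<otimes>\<^bsub>dual_algebra K C\<^esub> g)) \<and>
    (\<forall>m\<in>carrier M. ract K C M m \<one>\<^bsub>dual_algebra K C\<^esub> = m)" (is "_ \<longleftrightarrow> ?A \<and> ?B")
proof
  assume M: "left_comodule K C M"
  show "?A \<and> ?B"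
  proof (intro conjI ballI)
    fix m f g assume a: "m \<in> carrier M" "f \<in> dual_space K C" "g \<in> dual_space K C"
    show "ract K C M (ract K C M m f) g = ract K C M m (f \<otimes>\<^bsub>dual_algebra K C\<^esub> g)"
      unfolding contract_coassoc_left[OF a, symmetric] contract_coassoc_right[OF a, symmetric]
      by (simp add: left_comodule.coact_coassoc[OF M a(1)])
  next
    fix m assume m: "m \<in> carrier M"
    show "ract K C M m \<one>\<^bsub>dual_algebra K C\<^esub> = m"
      using left_comodule.coact_counit[OF M m] contract_counit[OF m] by simp
  qed
next
  assume AB: "?A \<and> ?B"
  note vCC = vec_tensor[OF vec_C vec_C] and vCM = vec_tensor[OF vec_C vec_M]
  show "left_comodule K C M"
  proof (rule left_comodule.intro[OF M_module M_coact])
    fix m assume m: "m \<in> carrier M"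
    note c = linear_map_closed[OF M_coact m]
    let ?l = "tensor_assoc K C C M (tensor_map K C M (tensor_product K C C) M (comult C) (\<lambda>x. x) (coact M m))"
    let ?r = "tensor_map K C M C (tensor_product K C M) (\<lambda>c. c) (coact M) (coact M m)"
    interpret T: two_vecs K C "tensor_product K C M" by (rule two_vecsI[OF vec_C vCM])
    show "?l = ?r"
    proof (rule T.tensor_eqI)
      show l: "?l \<in> carrier (tensor_product K C (tensor_product K C M))"
        by (rule linear_map_closed[OF tensor_assoc_linear[OF vec_C vec_C vec_M]
              linear_map_closed[OF tensor_map_linear[OF vec_C vec_M vCC vec_M comult_linear linear_map_id] c]])
      show r: "?r \<in> carrier (tensor_product K C (tensor_product K C M))"
        by (rule linear_map_closed[OF tensor_map_linear[OF vec_C vec_M vec_C vCM linear_map_id M_coact] c])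
      fix f assume f: "f \<in> dual_space K C"
      show "contract K C (tensor_product K C M) f ?l = contract K C (tensor_product K C M) f ?r"
      proof (rule CM.tensor_eqI[OF linear_map_closed[OF T.contract_linear[OF f] l]
            linear_map_closed[OF T.contract_linear[OF f] r]])
        fix g assume g: "g \<in> dual_space K C"
        show "contract K C M g (contract K C (tensor_product K C M) f ?l) =
          contract K C M g (contract K C (tensor_product K C M) f ?r)"
          unfolding contract_coassoc_left[OF m f g] contract_coassoc_right[OF m f g]
          using AB m f g by simp
      qed
    qed
    show "tensor_lift K C M M (\<lambda>c x. counit C c \<odot>\<^bsub>M\<^esub> x) (coact M m) = m"
      unfolding contract_counit[OF m] using AB m by simp
  qed
qed

end

locale comod = coalgebra K C + M?: left_comodule K C M
  for K :: "('k, 'x) ring_scheme" and C :: "('k, 'c, 'y) coalgebra_scheme"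
    and M :: "('k, 'c, 'm, 'z) comodule_scheme"

sublocale comod \<subseteq> comodule_data K C M
  by (rule comodule_data.intro[OF coalgebra_axioms comodule_data_axioms.intro[OF M.vector_space M.coact_linear]])

lemma (in comod) ract_ract:
  assumes "m \<in> carrier M" "f \<in> dual_space K C" "g \<in> dual_space K C"
  shows "ract K C M (ract K C M m f) g = ract K C M m (f \<otimes>\<^bsub>dual_algebra K C\<^esub> g)"
  using left_comodule_iff M.left_comodule_axioms assms by simp

lemma (in comod) ract_one: "m \<in> carrier M \<Longrightarrow> ract K C M m \<one>\<^bsub>dual_algebra K C\<^esub> = m"
  using left_comodule_iff M.left_comodule_axioms by simp

text \<open>Contracting the equation for \<open>coact N (f m)\<close> by \<open>g\<close> gives
  equivariance at \<open>g\<close>, and contractions separate the points of C \<otimes> N.\<close>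

lemma comodule_map_iff:
  assumes "comodule_data K C M" "comodule_data K C N"
  shows "comodule_map K C M N f \<longleftrightarrow> linear_map K M N f \<and>
    (\<forall>m\<in>carrier M. \<forall>g\<in>dual_space K C. f (ract K C M m g) = ract K C N (f m) g)"
proof -
  interpret M: comodule_data K C M by fact
  interpret N: comodule_data K C N by fact
  show ?thesis
  proof (cases "linear_map K M N f")
    case True
    note f = True
    have "coact N (f m) = tensor_map K C M C N (\<lambda>c. c) f (coact M m) \<longleftrightarrow>
      (\<forall>g\<in>dual_space K C. f (ract K C M m g) = ract K C N (f m) g)" if m: "m \<in> carrier M" for m
    proof -
      note c = linear_map_closed[OF M.M_coact m]
      have eq: "contract K C N g (tensor_map K C M C N (\<lambda>c. c) f (coact M m)) = f (ract K C M m g)"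
        if "g \<in> dual_space K C" for g
        using contract_tensor_map_id[OF M.vec_C M.vec_M N.vec_M f that c] by (simp add: ract_def)
      show ?thesis
      proof
        assume "coact N (f m) = tensor_map K C M C N (\<lambda>c. c) f (coact M m)"
        then show "\<forall>g\<in>dual_space K C. f (ract K C M m g) = ract K C N (f m) g"
          using eq by (simp add: ract_def[of K C N])
      next
        assume a: "\<forall>g\<in>dual_space K C. f (ract K C M m g) = ract K C N (f m) g"
        show "coact N (f m) = tensor_map K C M C N (\<lambda>c. c) f (coact M m)"
        proof (rule N.CM.tensor_eqI)
          show "coact N (f m) \<in> carrier (tensor_product K C N)"
            by (rule linear_map_closed[OF N.M_coact linear_map_closed[OF f m]])
          show "tensor_map K C M C N (\<lambda>c. c) f (coact M m) \<in> carrier (tensor_product K C N)"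
            by (rule linear_map_closed[OF tensor_map_linear[OF M.vec_C M.vec_M M.vec_C N.vec_M linear_map_id f] c])
          fix g assume g: "g \<in> dual_space K C"
          show "contract K C N g (coact N (f m)) = contract K C N g (tensor_map K C M C N (\<lambda>c. c) f (coact M m))"
            using eq[OF g] a g by (simp add: ract_def[of K C N])
        qed
      qed
    qed
    then show ?thesis by (simp add: comodule_map_def f)
  qed (simp add: comodule_map_def)
qed

text \<open>A subspace stable under the action is a subcomodule because a linear projection onto it
  lifts the coaction to C \<otimes> N.\<close>

lemma (in comodule_data) subcomodule_iff:
  "subcomodule N K C M \<longleftrightarrow> submodule N K M \<and> (\<forall>n\<in>N. \<forall>f\<in>dual_space K C. ract K C M n f \<in> N)"
proof (cases "submodule N K M")
  case True
  let ?N = "M\<lparr>carrier := N\<rparr>"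
  have vN: "vec K ?N" by (rule vecI[OF field submodule.submodule_is_module[OF True M_module]])
  note sub = submoduleD[OF True]
  have inc: "linear_map K ?N M (\<lambda>x. x)" using sub(1) by (auto simp: linear_map_def)
  interpret CN: two_vecs K C ?N by (rule two_vecsI[OF vec_C vN])
  let ?i = "tensor_map K C ?N C M (\<lambda>c. c) (\<lambda>x. x)"
  have inc_contract: "contract K C M f (?i t) = contract K C ?N f t"
    if "f \<in> dual_space K C" "t \<in> carrier (tensor_product K C ?N)" for f t
    by (rule contract_tensor_map_id[OF vec_C vN vec_M inc that])
  have "coact M ` N \<subseteq> ?i ` carrier (tensor_product K C ?N) \<longleftrightarrow>
    (\<forall>n\<in>N. \<forall>f\<in>dual_space K C. ract K C M n f \<in> N)"
  proof
    assume a: "coact M ` N \<subseteq> ?i ` carrier (tensor_product K C ?N)"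
    show "\<forall>n\<in>N. \<forall>f\<in>dual_space K C. ract K C M n f \<in> N"
    proof (intro ballI)
      fix n f assume n: "n \<in> N" and f: "f \<in> dual_space K C"
      obtain t where t: "t \<in> carrier (tensor_product K C ?N)" "coact M n = ?i t"
        using subsetD[OF a imageI[OF n]] by (elim imageE)
      have "ract K C M n f = contract K C ?N f t"
        unfolding ract_def t(2) by (rule inc_contract[OF f t(1)])
      also have "\<dots> \<in> N" using linear_map_closed[OF CN.contract_linear[OF f] t(1)] by simp
      finally show "ract K C M n f \<in> N" .
    qed
  next
    assume a: "\<forall>n\<in>N. \<forall>f\<in>dual_space K C. ract K C M n f \<in> N"
    obtain P where P: "linear_map K M M P" "\<forall>x\<in>carrier M. P x \<in> N" "\<forall>x\<in>N. P x = x"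
      using vec.projection0[OF vec_M True] by (elim exE conjE)
    have P': "linear_map K M ?N P" using P(1,2) by (auto simp: linear_map_def)
    show "coact M ` N \<subseteq> ?i ` carrier (tensor_product K C ?N)"
    proof (intro subsetI, elim imageE)
      fix s n assume s: "s = coact M n" and n: "n \<in> N"
      note c = linear_map_closed[OF M_coact sub(1)[OF n]]
      \<comment> \<open>The lift of the coaction to C \<otimes> N. Its image in C \<otimes> M
        contracts to P(n f), and \<open>P\<close> fixes n f by stability.\<close>
      let ?t = "tensor_map K C M C ?N (\<lambda>c. c) P (coact M n)"
      have t: "?t \<in> carrier (tensor_product K C ?N)"
        by (rule linear_map_closed[OF tensor_map_linear[OF vec_C vec_M vec_C vN linear_map_id P'] c])
      have "coact M n = ?i ?t"
      proof (rule CM.tensor_eqI[OF c])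
        show "?i ?t \<in> carrier (tensor_product K C M)"
          by (rule linear_map_closed[OF tensor_map_linear[OF vec_C vN vec_C vec_M linear_map_id inc] t])
        fix f assume f: "f \<in> dual_space K C"
        have "contract K C M f (?i ?t) = P (ract K C M n f)"
          using inc_contract[OF f t] contract_tensor_map_id[OF vec_C vec_M vN P' f c] by (simp add: ract_def)
        also have "\<dots> = ract K C M n f" using P(3) a n f by simp
        finally show "contract K C M f (coact M n) = contract K C M f (?i ?t)" by (simp add: ract_def)
      qed
      then show "s \<in> ?i ` carrier (tensor_product K C ?N)" unfolding s by (rule image_eqI[OF _ t])
    qed
  qed
  then show ?thesis by (simp add: subcomodule_def True)
qed (simp add: subcomodule_def)

section \<open>Finitely generated and Noetherian modules\<close>

lemma finsum_hom:
  assumes "abelian_group V" "abelian_group W" "finite A" "g \<in> A \<rightarrow> carrier V"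
    and h: "\<And>x. x \<in> carrier V \<Longrightarrow> h x \<in> carrier W"
      "\<And>x y. x \<in> carrier V \<Longrightarrow> y \<in> carrier V \<Longrightarrow> h (x \<oplus>\<^bsub>V\<^esub> y) = h x \<oplus>\<^bsub>W\<^esub> h y"
  shows "h (finsum V g A) = finsum W (\<lambda>i. h (g i)) A"
proof -
  interpret V: abelian_group V by fact
  interpret W: abelian_group W by fact
  have h0: "h \<zero>\<^bsub>V\<^esub> = \<zero>\<^bsub>W\<^esub>"
    using h(2)[of "\<zero>\<^bsub>V\<^esub>" "\<zero>\<^bsub>V\<^esub>"] h(1)[of "\<zero>\<^bsub>V\<^esub>"] W.add.r_cancel_one'[of "h \<zero>\<^bsub>V\<^esub>" "h \<zero>\<^bsub>V\<^esub>"] by simp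
  show ?thesis using assms(3,4)
  proof (induct rule: finite_induct)
    case empty show ?case by (simp add: h0)
  next
    case (insert a A)
    then have g: "g a \<in> carrier V" "g \<in> A \<rightarrow> carrier V" by auto
    have hg: "(\<lambda>i. h (g i)) \<in> A \<rightarrow> carrier W" "h (g a) \<in> carrier W" using g h(1) by auto
    show ?case
      using insert(1,2) insert(3)[OF g(2)] g hg h(2)[OF g(1) V.finsum_closed[OF g(2)]]
      by (simp add: V.finsum_insert W.finsum_insert)
  qed
qed

definition msum where
  "msum X a x n = finsum X (\<lambda>i. a i \<odot>\<^bsub>X\<^esub> x i) {..<n::nat}"

text \<open>Generators are indexed by \<open>{..<n}\<close> rather than collected in a set, so that
  their number can serve as the exponent of a power of \<open>C\<close>.\<close>

definition gspan where
  "gspan R X x n = {msum X a x n | a. a \<in> {..<n} \<rightarrow> carrier R}"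

lemma Pi_Suc_D: "x \<in> {..<Suc n} \<rightarrow> S \<Longrightarrow> x \<in> {..<n} \<rightarrow> S" "x \<in> {..<Suc n} \<rightarrow> S \<Longrightarrow> x n \<in> S" for n :: nat
  by auto

lemma chain_mono:
  fixes N :: "nat \<Rightarrow> 'd set"
  assumes "\<And>i. N i \<subseteq> N (Suc i)" "i \<le> j"
  shows "N i \<subseteq> N j"
  using lift_Suc_mono_le[of N i j] assms by simp

lemma noetherianD:
  assumes "noetherian_module R M" "\<And>i. submodule (N i) R M" "\<And>i. N i \<subseteq> N (Suc i)"
  shows "\<exists>n. \<forall>i\<ge>n. N i = N n"
  using assms by (simp add: noetherian_module_def)

context left_module
begin

lemma msum_0 [simp]: "msum M a x 0 = \<zero>\<^bsub>M\<^esub>"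
  by (simp add: msum_def)

lemma msum_terms: "a \<in> {..<n} \<rightarrow> carrier R \<Longrightarrow> x \<in> {..<n} \<rightarrow> carrier M \<Longrightarrow>
    (\<lambda>i. a i \<odot>\<^bsub>M\<^esub> x i) \<in> {..<n} \<rightarrow> carrier M"
  by (auto intro!: smult_closed)

lemma msum_closed: "a \<in> {..<n} \<rightarrow> carrier R \<Longrightarrow> x \<in> {..<n} \<rightarrow> carrier M \<Longrightarrow> msum M a x n \<in> carrier M"
  unfolding msum_def by (rule M.finsum_closed[OF msum_terms])

lemma msum_Suc:
  assumes "a \<in> {..<Suc n} \<rightarrow> carrier R" "x \<in> {..<Suc n} \<rightarrow> carrier M"
  shows "msum M a x (Suc n) = a n \<odot>\<^bsub>M\<^esub> x n \<oplus>\<^bsub>M\<^esub> msum M a x n"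
proof -
  have "(\<lambda>i. a i \<odot>\<^bsub>M\<^esub> x i) \<in> {..<Suc n} \<rightarrow> carrier M" by (rule msum_terms[OF assms])
  then have "(\<lambda>i. a i \<odot>\<^bsub>M\<^esub> x i) \<in> {..<n} \<rightarrow> carrier M" "a n \<odot>\<^bsub>M\<^esub> x n \<in> carrier M" by auto
  then show ?thesis by (simp add: msum_def lessThan_Suc M.finsum_insert)
qed

lemma msum_cong:
  assumes "a \<in> {..<n} \<rightarrow> carrier R" "x \<in> {..<n} \<rightarrow> carrier M"
    and "\<And>i. i < n \<Longrightarrow> a i = b i" "\<And>i. i < n \<Longrightarrow> x i = y i"
  shows "msum M a x n = msum M b y n"
proof -
  have "(\<lambda>i. b i \<odot>\<^bsub>M\<^esub> y i) \<in> {..<n} \<rightarrow> carrier M"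
    using msum_terms[OF assms(1,2)] assms(3,4) by (simp add: Pi_iff)
  then show ?thesis unfolding msum_def
    by (rule M.finsum_cong'[OF refl]) (use assms(3,4) in simp_all)
qed

lemma gspan_0 [simp]: "gspan R M x 0 = {\<zero>\<^bsub>M\<^esub>}"
  by (auto simp: gspan_def)

lemma gspan_Suc:
  assumes x: "x \<in> {..<Suc n} \<rightarrow> carrier M"
  shows "gspan R M x (Suc n) = {a \<odot>\<^bsub>M\<^esub> x n \<oplus>\<^bsub>M\<^esub> y | a y. a \<in> carrier R \<and> y \<in> gspan R M x n}" (is "?l = ?r")
proof (intro equalityI subsetI)
  fix z assume "z \<in> ?l"
  then obtain a where a: "a \<in> {..<Suc n} \<rightarrow> carrier R" "z = msum M a x (Suc n)" by (auto simp: gspan_def)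
  have "z = a n \<odot>\<^bsub>M\<^esub> x n \<oplus>\<^bsub>M\<^esub> msum M a x n" using a x by (simp add: msum_Suc)
  moreover have "a n \<in> carrier R" using a by auto
  moreover have "msum M a x n \<in> gspan R M x n"
    unfolding gspan_def using Pi_Suc_D(1)[OF a(1)] by blast
  ultimately show "z \<in> ?r" by blast
next
  fix z assume "z \<in> ?r"
  then obtain b a where z: "z = b \<odot>\<^bsub>M\<^esub> x n \<oplus>\<^bsub>M\<^esub> msum M a x n" and b: "b \<in> carrier R"
    and a: "a \<in> {..<n} \<rightarrow> carrier R" by (auto simp: gspan_def)
  let ?a = "a(n := b)"
  have a': "?a \<in> {..<Suc n} \<rightarrow> carrier R" using a b by (auto simp: less_Suc_eq)
  have "msum M ?a x n = msum M a x n"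
    using a x by (intro msum_cong[symmetric]) auto
  then have "z = msum M ?a x (Suc n)" using msum_Suc[OF a' x] by (simp add: z)
  then show "z \<in> ?l" using a' unfolding gspan_def by blast
qed

lemma gspan_SucI: "x \<in> {..<Suc n} \<rightarrow> carrier M \<Longrightarrow> a \<in> carrier R \<Longrightarrow> y \<in> gspan R M x n \<Longrightarrow>
    a \<odot>\<^bsub>M\<^esub> x n \<oplus>\<^bsub>M\<^esub> y \<in> gspan R M x (Suc n)"
  unfolding gspan_Suc by blast

lemma gspan_SucE:
  assumes "x \<in> {..<Suc n} \<rightarrow> carrier M" "z \<in> gspan R M x (Suc n)"
  obtains a y where "a \<in> carrier R" "y \<in> gspan R M x n" "z = a \<odot>\<^bsub>M\<^esub> x n \<oplus>\<^bsub>M\<^esub> y"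
  using assms(2) unfolding gspan_Suc[OF assms(1)] by blast

lemma gspan_submodule: "x \<in> {..<n} \<rightarrow> carrier M \<Longrightarrow> submodule (gspan R M x n) R M"
proof (induct n)
  case 0 then show ?case by (simp add: submodule_iff smult_r_null)
next
  case (Suc n)
  note x = Suc(2) Pi_Suc_D[OF Suc(2)]
  note S = submoduleD[OF Suc(1)[OF x(2)]]
  show ?case unfolding submodule_iff
  proof (intro conjI ballI subsetI)
    fix z assume "z \<in> gspan R M x (Suc n)"
    then obtain a y where z: "a \<in> carrier R" "y \<in> gspan R M x n" "z = a \<odot>\<^bsub>M\<^esub> x n \<oplus>\<^bsub>M\<^esub> y"
      by (rule gspan_SucE[OF x(1)])
    show "z \<in> carrier M" using z x S(1) by (simp add: smult_closed)
    fix b assume b: "b \<in> carrier R"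
    have "b \<odot>\<^bsub>M\<^esub> z = (b \<otimes> a) \<odot>\<^bsub>M\<^esub> x n \<oplus>\<^bsub>M\<^esub> (b \<odot>\<^bsub>M\<^esub> y)"
      using b z x S(1)[OF z(2)] by (simp add: smult_r_distr smult_assoc1 smult_closed)
    then show "b \<odot>\<^bsub>M\<^esub> z \<in> gspan R M x (Suc n)"
      using gspan_SucI[OF x(1) _ S(5)[OF b z(2)], of "b \<otimes> a"] b z(1) by simp
  next
    have "\<zero> \<odot>\<^bsub>M\<^esub> x n \<oplus>\<^bsub>M\<^esub> \<zero>\<^bsub>M\<^esub> = \<zero>\<^bsub>M\<^esub>" using x by (simp add: smult_l_null)
    then show "\<zero>\<^bsub>M\<^esub> \<in> gspan R M x (Suc n)" using gspan_SucI[OF x(1) R.zero_closed S(2)] by simp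
  next
    fix z z' assume "z \<in> gspan R M x (Suc n)" "z' \<in> gspan R M x (Suc n)"
    then obtain a y a' y' where z: "a \<in> carrier R" "y \<in> gspan R M x n" "z = a \<odot>\<^bsub>M\<^esub> x n \<oplus>\<^bsub>M\<^esub> y"
      and z': "a' \<in> carrier R" "y' \<in> gspan R M x n" "z' = a' \<odot>\<^bsub>M\<^esub> x n \<oplus>\<^bsub>M\<^esub> y'"
      by (elim gspan_SucE[OF x(1)])
    have "z \<oplus>\<^bsub>M\<^esub> z' = (a \<oplus> a') \<odot>\<^bsub>M\<^esub> x n \<oplus>\<^bsub>M\<^esub> (y \<oplus>\<^bsub>M\<^esub> y')"
      using z z' x S(1)[OF z(2)] S(1)[OF z'(2)] by (simp add: smult_l_distr smult_closed M.a_ac)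
    then show "z \<oplus>\<^bsub>M\<^esub> z' \<in> gspan R M x (Suc n)"
      using gspan_SucI[OF x(1) _ S(3)[OF z(2) z'(2)], of "a \<oplus> a'"] z(1) z'(1) by simp
  qed
qed

lemma gspan_mem: "x \<in> {..<n} \<rightarrow> carrier M \<Longrightarrow> i < n \<Longrightarrow> x i \<in> gspan R M x n"
proof (induct n)
  case (Suc n)
  note x = Suc(2) Pi_Suc_D[OF Suc(2)]
  note S = submoduleD[OF gspan_submodule[OF x(2)]]
  show ?case
  proof (cases "i = n")
    case True
    then show ?thesis using gspan_SucI[OF x(1) R.one_closed S(2)] x(3) by (simp add: smult_one)
  next
    case False
    then have i: "x i \<in> gspan R M x n" using Suc x by simp
    then show ?thesis using gspan_SucI[OF x(1) R.zero_closed i] x(3) S(1)[OF i] by (simp add: smult_l_null)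
  qed
qed simp

lemma gspan_least:
  "submodule N R M \<Longrightarrow> x \<in> {..<n} \<rightarrow> carrier M \<Longrightarrow> (\<And>i. i < n \<Longrightarrow> x i \<in> N) \<Longrightarrow> gspan R M x n \<subseteq> N"
proof (induct n)
  case 0 then show ?case using submoduleD(2)[OF 0(1)] by simp
next
  case (Suc n)
  note x = Suc(3) Pi_Suc_D[OF Suc(3)]
  have IH: "gspan R M x n \<subseteq> N" using Suc x by simp
  show ?case
  proof
    fix z assume "z \<in> gspan R M x (Suc n)"
    then obtain a y where z: "a \<in> carrier R" "y \<in> gspan R M x n" "z = a \<odot>\<^bsub>M\<^esub> x n \<oplus>\<^bsub>M\<^esub> y"
      by (rule gspan_SucE[OF x(1)])
    have "y \<in> N" using IH z(2) by blast
    moreover have "a \<odot>\<^bsub>M\<^esub> x n \<in> N" using submoduleD(5)[OF Suc(2) z(1)] Suc(4) by simp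
    ultimately show "z \<in> N" using submoduleD(3)[OF Suc(2)] z(3) by simp
  qed
qed

lemma fin_gen_iff:
  "fin_gen_module R M \<longleftrightarrow> (\<exists>n x. x \<in> {..<n} \<rightarrow> carrier M \<and> gspan R M x n = carrier M)"
proof
  assume "fin_gen_module R M"
  then obtain A where A: "finite A" "A \<subseteq> carrier M"
    and gen: "\<And>N. submodule N R M \<Longrightarrow> A \<subseteq> N \<Longrightarrow> N = carrier M"
    by (auto simp: fin_gen_module_def)
  obtain n :: nat and x where x: "A = x ` {i. i < n}"
    using finite_imp_nat_seg_image_inj_on[OF A(1)] by blast
  have xc: "x \<in> {..<n} \<rightarrow> carrier M" using A(2) x by auto
  have "A \<subseteq> gspan R M x n" using gspan_mem[OF xc] x by auto
  from gen[OF gspan_submodule[OF xc] this] xc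
  show "\<exists>n x. x \<in> {..<n} \<rightarrow> carrier M \<and> gspan R M x n = carrier M" by (intro exI conjI)
next
  assume "\<exists>n x. x \<in> {..<n} \<rightarrow> carrier M \<and> gspan R M x n = carrier M"
  then obtain n x where x: "x \<in> {..<n} \<rightarrow> carrier M" "gspan R M x n = carrier M" by blast
  show "fin_gen_module R M" unfolding fin_gen_module_def
  proof (intro exI[of _ "x ` {..<n}"] conjI allI impI)
    fix N assume N: "submodule N R M \<and> x ` {..<n} \<subseteq> N"
    then have "carrier M \<subseteq> N" using gspan_least[of N x n] x by auto
    then show "N = carrier M" using submoduleD(1)[of N R M] N by auto
  qed (use x in auto)
qed

text \<open>Otherwise the span of any finite family in \<open>I\<close> misses an element of
  \<open>I\<close>; adjoining such elements one after the other gives a strictly increasing chain of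
  spans.\<close>

lemma noetherian_submodule_gspan:
  assumes noeth: "noetherian_module R M" and I: "submodule I R M"
  shows "\<exists>n x. x \<in> {..<n} \<rightarrow> I \<and> gspan R M x n = I"
proof (rule ccontr)
  assume neg: "\<not> ?thesis"
  define P where "P S \<longleftrightarrow> (\<exists>k x. x \<in> {..<k} \<rightarrow> I \<and> S = gspan R M x k)" for S
  have "\<exists>f. \<forall>n::nat. P (f n) \<and> f n \<subset> f (Suc n)"
  proof (rule dependent_nat_choice)
    show "\<exists>S. P S" unfolding P_def by (intro exI[of _ "{\<zero>\<^bsub>M\<^esub>}"] exI[of _ 0]) simp
    fix S and n :: nat assume "P S"
    then obtain k x where x: "x \<in> {..<k} \<rightarrow> I" and S: "S = gspan R M x k" by (auto simp: P_def)
    have xc: "x \<in> {..<k} \<rightarrow> carrier M" using x submoduleD(1)[OF I] by auto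
    have "S \<subseteq> I" unfolding S using x by (intro gspan_least[OF I xc]) auto
    moreover have "S \<noteq> I" using neg x S by blast
    ultimately obtain y where y: "y \<in> I" "y \<notin> S" by blast
    define x' where "x' = x(k := y)"
    have x': "x' \<in> {..<Suc k} \<rightarrow> I" using x y by (auto simp: x'_def less_Suc_eq)
    have xc': "x' \<in> {..<Suc k} \<rightarrow> carrier M" using x' submoduleD(1)[OF I] by auto
    have "S \<subseteq> gspan R M x' (Suc k)" unfolding S
    proof (rule gspan_least[OF gspan_submodule[OF xc'] xc])
      fix i assume "i < k"
      then show "x i \<in> gspan R M x' (Suc k)" using gspan_mem[OF xc', of i] by (simp add: x'_def)
    qed
    moreover have "y \<in> gspan R M x' (Suc k)" using gspan_mem[OF xc', of k] by (simp add: x'_def)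
    ultimately have "S \<subset> gspan R M x' (Suc k)" using y by blast
    then show "\<exists>S'. P S' \<and> S \<subset> S'" unfolding P_def using x' by blast
  qed
  then obtain f where f: "\<And>n. P (f n)" "\<And>n::nat. f n \<subset> f (Suc n)" by blast
  have "submodule (f n) R M" for n
  proof -
    obtain k x where x: "x \<in> {..<k} \<rightarrow> I" and S: "f n = gspan R M x k" using f(1)[of n] by (auto simp: P_def)
    have "x \<in> {..<k} \<rightarrow> carrier M" using x submoduleD(1)[OF I] by auto
    then show ?thesis unfolding S by (rule gspan_submodule)
  qed
  from noetherianD[of R M f, OF noeth this psubset_imp_subset[OF f(2)]]
  obtain n where "\<forall>i\<ge>n. f i = f n" by (elim exE)
  from this[rule_format, of "Suc n"] have "f (Suc n) = f n" by simp
  then show False using f(2)[of n] by simp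
qed

lemma noetherian_imp_fin_gen:
  assumes "noetherian_module R M"
  shows "fin_gen_module R M"
proof -
  have "submodule (carrier M) R M" by (simp add: submodule_iff smult_closed)
  from noetherian_submodule_gspan[OF assms this] show ?thesis by (simp add: fin_gen_iff)
qed

text \<open>Induction on the number of generators, tracking a chain by two invariants: its
  intersections with the span of the earlier generators, and its left ideals of coefficients at the
  last one.\<close>

lemma gspan_chain_stable:
  assumes noeth: "left_noetherian_ring R"
  shows "x \<in> {..<n} \<rightarrow> carrier M \<Longrightarrow> (\<And>i. submodule (N i) R M) \<Longrightarrow> (\<And>i. N i \<subseteq> N (Suc i)) \<Longrightarrow>
    (\<And>i. N i \<subseteq> gspan R M x n) \<Longrightarrow> \<exists>p. \<forall>i\<ge>p. N i = N p"
proof (induct n arbitrary: N)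
  case 0
  have "N i = {\<zero>\<^bsub>M\<^esub>}" for i
    using 0(4)[of i] submoduleD(2)[OF 0(2)[of i]] by auto
  then show ?case by simp
next
  case (Suc n)
  note x = Suc(2) Pi_Suc_D[OF Suc(2)]
  note sub = Suc(3) and mono = Suc(4) and bound = Suc(5)
  note S = gspan_submodule[OF x(2)]
  have int: "submodule (N i \<inter> gspan R M x n) R M" for i
    unfolding submodule_iff by (auto simp: submoduleD[OF sub[of i]] submoduleD[OF S])
  have "\<exists>p. \<forall>i\<ge>p. N i \<inter> gspan R M x n = N p \<inter> gspan R M x n"
    by (rule Suc(1)[OF x(2) int]) (use mono in \<open>rule Int_mono[OF _ order_refl]\<close>, rule Int_lower2)
  then obtain p where p: "\<forall>i\<ge>p. N i \<inter> gspan R M x n = N p \<inter> gspan R M x n" by (elim exE)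
  \<comment> \<open>Coefficients at \<open>x n\<close> of elements of \<open>N i\<close>, taken
    modulo the span of the earlier generators; they form a left ideal even when representations are
    not unique.\<close>
  define J where "J i = {a \<in> carrier R. \<exists>s\<in>gspan R M x n. a \<odot>\<^bsub>M\<^esub> x n \<oplus>\<^bsub>M\<^esub> s \<in> N i}" for i
  interpret RR: left_module R "self_module R" by (rule self_left_module[OF R.ring_axioms])
  have J: "submodule (J i) R (self_module R)" for i
    unfolding RR.submodule_iff self_module_sel
  proof (intro conjI ballI)
    show "J i \<subseteq> carrier R" by (auto simp: J_def)
    have "\<zero> \<odot>\<^bsub>M\<^esub> x n \<oplus>\<^bsub>M\<^esub> \<zero>\<^bsub>M\<^esub> \<in> N i" using x(3) submoduleD(2)[OF sub[of i]] by (simp add: smult_l_null)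
    then show "\<zero> \<in> J i" using submoduleD(2)[OF S] unfolding J_def by blast
  next
    fix a b assume "a \<in> J i" "b \<in> J i"
    then obtain s t where a: "a \<in> carrier R" "s \<in> gspan R M x n" "a \<odot>\<^bsub>M\<^esub> x n \<oplus>\<^bsub>M\<^esub> s \<in> N i"
      and b: "b \<in> carrier R" "t \<in> gspan R M x n" "b \<odot>\<^bsub>M\<^esub> x n \<oplus>\<^bsub>M\<^esub> t \<in> N i" by (auto simp: J_def)
    have "(a \<oplus> b) \<odot>\<^bsub>M\<^esub> x n \<oplus>\<^bsub>M\<^esub> (s \<oplus>\<^bsub>M\<^esub> t) = (a \<odot>\<^bsub>M\<^esub> x n \<oplus>\<^bsub>M\<^esub> s) \<oplus>\<^bsub>M\<^esub> (b \<odot>\<^bsub>M\<^esub> x n \<oplus>\<^bsub>M\<^esub> t)"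
      using a b x(3) submoduleD(1)[OF S a(2)] submoduleD(1)[OF S b(2)]
      by (simp add: smult_l_distr smult_closed M.a_ac)
    also have "\<dots> \<in> N i" by (rule submoduleD(3)[OF sub a(3) b(3)])
    finally show "a \<oplus> b \<in> J i" using a b submoduleD(3)[OF S a(2) b(2)] unfolding J_def by blast
  next
    fix b a assume b: "b \<in> carrier R" and "a \<in> J i"
    then obtain s where a: "a \<in> carrier R" "s \<in> gspan R M x n" "a \<odot>\<^bsub>M\<^esub> x n \<oplus>\<^bsub>M\<^esub> s \<in> N i"
      by (auto simp: J_def)
    have "(b \<otimes> a) \<odot>\<^bsub>M\<^esub> x n \<oplus>\<^bsub>M\<^esub> (b \<odot>\<^bsub>M\<^esub> s) = b \<odot>\<^bsub>M\<^esub> (a \<odot>\<^bsub>M\<^esub> x n \<oplus>\<^bsub>M\<^esub> s)"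
      using a b x(3) submoduleD(1)[OF S a(2)] by (simp add: smult_r_distr smult_assoc1 smult_closed)
    also have "\<dots> \<in> N i" by (rule submoduleD(5)[OF sub b a(3)])
    finally show "b \<otimes> a \<in> J i" using a b submoduleD(5)[OF S b a(2)] unfolding J_def by blast
  qed
  have "J i \<subseteq> J (Suc i)" for i using mono[of i] by (auto simp: J_def)
  from noetherianD[of R "self_module R" J, OF noeth[unfolded left_noetherian_ring_def] J this]
  obtain q where q: "\<forall>i\<ge>q. J i = J q" by (elim exE)
  show ?case
  proof (intro exI[of _ "max p q"] allI impI equalityI)
    fix i assume i: "max p q \<le> i"
    show "N (max p q) \<subseteq> N i" by (rule chain_mono[of N, OF mono i])
    show "N i \<subseteq> N (max p q)"
    proof
      fix y assume y: "y \<in> N i"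
      have "y \<in> gspan R M x (Suc n)" using y bound by blast
      then obtain a s where a: "a \<in> carrier R" "s \<in> gspan R M x n" "y = a \<odot>\<^bsub>M\<^esub> x n \<oplus>\<^bsub>M\<^esub> s"
        by (rule gspan_SucE[OF x(1)])
      have "a \<in> J i" using a y unfolding J_def by blast
      also have "J i = J (max p q)"
        using q[rule_format, of i] q[rule_format, of "max p q"] i by simp
      finally obtain t where t: "t \<in> gspan R M x n" "a \<odot>\<^bsub>M\<^esub> x n \<oplus>\<^bsub>M\<^esub> t \<in> N (max p q)"
        by (auto simp: J_def)
      have c: "a \<odot>\<^bsub>M\<^esub> x n \<in> carrier M" "s \<in> carrier M" "t \<in> carrier M"
        using a x(3) submoduleD(1)[OF S a(2)] submoduleD(1)[OF S t(1)] by (simp_all add: smult_closed)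
      have ti: "a \<odot>\<^bsub>M\<^esub> x n \<oplus>\<^bsub>M\<^esub> t \<in> N i" using chain_mono[of N, OF mono i] t(2) by blast
      \<comment> \<open>The elements \<open>y\<close> and a x_n + t have the same coefficient at
        \<open>x n\<close>, so their difference \<open>d\<close> lies in the intersection where the
        chain has already stabilised.\<close>
      define d where "d = s \<oplus>\<^bsub>M\<^esub> (\<ominus>\<^bsub>M\<^esub> t)"
      have "y \<oplus>\<^bsub>M\<^esub> (\<ominus>\<^bsub>M\<^esub> (a \<odot>\<^bsub>M\<^esub> x n \<oplus>\<^bsub>M\<^esub> t)) \<in> N i"
        by (rule submoduleD(3)[OF sub y submoduleD(4)[OF sub ti]])
      also have "y \<oplus>\<^bsub>M\<^esub> (\<ominus>\<^bsub>M\<^esub> (a \<odot>\<^bsub>M\<^esub> x n \<oplus>\<^bsub>M\<^esub> t)) = d"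
      proof -
        have "y \<oplus>\<^bsub>M\<^esub> (\<ominus>\<^bsub>M\<^esub> (a \<odot>\<^bsub>M\<^esub> x n \<oplus>\<^bsub>M\<^esub> t)) =
          (a \<odot>\<^bsub>M\<^esub> x n \<oplus>\<^bsub>M\<^esub> (\<ominus>\<^bsub>M\<^esub> (a \<odot>\<^bsub>M\<^esub> x n))) \<oplus>\<^bsub>M\<^esub> (s \<oplus>\<^bsub>M\<^esub> (\<ominus>\<^bsub>M\<^esub> t))"
          using c by (simp add: a(3) M.minus_add M.a_ac)
        then show ?thesis using c by (simp add: M.r_neg d_def)
      qed
      finally have "d \<in> N i \<inter> gspan R M x n"
        using submoduleD(3)[OF S a(2) submoduleD(4)[OF S t(1)]] by (simp add: d_def)
      also have "N i \<inter> gspan R M x n = N (max p q) \<inter> gspan R M x n"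
        using p[rule_format, of i] p[rule_format, of "max p q"] i by simp
      finally have d: "d \<in> N (max p q)" by blast
      have "y = (a \<odot>\<^bsub>M\<^esub> x n \<oplus>\<^bsub>M\<^esub> t) \<oplus>\<^bsub>M\<^esub> d"
      proof -
        have "(a \<odot>\<^bsub>M\<^esub> x n \<oplus>\<^bsub>M\<^esub> t) \<oplus>\<^bsub>M\<^esub> d = (a \<odot>\<^bsub>M\<^esub> x n \<oplus>\<^bsub>M\<^esub> s) \<oplus>\<^bsub>M\<^esub> (t \<oplus>\<^bsub>M\<^esub> (\<ominus>\<^bsub>M\<^esub> t))"
          using c by (simp add: d_def M.a_ac)
        then show ?thesis using c by (simp add: M.r_neg a(3))
      qed
      then show "y \<in> N (max p q)" using submoduleD(3)[OF sub t(2) d] by simp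
    qed
  qed
qed

lemma fin_gen_imp_noetherian:
  assumes "left_noetherian_ring R" "fin_gen_module R M"
  shows "noetherian_module R M"
proof -
  obtain n x where x: "x \<in> {..<n} \<rightarrow> carrier M" "gspan R M x n = carrier M"
    using assms(2) by (auto simp: fin_gen_iff)
  show ?thesis unfolding noetherian_module_def
  proof (intro allI impI)
    fix N :: "nat \<Rightarrow> 'c set" assume N: "\<forall>i. submodule (N i) R M \<and> N i \<subseteq> N (Suc i)"
    have b: "N i \<subseteq> gspan R M x n" for i unfolding x(2) using submoduleD(1)[of "N i" R M] N by blast
    show "\<exists>n. \<forall>i\<ge>n. N i = N n"
      by (rule gspan_chain_stable[OF assms(1) x(1) _ _ b]) (use N in simp_all)
  qed
qed

lemma noetherian_iff_fin_gen:
  "left_noetherian_ring R \<Longrightarrow> noetherian_module R M \<longleftrightarrow> fin_gen_module R M"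
  using fin_gen_imp_noetherian noetherian_imp_fin_gen by blast

end

lemma linear_map_msum:
  assumes "left_module R X" "left_module R Y" "linear_map R X Y h"
    and "a \<in> {..<n} \<rightarrow> carrier R" "x \<in> {..<n} \<rightarrow> carrier X"
  shows "h (msum X a x n) = msum Y a (\<lambda>i. h (x i)) n"
proof -
  interpret X: left_module R X by fact
  interpret Y: left_module R Y by fact
  note t = X.msum_terms[OF assms(4,5)]
  have "h (msum X a x n) = finsum Y (\<lambda>i. h (a i \<odot>\<^bsub>X\<^esub> x i)) {..<n}"
    unfolding msum_def
    by (rule finsum_hom[OF X.M.abelian_group_axioms Y.M.abelian_group_axioms _ t])
      (simp_all add: linear_map_closed[OF assms(3)] linear_map_add[OF assms(3)])
  also have "\<dots> = msum Y a (\<lambda>i. h (x i)) n"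
    unfolding msum_def
  proof (rule Y.M.finsum_cong'[OF refl])
    show "(\<lambda>i. a i \<odot>\<^bsub>Y\<^esub> h (x i)) \<in> {..<n} \<rightarrow> carrier Y"
      using Y.msum_terms[OF assms(4), of "\<lambda>i. h (x i)"] linear_map_closed[OF assms(3)] assms(5) by (simp add: Pi_iff)
    fix i assume "i \<in> {..<n}"
    then show "h (a i \<odot>\<^bsub>X\<^esub> x i) = a i \<odot>\<^bsub>Y\<^esub> h (x i)"
      using linear_map_smult[OF assms(3), of "a i" "x i"] assms(4,5) by auto
  qed
  finally show ?thesis .
qed

lemma fin_gen_image:
  assumes "left_module R X" "left_module R Y" "linear_map R X Y h" "h ` carrier X = carrier Y"
    and "fin_gen_module R X"
  shows "fin_gen_module R Y"
proof -
  interpret X: left_module R X by fact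
  interpret Y: left_module R Y by fact
  obtain n x where x: "x \<in> {..<n} \<rightarrow> carrier X" "gspan R X x n = carrier X"
    using assms(5) by (auto simp: X.fin_gen_iff)
  have hx: "(\<lambda>i. h (x i)) \<in> {..<n} \<rightarrow> carrier Y" using x(1) linear_map_closed[OF assms(3)] by (simp add: Pi_iff)
  have "gspan R Y (\<lambda>i. h (x i)) n = carrier Y"
  proof (intro equalityI subsetI)
    fix y assume "y \<in> carrier Y"
    then obtain z where z: "z \<in> carrier X" "y = h z" using assms(4) by blast
    then obtain a where a: "a \<in> {..<n} \<rightarrow> carrier R" "z = msum X a x n"
      using x(2) unfolding gspan_def by blast
    have "y = msum Y a (\<lambda>i. h (x i)) n"
      unfolding z(2) a(2) by (rule linear_map_msum[OF assms(1-3) a(1) x(1)])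
    then show "y \<in> gspan R Y (\<lambda>i. h (x i)) n" unfolding gspan_def using a(1) by blast
  qed (rule submoduleD(1)[OF Y.gspan_submodule[OF hx]])
  then show ?thesis using hx by (auto simp: Y.fin_gen_iff)
qed

section \<open>Dual modules\<close>

lemma module_transfer:
  assumes "module K V" "carrier V' = carrier V" "\<And>x y. x \<in> carrier V \<Longrightarrow> y \<in> carrier V \<Longrightarrow> x \<oplus>\<^bsub>V'\<^esub> y = x \<oplus>\<^bsub>V\<^esub> y"
    "\<zero>\<^bsub>V'\<^esub> = \<zero>\<^bsub>V\<^esub>" "\<And>a x. a \<in> carrier K \<Longrightarrow> x \<in> carrier V \<Longrightarrow> a \<odot>\<^bsub>V'\<^esub> x = a \<odot>\<^bsub>V\<^esub> x"
  shows "module K V'"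
proof -
  interpret V: module K V by fact
  have "abelian_group V'"
  proof (rule abelian_groupI)
    fix x assume "x \<in> carrier V'"
    then show "\<exists>y\<in>carrier V'. y \<oplus>\<^bsub>V'\<^esub> x = \<zero>\<^bsub>V'\<^esub>"
      by (intro bexI[of _ "\<ominus>\<^bsub>V\<^esub> x"]) (simp_all add: assms V.M.l_neg)
  qed (simp_all add: assms V.M.a_ac)
  then show ?thesis
    by (rule moduleI[OF V.R.cring_axioms])
      (simp_all add: assms V.smult_l_distr V.smult_r_distr V.smult_assoc1)
qed

section \<open>The regular comodule\<close>

lemma regular_comodule_sel [simp]:
  "carrier (regular_comodule C) = carrier C" "add (regular_comodule C) = add C"
  "ring.zero (regular_comodule C) = ring.zero C" "smult (regular_comodule C) = smult C"
  "coact (regular_comodule C) = comult C"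
  by (simp_all add: regular_comodule_def)

text \<open>The construction reads only these three fields of the right factor, so records that
  differ elsewhere, for instance by a \<open>coact\<close> field, have literally the same tensor
  product.\<close>

lemma tensor_right_cong:
  assumes "carrier W' = carrier W" "add W' = add W" "smult W' = smult W"
  shows "tensor_product K V W' = tensor_product K V W" "pure_tensor K V W' = pure_tensor K V W"
proof -
  have "tensor_relators K V W' = tensor_relators K V W"
    by (simp add: tensor_relators_def assms)
  then have n: "tensor_null K V W' = tensor_null K V W"
    by (simp add: tensor_null_def assms)
  then have c: "tensor_class K V W' = tensor_class K V W"
    by (intro ext) (simp add: tensor_class_def assms)
  show "tensor_product K V W' = tensor_product K V W"
    by (simp add: tensor_product_def n c assms)
  show "pure_tensor K V W' = pure_tensor K V W"
    by (intro ext) (simp add: pure_tensor_def c)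
qed

lemma tensor_lift_cong:
  assumes "carrier W' = carrier W" "add W' = add W" "smult W' = smult W"
    and "carrier U' = carrier U" "add U' = add U" "smult U' = smult U"
  shows "tensor_lift K V W' U' \<beta> = tensor_lift K V W U \<beta>"
  by (simp add: tensor_lift_def linear_map_def tensor_right_cong[OF assms(1-3)] assms)

lemma regular_tensor [simp]:
  "tensor_product K V (regular_comodule C) = tensor_product K V C"
  "pure_tensor K V (regular_comodule C) = pure_tensor K V C"
  by (rule tensor_right_cong; simp)+

lemma regular_lift [simp]:
  "tensor_lift K V (regular_comodule C) U \<beta> = tensor_lift K V C U \<beta>"
  "tensor_lift K V W (regular_comodule C) \<gamma> = tensor_lift K V W C \<gamma>"
  by (simp_all add: tensor_lift_def linear_map_def)

lemma regular_map [simp]: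
  "tensor_map K V (regular_comodule C) V' W' f g = tensor_map K V C V' W' f g"
  "tensor_map K V W V'' (regular_comodule C) f' g' = tensor_map K V W V'' C f' g'"
  "tensor_assoc K U V2 (regular_comodule C) = tensor_assoc K U V2 C"
  by (simp_all add: tensor_map_def tensor_assoc_def Let_def)

lemma (in coalgebra) regular_left_comodule: "left_comodule K C (regular_comodule C)"
proof (rule left_comodule.intro)
  show "module K (regular_comodule C)" by (rule module_transfer[OF vector_space]) simp_all
qed (use comult_linear coassoc counit_left in \<open>simp_all add: linear_map_def\<close>)

sublocale coalgebra \<subseteq> RC: comod K C "regular_comodule C"
  by (rule comod.intro[OF coalgebra_axioms regular_left_comodule])

text \<open>In Sweedler notation f(c_1) c_2: the action \<open>ract\<close> on the regular comodule,
  written directly on \<open>C\<close>.\<close>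

definition cact where
  "cact K C c f = contract K C C f (comult C c)"

lemma ract_regular: "ract K C (regular_comodule C) = cact K C"
  by (intro ext) (simp add: ract_def cact_def contract_def)

lemma dual_regular: "dual_space K (regular_comodule C) = dual_space K C"
  by (simp add: dual_space_def linear_map_def)

lemma dual_space_ext:
  assumes "f \<in> dual_space K V" "g \<in> dual_space K V" "\<And>x. x \<in> carrier V \<Longrightarrow> f x = g x"
  shows "f = g"
  using assms by (intro extensionalityI[of f "carrier V" g]) (auto simp: dual_space_def)

text \<open>Stated for any record with pointwise operations, because it serves both the dual algebra
  and the dual modules.\<close>

lemma (in vec) dual_abelian_group:
  assumes "carrier D = dual_space K V" "\<zero>\<^bsub>D\<^esub> = (\<lambda>x\<in>carrier V. \<zero>)"
    "\<And>f g. f \<oplus>\<^bsub>D\<^esub> g = (\<lambda>x\<in>carrier V. f x \<oplus> g x)"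
  shows "abelian_group D"
proof (rule abelian_groupI)
  show z: "\<zero>\<^bsub>D\<^esub> \<in> carrier D" unfolding assms by (rule dualI) simp_all
  have add: "f \<oplus>\<^bsub>D\<^esub> g \<in> carrier D" if "f \<in> carrier D" "g \<in> carrier D" for f g
    using that unfolding assms
    by (intro dualI) (simp_all add: dual_closed dual_add dual_smult V.R.a_ac V.R.r_distr)
  then show "\<And>f g. f \<in> carrier D \<Longrightarrow> g \<in> carrier D \<Longrightarrow> f \<oplus>\<^bsub>D\<^esub> g \<in> carrier D" .
  fix f g h assume fgh: "f \<in> carrier D" "g \<in> carrier D" "h \<in> carrier D"
  note d = fgh[unfolded assms(1)]
  show "(f \<oplus>\<^bsub>D\<^esub> g) \<oplus>\<^bsub>D\<^esub> h = f \<oplus>\<^bsub>D\<^esub> (g \<oplus>\<^bsub>D\<^esub> h)"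
    by (rule ext) (use add[OF add[OF fgh(1,2)] fgh(3)] add[OF fgh(1) add[OF fgh(2,3)]] d in
      \<open>simp_all add: assms dual_closed V.R.a_assoc\<close>)
next
  have add: "f \<oplus>\<^bsub>D\<^esub> g \<in> carrier D" if "f \<in> carrier D" "g \<in> carrier D" for f g
    using that unfolding assms
    by (intro dualI) (simp_all add: dual_closed dual_add dual_smult V.R.a_ac V.R.r_distr)
  have z: "\<zero>\<^bsub>D\<^esub> \<in> carrier D" unfolding assms by (rule dualI) simp_all
  fix f assume f: "f \<in> carrier D"
  note d = f[unfolded assms(1)]
  show "\<zero>\<^bsub>D\<^esub> \<oplus>\<^bsub>D\<^esub> f = f"
    by (rule dual_space_ext[OF add[OF z f, unfolded assms(1)] d]) (simp add: assms dual_closed d)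
  have neg: "(\<lambda>x\<in>carrier V. \<ominus> f x) \<in> dual_space K V"
    using d by (intro dualI) (simp_all add: dual_closed dual_add dual_smult V.R.minus_add V.R.r_minus)
  show "\<exists>g\<in>carrier D. g \<oplus>\<^bsub>D\<^esub> f = \<zero>\<^bsub>D\<^esub>"
  proof (rule bexI)
    show "(\<lambda>x\<in>carrier V. \<ominus> f x) \<oplus>\<^bsub>D\<^esub> f = \<zero>\<^bsub>D\<^esub>"
      unfolding assms by (rule restrict_ext) (use d in \<open>simp add: dual_closed V.R.l_neg\<close>)
    show "(\<lambda>x\<in>carrier V. \<ominus> f x) \<in> carrier D" using neg by (simp add: assms)
  qed
  fix g assume g: "g \<in> carrier D"
  show "f \<oplus>\<^bsub>D\<^esub> g = g \<oplus>\<^bsub>D\<^esub> f"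
    unfolding assms by (rule restrict_ext) (use d g[unfolded assms(1)] in \<open>simp add: dual_closed V.R.a_comm\<close>)
qed

section \<open>The dual algebra as a ring\<close>

context coalgebra
begin

abbreviation "R \<equiv> dual_algebra K C"

text \<open>Because f(c_1) g(c_2) = g(f(c_1) c_2). Products of functionals are thereby reduced to
  the right action on \<open>C\<close>, and associativity to \<open>cact_cact\<close>.\<close>

lemma dual_mult_apply:
  assumes "f \<in> dual_space K C" "g \<in> dual_space K C" "c \<in> carrier C"
  shows "(f \<otimes>\<^bsub>R\<^esub> g) c = g (cact K C c f)"
  using assms ev_contract[OF vec_C vec_C assms(1,2) linear_map_closed[OF comult_linear assms(3)]]
  by (simp add: dual_algebra_mult cact_def)

lemma cact_closed: "f \<in> dual_space K C \<Longrightarrow> c \<in> carrier C \<Longrightarrow> cact K C c f \<in> carrier C"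
  using RC.ract_closed[of f c] by (simp add: ract_regular)

lemma cact_cact: "c \<in> carrier C \<Longrightarrow> f \<in> dual_space K C \<Longrightarrow> g \<in> dual_space K C \<Longrightarrow>
    cact K C (cact K C c f) g = cact K C c (f \<otimes>\<^bsub>R\<^esub> g)"
  using RC.ract_ract[of c f g] by (simp add: ract_regular)

lemma cact_one: "c \<in> carrier C \<Longrightarrow> cact K C c \<one>\<^bsub>R\<^esub> = c"
  using RC.ract_one[of c] by (simp add: ract_regular)

text \<open>The right counit axiom of \<open>C\<close> gives f(c_1) \<epsilon>(c_2) = f(c). It makes
  the counit a right unit of the dual algebra; the left unit law comes from
  \<open>cact_one\<close>.\<close>

lemma counit_cact:
  assumes f: "f \<in> dual_space K C" and c: "c \<in> carrier C"
  shows "counit C (cact K C c f) = f c"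
proof -
  note d = linear_map_closed[OF comult_linear c]
  interpret CC: two_vecs K C C by (rule two_vecsI[OF vec_C vec_C])
  have b: "bilinear_map K C C C (\<lambda>d e. counit C e \<odot>\<^bsub>C\<^esub> d)"
    using contract_right_bilinear[OF vec_C vec_C counit_dual]
      RC.CM.VV.V.M.a_closed RC.CM.VV.V.smult_closed by (simp add: bilinear_map_def linear_map_def Pi_iff)
  have "contract_right K C C \<one>\<^bsub>R\<^esub> (comult C c) =
      tensor_lift K C C C (\<lambda>d e. counit C e \<odot>\<^bsub>C\<^esub> d) (comult C c)"
    unfolding contract_right_def dual_algebra_sel
  proof (rule CC.tensor_linear_eqI[OF vector_space
          CC.tensor_lift_linear[OF vector_space contract_right_bilinear[OF vec_C vec_C counit_dual]]
          CC.tensor_lift_linear[OF vector_space b] _ d])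
    fix v w assume vw: "v \<in> carrier C" "w \<in> carrier C"
    show "tensor_lift K C C C (\<lambda>v w. (\<lambda>c\<in>carrier C. counit C c) w \<odot>\<^bsub>C\<^esub> v) (pure_tensor K C C v w) =
      tensor_lift K C C C (\<lambda>d e. counit C e \<odot>\<^bsub>C\<^esub> d) (pure_tensor K C C v w)"
      unfolding CC.tensor_lift_pure[OF vector_space contract_right_bilinear[OF vec_C vec_C counit_dual] vw]
        CC.tensor_lift_pure[OF vector_space b vw] using vw by simp
  qed
  also have "\<dots> = c" by (rule counit_right[OF c])
  finally have "f c = ev K C C f \<one>\<^bsub>R\<^esub> (comult C c)"
    using ev_contract_right[OF vec_C vec_C f counit_dual d] by simp
  also have "\<dots> = counit C (cact K C c f)"
    using ev_contract[OF vec_C vec_C f counit_dual d] cact_closed[OF f c] by (simp add: cact_def)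
  finally show ?thesis by simp
qed

text \<open>Evaluated at \<open>c\<close>, each law becomes a fact about the right action on
  \<open>C\<close>; for associativity both sides are h((c f) g).\<close>

lemma dual_ring: "ring R"
proof -
  have ab: "abelian_group R" by (rule RC.CM.VV.dual_abelian_group) simp_all
  then interpret A: abelian_group R .
  have add: "f \<in> dual_space K C \<Longrightarrow> g \<in> dual_space K C \<Longrightarrow> f \<oplus>\<^bsub>R\<^esub> g \<in> dual_space K C" for f g
    using A.a_closed[of f g] by (simp del: dual_algebra_sel(4))
  have one: "\<one>\<^bsub>R\<^esub> \<in> dual_space K C" using counit_dual by simp
  show ?thesis
  proof (rule ringI[OF ab])
    show "monoid R"
    proof (rule monoidI)
      fix f g assume "f \<in> carrier R" "g \<in> carrier R"
      then show "f \<otimes>\<^bsub>R\<^esub> g \<in> carrier R" by (simp add: dual_mult_closed)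
    next
      show "\<one>\<^bsub>R\<^esub> \<in> carrier R" using one by simp
    next
      fix f g h assume "f \<in> carrier R" "g \<in> carrier R" "h \<in> carrier R"
      then have fgh: "f \<in> dual_space K C" "g \<in> dual_space K C" "h \<in> dual_space K C" by simp_all
      show "f \<otimes>\<^bsub>R\<^esub> g \<otimes>\<^bsub>R\<^esub> h = f \<otimes>\<^bsub>R\<^esub> (g \<otimes>\<^bsub>R\<^esub> h)"
      proof (rule dual_space_ext[where K = K and V = C])
        fix c assume c: "c \<in> carrier C"
        show "(f \<otimes>\<^bsub>R\<^esub> g \<otimes>\<^bsub>R\<^esub> h) c = (f \<otimes>\<^bsub>R\<^esub> (g \<otimes>\<^bsub>R\<^esub> h)) c"
          by (simp add: dual_mult_apply dual_mult_closed fgh c cact_closed cact_cact)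
      qed (simp_all add: fgh dual_mult_closed)
    next
      fix f assume "f \<in> carrier R"
      then have f: "f \<in> dual_space K C" by simp
      show "\<one>\<^bsub>R\<^esub> \<otimes>\<^bsub>R\<^esub> f = f"
      proof (rule dual_space_ext[where K = K and V = C])
        fix c assume c: "c \<in> carrier C"
        show "(\<one>\<^bsub>R\<^esub> \<otimes>\<^bsub>R\<^esub> f) c = f c"
          using dual_mult_apply[OF one f c] cact_one[OF c] by simp
      qed (rule dual_mult_closed[OF one f], rule f)
      show "f \<otimes>\<^bsub>R\<^esub> \<one>\<^bsub>R\<^esub> = f"
      proof (rule dual_space_ext[where K = K and V = C])
        fix c assume c: "c \<in> carrier C"
        show "(f \<otimes>\<^bsub>R\<^esub> \<one>\<^bsub>R\<^esub>) c = f c"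
          using dual_mult_apply[OF f one c] counit_cact[OF f c] cact_closed[OF f c] by simp
      qed (rule dual_mult_closed[OF f one], rule f)
    qed
  next
    fix f g h assume "f \<in> carrier R" "g \<in> carrier R" "h \<in> carrier R"
    then have fgh: "f \<in> dual_space K C" "g \<in> dual_space K C" "h \<in> dual_space K C" by simp_all
    show "(f \<oplus>\<^bsub>R\<^esub> g) \<otimes>\<^bsub>R\<^esub> h = f \<otimes>\<^bsub>R\<^esub> h \<oplus>\<^bsub>R\<^esub> g \<otimes>\<^bsub>R\<^esub> h"
    proof (rule dual_space_ext[where K = K and V = C])
      fix c assume c: "c \<in> carrier C"
      note d = linear_map_closed[OF comult_linear c]
      have "cact K C c (f \<oplus>\<^bsub>R\<^esub> g) = cact K C c f \<oplus>\<^bsub>C\<^esub> cact K C c g"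
        unfolding cact_def
        by (rule contract_add_functional[OF vec_C vec_C fgh(1,2) add[OF fgh(1,2)] _ d]) simp
      then have "((f \<oplus>\<^bsub>R\<^esub> g) \<otimes>\<^bsub>R\<^esub> h) c = h (cact K C c f) \<oplus>\<^bsub>K\<^esub> h (cact K C c g)"
        using dual_mult_apply[OF add[OF fgh(1,2)] fgh(3) c]
          RC.CM.VV.dual_add[OF fgh(3) cact_closed[OF fgh(1) c] cact_closed[OF fgh(2) c]] by simp
      then show "((f \<oplus>\<^bsub>R\<^esub> g) \<otimes>\<^bsub>R\<^esub> h) c = (f \<otimes>\<^bsub>R\<^esub> h \<oplus>\<^bsub>R\<^esub> g \<otimes>\<^bsub>R\<^esub> h) c"
        by (simp add: dual_mult_apply fgh c)
    qed (rule dual_mult_closed add fgh)+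
    show "h \<otimes>\<^bsub>R\<^esub> (f \<oplus>\<^bsub>R\<^esub> g) = h \<otimes>\<^bsub>R\<^esub> f \<oplus>\<^bsub>R\<^esub> h \<otimes>\<^bsub>R\<^esub> g"
    proof (rule dual_space_ext[where K = K and V = C])
      fix c assume c: "c \<in> carrier C"
      show "(h \<otimes>\<^bsub>R\<^esub> (f \<oplus>\<^bsub>R\<^esub> g)) c = (h \<otimes>\<^bsub>R\<^esub> f \<oplus>\<^bsub>R\<^esub> h \<otimes>\<^bsub>R\<^esub> g) c"
        using dual_mult_apply[OF fgh(3) add[OF fgh(1,2)] c] cact_closed[OF fgh(3) c]
        by (simp add: dual_mult_apply fgh c)
    qed (rule dual_mult_closed add fgh)+
  qed
qed

end

section \<open>The dual module of a comodule\<close>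

definition dual_module ::
  "('k, 'x) ring_scheme \<Rightarrow> ('k, 'c, 'y) coalgebra_scheme \<Rightarrow> ('k, 'c, 'm, 'z) comodule_scheme
    \<Rightarrow> ('c \<Rightarrow> 'k, 'm \<Rightarrow> 'k) module"
  where "dual_module K C M =
    \<lparr>carrier = dual_space K M, mult = undefined, one = undefined,
     ring.zero = (\<lambda>m\<in>carrier M. \<zero>\<^bsub>K\<^esub>),
     add = (\<lambda>\<phi> \<psi>. \<lambda>m\<in>carrier M. \<phi> m \<oplus>\<^bsub>K\<^esub> \<psi> m),
     smult = (\<lambda>f \<phi>. \<lambda>m\<in>carrier M. \<phi> (ract K C M m f))\<rparr>"

lemma dual_module_sel [simp]:
  "carrier (dual_module K C M) = dual_space K M"
  "\<zero>\<^bsub>dual_module K C M\<^esub> = (\<lambda>m\<in>carrier M. \<zero>\<^bsub>K\<^esub>)"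
  "\<phi> \<oplus>\<^bsub>dual_module K C M\<^esub> \<psi> = (\<lambda>m\<in>carrier M. \<phi> m \<oplus>\<^bsub>K\<^esub> \<psi> m)"
  "f \<odot>\<^bsub>dual_module K C M\<^esub> \<phi> = (\<lambda>m\<in>carrier M. \<phi> (ract K C M m f))"
  by (simp_all add: dual_module_def)

context comod
begin

abbreviation "MD \<equiv> dual_module K C M"

lemma dual_smult_closed:
  assumes "f \<in> dual_space K C" "\<phi> \<in> dual_space K M"
  shows "f \<odot>\<^bsub>MD\<^esub> \<phi> \<in> dual_space K M"
  using dual_compose[OF vec_M vec_M ract_linear[OF assms(1)] assms(2)] by simp

lemma ract_add:
  assumes "f \<in> dual_space K C" "g \<in> dual_space K C" "m \<in> carrier M"
  shows "ract K C M m (f \<oplus>\<^bsub>R\<^esub> g) = ract K C M m f \<oplus>\<^bsub>M\<^esub> ract K C M m g"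
proof -
  interpret DR: ring R by (rule dual_ring)
  have "f \<oplus>\<^bsub>R\<^esub> g \<in> dual_space K C" using DR.a_closed[of f g] assms by (simp del: dual_algebra_sel(4))
  then show ?thesis unfolding ract_def
    by (rule contract_add_functional[OF vec_C vec_M assms(1,2) _ _ linear_map_closed[OF M_coact assms(3)]]) simp
qed

text \<open>Dualising a right action gives a left one: (f (g \<phi>))(m) = \<phi>((m f) g), which is
  \<phi> at m acted on by f g.\<close>

lemma dual_left_module: "left_module R MD"
proof -
  interpret DR: ring R by (rule dual_ring)
  have ab: "abelian_group MD" by (rule CM.WW.dual_abelian_group) simp_all
  then interpret A: abelian_group MD .
  have add: "\<phi> \<in> dual_space K M \<Longrightarrow> \<psi> \<in> dual_space K M \<Longrightarrow> \<phi> \<oplus>\<^bsub>MD\<^esub> \<psi> \<in> dual_space K M" for \<phi> \<psi>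
    using A.a_closed[of \<phi> \<psi>] by (simp del: dual_module_sel(3))
  have radd: "f \<in> dual_space K C \<Longrightarrow> g \<in> dual_space K C \<Longrightarrow> f \<oplus>\<^bsub>R\<^esub> g \<in> dual_space K C" for f g
    using DR.a_closed[of f g] by (simp del: dual_algebra_sel(4))
  show ?thesis
  proof (rule left_module.intro[OF dual_ring ab left_module_axioms.intro])
    fix f \<phi> assume "f \<in> carrier R" "\<phi> \<in> carrier MD"
    then show "f \<odot>\<^bsub>MD\<^esub> \<phi> \<in> carrier MD" using dual_smult_closed by simp
  next
    fix f g \<phi> assume "f \<in> carrier R" "g \<in> carrier R" "\<phi> \<in> carrier MD"
    then have a: "f \<in> dual_space K C" "g \<in> dual_space K C" "\<phi> \<in> dual_space K M" by simp_all
    show "(f \<oplus>\<^bsub>R\<^esub> g) \<odot>\<^bsub>MD\<^esub> \<phi> = f \<odot>\<^bsub>MD\<^esub> \<phi> \<oplus>\<^bsub>MD\<^esub> g \<odot>\<^bsub>MD\<^esub> \<phi>"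
    proof (rule dual_space_ext[where K = K and V = M])
      fix m assume m: "m \<in> carrier M"
      show "((f \<oplus>\<^bsub>R\<^esub> g) \<odot>\<^bsub>MD\<^esub> \<phi>) m = (f \<odot>\<^bsub>MD\<^esub> \<phi> \<oplus>\<^bsub>MD\<^esub> g \<odot>\<^bsub>MD\<^esub> \<phi>) m"
        using ract_add[OF a(1,2) m] CM.WW.dual_add[OF a(3) ract_closed[OF a(1) m] ract_closed[OF a(2) m]] m by simp
    qed (rule dual_smult_closed add radd a)+
    show "f \<otimes>\<^bsub>R\<^esub> g \<odot>\<^bsub>MD\<^esub> \<phi> = f \<odot>\<^bsub>MD\<^esub> (g \<odot>\<^bsub>MD\<^esub> \<phi>)"
    proof (rule dual_space_ext[where K = K and V = M])
      fix m assume m: "m \<in> carrier M"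
      show "(f \<otimes>\<^bsub>R\<^esub> g \<odot>\<^bsub>MD\<^esub> \<phi>) m = (f \<odot>\<^bsub>MD\<^esub> (g \<odot>\<^bsub>MD\<^esub> \<phi>)) m"
        using ract_ract[OF m a(1,2)] ract_closed[OF a(1) m] m by simp
    qed (rule dual_smult_closed dual_mult_closed a)+
  next
    fix f \<phi> \<psi> assume "f \<in> carrier R" "\<phi> \<in> carrier MD" "\<psi> \<in> carrier MD"
    then have a: "f \<in> dual_space K C" "\<phi> \<in> dual_space K M" "\<psi> \<in> dual_space K M" by simp_all
    show "f \<odot>\<^bsub>MD\<^esub> (\<phi> \<oplus>\<^bsub>MD\<^esub> \<psi>) = f \<odot>\<^bsub>MD\<^esub> \<phi> \<oplus>\<^bsub>MD\<^esub> f \<odot>\<^bsub>MD\<^esub> \<psi>"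
    proof (rule dual_space_ext[where K = K and V = M])
      fix m assume m: "m \<in> carrier M"
      show "(f \<odot>\<^bsub>MD\<^esub> (\<phi> \<oplus>\<^bsub>MD\<^esub> \<psi>)) m = (f \<odot>\<^bsub>MD\<^esub> \<phi> \<oplus>\<^bsub>MD\<^esub> f \<odot>\<^bsub>MD\<^esub> \<psi>) m"
        using ract_closed[OF a(1) m] m by simp
    qed (rule dual_smult_closed add a)+
  next
    fix \<phi> assume "\<phi> \<in> carrier MD"
    then have a: "\<phi> \<in> dual_space K M" by simp
    have one: "\<one>\<^bsub>R\<^esub> \<in> dual_space K C" using counit_dual by simp
    show "\<one>\<^bsub>R\<^esub> \<odot>\<^bsub>MD\<^esub> \<phi> = \<phi>"
    proof (rule dual_space_ext[where K = K and V = M])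
      fix m assume m: "m \<in> carrier M"
      show "(\<one>\<^bsub>R\<^esub> \<odot>\<^bsub>MD\<^esub> \<phi>) m = \<phi> m" using ract_one[OF m] m by simp
    qed (rule dual_smult_closed[OF one a], rule a)
  qed
qed

end

section \<open>Artinian comodules and Noetherian dual modules\<close>

text \<open>In Sweedler notation, \<open>coef K C M \<phi> m = m\<^sub>-\<^sub>1 \<phi>(m\<^sub>0)\<close>.\<close>

definition coef where
  "coef K C M \<phi> m = contract_right K C M \<phi> (coact M m)"

text \<open>For a set of functionals on a comodule this is the largest subcomodule inside their
  common kernel; quantifying over \<open>f\<close> replaces passing to the submodule generated by
  \<open>S\<close>.\<close>

definition annih where
  "annih K C M S = {m \<in> carrier M. \<forall>\<phi>\<in>S. \<forall>f\<in>dual_space K C. \<phi> (ract K C M m f) = \<zero>\<^bsub>K\<^esub>}"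

lemma artinianD:
  assumes "artinian_comodule K C M" "\<And>i. subcomodule (N i) K C M" "\<And>i. N (Suc i) \<subseteq> N i"
  shows "\<exists>n. \<forall>i\<ge>n. N i = N n"
  using assms by (simp add: artinian_comodule_def)

context comod
begin

lemmas M_zero = CM.WW.V.M.zero_closed and M_add = CM.WW.V.M.a_closed and M_smult = CM.WW.V.smult_closed

lemma K_abelian: "abelian_group K"
  by (rule ring.is_abelian_group[OF cring.axioms(1)[OF module.axioms(1)[OF M_module]]])

lemma ract_lin:
  assumes "f \<in> dual_space K C"
  shows "m \<in> carrier M \<Longrightarrow> m' \<in> carrier M \<Longrightarrow>
      ract K C M (m \<oplus>\<^bsub>M\<^esub> m') f = ract K C M m f \<oplus>\<^bsub>M\<^esub> ract K C M m' f"
    and "a \<in> carrier K \<Longrightarrow> m \<in> carrier M \<Longrightarrow> ract K C M (a \<odot>\<^bsub>M\<^esub> m) f = a \<odot>\<^bsub>M\<^esub> ract K C M m f"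
    and "ract K C M \<zero>\<^bsub>M\<^esub> f = \<zero>\<^bsub>M\<^esub>"
  using linear_map_add[OF ract_linear[OF assms]] linear_map_smult[OF ract_linear[OF assms]]
    linear_map_zero[OF vec_abelian[OF vec_M] vec_abelian[OF vec_M] ract_linear[OF assms]] by simp_all

lemma coef_linear: "\<phi> \<in> dual_space K M \<Longrightarrow> linear_map K M C (coef K C M \<phi>)"
  unfolding coef_def by (rule linear_map_compose[OF M_coact contract_right_linear[OF vec_C vec_M]])

lemma coef_closed: "\<phi> \<in> dual_space K M \<Longrightarrow> m \<in> carrier M \<Longrightarrow> coef K C M \<phi> m \<in> carrier C"
  by (rule linear_map_closed[OF coef_linear])

text \<open>Both sides evaluate \<chi> \<otimes> \<phi> on the coaction, contracting either the
  right or the left factor first.\<close>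

lemma coef_apply:
  assumes "\<phi> \<in> dual_space K M" "\<chi> \<in> dual_space K C" "m \<in> carrier M"
  shows "\<chi> (coef K C M \<phi> m) = \<phi> (ract K C M m \<chi>)"
  unfolding coef_def ract_def ev_contract_right[OF vec_C vec_M assms(2,1) linear_map_closed[OF M_coact assms(3)]]
  by (rule ev_contract[OF vec_C vec_M assms(2,1) linear_map_closed[OF M_coact assms(3)]])

lemma coef_eqI:
  assumes "\<phi> \<in> dual_space K M" "m \<in> carrier M" "c \<in> carrier C"
    and "\<And>\<chi>. \<chi> \<in> dual_space K C \<Longrightarrow> \<phi> (ract K C M m \<chi>) = \<chi> c"
  shows "coef K C M \<phi> m = c"
  by (rule vec.dual_separates[OF vec_C coef_closed[OF assms(1,2)] assms(3)])
    (simp add: coef_apply[OF assms(1) _ assms(2)] assms(4))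

text \<open>Shows that \<open>coef K C M \<phi>\<close> is a comodule map from \<open>M\<close> to
  \<open>C\<close>. Tested on \<chi>, both sides are \<phi> at m acted on by the product g
  \<chi>.\<close>

lemma coef_ract:
  assumes \<phi>: "\<phi> \<in> dual_space K M" and g: "g \<in> dual_space K C" and m: "m \<in> carrier M"
  shows "coef K C M \<phi> (ract K C M m g) = cact K C (coef K C M \<phi> m) g"
proof (rule coef_eqI[OF \<phi> ract_closed[OF g m] cact_closed[OF g coef_closed[OF \<phi> m]]])
  fix \<chi> assume \<chi>: "\<chi> \<in> dual_space K C"
  have "\<phi> (ract K C M (ract K C M m g) \<chi>) = (g \<otimes>\<^bsub>R\<^esub> \<chi>) (coef K C M \<phi> m)"
    by (simp add: ract_ract[OF m g \<chi>] coef_apply[OF \<phi> dual_mult_closed[OF g \<chi>] m])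
  also have "\<dots> = \<chi> (cact K C (coef K C M \<phi> m) g)"
    by (rule dual_mult_apply[OF g \<chi> coef_closed[OF \<phi> m]])
  finally show "\<phi> (ract K C M (ract K C M m g) \<chi>) = \<chi> (cact K C (coef K C M \<phi> m) g)" .
qed

lemma annihD: "m \<in> annih K C M S \<Longrightarrow> m \<in> carrier M"
    "m \<in> annih K C M S \<Longrightarrow> \<phi> \<in> S \<Longrightarrow> f \<in> dual_space K C \<Longrightarrow> \<phi> (ract K C M m f) = \<zero>\<^bsub>K\<^esub>"
  by (simp_all add: annih_def)

lemma annih_subcomodule:
  assumes S: "S \<subseteq> dual_space K M"
  shows "subcomodule (annih K C M S) K C M"
proof -
  have S': "\<phi> \<in> dual_space K M" if "\<phi> \<in> S" for \<phi> using S that by blast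
  show ?thesis
    unfolding subcomodule_iff module_submodule_iff[OF M_module]
  proof (intro conjI ballI)
    show "annih K C M S \<subseteq> carrier M" by (auto simp: annih_def)
    show "\<zero>\<^bsub>M\<^esub> \<in> annih K C M S"
      using S' by (simp add: annih_def ract_lin M_zero CM.WW.dual_zero)
  next
    fix x y assume x: "x \<in> annih K C M S" and y: "y \<in> annih K C M S"
    show "x \<oplus>\<^bsub>M\<^esub> y \<in> annih K C M S" unfolding annih_def
    proof (intro CollectI conjI ballI)
      show "x \<oplus>\<^bsub>M\<^esub> y \<in> carrier M" by (rule M_add[OF annihD(1)[OF x] annihD(1)[OF y]])
      fix \<phi> f assume \<phi>: "\<phi> \<in> S" and f: "f \<in> dual_space K C"
      show "\<phi> (ract K C M (x \<oplus>\<^bsub>M\<^esub> y) f) = \<zero>\<^bsub>K\<^esub>"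
        using annihD(1)[OF x] annihD(1)[OF y] annihD(2)[OF x \<phi> f] annihD(2)[OF y \<phi> f]
        by (simp add: ract_lin[OF f] CM.WW.dual_add[OF S'[OF \<phi>]] ract_closed[OF f])
    qed
  next
    fix a x assume a: "a \<in> carrier K" and x: "x \<in> annih K C M S"
    show "a \<odot>\<^bsub>M\<^esub> x \<in> annih K C M S" unfolding annih_def
    proof (intro CollectI conjI ballI)
      show "a \<odot>\<^bsub>M\<^esub> x \<in> carrier M" by (rule M_smult[OF a annihD(1)[OF x]])
      fix \<phi> f assume \<phi>: "\<phi> \<in> S" and f: "f \<in> dual_space K C"
      show "\<phi> (ract K C M (a \<odot>\<^bsub>M\<^esub> x) f) = \<zero>\<^bsub>K\<^esub>"
        using annihD(1)[OF x] annihD(2)[OF x \<phi> f] a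
        by (simp add: ract_lin[OF f] CM.WW.dual_smult[OF S'[OF \<phi>]] ract_closed[OF f])
    qed
  next
    fix x g assume x: "x \<in> annih K C M S" and g: "g \<in> dual_space K C"
    show "ract K C M x g \<in> annih K C M S" unfolding annih_def
    proof (intro CollectI conjI ballI)
      show "ract K C M x g \<in> carrier M" by (rule ract_closed[OF g annihD(1)[OF x]])
      fix \<phi> f assume \<phi>: "\<phi> \<in> S" and f: "f \<in> dual_space K C"
      show "\<phi> (ract K C M (ract K C M x g) f) = \<zero>\<^bsub>K\<^esub>"
        using annihD(2)[OF x \<phi> dual_mult_closed[OF g f]] by (simp add: ract_ract[OF annihD(1)[OF x] g f])
    qed
  qed
qed

text \<open>A submodule contains f \<phi> along with \<phi>, so the quantifier over \<open>f\<close>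
  in \<open>annih\<close> is absorbed.\<close>

lemma annih_submodule:
  assumes I: "submodule I R MD"
  shows "annih K C M I = {m \<in> carrier M. \<forall>\<phi>\<in>I. \<phi> m = \<zero>\<^bsub>K\<^esub>}"
proof (intro equalityI subsetI)
  fix m assume m: "m \<in> annih K C M I"
  have one: "\<one>\<^bsub>R\<^esub> \<in> dual_space K C" using counit_dual by simp
  show "m \<in> {m \<in> carrier M. \<forall>\<phi>\<in>I. \<phi> m = \<zero>\<^bsub>K\<^esub>}"
    using annihD(1)[OF m] annihD(2)[OF m _ one] ract_one[OF annihD(1)[OF m]] by simp
next
  fix m assume m: "m \<in> {m \<in> carrier M. \<forall>\<phi>\<in>I. \<phi> m = \<zero>\<^bsub>K\<^esub>}"
  have "\<phi> (ract K C M m f) = \<zero>\<^bsub>K\<^esub>" if "\<phi> \<in> I" "f \<in> dual_space K C" for \<phi> f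
  proof -
    have "f \<odot>\<^bsub>MD\<^esub> \<phi> \<in> I" using submoduleD(5)[OF I, of f \<phi>] that by simp
    then have "(f \<odot>\<^bsub>MD\<^esub> \<phi>) m = \<zero>\<^bsub>K\<^esub>" using m by blast
    then show ?thesis using m by simp
  qed
  then show "m \<in> annih K C M I" using m by (simp add: annih_def)
qed

lemma dual_uminus:
  assumes "\<phi> \<in> dual_space K M" "m \<in> carrier M"
  shows "(\<ominus>\<^bsub>MD\<^esub> \<phi>) m = \<ominus>\<^bsub>K\<^esub> \<phi> m"
proof -
  interpret D: left_module R MD by (rule dual_left_module)
  have c: "\<ominus>\<^bsub>MD\<^esub> \<phi> \<in> dual_space K M" using D.M.a_inv_closed[of \<phi>] assms by simp
  have "\<ominus>\<^bsub>MD\<^esub> \<phi> \<oplus>\<^bsub>MD\<^esub> \<phi> = \<zero>\<^bsub>MD\<^esub>" using D.M.l_neg[of \<phi>] assms by simp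
  then have "(\<ominus>\<^bsub>MD\<^esub> \<phi> \<oplus>\<^bsub>MD\<^esub> \<phi>) m = \<zero>\<^bsub>MD\<^esub> m" by (rule fun_cong)
  then have "(\<ominus>\<^bsub>MD\<^esub> \<phi>) m \<oplus>\<^bsub>K\<^esub> \<phi> m = \<zero>\<^bsub>K\<^esub>" using assms by simp
  then show ?thesis
    using abelian_group.minus_equality[OF K_abelian, of "(\<ominus>\<^bsub>MD\<^esub> \<phi>) m" "\<phi> m"] CM.WW.dual_closed[OF c assms(2)] CM.WW.dual_closed[OF assms]
    by simp
qed

text \<open>Finitely generated submodules of the dual are closed: a functional vanishing on the
  common kernel of maps to \<open>C\<close> factors through them.\<close>

lemma gspan_closed:
  "\<phi> \<in> {..<n} \<rightarrow> dual_space K M \<Longrightarrow> \<psi> \<in> dual_space K M \<Longrightarrow>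
    (\<And>m. m \<in> annih K C M (\<phi> ` {..<n}) \<Longrightarrow> \<psi> m = \<zero>\<^bsub>K\<^esub>) \<Longrightarrow> \<psi> \<in> gspan R MD \<phi> n"
proof (induct n arbitrary: \<psi>)
  case 0
  interpret D: left_module R MD by (rule dual_left_module)
  have "\<psi> = \<zero>\<^bsub>MD\<^esub>"
  proof (rule dual_space_ext[where K = K and V = M])
    show "\<zero>\<^bsub>MD\<^esub> \<in> dual_space K M" using D.M.zero_closed by simp
    fix m assume m: "m \<in> carrier M"
    show "\<psi> m = \<zero>\<^bsub>MD\<^esub> m" using 0(3)[of m] m by (simp add: annih_def)
  qed (rule 0(2))
  then show ?case by (simp del: dual_module_sel(2))
next
  case (Suc n)
  interpret D: left_module R MD by (rule dual_left_module)
  let ?N = "annih K C M (\<phi> ` {..<n})"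
  note \<phi> = Pi_Suc_D[OF Suc(2)] and \<psi> = Suc(3)
  have sub: "submodule ?N K M"
    using annih_subcomodule[of "\<phi> ` {..<n}"] \<phi>(1) by (auto simp: subcomodule_iff)
  \<comment> \<open>On the annihilator of the first \<open>n\<close> functionals, a zero of the
    coefficient map of \<open>\<phi> n\<close> is annihilated by all n + 1 of them, so \<psi>
    vanishes there.\<close>
  have van: "\<psi> m = \<zero>\<^bsub>K\<^esub>" if m: "m \<in> ?N" and z: "coef K C M (\<phi> n) m = \<zero>\<^bsub>C\<^esub>" for m
  proof (rule Suc(4))
    have "\<phi> n (ract K C M m f) = \<zero>\<^bsub>K\<^esub>" if f: "f \<in> dual_space K C" for f
      using coef_apply[OF \<phi>(2) f annihD(1)[OF m]] z vec.dual_zero[OF vec_C f] by simp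
    then show "m \<in> annih K C M (\<phi> ` {..<Suc n})"
      using m by (simp add: annih_def lessThan_Suc)
  qed
  have "\<exists>\<chi>\<in>dual_space K C. \<forall>m\<in>?N. \<psi> m = \<chi> (coef K C M (\<phi> n) m)"
    by (rule functional_factor[OF vec_M vec_C sub coef_linear[OF \<phi>(2)] \<psi>]) (rule van)
  then obtain \<chi> where \<chi>: "\<chi> \<in> dual_space K C" "\<forall>m\<in>?N. \<psi> m = \<chi> (coef K C M (\<phi> n) m)" by (elim bexE)
  \<comment> \<open>This multiple of \<open>\<phi> n\<close> agrees with \<psi> on
    \<open>?N\<close>, because \<psi> factors there through the coefficient map; the induction
    hypothesis then applies to \<psi> - \<theta>.\<close>
  define \<theta> where "\<theta> = \<chi> \<odot>\<^bsub>MD\<^esub> \<phi> n"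
  have \<theta>: "\<theta> \<in> dual_space K M" unfolding \<theta>_def by (rule dual_smult_closed[OF \<chi>(1) \<phi>(2)])
  have n\<theta>: "\<ominus>\<^bsub>MD\<^esub> \<theta> \<in> dual_space K M" using D.M.a_inv_closed[of \<theta>] \<theta> by simp
  have c: "\<psi> \<oplus>\<^bsub>MD\<^esub> \<ominus>\<^bsub>MD\<^esub> \<theta> \<in> dual_space K M"
    using D.M.a_closed[of \<psi> "\<ominus>\<^bsub>MD\<^esub> \<theta>"] \<psi> n\<theta> by (simp del: dual_module_sel(3))
  have "\<psi> \<oplus>\<^bsub>MD\<^esub> \<ominus>\<^bsub>MD\<^esub> \<theta> \<in> gspan R MD \<phi> n"
  proof (rule Suc(1)[OF \<phi>(1) c])
    fix m assume m: "m \<in> ?N"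
    note mM = annihD(1)[OF m]
    have "\<psi> m = \<theta> m" using \<chi>(2) m coef_apply[OF \<phi>(2) \<chi>(1) mM] mM by (simp add: \<theta>_def)
    then show "(\<psi> \<oplus>\<^bsub>MD\<^esub> \<ominus>\<^bsub>MD\<^esub> \<theta>) m = \<zero>\<^bsub>K\<^esub>"
      using mM by (simp add: dual_uminus[OF \<theta> mM] abelian_group.r_neg[OF K_abelian] CM.WW.dual_closed[OF \<theta>])
  qed
  note IH = this
  have "\<phi> \<in> {..<Suc n} \<rightarrow> carrier MD" "\<chi> \<in> carrier R" using Suc(2) \<chi>(1) by simp_all
  then have "\<theta> \<oplus>\<^bsub>MD\<^esub> (\<psi> \<oplus>\<^bsub>MD\<^esub> \<ominus>\<^bsub>MD\<^esub> \<theta>) \<in> gspan R MD \<phi> (Suc n)"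
    using D.gspan_SucI[of \<phi> n \<chi>, OF _ _ IH, folded \<theta>_def] by (simp only:)
  moreover have "\<theta> \<oplus>\<^bsub>MD\<^esub> (\<psi> \<oplus>\<^bsub>MD\<^esub> \<ominus>\<^bsub>MD\<^esub> \<theta>) = \<psi>"
  proof -
    have "\<theta> \<oplus>\<^bsub>MD\<^esub> (\<psi> \<oplus>\<^bsub>MD\<^esub> \<ominus>\<^bsub>MD\<^esub> \<theta>) = \<psi> \<oplus>\<^bsub>MD\<^esub> (\<theta> \<oplus>\<^bsub>MD\<^esub> \<ominus>\<^bsub>MD\<^esub> \<theta>)"
      by (rule D.M.a_lcomm) (simp_all add: \<theta> \<psi> n\<theta>)
    also have "\<theta> \<oplus>\<^bsub>MD\<^esub> \<ominus>\<^bsub>MD\<^esub> \<theta> = \<zero>\<^bsub>MD\<^esub>" by (rule D.M.r_neg) (simp add: \<theta>)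
    also have "\<psi> \<oplus>\<^bsub>MD\<^esub> \<zero>\<^bsub>MD\<^esub> = \<psi>" by (rule D.M.r_zero) (simp add: \<psi>)
    finally show ?thesis .
  qed
  ultimately show ?case by simp
qed

section \<open>Chains of subcomodules and chains of submodules of the dual\<close>

lemma ann_submodule:
  assumes N: "subcomodule N K C M"
  shows "submodule {\<phi> \<in> dual_space K M. \<forall>m\<in>N. \<phi> m = \<zero>\<^bsub>K\<^esub>} R MD" (is "submodule ?I R MD")
proof -
  interpret D: left_module R MD by (rule dual_left_module)
  have sub: "submodule N K M" and ra: "\<And>m f. m \<in> N \<Longrightarrow> f \<in> dual_space K C \<Longrightarrow> ract K C M m f \<in> N"
    using N by (simp_all add: subcomodule_iff)
  note NM = submoduleD(1)[OF sub]
  show ?thesis unfolding D.submodule_iff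
  proof (intro conjI ballI)
    show "?I \<subseteq> carrier MD" by auto
    show "\<zero>\<^bsub>MD\<^esub> \<in> ?I" using D.M.zero_closed NM by simp
  next
    fix \<phi> \<psi> assume a: "\<phi> \<in> ?I" "\<psi> \<in> ?I"
    then have "\<phi> \<oplus>\<^bsub>MD\<^esub> \<psi> \<in> dual_space K M"
      using D.M.a_closed[of \<phi> \<psi>] by (simp del: dual_module_sel(3))
    moreover have "\<forall>m\<in>N. (\<phi> \<oplus>\<^bsub>MD\<^esub> \<psi>) m = \<zero>\<^bsub>K\<^esub>" using a NM by simp
    ultimately show "\<phi> \<oplus>\<^bsub>MD\<^esub> \<psi> \<in> ?I" by blast
  next
    fix f \<phi> assume "f \<in> carrier R" and a: "\<phi> \<in> ?I"
    then have f: "f \<in> dual_space K C" by simp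
    have "f \<odot>\<^bsub>MD\<^esub> \<phi> \<in> dual_space K M" using a by (intro dual_smult_closed[OF f]) simp
    moreover have "\<forall>m\<in>N. (f \<odot>\<^bsub>MD\<^esub> \<phi>) m = \<zero>\<^bsub>K\<^esub>" using a NM ra[OF _ f] by simp
    ultimately show "f \<odot>\<^bsub>MD\<^esub> \<phi> \<in> ?I" by blast
  qed
qed

text \<open>A subspace is the common zero set of the functionals that vanish on it, by
  \<open>separation\<close>, so a descending chain of subcomodules is recovered from the ascending
  chain of its annihilators.\<close>

lemma noetherian_imp_artinian:
  assumes noeth: "noetherian_module R MD"
  shows "artinian_comodule K C M"
  unfolding artinian_comodule_def
proof (intro allI impI)
  fix N :: "nat \<Rightarrow> 'm set" assume a: "\<forall>i. subcomodule (N i) K C M \<and> N (Suc i) \<subseteq> N i"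
  define I where "I i = {\<phi> \<in> dual_space K M. \<forall>m\<in>N i. \<phi> m = \<zero>\<^bsub>K\<^esub>}" for i
  have sub: "submodule (N i) K M" for i using a by (simp add: subcomodule_iff)
  have I: "submodule (I i) R MD" for i unfolding I_def by (rule ann_submodule) (use a in simp)
  have "I i \<subseteq> I (Suc i)" for i using a unfolding I_def by blast
  from noetherianD[of R MD I, OF noeth I this] obtain n where n: "\<forall>i\<ge>n. I i = I n" by (elim exE)
  have N: "N i = {m \<in> carrier M. \<forall>\<phi>\<in>I i. \<phi> m = \<zero>\<^bsub>K\<^esub>}" for i
  proof (intro equalityI subsetI)
    fix m assume "m \<in> N i"
    then show "m \<in> {m \<in> carrier M. \<forall>\<phi>\<in>I i. \<phi> m = \<zero>\<^bsub>K\<^esub>}"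
      using submoduleD(1)[OF sub] by (auto simp: I_def)
  next
    fix m assume m: "m \<in> {m \<in> carrier M. \<forall>\<phi>\<in>I i. \<phi> m = \<zero>\<^bsub>K\<^esub>}"
    show "m \<in> N i"
    proof (rule ccontr)
      assume "m \<notin> N i"
      with m obtain f where f: "f \<in> dual_space K M" "\<forall>y\<in>N i. f y = \<zero>\<^bsub>K\<^esub>" "f m = \<one>\<^bsub>K\<^esub>"
        using CM.WW.separation[OF sub[of i], of m] by auto
      then have "f \<in> I i" by (simp add: I_def)
      then show False using m f(3) CM.WW.one_not_zero by auto
    qed
  qed
  have "N i = N n" if "n \<le> i" for i
    unfolding N[of i] N[of n] n[rule_format, OF that] ..
  then show "\<exists>n. \<forall>i\<ge>n. N i = N n" by (intro exI[of _ n] allI impI)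
qed

text \<open>By the descending chain condition finitely many members of \<open>I\<close> already have
  the annihilator of \<open>I\<close>; being closed, their span contains all of
  \<open>I\<close>.\<close>

lemma artinian_closed:
  assumes art: "artinian_comodule K C M" and I: "submodule I R MD"
  shows "\<exists>n \<phi>. \<phi> \<in> {..<n} \<rightarrow> I \<and> I = gspan R MD \<phi> n \<and> annih K C M (\<phi> ` {..<n}) = annih K C M I"
proof -
  interpret D: left_module R MD by (rule dual_left_module)
  have ID: "I \<subseteq> dual_space K M" using submoduleD(1)[OF I] by auto
  have "\<exists>(n::nat) \<phi>. \<phi> \<in> {..<n} \<rightarrow> I \<and> annih K C M (\<phi> ` {..<n}) = annih K C M I"
  proof (rule ccontr)
    assume neg: "\<not> ?thesis"
    define P where "P N \<longleftrightarrow> (\<exists>(k::nat) \<phi>. \<phi> \<in> {..<k} \<rightarrow> I \<and> N = annih K C M (\<phi> ` {..<k}))" for N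
    \<comment> \<open>If no finite family suffices, some point \<open>m\<close> of its annihilator
      is detected by a further \<psi> in \<open>I\<close>; adding \<psi> makes the annihilator
      strictly smaller.\<close>
    have "\<exists>f. \<forall>n::nat. P (f n) \<and> f (Suc n) \<subset> f n"
    proof (rule dependent_nat_choice)
      show "\<exists>N. P N" unfolding P_def by (intro exI[of _ "annih K C M {}"] exI[of _ 0]) simp
      fix N and n :: nat assume "P N"
      then obtain k :: nat and \<phi> where \<phi>: "\<phi> \<in> {..<k} \<rightarrow> I" and N: "N = annih K C M (\<phi> ` {..<k})"
        by (auto simp: P_def)
      have "annih K C M I \<subseteq> N" unfolding N annih_def using \<phi> by auto
      moreover have "annih K C M I \<noteq> N" using neg \<phi> N by blast
      ultimately obtain m where m: "m \<in> N" "m \<notin> annih K C M I" by blast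
      then obtain \<psi> f where \<psi>: "\<psi> \<in> I" "f \<in> dual_space K C" "\<psi> (ract K C M m f) \<noteq> \<zero>\<^bsub>K\<^esub>"
        unfolding N annih_def by auto
      define \<phi>' where "\<phi>' = \<phi>(k := \<psi>)"
      have \<phi>': "\<phi>' \<in> {..<Suc k} \<rightarrow> I" using \<phi> \<psi>(1) by (auto simp: \<phi>'_def less_Suc_eq)
      have im: "\<phi>' ` {..<Suc k} = insert \<psi> (\<phi> ` {..<k})" by (auto simp: \<phi>'_def lessThan_Suc)
      have "annih K C M (\<phi>' ` {..<Suc k}) \<subseteq> N" unfolding im N annih_def by auto
      moreover have "m \<notin> annih K C M (\<phi>' ` {..<Suc k})" unfolding im annih_def using \<psi> by auto
      ultimately have "annih K C M (\<phi>' ` {..<Suc k}) \<subset> N" using m(1) by blast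
      then show "\<exists>N'. P N' \<and> N' \<subset> N" unfolding P_def using \<phi>' by blast
    qed
    then obtain f where f: "\<And>n. P (f n)" "\<And>n::nat. f (Suc n) \<subset> f n" by blast
    have "subcomodule (f n) K C M" for n
    proof -
      obtain k :: nat and \<phi> where \<phi>: "\<phi> \<in> {..<k} \<rightarrow> I" and N: "f n = annih K C M (\<phi> ` {..<k})"
        using f(1)[of n] by (auto simp: P_def)
      show ?thesis unfolding N using \<phi> ID by (intro annih_subcomodule) auto
    qed
    from artinianD[of K C M f, OF art this psubset_imp_subset[OF f(2)]]
    obtain n where "\<forall>i\<ge>n. f i = f n" by (elim exE)
    from this[rule_format, of "Suc n"] have "f (Suc n) = f n" by simp
    then show False using f(2)[of n] by simp
  qed
  then obtain n :: nat and \<phi> where \<phi>: "\<phi> \<in> {..<n} \<rightarrow> I" and an: "annih K C M (\<phi> ` {..<n}) = annih K C M I"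
    by blast
  have \<phi>D: "\<phi> \<in> {..<n} \<rightarrow> dual_space K M" using \<phi> ID by auto
  have "I = gspan R MD \<phi> n"
  proof
    show "gspan R MD \<phi> n \<subseteq> I" by (rule D.gspan_least[OF I]) (use \<phi>D \<phi> in auto)
    show "I \<subseteq> gspan R MD \<phi> n"
    proof
      fix \<psi> assume \<psi>: "\<psi> \<in> I"
      then have "\<psi> \<in> dual_space K M" using ID by blast
      then show "\<psi> \<in> gspan R MD \<phi> n"
        by (rule gspan_closed[OF \<phi>D]) (use \<psi> in \<open>simp add: an annih_submodule[OF I]\<close>)
    qed
  qed
  then show ?thesis using \<phi> an by blast
qed

text \<open>The finite family from \<open>artinian_closed\<close> spans \<open>I\<close> and has the
  same annihilator, so \<open>gspan_closed\<close> applies. Ascending chains of submodules are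
  thereby recovered from descending chains of subcomodules.\<close>

lemma artinian_double_annih:
  assumes art: "artinian_comodule K C M" and I: "submodule I R MD"
  shows "I = {\<psi> \<in> dual_space K M. \<forall>m\<in>annih K C M I. \<psi> m = \<zero>\<^bsub>K\<^esub>}"
proof (intro equalityI subsetI)
  fix \<psi> assume "\<psi> \<in> I"
  then show "\<psi> \<in> {\<psi> \<in> dual_space K M. \<forall>m\<in>annih K C M I. \<psi> m = \<zero>\<^bsub>K\<^esub>}"
    using submoduleD(1)[OF I] by (simp add: annih_submodule[OF I])
next
  fix \<psi> assume \<psi>: "\<psi> \<in> {\<psi> \<in> dual_space K M. \<forall>m\<in>annih K C M I. \<psi> m = \<zero>\<^bsub>K\<^esub>}"
  obtain n \<phi> where \<phi>: "\<phi> \<in> {..<n} \<rightarrow> I" "I = gspan R MD \<phi> n"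
    and an: "annih K C M (\<phi> ` {..<n}) = annih K C M I"
    using artinian_closed[OF assms] by blast
  have \<phi>D: "\<phi> \<in> {..<n} \<rightarrow> dual_space K M" using \<phi>(1) submoduleD(1)[OF I] by auto
  have "\<psi> \<in> gspan R MD \<phi> n" by (rule gspan_closed[OF \<phi>D]) (use \<psi> an in auto)
  then show "\<psi> \<in> I" using \<phi>(2) by simp
qed

lemma artinian_imp_noetherian:
  assumes art: "artinian_comodule K C M"
  shows "noetherian_module R MD"
  unfolding noetherian_module_def
proof (intro allI impI)
  fix I :: "nat \<Rightarrow> ('m \<Rightarrow> 'k) set" assume a: "\<forall>i. submodule (I i) R MD \<and> I i \<subseteq> I (Suc i)"
  have A: "subcomodule (annih K C M (I i)) K C M" for i
    using annih_subcomodule[of "I i"] submoduleD(1)[of "I i" R MD] a by auto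
  have "annih K C M (I (Suc i)) \<subseteq> annih K C M (I i)" for i
    using a unfolding annih_def by blast
  from artinianD[of K C M "\<lambda>i. annih K C M (I i)", OF art A this]
  obtain n where n: "\<forall>i\<ge>n. annih K C M (I i) = annih K C M (I n)" by (elim exE)
  have "I i = I n" if "n \<le> i" for i
  proof -
    have s: "submodule (I i) R MD" "submodule (I n) R MD" using a by simp_all
    show ?thesis
      by (subst artinian_double_annih[OF art s(1)], subst artinian_double_annih[OF art s(2)])
        (simp only: n[rule_format, OF that])
  qed
  then show "\<exists>n. \<forall>i\<ge>n. I i = I n" by (intro exI[of _ n] allI impI)
qed

lemma artinian_iff_noetherian: "artinian_comodule K C M \<longleftrightarrow> noetherian_module R MD"
  using artinian_imp_noetherian noetherian_imp_artinian by blast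

lemma msum_dual_apply:
  assumes "a \<in> {..<n} \<rightarrow> dual_space K C" "\<phi> \<in> {..<n} \<rightarrow> dual_space K M" "m \<in> carrier M"
  shows "msum MD a \<phi> n m = finsum K (\<lambda>i. \<phi> i (ract K C M m (a i))) {..<n}"
proof -
  interpret D: left_module R MD by (rule dual_left_module)
  have t: "(\<lambda>i. a i \<odot>\<^bsub>MD\<^esub> \<phi> i) \<in> {..<n} \<rightarrow> carrier MD"
    by (rule D.msum_terms) (use assms in simp_all)
  have "msum MD a \<phi> n m = finsum K (\<lambda>i. (a i \<odot>\<^bsub>MD\<^esub> \<phi> i) m) {..<n}"
    unfolding msum_def
    by (rule finsum_hom[OF D.M.abelian_group_axioms K_abelian _ t, where h = "\<lambda>\<psi>. \<psi> m"])
      (use assms(3) in \<open>simp_all add: CM.WW.dual_closed\<close>)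
  then show ?thesis using assms(3) by simp
qed

end

text \<open>In the dual algebra (f g)(c) = g(c f), so the dual of the regular comodule is the dual
  algebra as a left module over itself. The two scalar products agree on functionals, which is
  enough to identify the submodules.\<close>

lemma (in coalgebra) left_artinian_iff_left_noetherian:
  "left_artinian_coalgebra K C \<longleftrightarrow> left_noetherian_ring R"
proof -
  interpret S: left_module R "self_module R" by (rule self_left_module[OF dual_ring])
  interpret D: left_module R "dual_module K C (regular_comodule C)" by (rule RC.dual_left_module)
  let ?D = "dual_module K C (regular_comodule C)"
  have add: "f \<oplus>\<^bsub>?D\<^esub> g = f \<oplus>\<^bsub>R\<^esub> g" for f g by simp
  have sm: "f \<odot>\<^bsub>?D\<^esub> g = f \<otimes>\<^bsub>R\<^esub> g" if "f \<in> dual_space K C" "g \<in> dual_space K C" for f g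
  proof (rule dual_space_ext[where K = K and V = C])
    show "f \<odot>\<^bsub>?D\<^esub> g \<in> dual_space K C"
      using RC.dual_smult_closed[of f g] that by (simp only: dual_regular)
    fix c assume "c \<in> carrier C"
    then show "(f \<odot>\<^bsub>?D\<^esub> g) c = (f \<otimes>\<^bsub>R\<^esub> g) c"
      by (simp add: dual_mult_apply that ract_regular)
  qed (rule dual_mult_closed[OF that])
  have "submodule N R (self_module R) \<longleftrightarrow> submodule N R ?D" for N
  proof (cases "N \<subseteq> dual_space K C")
    case True
    then have *: "f \<in> N \<Longrightarrow> f \<in> dual_space K C" for f by blast
    show ?thesis unfolding S.submodule_iff D.submodule_iff
      using True by (simp add: sm * dual_regular add del: dual_module_sel(3,4) dual_algebra_sel(4))
  qed (auto simp: S.submodule_iff D.submodule_iff dual_regular)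
  then have "noetherian_module R (self_module R) \<longleftrightarrow> noetherian_module R ?D"
    by (simp add: noetherian_module_def)
  then show ?thesis
    unfolding left_artinian_coalgebra_def left_noetherian_ring_def RC.artinian_iff_noetherian by simp
qed

section \<open>Powers of a coalgebra and finitely cogenerated comodules\<close>

lemma module_power_sel [simp]:
  "carrier (module_power V n) = (\<Pi>\<^sub>E i\<in>{..<n}. carrier V)"
  "\<zero>\<^bsub>module_power V n\<^esub> = (\<lambda>i\<in>{..<n}. \<zero>\<^bsub>V\<^esub>)"
  "x \<oplus>\<^bsub>module_power V n\<^esub> y = (\<lambda>i\<in>{..<n}. x i \<oplus>\<^bsub>V\<^esub> y i)"
  "a \<odot>\<^bsub>module_power V n\<^esub> x = (\<lambda>i\<in>{..<n}. a \<odot>\<^bsub>V\<^esub> x i)"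
  by (simp_all add: module_power_def)

lemma comodule_power_sel:
  "carrier (comodule_power K C n) = carrier (module_power C n)"
  "add (comodule_power K C n) = add (module_power C n)"
  "ring.zero (comodule_power K C n) = ring.zero (module_power C n)"
  "smult (comodule_power K C n) = smult (module_power C n)"
  "coact (comodule_power K C n) = (\<lambda>x. finsum (tensor_product K C (module_power C n))
       (\<lambda>i. tensor_map K C C C (module_power C n) (\<lambda>c. c) (power_incl C n i) (comult C (x i)))
       {..<n})"
  by (simp_all add: comodule_power_def module.defs)

lemma module_power_module:
  assumes "module K V"
  shows "module K (module_power V n)"
proof -
  interpret V: module K V by fact
  have "abelian_group (module_power V n)"
  proof (rule abelian_groupI)
    fix x assume x: "x \<in> carrier (module_power V n)"
    show "\<exists>y\<in>carrier (module_power V n). y \<oplus>\<^bsub>module_power V n\<^esub> x = \<zero>\<^bsub>module_power V n\<^esub>"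
      by (rule bexI[of _ "\<lambda>i\<in>{..<n}. \<ominus>\<^bsub>V\<^esub> x i"])
        (use x in \<open>auto simp: PiE_iff V.M.l_neg intro!: restrict_ext\<close>)
  qed (auto simp: PiE_iff V.M.a_ac extensional_def fun_eq_iff)
  then show ?thesis
    by (rule moduleI[OF V.R.cring_axioms])
      (auto simp: PiE_iff V.smult_l_distr V.smult_r_distr V.smult_assoc1 extensional_def fun_eq_iff)
qed

lemma module_power_proj_linear: "i < n \<Longrightarrow> linear_map K (module_power V n) V (\<lambda>x. x i)"
  by (rule linear_mapI) (auto simp: PiE_iff)

lemma power_incl_linear:
  assumes "module K V" "i < n"
  shows "linear_map K V (module_power V n) (power_incl V n i)"
proof -
  interpret V: module K V by fact
  show ?thesis
    by (rule linear_mapI) (auto simp: power_incl_def PiE_iff intro!: restrict_ext)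
qed

lemma linear_map_finsum:
  assumes "vec K V" "vec K W" "finite A" "\<And>i. i \<in> A \<Longrightarrow> linear_map K V W (g i)"
  shows "linear_map K V W (\<lambda>x. finsum W (\<lambda>i. g i x) A)"
  using assms(3,4)
proof (induct rule: finite_induct)
  interpret W: module K W by (rule vec_module[OF assms(2)])
  case empty show ?case by (rule linear_mapI) simp_all
next
  interpret W: module K W by (rule vec_module[OF assms(2)])
  case (insert a A)
  have gA: "x \<in> carrier V \<Longrightarrow> (\<lambda>i. g i x) \<in> A \<rightarrow> carrier W" and ga: "x \<in> carrier V \<Longrightarrow> g a x \<in> carrier W" for x
    using linear_map_closed[OF insert(4)] by auto
  have eq: "finsum W (\<lambda>i. g i x) (insert a A) = g a x \<oplus>\<^bsub>W\<^esub> finsum W (\<lambda>i. g i x) A" if "x \<in> carrier V" for x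
    by (rule W.M.finsum_insert[OF insert(1,2) gA[OF that] ga[OF that]])
  have lin: "linear_map K V W (\<lambda>x. g a x \<oplus>\<^bsub>W\<^esub> finsum W (\<lambda>i. g i x) A)"
    by (rule linear_map_plus[OF assms(1,2) insert(4) insert(3)]) (use insert(4) in auto)
  interpret V: module K V by (rule vec_module[OF assms(1)])
  show ?case
    by (rule linear_mapI)
      (simp_all add: eq linear_map_closed[OF lin] linear_map_add[OF lin] linear_map_smult[OF lin] del: W.M.finsum_insert)
qed

lemma vec_zero_closed: "vec K V \<Longrightarrow> \<zero>\<^bsub>V\<^esub> \<in> carrier V"
  by (rule abelian_monoid.zero_closed[OF abelian_group.axioms(1)[OF vec_abelian]])

context coalgebra
begin

abbreviation "Pw n \<equiv> comodule_power K C n"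

lemma power_vec: "vec K (module_power C n)"
  by (rule vecI[OF field module_power_module[OF vector_space]])

lemma power_linear_iff: "linear_map K (Pw n) W f \<longleftrightarrow> linear_map K (module_power C n) W f"
    "linear_map K V (Pw n) g \<longleftrightarrow> linear_map K V (module_power C n) g"
  by (simp_all add: linear_map_def comodule_power_sel del: module_power_sel)

lemma power_term_linear: "i < n \<Longrightarrow> linear_map K (module_power C n) (tensor_product K C (module_power C n))
    (\<lambda>x. tensor_map K C C C (module_power C n) (\<lambda>c. c) (power_incl C n i) (comult C (x i)))"
  by (rule linear_map_compose[OF linear_map_compose[OF module_power_proj_linear comult_linear]
        tensor_map_linear[OF vec_C vec_C vec_C power_vec linear_map_id power_incl_linear[OF vector_space]]])

lemma power_tensor: "tensor_product K V (Pw n) = tensor_product K V (module_power C n)"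
  by (rule tensor_right_cong) (simp_all only: comodule_power_sel)

lemma power_contract: "contract K V (Pw n) f = contract K V (module_power C n) f"
  unfolding contract_def comodule_power_sel(4)
  by (rule tensor_lift_cong) (simp_all only: comodule_power_sel)

lemma power_data: "comodule_data K C (Pw n)"
proof (rule comodule_data.intro[OF coalgebra_axioms comodule_data_axioms.intro])
  show "module K (Pw n)"
    by (rule module_transfer[OF module_power_module[OF vector_space, of n]]) (simp_all only: comodule_power_sel)
  show "linear_map K (Pw n) (tensor_product K C (Pw n)) (coact (Pw n))"
    unfolding power_linear_iff power_tensor comodule_power_sel(5)
    by (rule linear_map_finsum[OF power_vec vec_tensor[OF vec_C power_vec]]) (simp_all add: power_term_linear)
qed

lemma finsum_power_apply:
  assumes g: "g \<in> A \<rightarrow> carrier (module_power C n)" and A: "finite A" and j: "j < n"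
  shows "finsum (module_power C n) g A j = finsum C (\<lambda>i. g i j) A"
  using j
  by (intro finsum_hom[OF vec_abelian[OF power_vec] vec_abelian[OF vec_C] A g, where h = "\<lambda>x. x j"])
    (auto simp: PiE_iff)

lemma finsum_power_incl:
  assumes y: "y \<in> {..<n} \<rightarrow> carrier C"
  shows "finsum (module_power C n) (\<lambda>i. power_incl C n i (y i)) {..<n} = restrict y {..<n}"
proof (rule PiE_ext)
  interpret P: module K "module_power C n" by (rule module_power_module[OF vector_space])
  have g: "(\<lambda>i. power_incl C n i (y i)) \<in> {..<n} \<rightarrow> carrier (module_power C n)"
    using linear_map_closed[OF power_incl_linear[OF vector_space]] y by (auto simp del: module_power_sel)
  show "finsum (module_power C n) (\<lambda>i. power_incl C n i (y i)) {..<n} \<in> (\<Pi>\<^sub>E i\<in>{..<n}. carrier C)"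
    using P.M.finsum_closed[OF g] by simp
  show "restrict y {..<n} \<in> (\<Pi>\<^sub>E i\<in>{..<n}. carrier C)" using y by auto
  fix j assume "j \<in> {..<n}"
  then have j: "j < n" by simp
  have "finsum (module_power C n) (\<lambda>i. power_incl C n i (y i)) {..<n} j =
     finsum C (\<lambda>i. power_incl C n i (y i) j) {..<n}"
    by (rule finsum_power_apply[OF g _ j]) simp
  also have "\<dots> = finsum C (\<lambda>i. if j = i then y i else \<zero>\<^bsub>C\<^esub>) {..<n}"
    by (rule abelian_monoid.finsum_cong'[OF abelian_group.axioms(1)[OF vec_abelian[OF vec_C]] refl]) (use y j vec_zero_closed[OF vec_C] in \<open>auto simp: power_incl_def\<close>)
  also have "\<dots> = y j" by (rule abelian_monoid.finsum_singleton[OF abelian_group.axioms(1)[OF vec_abelian[OF vec_C]]]) (use y j in auto)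
  finally show "finsum (module_power C n) (\<lambda>i. power_incl C n i (y i)) {..<n} j = restrict y {..<n} j"
    using j by simp
qed

text \<open>Contraction turns the i-th summand of the coaction into the i-th inclusion of x_i f.
  Hence the comodule axioms for the power reduce to those of the regular comodule in each
  component.\<close>

lemma power_ract:
  assumes x: "x \<in> carrier (module_power C n)" and f: "f \<in> dual_space K C"
  shows "ract K C (Pw n) x f = (\<lambda>i\<in>{..<n}. cact K C (x i) f)"
proof -
  interpret CP: two_vecs K C "module_power C n" by (rule two_vecsI[OF vec_C power_vec])
  let ?t = "\<lambda>i. tensor_map K C C C (module_power C n) (\<lambda>c. c) (power_incl C n i) (comult C (x i))"
  have t: "?t \<in> {..<n} \<rightarrow> carrier (tensor_product K C (module_power C n))"
    using linear_map_closed[OF power_term_linear x] by simp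
  have xi: "x i \<in> carrier C" if "i < n" for i using linear_map_closed[OF module_power_proj_linear[OF that] x] .
  note lin = CP.contract_linear[OF f]
  have "ract K C (Pw n) x f = finsum (module_power C n) (\<lambda>i. contract K C (module_power C n) f (?t i)) {..<n}"
    unfolding ract_def power_contract comodule_power_sel(5)
    by (rule finsum_hom[OF CP.tensor_abelian_group vec_abelian[OF power_vec] _ t])
      (rule finite_lessThan linear_map_closed[OF lin] linear_map_add[OF lin], assumption?)+
  also have "\<dots> = finsum (module_power C n) (\<lambda>i. power_incl C n i (cact K C (x i) f)) {..<n}"
  proof (rule abelian_monoid.finsum_cong'[OF abelian_group.axioms(1)[OF vec_abelian[OF power_vec]] refl])
    show "(\<lambda>i. power_incl C n i (cact K C (x i) f)) \<in> {..<n} \<rightarrow> carrier (module_power C n)"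
      using linear_map_closed[OF power_incl_linear[OF vector_space]] cact_closed[OF f xi]
      by (auto simp del: module_power_sel)
    fix i assume "i \<in> {..<n}"
    then have i: "i < n" by simp
    show "contract K C (module_power C n) f (?t i) = power_incl C n i (cact K C (x i) f)"
      using contract_tensor_map_id[OF vec_C vec_C power_vec power_incl_linear[OF vector_space i] f
          linear_map_closed[OF comult_linear xi[OF i]]] by (simp add: cact_def)
  qed
  also have "\<dots> = (\<lambda>i\<in>{..<n}. cact K C (x i) f)"
    by (rule finsum_power_incl) (use cact_closed[OF f xi] in auto)
  finally show ?thesis .
qed

lemma power_left_comodule: "left_comodule K C (Pw n)"
  unfolding comodule_data.left_comodule_iff[OF power_data] comodule_power_sel
proof (intro conjI ballI)
  have one: "\<one>\<^bsub>R\<^esub> \<in> dual_space K C" using counit_dual by simp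
  fix x assume x: "x \<in> carrier (module_power C n)"
  have xi: "x i \<in> carrier C" if "i < n" for i using linear_map_closed[OF module_power_proj_linear[OF that] x] .
  show "ract K C (Pw n) x \<one>\<^bsub>R\<^esub> = x"
    unfolding power_ract[OF x one]
  proof (rule PiE_ext)
    show "x \<in> (\<Pi>\<^sub>E i\<in>{..<n}. carrier C)" using x by simp
  qed (use cact_one[OF xi] xi in simp_all)
  fix f g assume f: "f \<in> dual_space K C" and g: "g \<in> dual_space K C"
  have y: "(\<lambda>i\<in>{..<n}. cact K C (x i) f) \<in> carrier (module_power C n)" using cact_closed[OF f xi] by simp
  show "ract K C (Pw n) (ract K C (Pw n) x f) g = ract K C (Pw n) x (f \<otimes>\<^bsub>R\<^esub> g)"
    unfolding power_ract[OF x f] power_ract[OF y g] power_ract[OF x dual_mult_closed[OF f g]]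
    by (rule restrict_ext) (simp add: cact_cact[OF xi f g])
qed

lemma power_comod: "comod K C (Pw n)"
  by (rule comod.intro[OF coalgebra_axioms power_left_comodule])

end

section \<open>Embeddings into powers of the coalgebra and generators of the dual\<close>

context comod
begin

lemma comodule_mapI:
  assumes "comod K C N" "linear_map K M N f"
    "\<And>m g. m \<in> carrier M \<Longrightarrow> g \<in> dual_space K C \<Longrightarrow> f (ract K C M m g) = ract K C N (f m) g"
  shows "comodule_map K C M N f"
proof -
  interpret N: comod K C N by fact
  show ?thesis
    using comodule_map_iff[OF comodule_data_axioms N.comodule_data_axioms, of f] assms(2,3) by simp
qed

lemma comodule_mapD:
  assumes "comod K C N" "comodule_map K C M N f"
  shows "linear_map K M N f"
    "\<And>m g. m \<in> carrier M \<Longrightarrow> g \<in> dual_space K C \<Longrightarrow> f (ract K C M m g) = ract K C N (f m) g"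
proof -
  interpret N: comod K C N by fact
  show "linear_map K M N f"
    "\<And>m g. m \<in> carrier M \<Longrightarrow> g \<in> dual_space K C \<Longrightarrow> f (ract K C M m g) = ract K C N (f m) g"
    using comodule_map_iff[OF comodule_data_axioms N.comodule_data_axioms, of f] assms(2) by simp_all
qed

lemma power_map:
  assumes "comodule_map K C M (Pw n) j"
  shows "m \<in> carrier M \<Longrightarrow> j m \<in> carrier (module_power C n)"
    and "i < n \<Longrightarrow> linear_map K M C (\<lambda>m. j m i)"
    and "m \<in> carrier M \<Longrightarrow> i < n \<Longrightarrow> j m i \<in> carrier C"
    and "m \<in> carrier M \<Longrightarrow> g \<in> dual_space K C \<Longrightarrow> i < n \<Longrightarrow> j (ract K C M m g) i = cact K C (j m i) g"
proof -
  note j = comodule_mapD[OF power_comod assms]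
  note lin = j(1)[unfolded power_linear_iff]
  show jm: "m \<in> carrier M \<Longrightarrow> j m \<in> carrier (module_power C n)" for m
    by (rule linear_map_closed[OF lin])
  show l: "i < n \<Longrightarrow> linear_map K M C (\<lambda>m. j m i)" for i
    by (rule linear_map_compose[OF lin module_power_proj_linear])
  show "m \<in> carrier M \<Longrightarrow> i < n \<Longrightarrow> j m i \<in> carrier C" by (rule linear_map_closed[OF l])
  assume "m \<in> carrier M" "g \<in> dual_space K C" "i < n"
  then show "j (ract K C M m g) i = cact K C (j m i) g"
    using j(2)[of m g] power_ract[OF jm, of m g] by simp
qed

text \<open>Composition with the counit turns the i-th component of a comodule map into C^n into a
  functional; \<open>coord_ract\<close> recovers the component from it.\<close>

definition coord where
  "coord j i = (\<lambda>m\<in>carrier M. counit C (j m i))"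

lemma coord_dual:
  assumes "comodule_map K C M (Pw n) j" "i < n"
  shows "coord j i \<in> dual_space K M"
  unfolding coord_def
  by (rule CM.WW.dual_restrict[OF linear_map_compose[OF power_map(2)[OF assms] counit_linear]])

lemma coord_ract:
  assumes j: "comodule_map K C M (Pw n) j" and i: "i < n" and m: "m \<in> carrier M" and f: "f \<in> dual_space K C"
  shows "coord j i (ract K C M m f) = f (j m i)"
  using ract_closed[OF f m] power_map(4)[OF j m f i] counit_cact[OF f power_map(3)[OF j m i]]
  by (simp add: coord_def)

text \<open>A point of the annihilator satisfies f((j m)_i) = 0 for every functional
  \<open>f\<close>, hence j m = 0, and injectivity finishes.\<close>

lemma annih_coord:
  assumes j: "comodule_map K C M (Pw n) j" and inj: "inj_on j (carrier M)"
  shows "annih K C M (coord j ` {..<n}) = {\<zero>\<^bsub>M\<^esub>}"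
proof (intro equalityI subsetI)
  fix m assume m: "m \<in> annih K C M (coord j ` {..<n})"
  note mM = annihD(1)[OF m]
  have "j m i = \<zero>\<^bsub>C\<^esub>" if i: "i < n" for i
  proof (rule vec.dual_separates[OF vec_C power_map(3)[OF j mM i]])
    show "\<zero>\<^bsub>C\<^esub> \<in> carrier C" by (rule vec_zero_closed[OF vec_C])
    fix f assume f: "f \<in> dual_space K C"
    show "f (j m i) = f \<zero>\<^bsub>C\<^esub>"
      using annihD(2)[OF m _ f, of "coord j i"] coord_ract[OF j i mM f] i vec.dual_zero[OF vec_C f] by simp
  qed
  moreover have "j \<zero>\<^bsub>M\<^esub> i = \<zero>\<^bsub>C\<^esub>" if i: "i < n" for i
    by (rule linear_map_zero[OF vec_abelian[OF vec_M] vec_abelian[OF vec_C] power_map(2)[OF j i]])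
  ultimately have "j m = j \<zero>\<^bsub>M\<^esub>"
    using power_map(1)[OF j mM] power_map(1)[OF j M_zero] by (intro PiE_ext[of _ "{..<n}" "\<lambda>_. carrier C"]) simp_all
  then show "m \<in> {\<zero>\<^bsub>M\<^esub>}" using inj_onD[OF inj _ mM M_zero] by simp
next
  fix m assume "m \<in> {\<zero>\<^bsub>M\<^esub>}"
  moreover have "coord j ` {..<n} \<subseteq> dual_space K M" using coord_dual[OF j] by auto
  then have "submodule (annih K C M (coord j ` {..<n})) K M"
    using annih_subcomodule by (simp add: subcomodule_iff)
  ultimately show "m \<in> annih K C M (coord j ` {..<n})" using submoduleD(2) by auto
qed

text \<open>The coordinates have trivial annihilator, so by closedness their span contains every
  functional.\<close>

lemma gspan_coord:
  assumes j: "comodule_map K C M (Pw n) j" and inj: "inj_on j (carrier M)"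
  shows "gspan R MD (coord j) n = dual_space K M"
proof -
  interpret D: left_module R MD by (rule dual_left_module)
  have c: "coord j \<in> {..<n} \<rightarrow> dual_space K M" using coord_dual[OF j] by auto
  show ?thesis
  proof (intro equalityI subsetI)
    fix \<psi> assume \<psi>: "\<psi> \<in> dual_space K M"
    show "\<psi> \<in> gspan R MD (coord j) n"
      by (rule gspan_closed[OF c \<psi>]) (simp add: annih_coord[OF j inj] CM.WW.dual_zero[OF \<psi>])
  qed (use submoduleD(1)[OF D.gspan_submodule[of "coord j" n]] c in simp)
qed

text \<open>For injectivity, each functional is a sum of a_i \<phi>_i, and its value at m is the sum
  of the values of a_i at the i-th coefficient of m. Points with the same coefficients are therefore
  not separated by any functional.\<close>

lemma fin_gen_embedding:
  assumes \<phi>: "\<phi> \<in> {..<n} \<rightarrow> dual_space K M" and gen: "gspan R MD \<phi> n = dual_space K M"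
  shows "comodule_map K C M (Pw n) (\<lambda>m. \<lambda>i\<in>{..<n}. coef K C M (\<phi> i) m) \<and>
    inj_on (\<lambda>m. \<lambda>i\<in>{..<n}. coef K C M (\<phi> i) m) (carrier M)" (is "comodule_map K C M (Pw n) ?j \<and> _")
proof
  have \<phi>i: "\<phi> i \<in> dual_space K M" if "i < n" for i using \<phi> that by auto
  have lin: "linear_map K M (Pw n) ?j"
    unfolding power_linear_iff
  proof (rule linear_mapI)
    fix m assume "m \<in> carrier M"
    then show "?j m \<in> carrier (module_power C n)" using coef_closed[OF \<phi>i] by simp
  next
    fix m m' assume "m \<in> carrier M" "m' \<in> carrier M"
    then show "?j (m \<oplus>\<^bsub>M\<^esub> m') = ?j m \<oplus>\<^bsub>module_power C n\<^esub> ?j m'"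
      by (simp add: linear_map_add[OF coef_linear[OF \<phi>i]] cong: restrict_cong)
  next
    fix a m assume "a \<in> carrier K" "m \<in> carrier M"
    then show "?j (a \<odot>\<^bsub>M\<^esub> m) = a \<odot>\<^bsub>module_power C n\<^esub> ?j m"
      by (simp add: linear_map_smult[OF coef_linear[OF \<phi>i]] cong: restrict_cong)
  qed
  show "comodule_map K C M (Pw n) ?j"
  proof (rule comodule_mapI[OF power_comod lin])
    fix m g assume m: "m \<in> carrier M" and g: "g \<in> dual_space K C"
    have "?j m \<in> carrier (module_power C n)" using coef_closed[OF \<phi>i m] by simp
    then show "?j (ract K C M m g) = ract K C (Pw n) (?j m) g"
      by (simp add: power_ract[OF _ g] coef_ract[OF \<phi>i g m] cong: restrict_cong)
  qed
  show "inj_on ?j (carrier M)"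
  proof (rule inj_onI)
    fix m m' assume m: "m \<in> carrier M" "m' \<in> carrier M" and eq: "?j m = ?j m'"
    show "m = m'"
    proof (rule CM.WW.dual_separates[OF m])
      fix \<psi> assume "\<psi> \<in> dual_space K M"
      then obtain a where a: "a \<in> {..<n} \<rightarrow> dual_space K C" "\<psi> = msum MD a \<phi> n"
        unfolding gen[symmetric] gspan_def by auto
      have "\<phi> i (ract K C M m (a i)) = \<phi> i (ract K C M m' (a i))" if i: "i < n" for i
      proof -
        have ai: "a i \<in> dual_space K C" using a(1) i by auto
        have "coef K C M (\<phi> i) m = coef K C M (\<phi> i) m'" using fun_cong[OF eq, of i] i by simp
        then show ?thesis using coef_apply[OF \<phi>i[OF i] ai m(1)] coef_apply[OF \<phi>i[OF i] ai m(2)] by simp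
      qed
      moreover have "(\<lambda>i. \<phi> i (ract K C M m' (a i))) \<in> {..<n} \<rightarrow> carrier K"
        using CM.WW.dual_closed[OF \<phi>i ract_closed[OF _ m(2)]] a(1) by auto
      ultimately have "finsum K (\<lambda>i. \<phi> i (ract K C M m (a i))) {..<n} = finsum K (\<lambda>i. \<phi> i (ract K C M m' (a i))) {..<n}"
        by (intro abelian_monoid.finsum_cong'[OF abelian_group.axioms(1)[OF K_abelian] refl]) simp_all
      then show "\<psi> m = \<psi> m'"
        unfolding a(2) msum_dual_apply[OF a(1) \<phi> m(1)] msum_dual_apply[OF a(1) \<phi> m(2)] .
    qed
  qed
qed

lemma fin_cogen_iff_fin_gen: "fin_cogen_comodule K C M \<longleftrightarrow> fin_gen_module R MD"
proof
  interpret D: left_module R MD by (rule dual_left_module)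
  assume "fin_cogen_comodule K C M"
  then obtain n j where j: "comodule_map K C M (Pw n) j" "inj_on j (carrier M)"
    by (auto simp: fin_cogen_comodule_def)
  have "coord j \<in> {..<n} \<rightarrow> carrier MD" using coord_dual[OF j(1)] by auto
  then show "fin_gen_module R MD" unfolding D.fin_gen_iff using gspan_coord[OF j] by auto
next
  interpret D: left_module R MD by (rule dual_left_module)
  assume "fin_gen_module R MD"
  then obtain n \<phi> where \<phi>: "\<phi> \<in> {..<n} \<rightarrow> dual_space K M" "gspan R MD \<phi> n = dual_space K M"
    by (auto simp: D.fin_gen_iff)
  \<comment> \<open>Finite cogeneration asks for a positive exponent, so the family is padded with
    the zero functional; this covers the case n = 0.\<close>
  define \<phi>' where "\<phi>' = \<phi>(n := \<zero>\<^bsub>MD\<^esub>)"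
  have \<phi>': "\<phi>' \<in> {..<Suc n} \<rightarrow> dual_space K M"
    using \<phi>(1) D.M.zero_closed by (auto simp: \<phi>'_def less_Suc_eq)
  have s: "submodule (gspan R MD \<phi>' (Suc n)) R MD" by (rule D.gspan_submodule) (use \<phi>' in simp)
  have "gspan R MD \<phi> n \<subseteq> gspan R MD \<phi>' (Suc n)"
  proof (rule D.gspan_least[OF s])
    fix i assume "i < n"
    then show "\<phi> i \<in> gspan R MD \<phi>' (Suc n)"
      using D.gspan_mem[of \<phi>' "Suc n" i] \<phi>' by (simp add: \<phi>'_def del: dual_module_sel(2))
  qed (use \<phi>(1) in simp)
  then have "gspan R MD \<phi>' (Suc n) = dual_space K M" using \<phi>(2) submoduleD(1)[OF s] by auto
  from fin_gen_embedding[OF \<phi>' this] show "fin_cogen_comodule K C M"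
    unfolding fin_cogen_comodule_def by blast
qed

end

text \<open>The identity embeds the power into itself, so its coordinate functionals generate the
  dual.\<close>

lemma (in coalgebra) power_fin_gen: "fin_gen_module R (dual_module K C (Pw n))"
proof -
  interpret P: comod K C "Pw n" by (rule power_comod)
  interpret D: left_module R "dual_module K C (Pw n)" by (rule P.dual_left_module)
  have j: "comodule_map K C (Pw n) (Pw n) (\<lambda>x. x)"
    by (rule P.comodule_mapI[OF power_comod linear_map_id]) simp
  have "P.coord (\<lambda>x. x) \<in> {..<n} \<rightarrow> carrier (dual_module K C (Pw n))" using P.coord_dual[OF j] by auto
  then show ?thesis unfolding D.fin_gen_iff using P.gspan_coord[OF j] by auto
qed

section \<open>Transport of structure\<close>

lemma linear_map_source_cong:
  assumes "carrier V' = carrier V" "add V' = add V" "smult V' = smult V"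
  shows "linear_map K V' W f \<longleftrightarrow> linear_map K V W f"
  by (simp add: linear_map_def assms)

text \<open>Relocates a module to another carrier type along a function that is injective on its
  carrier, as the objects of one category must share a carrier type.\<close>

definition transport_module :: "('b \<Rightarrow> 'd) \<Rightarrow> ('r, 'b, 'y) module_scheme \<Rightarrow> ('r, 'd) module"
  where "transport_module k X =
    \<lparr>carrier = k ` carrier X, mult = undefined, one = undefined, ring.zero = k \<zero>\<^bsub>X\<^esub>,
     add = (\<lambda>x y. k (inv_into (carrier X) k x \<oplus>\<^bsub>X\<^esub> inv_into (carrier X) k y)),
     smult = (\<lambda>a x. k (a \<odot>\<^bsub>X\<^esub> inv_into (carrier X) k x))\<rparr>"

lemma transport_module_sel [simp]:
  "carrier (transport_module k X) = k ` carrier X"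
  "\<zero>\<^bsub>transport_module k X\<^esub> = k \<zero>\<^bsub>X\<^esub>"
  "x \<oplus>\<^bsub>transport_module k X\<^esub> y = k (inv_into (carrier X) k x \<oplus>\<^bsub>X\<^esub> inv_into (carrier X) k y)"
  "a \<odot>\<^bsub>transport_module k X\<^esub> x = k (a \<odot>\<^bsub>X\<^esub> inv_into (carrier X) k x)"
  by (simp_all add: transport_module_def)

lemma transport_left_module:
  assumes "left_module R X" "inj_on k (carrier X)"
  shows "left_module R (transport_module k X)"
proof -
  interpret X: left_module R X by fact
  note [simp] = inv_into_f_f[OF assms(2)]
  have "abelian_group (transport_module k X)"
  proof (rule abelian_groupI)
    fix y assume "y \<in> carrier (transport_module k X)"
    then obtain x where x: "x \<in> carrier X" "y = k x" by auto
    show "\<exists>z\<in>carrier (transport_module k X). z \<oplus>\<^bsub>transport_module k X\<^esub> y = \<zero>\<^bsub>transport_module k X\<^esub>"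
      by (rule bexI[of _ "k (\<ominus>\<^bsub>X\<^esub> x)"]) (simp_all add: x X.M.l_neg)
  qed (auto simp: X.M.a_ac)
  then show ?thesis
    by (rule left_module.intro[OF X.R.ring_axioms _ left_module_axioms.intro])
      (auto simp: X.smult_closed X.smult_l_distr X.smult_r_distr X.smult_assoc1 X.smult_one)
qed

lemma transport_linear:
  assumes "left_module R X" "inj_on k (carrier X)"
  shows "linear_map R X (transport_module k X) k"
    and "linear_map R (transport_module k X) X (inv_into (carrier X) k)"
proof -
  interpret X: left_module R X by fact
  note [simp] = inv_into_f_f[OF assms(2)]
  show "linear_map R X (transport_module k X) k" by (rule linear_mapI) simp_all
  show "linear_map R (transport_module k X) X (inv_into (carrier X) k)"
    by (rule linear_mapI) (auto simp: X.smult_closed)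
qed

lemma left_module_imp_module: "cring K \<Longrightarrow> left_module K V \<Longrightarrow> module K V"
  by (auto simp: module_def left_module_def module_axioms_def left_module_axioms_def)

text \<open>Realises a subcomodule as a comodule on a prescribed carrier type, provided its points
  can be coded there.\<close>

lemma (in comod) transport_subcomodule:
  fixes k :: "'m \<Rightarrow> 'd"
  assumes N: "subcomodule N K C M" and k: "inj_on k N"
  shows "\<exists>(M' :: ('k, 'c, 'd) comodule) j. left_comodule K C M' \<and> comodule_map K C M' M j \<and>
    inj_on j (carrier M') \<and> j ` carrier M' = N"
proof -
  have sub: "submodule N K M" and ra: "\<And>m f. m \<in> N \<Longrightarrow> f \<in> dual_space K C \<Longrightarrow> ract K C M m f \<in> N"
    using N by (simp_all add: subcomodule_iff)
  note NM = submoduleD(1)[OF sub]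
  let ?N = "M\<lparr>carrier := N\<rparr>"
  have mN: "module K ?N" by (rule submodule.submodule_is_module[OF sub M_module])
  have k': "inj_on k (carrier ?N)" using k by simp
  note lN = module_imp_left_module[OF mN]
  define M0 where "M0 = transport_module k ?N"
  have m0: "module K M0" unfolding M0_def
    by (rule left_module_imp_module[OF module.axioms(1)[OF M_module] transport_left_module[OF lN k']])
  note v0 = vecI[OF field m0]
  define j where "j = inv_into N k"
  have jl: "linear_map K M0 M j"
    using transport_linear(2)[OF lN k'] NM by (auto simp: linear_map_def j_def M0_def Pi_iff)
  obtain P where P: "linear_map K M M P" "\<forall>x\<in>carrier M. P x \<in> N" "\<forall>x\<in>N. P x = x"
    using vec.projection0[OF vec_M sub] by (elim exE conjE)
  have "linear_map K M ?N P" using P(1,2) by (auto simp: linear_map_def)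
  from linear_map_compose[OF this transport_linear(1)[OF lN k']]
  have pl: "linear_map K M M0 (\<lambda>x. k (P x))" unfolding M0_def .
  \<comment> \<open>The coaction restricted to \<open>N\<close> takes values in C \<otimes> M.
    Composing it with \<open>id \<otimes> k P\<close>, for a projection \<open>P\<close> onto
    \<open>N\<close>, brings it to the new carrier without choosing preimages in C \<otimes>
    N.\<close>
  define M' :: "('k, 'c, 'd) comodule" where
    "M' = module.extend M0 \<lparr>coact = (\<lambda>x. tensor_map K C M C M0 (\<lambda>c. c) (\<lambda>x. k (P x)) (coact M (j x)))\<rparr>"
  have sel: "carrier M' = carrier M0" "add M' = add M0" "ring.zero M' = ring.zero M0" "smult M' = smult M0"
    "coact M' = (\<lambda>x. tensor_map K C M C M0 (\<lambda>c. c) (\<lambda>x. k (P x)) (coact M (j x)))"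
    by (simp_all add: M'_def module.defs)
  have T: "tensor_product K C M' = tensor_product K C M0"
    by (rule tensor_right_cong) (simp_all only: sel)
  have ct: "contract K C M' f = contract K C M0 f" for f
    unfolding contract_def sel(4) by (rule tensor_lift_cong) (simp_all only: sel)
  have data: "comodule_data K C M'"
  proof (rule comodule_data.intro[OF coalgebra_axioms comodule_data_axioms.intro])
    show "module K M'" by (rule module_transfer[OF m0]) (simp_all only: sel)
    have "linear_map K M0 (tensor_product K C M0) (coact M')" unfolding sel
      by (rule linear_map_compose[OF linear_map_compose[OF jl M_coact]
            tensor_map_linear[OF vec_C vec_M vec_C v0 linear_map_id pl]])
    then show "linear_map K M' (tensor_product K C M') (coact M')"
      unfolding T linear_map_source_cong[OF sel(1,2,4)] .
  qed
  have c0: "carrier M0 = k ` N" by (simp add: M0_def)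
  have jN: "j x \<in> N" "k (j x) = x" if "x \<in> carrier M0" for x
    using that by (simp_all add: c0 j_def inv_into_into f_inv_into_f)
  have jk: "j (k n) = n" if "n \<in> N" for n using that k by (simp add: j_def)
  \<comment> \<open>The action keeps \<open>N\<close> stable and \<open>P\<close> is the identity
    there, so the new action is the old one carried along the mutually inverse maps \<open>k\<close>
    and \<open>j\<close>.\<close>
  have r: "ract K C M' x f = k (ract K C M (j x) f)" if x: "x \<in> carrier M0" and f: "f \<in> dual_space K C" for x f
  proof -
    note c = linear_map_closed[OF M_coact NM[OF jN(1)[OF x]]]
    have "ract K C M' x f = k (P (ract K C M (j x) f))"
      unfolding ract_def ct sel(5) by (rule contract_tensor_map_id[OF vec_C vec_M v0 pl f c])
    then show ?thesis using P(3) ra[OF jN(1)[OF x] f] by simp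
  qed
  have rc: "ract K C M' x f \<in> carrier M0" if "x \<in> carrier M0" "f \<in> dual_space K C" for x f
    using r[OF that] ra[OF jN(1)[OF that(1)] that(2)] by (simp add: c0)
  have "left_comodule K C M'"
    unfolding comodule_data.left_comodule_iff[OF data] sel(1)
  proof (intro conjI ballI)
    have one: "\<one>\<^bsub>R\<^esub> \<in> dual_space K C" using counit_dual by simp
    fix x assume x: "x \<in> carrier M0"
    show "ract K C M' x \<one>\<^bsub>R\<^esub> = x"
      using r[OF x one] ract_one[OF NM[OF jN(1)[OF x]]] jN(2)[OF x] by simp
    fix f g assume f: "f \<in> dual_space K C" and g: "g \<in> dual_space K C"
    show "ract K C M' (ract K C M' x f) g = ract K C M' x (f \<otimes>\<^bsub>R\<^esub> g)"
      using r[OF rc[OF x f] g] r[OF x f] r[OF x dual_mult_closed[OF f g]] jk[OF ra[OF jN(1)[OF x] f]]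
        ract_ract[OF NM[OF jN(1)[OF x]] f g] by simp
  qed
  moreover have "comodule_map K C M' M j"
  proof (rule comod.comodule_mapI[OF comod.intro[OF coalgebra_axioms calculation] comod_axioms])
    show "linear_map K M' M j" unfolding linear_map_source_cong[OF sel(1,2,4)] by (rule jl)
    fix m g assume "m \<in> carrier M'" "g \<in> dual_space K C"
    then have m: "m \<in> carrier M0" and g: "g \<in> dual_space K C" by (simp_all only: sel(1))
    show "j (ract K C M' m g) = ract K C M (j m) g"
      using r[OF m g] jk[OF ra[OF jN(1)[OF m] g]] by simp
  qed
  moreover have "inj_on j (carrier M')"
    by (rule inj_on_inverseI[of _ k]) (simp add: sel(1) jN)
  moreover have "j ` carrier M' = N"
  proof (intro equalityI subsetI)
    fix n assume n: "n \<in> N"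
    show "n \<in> j ` carrier M'" by (rule image_eqI[of _ _ "k n"]) (simp_all add: jk n sel(1) c0)
  qed (use jN in \<open>auto simp: sel(1)\<close>)
  ultimately show ?thesis by blast
qed

section \<open>The duality on morphisms and objects\<close>

context left_module
begin

lemma msum_add:
  assumes "a \<in> {..<n} \<rightarrow> carrier R" "b \<in> {..<n} \<rightarrow> carrier R" "x \<in> {..<n} \<rightarrow> carrier M"
    and c: "\<And>i. i < n \<Longrightarrow> c i = a i \<oplus> b i"
  shows "msum M c x n = msum M a x n \<oplus>\<^bsub>M\<^esub> msum M b x n"
proof -
  note t = msum_terms[OF assms(1,3)] msum_terms[OF assms(2,3)]
  have "msum M c x n = finsum M (\<lambda>i. a i \<odot>\<^bsub>M\<^esub> x i \<oplus>\<^bsub>M\<^esub> b i \<odot>\<^bsub>M\<^esub> x i) {..<n}"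
    unfolding msum_def
  proof (rule M.finsum_cong'[OF refl])
    show "(\<lambda>i. a i \<odot>\<^bsub>M\<^esub> x i \<oplus>\<^bsub>M\<^esub> b i \<odot>\<^bsub>M\<^esub> x i) \<in> {..<n} \<rightarrow> carrier M" using t by auto
    fix i assume "i \<in> {..<n}"
    then have "a i \<in> carrier R" "b i \<in> carrier R" "x i \<in> carrier M" "c i = a i \<oplus> b i" using assms by auto
    then show "c i \<odot>\<^bsub>M\<^esub> x i = a i \<odot>\<^bsub>M\<^esub> x i \<oplus>\<^bsub>M\<^esub> b i \<odot>\<^bsub>M\<^esub> x i" by (simp add: smult_l_distr)
  qed
  also have "\<dots> = msum M a x n \<oplus>\<^bsub>M\<^esub> msum M b x n"
    unfolding msum_def by (rule M.finsum_addf[OF t])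
  finally show ?thesis .
qed

lemma msum_smult:
  assumes "a \<in> {..<n} \<rightarrow> carrier R" "x \<in> {..<n} \<rightarrow> carrier M" "b \<in> carrier R"
    and c: "\<And>i. i < n \<Longrightarrow> c i = b \<otimes> a i"
  shows "msum M c x n = b \<odot>\<^bsub>M\<^esub> msum M a x n"
proof -
  note t = msum_terms[OF assms(1,2)]
  have "b \<odot>\<^bsub>M\<^esub> msum M a x n = finsum M (\<lambda>i. b \<odot>\<^bsub>M\<^esub> (a i \<odot>\<^bsub>M\<^esub> x i)) {..<n}"
    unfolding msum_def
    by (rule finsum_hom[OF M.abelian_group_axioms M.abelian_group_axioms _ t])
      (simp_all add: assms(3) smult_closed smult_r_distr)
  also have "\<dots> = msum M c x n"
    unfolding msum_def
  proof (rule M.finsum_cong'[OF refl])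
    have ci: "c i \<in> carrier R" "x i \<in> carrier M" if "i < n" for i using assms that by auto
    then show "(\<lambda>i. c i \<odot>\<^bsub>M\<^esub> x i) \<in> {..<n} \<rightarrow> carrier M" by (simp add: smult_closed)
    fix i assume i: "i \<in> {..<n}"
    then have "a i \<in> carrier R" "x i \<in> carrier M" "c i = b \<otimes> a i" using assms by auto
    then show "b \<odot>\<^bsub>M\<^esub> (a i \<odot>\<^bsub>M\<^esub> x i) = c i \<odot>\<^bsub>M\<^esub> x i" by (simp add: smult_assoc1 assms(3))
  qed
  finally show ?thesis by simp
qed

lemma kernel_submodule:
  assumes "left_module R Y" "linear_map R M Y h"
  shows "submodule {x \<in> carrier M. h x = \<zero>\<^bsub>Y\<^esub>} R M"
proof -
  interpret Y: left_module R Y by fact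
  show ?thesis unfolding submodule_iff
  proof (intro conjI ballI)
    show "\<zero>\<^bsub>M\<^esub> \<in> {x \<in> carrier M. h x = \<zero>\<^bsub>Y\<^esub>}"
      using linear_map_zero[OF M.abelian_group_axioms Y.M.abelian_group_axioms assms(2)] by simp
  next
    fix x y assume "x \<in> {x \<in> carrier M. h x = \<zero>\<^bsub>Y\<^esub>}" "y \<in> {x \<in> carrier M. h x = \<zero>\<^bsub>Y\<^esub>}"
    then show "x \<oplus>\<^bsub>M\<^esub> y \<in> {x \<in> carrier M. h x = \<zero>\<^bsub>Y\<^esub>}"
      using linear_map_add[OF assms(2), of x y] by simp
  next
    fix a x assume "a \<in> carrier R" "x \<in> {x \<in> carrier M. h x = \<zero>\<^bsub>Y\<^esub>}"
    then show "a \<odot>\<^bsub>M\<^esub> x \<in> {x \<in> carrier M. h x = \<zero>\<^bsub>Y\<^esub>}"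
      using linear_map_smult[OF assms(2), of a x] by (simp add: smult_closed Y.smult_r_null)
  qed auto
qed

end

lemma left_module_diff_eq_zero:
  assumes "left_module R Y" "left_module R W" "linear_map R Y W h" "y \<in> carrier Y" "y' \<in> carrier Y"
  shows "h (y \<oplus>\<^bsub>Y\<^esub> \<ominus>\<^bsub>Y\<^esub> y') = \<zero>\<^bsub>W\<^esub> \<longleftrightarrow> h y = h y'"
proof -
  interpret Y: left_module R Y by fact
  interpret W: left_module R W by fact
  note c = linear_map_closed[OF assms(3,4)] linear_map_closed[OF assms(3,5)]
  have eq: "h (y \<oplus>\<^bsub>Y\<^esub> \<ominus>\<^bsub>Y\<^esub> y') = h y \<oplus>\<^bsub>W\<^esub> \<ominus>\<^bsub>W\<^esub> h y'"
    using linear_map_add[OF assms(3,4) Y.M.a_inv_closed[OF assms(5)]]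
      linear_map_minus[OF Y.M.abelian_group_axioms W.M.abelian_group_axioms assms(3,5)] by simp
  show ?thesis unfolding eq
  proof
    assume "h y \<oplus>\<^bsub>W\<^esub> \<ominus>\<^bsub>W\<^esub> h y' = \<zero>\<^bsub>W\<^esub>"
    then show "h y = h y'" by (rule W.M.eq_if_diff_zero[OF c])
  next
    assume "h y = h y'"
    then show "h y \<oplus>\<^bsub>W\<^esub> \<ominus>\<^bsub>W\<^esub> h y' = \<zero>\<^bsub>W\<^esub>" using W.M.r_neg[OF c(2)] by simp
  qed
qed

text \<open>Plays the role of the first isomorphism theorem: two images of one module with a common
  kernel are identified by choosing preimages, and the quotient itself is never formed.\<close>

lemma surjections_same_kernel:
  assumes "left_module R Y" "left_module R X" "left_module R Z"
    and p: "linear_map R Y X p" "p ` carrier Y = carrier X"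
    and q: "linear_map R Y Z q" "q ` carrier Y = carrier Z"
    and ker: "\<And>y. y \<in> carrier Y \<Longrightarrow> p y = \<zero>\<^bsub>X\<^esub> \<longleftrightarrow> q y = \<zero>\<^bsub>Z\<^esub>"
  shows "\<exists>\<alpha>. linear_map R X Z \<alpha> \<and> bij_betw \<alpha> (carrier X) (carrier Z)"
proof -
  interpret Y: left_module R Y by fact
  interpret X: left_module R X by fact
  interpret Z: left_module R Z by fact
  have pq: "p y = p y' \<longleftrightarrow> q y = q y'" if "y \<in> carrier Y" "y' \<in> carrier Y" for y y'
  proof -
    have "y \<oplus>\<^bsub>Y\<^esub> \<ominus>\<^bsub>Y\<^esub> y' \<in> carrier Y" using that by simp
    from ker[OF this] show ?thesis
      unfolding left_module_diff_eq_zero[OF assms(1,2) p(1) that] left_module_diff_eq_zero[OF assms(1,3) q(1) that] .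
  qed
  define s where "s x = inv_into (carrier Y) p x" for x
  have s: "s x \<in> carrier Y" "p (s x) = x" if "x \<in> carrier X" for x
    using that inv_into_into[of x p "carrier Y"] f_inv_into_f[of x p "carrier Y"] p(2) by (simp_all add: s_def)
  define \<alpha> where "\<alpha> x = q (s x)" for x
  have \<alpha>p: "\<alpha> x = q y" if "y \<in> carrier Y" "p y = x" "x \<in> carrier X" for x y
    unfolding \<alpha>_def using pq[OF s(1)[OF that(3)] that(1)] s(2)[OF that(3)] that(2) by simp
  have "linear_map R X Z \<alpha>"
  proof (rule linear_mapI)
    fix x assume "x \<in> carrier X" then show "\<alpha> x \<in> carrier Z"
      unfolding \<alpha>_def by (rule linear_map_closed[OF q(1) s(1)])
  next
    fix x y assume xy: "x \<in> carrier X" "y \<in> carrier X"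
    have "\<alpha> (x \<oplus>\<^bsub>X\<^esub> y) = q (s x \<oplus>\<^bsub>Y\<^esub> s y)"
      by (rule \<alpha>p) (simp_all add: s xy linear_map_add[OF p(1) s(1)[OF xy(1)] s(1)[OF xy(2)]])
    then show "\<alpha> (x \<oplus>\<^bsub>X\<^esub> y) = \<alpha> x \<oplus>\<^bsub>Z\<^esub> \<alpha> y"
      by (simp add: \<alpha>_def linear_map_add[OF q(1) s(1)[OF xy(1)] s(1)[OF xy(2)]])
  next
    fix a x assume a: "a \<in> carrier R" and x: "x \<in> carrier X"
    have "\<alpha> (a \<odot>\<^bsub>X\<^esub> x) = q (a \<odot>\<^bsub>Y\<^esub> s x)"
      by (rule \<alpha>p) (simp_all add: s x a linear_map_smult[OF p(1) a s(1)[OF x]] X.smult_closed Y.smult_closed)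
    then show "\<alpha> (a \<odot>\<^bsub>X\<^esub> x) = a \<odot>\<^bsub>Z\<^esub> \<alpha> x"
      by (simp add: \<alpha>_def linear_map_smult[OF q(1) a s(1)[OF x]])
  qed
  moreover have "bij_betw \<alpha> (carrier X) (carrier Z)"
    unfolding bij_betw_def
  proof (intro conjI inj_onI equalityI subsetI)
    fix x y assume xy: "x \<in> carrier X" "y \<in> carrier X" and "\<alpha> x = \<alpha> y"
    then have "p (s x) = p (s y)" unfolding \<alpha>_def using pq[OF s(1)[OF xy(1)] s(1)[OF xy(2)]] by simp
    then show "x = y" using s(2) xy by simp
  next
    fix z assume "z \<in> \<alpha> ` carrier X"
    then show "z \<in> carrier Z" using linear_map_closed[OF q(1) s(1)] by (auto simp: \<alpha>_def)
  next
    fix z assume "z \<in> carrier Z"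
    then obtain y where y: "y \<in> carrier Y" "z = q y" using q(2) by blast
    show "z \<in> \<alpha> ` carrier X"
      by (rule image_eqI[of _ _ "p y"])
        (use \<alpha>p[OF y(1) refl linear_map_closed[OF p(1) y(1)]] linear_map_closed[OF p(1) y(1)] y(2) in simp_all)
  qed
  ultimately show ?thesis by blast
qed

section \<open>Fullness and essential surjectivity of the dual\<close>

context coalgebra
begin

text \<open>A point of C^n is the sum of the inclusions of its entries, so a functional on C^n is
  determined by its restrictions to the n factors.\<close>

lemma power_functional:
  assumes \<chi>: "\<chi> \<in> dual_space K (module_power C n)"
  shows "i < n \<Longrightarrow> (\<lambda>c\<in>carrier C. \<chi> (power_incl C n i c)) \<in> dual_space K C"
    and "z \<in> carrier (module_power C n) \<Longrightarrow>
      \<chi> z = finsum K (\<lambda>i. (\<lambda>c\<in>carrier C. \<chi> (power_incl C n i c)) (z i)) {..<n}"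
proof -
  show "i < n \<Longrightarrow> (\<lambda>c\<in>carrier C. \<chi> (power_incl C n i c)) \<in> dual_space K C"
    by (rule dual_compose[OF vec_C power_vec power_incl_linear[OF vector_space] \<chi>])
  interpret P: vec K "module_power C n" by (rule power_vec)
  assume z: "z \<in> carrier (module_power C n)"
  have zi: "z i \<in> carrier C" if "i < n" for i using linear_map_closed[OF module_power_proj_linear[OF that] z] .
  have g: "(\<lambda>i. power_incl C n i (z i)) \<in> {..<n} \<rightarrow> carrier (module_power C n)"
    using linear_map_closed[OF power_incl_linear[OF vector_space] zi] by (simp del: module_power_sel)
  have "restrict z {..<n} = z" using z by (simp add: PiE_restrict)
  then have "\<chi> z = \<chi> (finsum (module_power C n) (\<lambda>i. power_incl C n i (z i)) {..<n})"
    using finsum_power_incl[of z n] zi by simp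
  also have "\<dots> = finsum K (\<lambda>i. \<chi> (power_incl C n i (z i))) {..<n}"
    by (rule finsum_hom[OF vec_abelian[OF power_vec] RC.K_abelian _ g])
      (rule finite_lessThan P.dual_closed[OF \<chi>] P.dual_add[OF \<chi>], assumption?)+
  also have "\<dots> = finsum K (\<lambda>i. (\<lambda>c\<in>carrier C. \<chi> (power_incl C n i c)) (z i)) {..<n}"
  proof (rule abelian_monoid.finsum_cong'[OF abelian_group.axioms(1)[OF RC.K_abelian] refl])
    show "(\<lambda>i. (\<lambda>c\<in>carrier C. \<chi> (power_incl C n i c)) (z i)) \<in> {..<n} \<rightarrow> carrier K"
      using P.dual_closed[OF \<chi> linear_map_closed[OF power_incl_linear[OF vector_space] zi]] zi by simp
  qed (use zi in simp)
  finally show "\<chi> z = finsum K (\<lambda>i. (\<lambda>c\<in>carrier C. \<chi> (power_incl C n i c)) (z i)) {..<n}" .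
qed

text \<open>Equivariance of \<open>f\<close> for the right actions dualises to linearity over the
  dual algebra.\<close>

lemma transpose_linear:
  assumes M: "comod K C M" and N: "comod K C N" and f: "comodule_map K C M N f"
  shows "linear_map R (dual_module K C N) (dual_module K C M) (\<lambda>\<phi>. \<lambda>m\<in>carrier M. \<phi> (f m))"
proof -
  interpret M: comod K C M by (rule M)
  interpret N: comod K C N by (rule N)
  note fD = M.comodule_mapD[OF N f]
  have fc: "f m \<in> carrier N" if "m \<in> carrier M" for m by (rule linear_map_closed[OF fD(1) that])
  show ?thesis
  proof (rule linear_mapI)
    fix y assume "y \<in> carrier (dual_module K C N)"
    then show "(\<lambda>m\<in>carrier M. y (f m)) \<in> carrier (dual_module K C M)"
      using dual_compose[OF M.vec_M N.vec_M fD(1)] by simp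
  next
    fix y z assume "y \<in> carrier (dual_module K C N)" "z \<in> carrier (dual_module K C N)"
    show "(\<lambda>m\<in>carrier M. (y \<oplus>\<^bsub>dual_module K C N\<^esub> z) (f m)) =
      (\<lambda>m\<in>carrier M. y (f m)) \<oplus>\<^bsub>dual_module K C M\<^esub> (\<lambda>m\<in>carrier M. z (f m))"
      unfolding dual_module_sel by (rule restrict_ext) (simp add: fc)
  next
    fix g y assume "g \<in> carrier R" "y \<in> carrier (dual_module K C N)"
    then have g: "g \<in> dual_space K C" by simp
    show "(\<lambda>m\<in>carrier M. (g \<odot>\<^bsub>dual_module K C N\<^esub> y) (f m)) =
      g \<odot>\<^bsub>dual_module K C M\<^esub> (\<lambda>m\<in>carrier M. y (f m))"
      unfolding dual_module_sel by (rule restrict_ext) (simp add: fc fD(2)[OF _ g] M.ract_closed[OF g])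
  qed
qed

lemma dual_full:
  assumes M: "comod K C M" and N: "comod K C N"
    and fg: "fin_gen_module R (dual_module K C N)"
    and \<Phi>: "linear_map R (dual_module K C N) (dual_module K C M) \<Phi>"
  shows "\<exists>h. comodule_map K C M N h \<and> (\<forall>\<psi>\<in>dual_space K N. \<forall>m\<in>carrier M. \<Phi> \<psi> m = \<psi> (h m))"
proof -
  interpret M: comod K C M by (rule M)
  interpret N: comod K C N by (rule N)
  interpret DM: left_module R "dual_module K C M" by (rule M.dual_left_module)
  interpret DN: left_module R "dual_module K C N" by (rule N.dual_left_module)
  interpret P: vec K "module_power C n" for n by (rule power_vec)
  obtain n j where j: "comodule_map K C N (Pw n) j" "inj_on j (carrier N)"
    using fg unfolding N.fin_cogen_iff_fin_gen[symmetric] fin_cogen_comodule_def by blast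
  define \<phi> where "\<phi> = N.coord j"
  have \<phi>: "\<phi> \<in> {..<n} \<rightarrow> dual_space K N" using N.coord_dual[OF j(1)] by (auto simp: \<phi>_def)
  have gen: "gspan R (dual_module K C N) \<phi> n = dual_space K N" unfolding \<phi>_def by (rule N.gspan_coord[OF j])
  define \<mu> where "\<mu> i = \<Phi> (\<phi> i)" for i
  have \<mu>i: "\<mu> i \<in> dual_space K M" if "i < n" for i
    using linear_map_closed[OF \<Phi>, of "\<phi> i"] \<phi> that by (auto simp: \<mu>_def)
  then have \<mu>: "\<mu> \<in> {..<n} \<rightarrow> dual_space K M" by auto
  \<comment> \<open>The point of C^n whose coordinates are forced: if \<open>h\<close> exists and
    \<open>y m\<close> is its image under \<open>j\<close>, then every functional \<open>a\<close>
    must take at the i-th entry the value of a \<mu>_i at \<open>m\<close>.\<close>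
  define y where "y m = (\<lambda>i\<in>{..<n}. coef K C M (\<mu> i) m)" for m
  have yc: "y m \<in> carrier (module_power C n)" if "m \<in> carrier M" for m
    using M.coef_closed[OF \<mu>i that] by (simp add: y_def)
  have evN: "msum (dual_module K C N) a \<phi> n x = finsum K (\<lambda>i. a i (j x i)) {..<n}"
    if a: "a \<in> {..<n} \<rightarrow> dual_space K C" and x: "x \<in> carrier N" for a x
    unfolding N.msum_dual_apply[OF a \<phi> x]
  proof (rule abelian_monoid.finsum_cong'[OF abelian_group.axioms(1)[OF RC.K_abelian] refl])
    have ai: "a i \<in> dual_space K C" if "i < n" for i using a that by auto
    show "(\<lambda>i. a i (j x i)) \<in> {..<n} \<rightarrow> carrier K"
      using vec.dual_closed[OF vec_C ai N.power_map(3)[OF j(1) x]] by simp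
    fix i assume "i \<in> {..<n}"
    then show "\<phi> i (ract K C N x (a i)) = a i (j x i)"
      using N.coord_ract[OF j(1) _ x ai] by (simp add: \<phi>_def)
  qed
  have evM: "\<Phi> (msum (dual_module K C N) a \<phi> n) m = finsum K (\<lambda>i. a i (y m i)) {..<n}"
    if a: "a \<in> {..<n} \<rightarrow> dual_space K C" and m: "m \<in> carrier M" for a m
  proof -
    have ai: "a i \<in> dual_space K C" if "i < n" for i using a that by auto
    have "\<Phi> (msum (dual_module K C N) a \<phi> n) = msum (dual_module K C M) a \<mu> n"
      unfolding \<mu>_def
      by (rule linear_map_msum[OF DN.left_module_axioms DM.left_module_axioms \<Phi>]) (use a \<phi> in simp_all)
    moreover have "msum (dual_module K C M) a \<mu> n m = finsum K (\<lambda>i. a i (y m i)) {..<n}"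
      unfolding M.msum_dual_apply[OF a \<mu> m]
    proof (rule abelian_monoid.finsum_cong'[OF abelian_group.axioms(1)[OF RC.K_abelian] refl])
      show "(\<lambda>i. a i (y m i)) \<in> {..<n} \<rightarrow> carrier K"
        using vec.dual_closed[OF vec_C ai M.coef_closed[OF \<mu>i m]] by (simp add: y_def)
      fix i assume "i \<in> {..<n}"
      then show "\<mu> i (ract K C M m (a i)) = a i (y m i)"
        using M.coef_apply[OF \<mu>i ai m] by (simp add: y_def)
    qed
    ultimately show ?thesis by simp
  qed
  have jN: "submodule (j ` carrier N) K (module_power C n)"
    by (rule linear_image_submodule[OF N.M_module vec_module[OF power_vec] module.carrier_is_submodule[OF N.M_module]])
      (use N.comodule_mapD(1)[OF power_comod j(1)] in \<open>simp only: power_linear_iff\<close>)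
  \<comment> \<open>A functional on C^n that vanishes on the image of \<open>N\<close> has
    components a_i for which the sum of the a_i \<phi>_i is zero. Applying \<Phi> shows that it also
    vanishes at \<open>y m\<close>, so no functional separates \<open>y m\<close> from the
    image.\<close>
  have yj: "y m \<in> j ` carrier N" if m: "m \<in> carrier M" for m
  proof (rule ccontr)
    assume "y m \<notin> j ` carrier N"
    from P.separation[OF jN yc[OF m] this]
    obtain \<chi> where \<chi>: "\<chi> \<in> dual_space K (module_power C n)" "\<forall>z\<in>j ` carrier N. \<chi> z = \<zero>\<^bsub>K\<^esub>" "\<chi> (y m) = \<one>\<^bsub>K\<^esub>"
      by blast
    define a where "a i = (\<lambda>c\<in>carrier C. \<chi> (power_incl C n i c))" for i
    have a: "a \<in> {..<n} \<rightarrow> dual_space K C" using power_functional(1)[OF \<chi>(1)] by (simp add: a_def)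
    note \<chi>a = power_functional(2)[OF \<chi>(1), folded a_def]
    have "msum (dual_module K C N) a \<phi> n = \<zero>\<^bsub>dual_module K C N\<^esub>"
    proof (rule dual_space_ext[where K = K and V = N])
      show "msum (dual_module K C N) a \<phi> n \<in> dual_space K N" using DN.msum_closed[of a n \<phi>] a \<phi> by simp
      show "\<zero>\<^bsub>dual_module K C N\<^esub> \<in> dual_space K N" using DN.M.zero_closed by simp
      fix x assume x: "x \<in> carrier N"
      show "msum (dual_module K C N) a \<phi> n x = \<zero>\<^bsub>dual_module K C N\<^esub> x"
        using evN[OF a x] \<chi>a[OF N.power_map(1)[OF j(1) x]] \<chi>(2) x by simp
    qed
    then have "\<Phi> (msum (dual_module K C N) a \<phi> n) = \<zero>\<^bsub>dual_module K C M\<^esub>"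
      using linear_map_zero[OF DN.M.abelian_group_axioms DM.M.abelian_group_axioms \<Phi>] by (simp del: dual_module_sel)
    then have "\<chi> (y m) = \<zero>\<^bsub>K\<^esub>" using evM[OF a m] \<chi>a[OF yc[OF m]] m by simp
    then show False using \<chi>(3) RC.CM.VV.one_not_zero by simp
  qed
  define h where "h m = inv_into (carrier N) j (y m)" for m
  have h: "h m \<in> carrier N" "j (h m) = y m" if "m \<in> carrier M" for m
    using inv_into_into[OF yj[OF that]] f_inv_into_f[OF yj[OF that]] by (simp_all add: h_def)
  \<comment> \<open>This identity determines \<open>h\<close> pointwise; linearity and equivariance
    of \<open>h\<close> are inherited from \<Phi> by testing against all \<psi>.\<close>
  have key: "\<Phi> \<psi> m = \<psi> (h m)" if \<psi>: "\<psi> \<in> dual_space K N" and m: "m \<in> carrier M" for \<psi> m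
  proof -
    obtain a where a: "a \<in> {..<n} \<rightarrow> dual_space K C" "\<psi> = msum (dual_module K C N) a \<phi> n"
      using \<psi> unfolding gen[symmetric] gspan_def by auto
    show ?thesis unfolding a(2) evM[OF a(1) m] evN[OF a(1) h(1)[OF m]] h(2)[OF m] ..
  qed
  have \<Phi>c: "\<Phi> \<psi> \<in> dual_space K M" if "\<psi> \<in> dual_space K N" for \<psi>
    using linear_map_closed[OF \<Phi>, of \<psi>] that by simp
  have "linear_map K M N h"
  proof (rule linear_mapI)
    fix m m' assume m: "m \<in> carrier M" "m' \<in> carrier M"
    show "h (m \<oplus>\<^bsub>M\<^esub> m') = h m \<oplus>\<^bsub>N\<^esub> h m'"
    proof (rule N.CM.WW.dual_separates[OF h(1)[OF M.M_add[OF m]] N.M_add[OF h(1)[OF m(1)] h(1)[OF m(2)]]])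
      fix \<psi> assume \<psi>: "\<psi> \<in> dual_space K N"
      show "\<psi> (h (m \<oplus>\<^bsub>M\<^esub> m')) = \<psi> (h m \<oplus>\<^bsub>N\<^esub> h m')"
        using key[OF \<psi> M.M_add[OF m]] key[OF \<psi> m(1)] key[OF \<psi> m(2)]
          M.CM.WW.dual_add[OF \<Phi>c[OF \<psi>] m] N.CM.WW.dual_add[OF \<psi> h(1)[OF m(1)] h(1)[OF m(2)]] by simp
    qed
  next
    fix a m assume a: "a \<in> carrier K" and m: "m \<in> carrier M"
    show "h (a \<odot>\<^bsub>M\<^esub> m) = a \<odot>\<^bsub>N\<^esub> h m"
    proof (rule N.CM.WW.dual_separates[OF h(1)[OF M.M_smult[OF a m]] N.M_smult[OF a h(1)[OF m]]])
      fix \<psi> assume \<psi>: "\<psi> \<in> dual_space K N"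
      show "\<psi> (h (a \<odot>\<^bsub>M\<^esub> m)) = \<psi> (a \<odot>\<^bsub>N\<^esub> h m)"
        using key[OF \<psi> M.M_smult[OF a m]] key[OF \<psi> m]
          M.CM.WW.dual_smult[OF \<Phi>c[OF \<psi>] a m] N.CM.WW.dual_smult[OF \<psi> a h(1)[OF m]] by simp
    qed
  qed (rule h(1))
  then have "comodule_map K C M N h"
  proof (rule M.comodule_mapI[OF N])
    fix m g assume m: "m \<in> carrier M" and g: "g \<in> dual_space K C"
    show "h (ract K C M m g) = ract K C N (h m) g"
    proof (rule N.CM.WW.dual_separates[OF h(1)[OF M.ract_closed[OF g m]] N.ract_closed[OF g h(1)[OF m]]])
      fix \<psi> assume \<psi>: "\<psi> \<in> dual_space K N"
      have "\<psi> (h (ract K C M m g)) = (g \<odot>\<^bsub>dual_module K C M\<^esub> \<Phi> \<psi>) m"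
        using key[OF \<psi> M.ract_closed[OF g m]] m by simp
      also have "g \<odot>\<^bsub>dual_module K C M\<^esub> \<Phi> \<psi> = \<Phi> (g \<odot>\<^bsub>dual_module K C N\<^esub> \<psi>)"
        using linear_map_smult[OF \<Phi>, of g \<psi>] g \<psi> by (simp del: dual_module_sel(4))
      also have "\<Phi> (g \<odot>\<^bsub>dual_module K C N\<^esub> \<psi>) m = \<psi> (ract K C N (h m) g)"
        using key[OF N.dual_smult_closed[OF g \<psi>] m] h(1)[OF m] by simp
      finally show "\<psi> (h (ract K C M m g)) = \<psi> (ract K C N (h m) g)" .
    qed
  qed
  then show ?thesis using key by blast
qed

lemma power_incl_ract:
  assumes i: "i < n" and c: "c \<in> carrier C" and f: "f \<in> dual_space K C"
  shows "ract K C (Pw n) (power_incl C n i c) f = power_incl C n i (cact K C c f)"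
proof -
  have x: "power_incl C n i c \<in> carrier (module_power C n)"
    by (rule linear_map_closed[OF power_incl_linear[OF vector_space i] c])
  have "cact K C \<zero>\<^bsub>C\<^esub> f = \<zero>\<^bsub>C\<^esub>" using RC.ract_lin(3)[OF f] by (simp add: ract_regular)
  then show ?thesis unfolding power_ract[OF x f] by (auto simp: power_incl_def)
qed

text \<open>Generators of \<open>X\<close> present it as an image of the dual of C^n with kernel
  \<open>L\<close>; restriction to the annihilator \<open>A\<close> of \<open>L\<close> presents the
  dual of \<open>A\<close> as an image of the same module. Closedness of \<open>L\<close> makes the
  two kernels equal.\<close>

lemma dual_essentially_surjective:
  fixes \<kappa> :: "'c list \<Rightarrow> 'd"
  assumes art: "left_artinian_coalgebra K C" and \<kappa>: "inj_on \<kappa> (lists (carrier C))"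
    and X: "left_module R X" and fg: "fin_gen_module R X"
  shows "\<exists>M :: ('k, 'c, 'd) comodule. left_comodule K C M \<and>
    (\<exists>\<alpha>. linear_map R X (dual_module K C M) \<alpha> \<and> bij_betw \<alpha> (carrier X) (dual_space K M))"
proof -
  interpret X: left_module R X by (rule X)
  obtain n x where x: "x \<in> {..<n} \<rightarrow> carrier X" and gen: "gspan R X x n = carrier X"
    using fg by (auto simp: X.fin_gen_iff)
  interpret P: comod K C "Pw n" by (rule power_comod)
  let ?Y = "dual_module K C (Pw n)"
  interpret Y: left_module R ?Y by (rule P.dual_left_module)
  have noeth: "left_noetherian_ring R" using art left_artinian_iff_left_noetherian by simp
  \<comment> \<open>The power is Artinian because its dual is finitely generated over a left
    Noetherian ring; this is what makes \<open>L\<close> closed below.\<close>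
  have Part: "artinian_comodule K C (Pw n)"
    unfolding P.artinian_iff_noetherian by (rule Y.fin_gen_imp_noetherian[OF noeth power_fin_gen])
  have dP: "dual_space K (Pw n) = dual_space K (module_power C n)"
    by (simp only: dual_space_def linear_map_def comodule_power_sel)
  \<comment> \<open>The i-th component of a functional on C^n; these identify the dual of C^n with n
    copies of the dual algebra.\<close>
  define comp where "comp y i = (\<lambda>c\<in>carrier C. y (power_incl C n i c))" for y :: "(nat \<Rightarrow> 'c) \<Rightarrow> 'k" and i
  have comp: "comp y \<in> {..<n} \<rightarrow> dual_space K C" if "y \<in> dual_space K (Pw n)" for y
    using power_functional(1)[of y n] that by (simp add: comp_def dP)
  have ic: "power_incl C n i c \<in> carrier (Pw n)" if "i < n" "c \<in> carrier C" for i c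
    unfolding comodule_power_sel by (rule linear_map_closed[OF power_incl_linear[OF vector_space that(1)] that(2)])
  define \<pi> where "\<pi> y = msum X (comp y) x n" for y
  have \<pi>lin: "linear_map R ?Y X \<pi>"
  proof (rule linear_mapI)
    fix y assume "y \<in> carrier ?Y"
    then show "\<pi> y \<in> carrier X" unfolding \<pi>_def using comp[of y] x by (intro X.msum_closed) simp_all
  next
    fix y z assume "y \<in> carrier ?Y" "z \<in> carrier ?Y"
    then have yz: "y \<in> dual_space K (Pw n)" "z \<in> dual_space K (Pw n)" by simp_all
    show "\<pi> (y \<oplus>\<^bsub>?Y\<^esub> z) = \<pi> y \<oplus>\<^bsub>X\<^esub> \<pi> z"
      unfolding \<pi>_def
    proof (rule X.msum_add)
      fix i assume i: "i < n"
      show "comp (y \<oplus>\<^bsub>?Y\<^esub> z) i = comp y i \<oplus>\<^bsub>R\<^esub> comp z i"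
        unfolding comp_def dual_algebra_sel by (rule restrict_ext) (use ic[OF i] in simp)
    qed (use comp yz x in simp_all)
  next
    fix f y assume "f \<in> carrier R" "y \<in> carrier ?Y"
    then have f: "f \<in> dual_space K C" and y: "y \<in> dual_space K (Pw n)" by simp_all
    show "\<pi> (f \<odot>\<^bsub>?Y\<^esub> y) = f \<odot>\<^bsub>X\<^esub> \<pi> y"
      unfolding \<pi>_def
    proof (rule X.msum_smult)
      fix i assume i: "i < n"
      have ci: "comp y i \<in> dual_space K C" using comp[OF y] i by auto
      have cf: "comp (f \<odot>\<^bsub>?Y\<^esub> y) i \<in> dual_space K C" using comp[OF P.dual_smult_closed[OF f y]] i by auto
      show "comp (f \<odot>\<^bsub>?Y\<^esub> y) i = f \<otimes>\<^bsub>R\<^esub> comp y i"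
      proof (rule dual_space_ext[OF cf dual_mult_closed[OF f ci]])
        fix c assume c: "c \<in> carrier C"
        show "comp (f \<odot>\<^bsub>?Y\<^esub> y) i c = (f \<otimes>\<^bsub>R\<^esub> comp y i) c"
          using dual_mult_apply[OF f ci c] cact_closed[OF f c] power_incl_ract[OF i c f] ic[OF i c] c
          by (simp add: comp_def)
      qed
    qed (use comp[OF y] x f in simp_all)
  qed
  have \<pi>surj: "\<pi> ` carrier ?Y = carrier X"
  proof (intro equalityI subsetI)
    fix z assume "z \<in> carrier X"
    then obtain a where a: "a \<in> {..<n} \<rightarrow> dual_space K C" "z = msum X a x n"
      unfolding gen[symmetric] gspan_def by auto
    have ai: "a i \<in> dual_space K C" if "i < n" for i using a(1) that by auto
    define y where "y = (\<lambda>p\<in>carrier (module_power C n). finsum K (\<lambda>i. a i (p i)) {..<n})"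
    have "linear_map K (module_power C n) (self_module K) (\<lambda>p. finsum (self_module K) (\<lambda>i. a i (p i)) {..<n})"
      by (rule linear_map_finsum[OF power_vec vec_self[OF power_vec]])
        (use linear_map_compose[OF module_power_proj_linear vec.dual_linear[OF vec_C ai]] in simp_all)
    \<comment> \<open>Both sums read the same operations of \<open>K\<close>; this bridges
      \<open>K\<close> as a ring and \<open>K\<close> as a module over itself.\<close>
    moreover have "finsum (self_module K) g A = finsum K g A" for g and A :: "nat set"
      by (simp add: finsum_def finprod_def)
    ultimately have y: "y \<in> dual_space K (Pw n)"
      unfolding y_def dP using vec.dual_restrict[OF power_vec] by simp
    have "comp y i = a i" if i: "i < n" for i
    proof (rule dual_space_ext[where K = K and V = C])
      show "comp y i \<in> dual_space K C" using comp[OF y] i by auto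
      fix c assume c: "c \<in> carrier C"
      note z = vec.dual_closed[OF vec_C ai]
      have "comp y i c = finsum K (\<lambda>k. a k (power_incl C n i c k)) {..<n}"
        using c ic[OF i c] by (simp add: comp_def y_def comodule_power_sel del: module_power_sel)
      also have "\<dots> = finsum K (\<lambda>k. if i = k then a k c else \<zero>\<^bsub>K\<^esub>) {..<n}"
        by (rule abelian_monoid.finsum_cong'[OF abelian_group.axioms(1)[OF RC.K_abelian] refl])
          (use z c vec.dual_zero[OF vec_C ai] abelian_monoid.zero_closed[OF abelian_group.axioms(1)[OF RC.K_abelian]]
            in \<open>auto simp: power_incl_def\<close>)
      also have "\<dots> = a i c"
        by (rule abelian_monoid.finsum_singleton[OF abelian_group.axioms(1)[OF RC.K_abelian]]) (use i z c in auto)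
      finally show "comp y i c = a i c" .
    qed (rule ai[OF i])
    then have "\<pi> y = z" unfolding \<pi>_def a(2) by (intro X.msum_cong) (use comp[OF y] x in simp_all)
    then show "z \<in> \<pi> ` carrier ?Y" using y by (intro image_eqI[of _ _ y]) simp_all
  qed (use linear_map_closed[OF \<pi>lin] in auto)
  define L where "L = {y \<in> carrier ?Y. \<pi> y = \<zero>\<^bsub>X\<^esub>}"
  have L: "submodule L R ?Y" unfolding L_def by (rule Y.kernel_submodule[OF X \<pi>lin])
  define A where "A = annih K C (Pw n) L"
  have "L \<subseteq> dual_space K (Pw n)" by (auto simp: L_def)
  then have A: "subcomodule A K C (Pw n)" unfolding A_def by (rule P.annih_subcomodule)
  have AP: "a \<in> carrier (module_power C n)" if "a \<in> A" for a
    using P.annihD(1) that by (simp add: A_def comodule_power_sel(1) del: module_power_sel)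
  \<comment> \<open>A tuple is coded by the list of its \<open>n\<close> entries, which is where the
    injection \<kappa> on lists is used.\<close>
  define k where "k p = \<kappa> (map p [0..<n])" for p :: "nat \<Rightarrow> 'c"
  have k: "inj_on k A"
  proof (rule inj_onI)
    fix p q assume pq: "p \<in> A" "q \<in> A" and eq: "k p = k q"
    have pc: "p \<in> (\<Pi>\<^sub>E i\<in>{..<n}. carrier C)" "q \<in> (\<Pi>\<^sub>E i\<in>{..<n}. carrier C)" using AP pq by simp_all
    then have l: "map p [0..<n] \<in> lists (carrier C)" "map q [0..<n] \<in> lists (carrier C)"
      by (simp_all add: in_lists_conv_set PiE_iff)
    have "map p [0..<n] = map q [0..<n]" by (rule inj_onD[OF \<kappa> eq[unfolded k_def] l])
    then have "p i = q i" if "i < n" for i using that by simp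
    then show "p = q" by (intro PiE_ext[OF pc]) simp
  qed
  obtain M :: "('k, 'c, 'd) comodule" and j where M: "left_comodule K C M"
    and j: "comodule_map K C M (Pw n) j" "inj_on j (carrier M)" "j ` carrier M = A"
    using P.transport_subcomodule[OF A k] by blast
  interpret M: comod K C M by (rule comod.intro[OF coalgebra_axioms M])
  note jD = M.comodule_mapD[OF power_comod j(1)]
  define \<theta> where "\<theta> y = (\<lambda>m\<in>carrier M. y (j m))" for y :: "(nat \<Rightarrow> 'c) \<Rightarrow> 'k"
  have jc: "j m \<in> carrier (Pw n)" if "m \<in> carrier M" for m by (rule linear_map_closed[OF jD(1) that])
  have \<theta>c: "\<theta> y \<in> dual_space K M" if "y \<in> dual_space K (Pw n)" for y
    unfolding \<theta>_def by (rule dual_compose[OF M.vec_M P.vec_M jD(1) that])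
  have \<theta>lin: "linear_map R ?Y (dual_module K C M) \<theta>"
    unfolding \<theta>_def by (rule transpose_linear[OF M.comod_axioms power_comod j(1)])
  \<comment> \<open>Functionals extend from the embedded subcomodule to the power: since
    \<open>j\<close> is injective, the vanishing condition of \<open>functional_factor\<close> holds
    automatically.\<close>
  have \<theta>surj: "\<theta> ` carrier ?Y = carrier (dual_module K C M)"
  proof (intro equalityI subsetI)
    fix \<psi> assume "\<psi> \<in> carrier (dual_module K C M)"
    then have \<psi>: "\<psi> \<in> dual_space K M" by simp
    have "\<exists>y\<in>dual_space K (Pw n). \<forall>m\<in>carrier M. \<psi> m = y (j m)"
    proof (rule functional_factor[OF M.vec_M P.vec_M module.carrier_is_submodule[OF M.M_module] jD(1) \<psi>])
      fix m assume m: "m \<in> carrier M" and "j m = \<zero>\<^bsub>Pw n\<^esub>"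
      then have "j m = j \<zero>\<^bsub>M\<^esub>"
        using linear_map_zero[OF vec_abelian[OF M.vec_M] vec_abelian[OF P.vec_M] jD(1)] by simp
      then have "m = \<zero>\<^bsub>M\<^esub>" by (rule inj_onD[OF j(2) _ m M.M_zero])
      then show "\<psi> m = \<zero>\<^bsub>K\<^esub>" using M.CM.WW.dual_zero[OF \<psi>] by simp
    qed
    then obtain y where y: "y \<in> dual_space K (Pw n)" "\<forall>m\<in>carrier M. \<psi> m = y (j m)" by (elim bexE)
    have "\<psi> = \<theta> y" by (rule dual_space_ext[OF \<psi> \<theta>c[OF y(1)]]) (simp add: \<theta>_def y(2))
    then show "\<psi> \<in> \<theta> ` carrier ?Y" using y(1) by (intro image_eqI[of _ _ y]) simp_all
  qed (use linear_map_closed[OF \<theta>lin] in auto)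
  \<comment> \<open>By the double annihilator property \<open>y\<close> lies in \<open>L\<close> iff
    it vanishes on \<open>A\<close>, and \<open>A\<close> is the image of \<open>j\<close>.\<close>
  have "\<pi> y = \<zero>\<^bsub>X\<^esub> \<longleftrightarrow> \<theta> y = \<zero>\<^bsub>dual_module K C M\<^esub>" if y: "y \<in> carrier ?Y" for y
  proof -
    have "\<pi> y = \<zero>\<^bsub>X\<^esub> \<longleftrightarrow> y \<in> L" using y by (simp add: L_def)
    also have "\<dots> \<longleftrightarrow> (\<forall>a\<in>A. y a = \<zero>\<^bsub>K\<^esub>)"
      using P.artinian_double_annih[OF Part L] y unfolding A_def by auto
    also have "\<dots> \<longleftrightarrow> (\<forall>m\<in>carrier M. y (j m) = \<zero>\<^bsub>K\<^esub>)" unfolding j(3)[symmetric] by simp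
    also have "\<dots> \<longleftrightarrow> \<theta> y = \<zero>\<^bsub>dual_module K C M\<^esub>"
    proof
      assume "\<theta> y = \<zero>\<^bsub>dual_module K C M\<^esub>"
      then have e: "\<theta> y m = \<zero>\<^bsub>dual_module K C M\<^esub> m" for m by simp
      show "\<forall>m\<in>carrier M. y (j m) = \<zero>\<^bsub>K\<^esub>"
      proof
        fix m assume "m \<in> carrier M" then show "y (j m) = \<zero>\<^bsub>K\<^esub>" using e[of m] by (simp add: \<theta>_def)
      qed
    next
      assume "\<forall>m\<in>carrier M. y (j m) = \<zero>\<^bsub>K\<^esub>"
      then show "\<theta> y = \<zero>\<^bsub>dual_module K C M\<^esub>" unfolding \<theta>_def dual_module_sel by (intro restrict_ext) simp
    qed
    finally show ?thesis .
  qed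
  from surjections_same_kernel[OF Y.left_module_axioms X M.dual_left_module \<pi>lin \<pi>surj \<theta>lin \<theta>surj this]
  show ?thesis using M by auto
qed

end

section \<open>Equivalences from fully faithful, essentially surjective functors\<close>

lemma categoryD:
  assumes "category A"
  shows "x \<in> Ob A \<Longrightarrow> Idn A x \<in> Hom A x x"
    and "x \<in> Ob A \<Longrightarrow> y \<in> Ob A \<Longrightarrow> z \<in> Ob A \<Longrightarrow> f \<in> Hom A x y \<Longrightarrow> g \<in> Hom A y z \<Longrightarrow>
      Cmp A x y z g f \<in> Hom A x z"
    and "x \<in> Ob A \<Longrightarrow> y \<in> Ob A \<Longrightarrow> f \<in> Hom A x y \<Longrightarrow> Cmp A x x y f (Idn A x) = f"
    and "x \<in> Ob A \<Longrightarrow> y \<in> Ob A \<Longrightarrow> f \<in> Hom A x y \<Longrightarrow> Cmp A x y y (Idn A y) f = f"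
    and "w \<in> Ob A \<Longrightarrow> x \<in> Ob A \<Longrightarrow> y \<in> Ob A \<Longrightarrow> z \<in> Ob A \<Longrightarrow>
      f \<in> Hom A w x \<Longrightarrow> g \<in> Hom A x y \<Longrightarrow> h \<in> Hom A y z \<Longrightarrow>
      Cmp A w y z h (Cmp A w x y g f) = Cmp A w x z (Cmp A x y z h g) f"
  using assms unfolding category_def by simp_all

lemma functorD:
  assumes "is_functor A B F"
  shows "x \<in> Ob A \<Longrightarrow> on_ob F x \<in> Ob B"
    and "x \<in> Ob A \<Longrightarrow> on_ar F x x (Idn A x) = Idn B (on_ob F x)"
    and "x \<in> Ob A \<Longrightarrow> y \<in> Ob A \<Longrightarrow> f \<in> Hom A x y \<Longrightarrow> on_ar F x y f \<in> Hom B (on_ob F x) (on_ob F y)"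
    and "x \<in> Ob A \<Longrightarrow> y \<in> Ob A \<Longrightarrow> z \<in> Ob A \<Longrightarrow> f \<in> Hom A x y \<Longrightarrow> g \<in> Hom A y z \<Longrightarrow>
      on_ar F x z (Cmp A x y z g f) =
      Cmp B (on_ob F x) (on_ob F y) (on_ob F z) (on_ar F y z g) (on_ar F x y f)"
  using assms unfolding is_functor_def by simp_all

text \<open>The quasi-inverse \<open>F\<close> picks for each \<open>a\<close> an object whose image
  is isomorphic to \<open>a\<close>; on arrows it takes the preimage under \<open>G\<close> of the
  conjugate by these isomorphisms.\<close>

lemma equivalent_categoriesI:
  assumes A: "category A" and B: "category B" and G: "is_functor B A G"
    and ff: "\<And>x y. x \<in> Ob B \<Longrightarrow> y \<in> Ob B \<Longrightarrow>
      bij_betw (on_ar G x y) (Hom B x y) (Hom A (on_ob G x) (on_ob G y))"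
    and es: "\<And>a. a \<in> Ob A \<Longrightarrow> \<exists>b\<in>Ob B. \<exists>f. iso_arrow A a (on_ob G b) f"
  shows "equivalent_categories A B"
proof -
  note catA = categoryD[OF A] and catB = categoryD[OF B] and Gf = functorD[OF G]
  let ?g = "on_ob G"
  \<comment> \<open>The object, the isomorphism and its inverse are taken from one statement, since
    \<open>iso_arrow\<close> only asserts that an inverse exists.\<close>
  have "\<forall>a. \<exists>b f f'. a \<in> Ob A \<longrightarrow> b \<in> Ob B \<and> f \<in> Hom A a (?g b) \<and> f' \<in> Hom A (?g b) a \<and>
    Cmp A a (?g b) a f' f = Idn A a \<and> Cmp A (?g b) a (?g b) f f' = Idn A (?g b)"
    using es unfolding iso_arrow_def by blast
  then obtain Fo where "\<forall>a. \<exists>f f'. a \<in> Ob A \<longrightarrow> Fo a \<in> Ob B \<and> f \<in> Hom A a (?g (Fo a)) \<and> f' \<in> Hom A (?g (Fo a)) a \<and>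
    Cmp A a (?g (Fo a)) a f' f = Idn A a \<and> Cmp A (?g (Fo a)) a (?g (Fo a)) f f' = Idn A (?g (Fo a))"
    by (rule choice[THEN exE])
  then obtain \<eta> where "\<forall>a. \<exists>f'. a \<in> Ob A \<longrightarrow> Fo a \<in> Ob B \<and> \<eta> a \<in> Hom A a (?g (Fo a)) \<and> f' \<in> Hom A (?g (Fo a)) a \<and>
    Cmp A a (?g (Fo a)) a f' (\<eta> a) = Idn A a \<and> Cmp A (?g (Fo a)) a (?g (Fo a)) (\<eta> a) f' = Idn A (?g (Fo a))"
    by (rule choice[THEN exE])
  then obtain \<eta>' where ch: "\<forall>a. a \<in> Ob A \<longrightarrow> Fo a \<in> Ob B \<and> \<eta> a \<in> Hom A a (?g (Fo a)) \<and> \<eta>' a \<in> Hom A (?g (Fo a)) a \<and>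
    Cmp A a (?g (Fo a)) a (\<eta>' a) (\<eta> a) = Idn A a \<and> Cmp A (?g (Fo a)) a (?g (Fo a)) (\<eta> a) (\<eta>' a) = Idn A (?g (Fo a))"
    by (rule choice[THEN exE])
  have FoB: "Fo a \<in> Ob B" and gF: "?g (Fo a) \<in> Ob A"
    and \<eta>: "\<eta> a \<in> Hom A a (?g (Fo a))" and \<eta>': "\<eta>' a \<in> Hom A (?g (Fo a)) a"
    and \<eta>1: "Cmp A a (?g (Fo a)) a (\<eta>' a) (\<eta> a) = Idn A a"
    and \<eta>2: "Cmp A (?g (Fo a)) a (?g (Fo a)) (\<eta> a) (\<eta>' a) = Idn A (?g (Fo a))" if "a \<in> Ob A" for a
    using ch that Gf(1) by simp_all
  define ginv where "ginv x y = inv_into (Hom B x y) (on_ar G x y)" for x y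
  have invH: "ginv x y f \<in> Hom B x y" and Ginv: "on_ar G x y (ginv x y f) = f"
    if "x \<in> Ob B" "y \<in> Ob B" "f \<in> Hom A (?g x) (?g y)" for x y f
    using bij_betw_imp_surj_on[OF ff[OF that(1,2)]] that(3) inv_into_into[of f "on_ar G x y" "Hom B x y"]
      f_inv_into_f[of f "on_ar G x y" "Hom B x y"] by (simp_all add: ginv_def)
  have inj: "h = h'" if "x \<in> Ob B" "y \<in> Ob B" "h \<in> Hom B x y" "h' \<in> Hom B x y"
    "on_ar G x y h = on_ar G x y h'" for x y h h'
    by (rule inj_onD[OF bij_betw_imp_inj_on[OF ff[OF that(1,2)]] that(5,3,4)])
  \<comment> \<open>The arrow \<eta>_b f \<eta>_a^{-1}. Functoriality and naturality are proved for
    it before pulling back along \<open>G\<close>.\<close>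
  define conj where "conj a b f = Cmp A (?g (Fo a)) a (?g (Fo b)) (Cmp A a b (?g (Fo b)) (\<eta> b) f) (\<eta>' a)" for a b f
  have c1: "Cmp A a b (?g (Fo b)) (\<eta> b) f \<in> Hom A a (?g (Fo b))"
    if "a \<in> Ob A" "b \<in> Ob A" "f \<in> Hom A a b" for a b f
    by (rule catA(2)[OF that(1,2) gF[OF that(2)] that(3) \<eta>[OF that(2)]])
  have conjH: "conj a b f \<in> Hom A (?g (Fo a)) (?g (Fo b))" if "a \<in> Ob A" "b \<in> Ob A" "f \<in> Hom A a b" for a b f
    unfolding conj_def by (rule catA(2)[OF gF[OF that(1)] that(1) gF[OF that(2)] \<eta>'[OF that(1)] c1[OF that]])
  have conj_id: "conj a a (Idn A a) = Idn A (?g (Fo a))" if a: "a \<in> Ob A" for a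
    unfolding conj_def catA(3)[OF a gF[OF a] \<eta>[OF a]] by (rule \<eta>2[OF a])
  have conj_\<eta>: "Cmp A a (?g (Fo a)) (?g (Fo b)) (conj a b f) (\<eta> a) = Cmp A a b (?g (Fo b)) (\<eta> b) f"
    if a: "a \<in> Ob A" and b: "b \<in> Ob A" and f: "f \<in> Hom A a b" for a b f
    unfolding conj_def
      catA(5)[OF a gF[OF a] a gF[OF b] \<eta>[OF a] \<eta>'[OF a] c1[OF that], symmetric] \<eta>1[OF a]
    by (rule catA(3)[OF a gF[OF b] c1[OF that]])
  have conj_cmp: "conj a c (Cmp A a b c h f) = Cmp A (?g (Fo a)) (?g (Fo b)) (?g (Fo c)) (conj b c h) (conj a b f)"
    if a: "a \<in> Ob A" and b: "b \<in> Ob A" and c: "c \<in> Ob A" and f: "f \<in> Hom A a b" and h: "h \<in> Hom A b c" for a b c f h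
  proof -
    have "Cmp A (?g (Fo a)) (?g (Fo b)) (?g (Fo c)) (conj b c h) (conj a b f) =
      Cmp A (?g (Fo a)) a (?g (Fo c)) (Cmp A a (?g (Fo b)) (?g (Fo c)) (conj b c h) (Cmp A a b (?g (Fo b)) (\<eta> b) f)) (\<eta>' a)"
      unfolding conj_def[of a b]
      by (rule catA(5)[OF gF[OF a] a gF[OF b] gF[OF c] \<eta>'[OF a] c1[OF a b f] conjH[OF b c h]])
    also have "Cmp A a (?g (Fo b)) (?g (Fo c)) (conj b c h) (Cmp A a b (?g (Fo b)) (\<eta> b) f) =
      Cmp A a b (?g (Fo c)) (Cmp A b c (?g (Fo c)) (\<eta> c) h) f"
      unfolding catA(5)[OF a b gF[OF b] gF[OF c] f \<eta>[OF b] conjH[OF b c h]] conj_\<eta>[OF b c h] ..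
    also have "\<dots> = Cmp A a c (?g (Fo c)) (\<eta> c) (Cmp A a b c h f)"
      by (rule catA(5)[OF a b c gF[OF c] f h \<eta>[OF c], symmetric])
    finally show ?thesis unfolding conj_def[of a c] ..
  qed
  define F where "F = \<lparr>on_ob = Fo, on_ar = (\<lambda>a b f. ginv (Fo a) (Fo b) (conj a b f))\<rparr>"
  have GF: "on_ar G (Fo a) (Fo b) (on_ar F a b f) = conj a b f" and FH: "on_ar F a b f \<in> Hom B (Fo a) (Fo b)"
    if "a \<in> Ob A" "b \<in> Ob A" "f \<in> Hom A a b" for a b f
    using Ginv[OF FoB[OF that(1)] FoB[OF that(2)] conjH[OF that]] invH[OF FoB[OF that(1)] FoB[OF that(2)] conjH[OF that]]
    by (simp_all add: F_def)
  have Fob: "on_ob F = Fo" by (simp add: F_def)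
  have F: "is_functor A B F"
    unfolding is_functor_def Fob
  proof (intro conjI ballI)
    fix a assume a: "a \<in> Ob A"
    show "Fo a \<in> Ob B" by (rule FoB[OF a])
    show "on_ar F a a (Idn A a) = Idn B (Fo a)"
      by (rule inj[OF FoB[OF a] FoB[OF a] FH[OF a a catA(1)[OF a]] catB(1)[OF FoB[OF a]]])
        (simp add: GF[OF a a catA(1)[OF a]] conj_id[OF a] Gf(2)[OF FoB[OF a]])
    fix b f assume b: "b \<in> Ob A" and f: "f \<in> Hom A a b"
    show "on_ar F a b f \<in> Hom B (Fo a) (Fo b)" by (rule FH[OF a b f])
  next
    fix a b c f h assume a: "a \<in> Ob A" and b: "b \<in> Ob A" and c: "c \<in> Ob A"
      and f: "f \<in> Hom A a b" and h: "h \<in> Hom A b c"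
    note hf = catA(2)[OF a b c f h]
    show "on_ar F a c (Cmp A a b c h f) = Cmp B (Fo a) (Fo b) (Fo c) (on_ar F b c h) (on_ar F a b f)"
      by (rule inj[OF FoB[OF a] FoB[OF c] FH[OF a c hf]
            catB(2)[OF FoB[OF a] FoB[OF b] FoB[OF c] FH[OF a b f] FH[OF b c h]]])
        (simp add: GF[OF a c hf] conj_cmp[OF a b c f h] GF[OF a b f] GF[OF b c h]
          Gf(4)[OF FoB[OF a] FoB[OF b] FoB[OF c] FH[OF a b f] FH[OF b c h]])
  qed
  have \<eta>nat: "natural_iso A A id_functor (comp_functor G F) \<eta>"
    unfolding natural_iso_def id_functor_def comp_functor_def cat_functor.simps Fob
  proof (intro conjI ballI)
    fix a assume a: "a \<in> Ob A"
    show "iso_arrow A a (?g (Fo a)) (\<eta> a)"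
      unfolding iso_arrow_def using \<eta>[OF a] \<eta>'[OF a] \<eta>1[OF a] \<eta>2[OF a] by blast
    fix b f assume b: "b \<in> Ob A" and f: "f \<in> Hom A a b"
    show "Cmp A a b (?g (Fo b)) (\<eta> b) f =
      Cmp A a (?g (Fo a)) (?g (Fo b)) (on_ar G (Fo a) (Fo b) (on_ar F a b f)) (\<eta> a)"
      unfolding GF[OF a b f] by (rule conj_\<eta>[OF a b f, symmetric])
  qed
  \<comment> \<open>The preimage under \<open>G\<close> of the inverse of \<eta> at G b, as the
    triangle identity would force.\<close>
  define \<theta> where "\<theta> b = ginv (Fo (?g b)) b (\<eta>' (?g b))" for b
  have gb: "?g b \<in> Ob A" if "b \<in> Ob B" for b by (rule Gf(1)[OF that])
  have \<theta>H: "\<theta> b \<in> Hom B (Fo (?g b)) b" and G\<theta>: "on_ar G (Fo (?g b)) b (\<theta> b) = \<eta>' (?g b)" if b: "b \<in> Ob B" for b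
    unfolding \<theta>_def by (rule invH[OF FoB[OF gb[OF b]] b \<eta>'[OF gb[OF b]]], rule Ginv[OF FoB[OF gb[OF b]] b \<eta>'[OF gb[OF b]]])
  have \<theta>nat: "natural_iso B B (comp_functor F G) id_functor \<theta>"
    unfolding natural_iso_def id_functor_def comp_functor_def cat_functor.simps Fob
  proof (intro conjI ballI)
    fix b assume b: "b \<in> Ob B"
    note g = gb[OF b] and Fg = FoB[OF gb[OF b]]
    define \<theta>' where "\<theta>' = ginv b (Fo (?g b)) (\<eta> (?g b))"
    have \<theta>': "\<theta>' \<in> Hom B b (Fo (?g b))" "on_ar G b (Fo (?g b)) \<theta>' = \<eta> (?g b)"
      unfolding \<theta>'_def by (rule invH[OF b Fg \<eta>[OF g]], rule Ginv[OF b Fg \<eta>[OF g]])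
    have "Cmp B (Fo (?g b)) b (Fo (?g b)) \<theta>' (\<theta> b) = Idn B (Fo (?g b))"
      by (rule inj[OF Fg Fg catB(2)[OF Fg b Fg \<theta>H[OF b] \<theta>'(1)] catB(1)[OF Fg]])
        (simp add: Gf(4)[OF Fg b Fg \<theta>H[OF b] \<theta>'(1)] \<theta>'(2) G\<theta>[OF b] Gf(2)[OF Fg] \<eta>2[OF g])
    moreover have "Cmp B b (Fo (?g b)) b (\<theta> b) \<theta>' = Idn B b"
      by (rule inj[OF b b catB(2)[OF b Fg b \<theta>'(1) \<theta>H[OF b]] catB(1)[OF b]])
        (simp add: Gf(4)[OF b Fg b \<theta>'(1) \<theta>H[OF b]] \<theta>'(2) G\<theta>[OF b] Gf(2)[OF b] \<eta>1[OF g])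
    ultimately show "iso_arrow B (Fo (?g b)) b (\<theta> b)"
      unfolding iso_arrow_def using \<theta>H[OF b] \<theta>'(1) by blast
    fix c k assume c: "c \<in> Ob B" and k: "k \<in> Hom B b c"
    note gc = gb[OF c] and Fgc = FoB[OF gb[OF c]] and Gk = Gf(3)[OF b c k]
    have Fk: "on_ar F (?g b) (?g c) (on_ar G b c k) \<in> Hom B (Fo (?g b)) (Fo (?g c))" by (rule FH[OF g gc Gk])
    \<comment> \<open>Naturality is tested after applying the faithful \<open>G\<close>, where the
      conjugation cancels against the inverse of \<eta>.\<close>
    show "Cmp B (Fo (?g b)) (Fo (?g c)) c (\<theta> c) (on_ar F (?g b) (?g c) (on_ar G b c k)) =
      Cmp B (Fo (?g b)) b c k (\<theta> b)"
    proof (rule inj[OF Fg c catB(2)[OF Fg Fgc c Fk \<theta>H[OF c]] catB(2)[OF Fg b c \<theta>H[OF b] k]])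
      have "on_ar G (Fo (?g b)) c (Cmp B (Fo (?g b)) (Fo (?g c)) c (\<theta> c) (on_ar F (?g b) (?g c) (on_ar G b c k))) =
        Cmp A (?g (Fo (?g b))) (?g (Fo (?g c))) (?g c) (\<eta>' (?g c)) (conj (?g b) (?g c) (on_ar G b c k))"
        unfolding Gf(4)[OF Fg Fgc c Fk \<theta>H[OF c]] G\<theta>[OF c] GF[OF g gc Gk] ..
      also have "\<dots> = Cmp A (?g (Fo (?g b))) (?g b) (?g c)
        (Cmp A (?g b) (?g (Fo (?g c))) (?g c) (\<eta>' (?g c)) (Cmp A (?g b) (?g c) (?g (Fo (?g c))) (\<eta> (?g c)) (on_ar G b c k)))
        (\<eta>' (?g b))"
        unfolding conj_def by (rule catA(5)[OF gF[OF g] g gF[OF gc] gc \<eta>'[OF g] c1[OF g gc Gk] \<eta>'[OF gc]])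
      also have "Cmp A (?g b) (?g (Fo (?g c))) (?g c) (\<eta>' (?g c)) (Cmp A (?g b) (?g c) (?g (Fo (?g c))) (\<eta> (?g c)) (on_ar G b c k))
        = on_ar G b c k"
        unfolding catA(5)[OF g gc gF[OF gc] gc Gk \<eta>[OF gc] \<eta>'[OF gc]] \<eta>1[OF gc]
        by (rule catA(4)[OF g gc Gk])
      also have "Cmp A (?g (Fo (?g b))) (?g b) (?g c) (on_ar G b c k) (\<eta>' (?g b)) =
        on_ar G (Fo (?g b)) c (Cmp B (Fo (?g b)) b c k (\<theta> b))"
        unfolding Gf(4)[OF Fg b c \<theta>H[OF b] k] G\<theta>[OF b] ..
      finally show "on_ar G (Fo (?g b)) c (Cmp B (Fo (?g b)) (Fo (?g c)) c (\<theta> c) (on_ar F (?g b) (?g c) (on_ar G b c k))) =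
        on_ar G (Fo (?g b)) c (Cmp B (Fo (?g b)) b c k (\<theta> b))" .
    qed
  qed
  show ?thesis unfolding equivalent_categories_def using A B F G \<eta>nat \<theta>nat by blast
qed

section \<open>The categories of modules and of comodules\<close>

lemma op_cat_sel [simp]:
  "Ob (op_cat A) = Ob A" "Hom (op_cat A) x y = Hom A y x" "Idn (op_cat A) = Idn A"
  "Cmp (op_cat A) x y z g f = Cmp A z y x f g"
  by (simp_all add: op_cat_def)

lemma category_op_cat:
  assumes "category A"
  shows "category (op_cat A)"
  using categoryD[OF assms] unfolding category_def op_cat_sel by simp

lemma left_module_cat_sel [simp]:
  "Ob (left_module_cat R P) = {M. left_module R M \<and> P M}"
  "Hom (left_module_cat R P) M N = {f \<in> extensional (carrier M). linear_map R M N f}"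
  "Idn (left_module_cat R P) M = (\<lambda>x\<in>carrier M. x)"
  "Cmp (left_module_cat R P) L M N g f = compose (carrier L) g f"
  by (simp_all add: left_module_cat_def)

lemma left_comodule_cat_sel [simp]:
  "Ob (left_comodule_cat K C P) = {M. left_comodule K C M \<and> P M}"
  "Hom (left_comodule_cat K C P) M N = {f \<in> extensional (carrier M). comodule_map K C M N f}"
  "Idn (left_comodule_cat K C P) M = (\<lambda>x\<in>carrier M. x)"
  "Cmp (left_comodule_cat K C P) L M N g f = compose (carrier L) g f"
  by (simp_all add: left_comodule_cat_def)

lemma (in left_module) linear_map_restrict_iff:
  "linear_map R M N (restrict f (carrier M)) \<longleftrightarrow> linear_map R M N f"
  by (auto simp: linear_map_def smult_closed Pi_iff)

lemma linear_map_funcset: "linear_map K V W f \<Longrightarrow> f \<in> carrier V \<rightarrow> carrier W"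
  by (simp add: linear_map_def)

lemma category_left_module_cat:
  fixes P :: "('r, 'd) module \<Rightarrow> bool"
  shows "category (left_module_cat R P)"
proof -
  have id: "linear_map R M M (\<lambda>x\<in>carrier M. x)" if "left_module R M" for M :: "('r, 'd) module"
    unfolding left_module.linear_map_restrict_iff[OF that] by (rule linear_map_id)
  have cmp: "linear_map R L N (compose (carrier L) g f)"
    if "left_module R L" "linear_map R L M f" "linear_map R M N g"
    for L M N :: "('r, 'd) module" and f g
    unfolding compose_def left_module.linear_map_restrict_iff[OF that(1)]
    by (rule linear_map_compose[OF that(2,3)])
  show ?thesis
    unfolding category_def left_module_cat_sel
  proof (intro conjI ballI)
    fix w x y z f g h
    assume "w \<in> {M. left_module R M \<and> P M}" "x \<in> {M. left_module R M \<and> P M}"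
      and f: "f \<in> {f \<in> extensional (carrier w). linear_map R w x f}"
    then have c: "f \<in> carrier w \<rightarrow> carrier x" by (simp add: linear_map_def)
    show "compose (carrier w) h (compose (carrier w) g f) = compose (carrier w) (compose (carrier x) h g) f"
      by (rule compose_assoc[OF c])
  qed (auto simp: id linear_map_funcset[where K = R] Id_compose intro: cmp compose_Id[OF linear_map_funcset[where K = R]])
qed

lemma (in comod) comodule_map_restrict_iff:
  assumes "comod K C N"
  shows "comodule_map K C M N (restrict f (carrier M)) \<longleftrightarrow> comodule_map K C M N f"
proof -
  interpret N: comod K C N by fact
  have "linear_map K M N (restrict f (carrier M)) \<longleftrightarrow> linear_map K M N f"
    by (rule left_module.linear_map_restrict_iff[OF module_imp_left_module[OF M_module]])
  then show ?thesis
    unfolding comodule_map_iff[OF comodule_data_axioms N.comodule_data_axioms] by (simp add: ract_closed)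
qed

lemma comodule_map_funcset: "comodule_map K C M N f \<Longrightarrow> f \<in> carrier M \<rightarrow> carrier N"
  by (simp add: comodule_map_def linear_map_def)

lemma (in coalgebra) category_left_comodule_cat:
  fixes P :: "('k, 'c, 'd) comodule \<Rightarrow> bool"
  shows "category (left_comodule_cat K C P)"
proof -
  have cm: "comod K C M" if "left_comodule K C M" for M :: "('k, 'c, 'd) comodule"
    by (rule comod.intro[OF coalgebra_axioms that])
  have id: "comodule_map K C M M (\<lambda>x\<in>carrier M. x)" if "left_comodule K C M" for M :: "('k, 'c, 'd) comodule"
    unfolding comod.comodule_map_restrict_iff[OF cm[OF that] cm[OF that]]
    by (rule comod.comodule_mapI[OF cm[OF that] cm[OF that] linear_map_id]) simp
  have cmp: "comodule_map K C L N (compose (carrier L) g f)"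
    if l: "left_comodule K C L" "left_comodule K C M" "left_comodule K C N"
      and f: "comodule_map K C L M f" and g: "comodule_map K C M N g" for L M N :: "('k, 'c, 'd) comodule" and f g
    unfolding compose_def comod.comodule_map_restrict_iff[OF cm[OF l(1)] cm[OF l(3)]]
  proof (rule comod.comodule_mapI[OF cm[OF l(1)] cm[OF l(3)]])
    note fD = comod.comodule_mapD[OF cm[OF l(1)] cm[OF l(2)] f]
    note gD = comod.comodule_mapD[OF cm[OF l(2)] cm[OF l(3)] g]
    show "linear_map K L N (\<lambda>x. g (f x))" by (rule linear_map_compose[OF fD(1) gD(1)])
    show "g (f (ract K C L m h)) = ract K C N (g (f m)) h" if "m \<in> carrier L" "h \<in> dual_space K C" for m h
      using fD(2)[OF that] gD(2)[OF linear_map_closed[OF fD(1) that(1)] that(2)] by simp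
  qed
  show ?thesis
    unfolding category_def left_comodule_cat_sel
  proof (intro conjI ballI)
    fix w x y z f g h
    assume f: "f \<in> {f \<in> extensional (carrier w). comodule_map K C w x f}"
    show "compose (carrier w) h (compose (carrier w) g f) = compose (carrier w) (compose (carrier x) h g) f"
      by (rule compose_assoc[OF comodule_map_funcset[where K = K and C = C]]) (use f in simp)
  qed (auto simp: id comodule_map_funcset[where K = K and C = C] Id_compose
      intro: cmp compose_Id[OF comodule_map_funcset[where K = K and C = C]])
qed

section \<open>The duality\<close>

lemma linear_map_inv_into:
  assumes "left_module R X" "left_module R Y" "linear_map R X Y \<beta>" "bij_betw \<beta> (carrier X) (carrier Y)"
  shows "linear_map R Y X (inv_into (carrier X) \<beta>)"
proof -
  interpret X: left_module R X by fact
  interpret Y: left_module R Y by fact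
  have b: "inv_into (carrier X) \<beta> y \<in> carrier X" "\<beta> (inv_into (carrier X) \<beta> y) = y" if "y \<in> carrier Y" for y
    using that bij_betw_imp_surj_on[OF assms(4)] inv_into_into[of y \<beta> "carrier X"]
      f_inv_into_f[of y \<beta> "carrier X"] by simp_all
  have eq: "inv_into (carrier X) \<beta> y = x" if "x \<in> carrier X" "\<beta> x = y" for x y
    using inv_into_f_f[OF bij_betw_imp_inj_on[OF assms(4)] that(1)] that(2) by simp
  show ?thesis
  proof (rule linear_mapI)
    fix y z assume yz: "y \<in> carrier Y" "z \<in> carrier Y"
    show "inv_into (carrier X) \<beta> (y \<oplus>\<^bsub>Y\<^esub> z) = inv_into (carrier X) \<beta> y \<oplus>\<^bsub>X\<^esub> inv_into (carrier X) \<beta> z"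
      by (rule eq) (simp_all add: b yz linear_map_add[OF assms(3) b(1)[OF yz(1)] b(1)[OF yz(2)]])
  next
    fix a y assume a: "a \<in> carrier R" and y: "y \<in> carrier Y"
    show "inv_into (carrier X) \<beta> (a \<odot>\<^bsub>Y\<^esub> y) = a \<odot>\<^bsub>X\<^esub> inv_into (carrier X) \<beta> y"
      by (rule eq) (simp_all add: b a y X.smult_closed linear_map_smult[OF assms(3) a b(1)[OF y]])
  qed (rule b(1))
qed

lemma iso_arrow_left_module_cat:
  assumes "left_module R X" "left_module R Y" "linear_map R X Y \<beta>" "bij_betw \<beta> (carrier X) (carrier Y)"
  shows "iso_arrow (left_module_cat R P) X Y (restrict \<beta> (carrier X))"
proof -
  let ?i = "inv_into (carrier X) \<beta>"
  note lin = linear_map_inv_into[OF assms]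
  have b: "?i y \<in> carrier X" "\<beta> (?i y) = y" if "y \<in> carrier Y" for y
    using that bij_betw_imp_surj_on[OF assms(4)] inv_into_into[of y \<beta> "carrier X"]
      f_inv_into_f[of y \<beta> "carrier X"] by simp_all
  have i: "?i (\<beta> x) = x" "\<beta> x \<in> carrier Y" if "x \<in> carrier X" for x
    using inv_into_f_f[OF bij_betw_imp_inj_on[OF assms(4)] that] linear_map_closed[OF assms(3) that] by simp_all
  show ?thesis
    unfolding iso_arrow_def left_module_cat_sel
  proof (intro conjI bexI)
    show "restrict \<beta> (carrier X) \<in> {f \<in> extensional (carrier X). linear_map R X Y f}"
      by (simp add: left_module.linear_map_restrict_iff[OF assms(1)] assms(3))
    show "restrict ?i (carrier Y) \<in> {f \<in> extensional (carrier Y). linear_map R Y X f}"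
      by (simp add: left_module.linear_map_restrict_iff[OF assms(2)] lin)
    show "compose (carrier X) (restrict ?i (carrier Y)) (restrict \<beta> (carrier X)) = (\<lambda>x\<in>carrier X. x)"
      unfolding compose_def by (rule restrict_ext) (simp add: i)
    show "compose (carrier Y) (restrict \<beta> (carrier X)) (restrict ?i (carrier Y)) = (\<lambda>x\<in>carrier Y. x)"
      unfolding compose_def by (rule restrict_ext) (simp add: b)
  qed
qed

text \<open>Each element is coded by one chosen list of its coefficients at the generators, and the
  list recovers the element.\<close>

lemma (in left_module) fin_gen_inj_lists:
  fixes \<iota> :: "'a list \<Rightarrow> 'n"
  assumes "fin_gen_module R M" "inj_on \<iota> (lists (carrier R))"
  shows "\<exists>t :: 'c \<Rightarrow> 'n. inj_on t (carrier M)"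
proof -
  obtain n x where x: "x \<in> {..<n} \<rightarrow> carrier M" and gen: "gspan R M x n = carrier M"
    using assms(1) by (auto simp: fin_gen_iff)
  have "\<forall>z\<in>carrier M. \<exists>a. a \<in> {..<n} \<rightarrow> carrier R \<and> z = msum M a x n"
    unfolding gen[symmetric] gspan_def by blast
  then obtain a where a: "\<forall>z\<in>carrier M. a z \<in> {..<n} \<rightarrow> carrier R \<and> z = msum M (a z) x n"
    by (rule bchoice[THEN exE])
  have "inj_on (\<lambda>z. \<iota> (map (a z) [0..<n])) (carrier M)"
  proof (rule inj_onI)
    fix y z assume yz: "y \<in> carrier M" "z \<in> carrier M" and eq: "\<iota> (map (a y) [0..<n]) = \<iota> (map (a z) [0..<n])"
    have l: "map (a w) [0..<n] \<in> lists (carrier R)" if "w \<in> carrier M" for w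
      using bspec[OF a that] by (auto simp: in_lists_conv_set Pi_iff)
    have "map (a y) [0..<n] = map (a z) [0..<n]" by (rule inj_onD[OF assms(2) eq l[OF yz(1)] l[OF yz(2)]])
    then have "a y i = a z i" if "i < n" for i using that by simp
    then have "msum M (a y) x n = msum M (a z) x n" by (intro msum_cong) (use a yz x in simp_all)
    then show "y = z" using a yz by simp
  qed
  then show ?thesis by blast
qed

text \<open>The functor goes from the opposite of the comodules to the modules, and is shown to be
  fully faithful and essentially surjective. Duals of comodules are functions on \<open>'m\<close>
  and have to be relocated to \<open>'n\<close>.\<close>

lemma (in coalgebra) duality:
  fixes \<iota> :: "('c \<Rightarrow> 'k) list \<Rightarrow> 'n" and \<kappa> :: "'c list \<Rightarrow> 'm"
  assumes \<iota>: "inj_on \<iota> (lists (carrier R))" and \<kappa>: "inj_on \<kappa> (lists (carrier C))"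
    and art: "left_artinian_coalgebra K C"
  shows "dual_categories
        (left_module_cat R (noetherian_module R) :: (('c \<Rightarrow> 'k, 'n) module, 'n \<Rightarrow> 'n) cat)
        (left_comodule_cat K C (artinian_comodule K C) :: (('k, 'c, 'm) comodule, 'm \<Rightarrow> 'm) cat)"
    (is "dual_categories ?A ?B")
proof -
  have noeth: "left_noetherian_ring R" using art left_artinian_iff_left_noetherian by simp
  \<comment> \<open>Some injection of the dual into the carrier type of the modules. It exists for
    Artinian \<open>M\<close>, whose dual is finitely generated and hence coded by lists of
    coefficients through \<iota>.\<close>
  define t :: "('k, 'c, 'm) comodule \<Rightarrow> ('m \<Rightarrow> 'k) \<Rightarrow> 'n"
    where "t M = (SOME t. inj_on t (dual_space K M))" for M
  define u where "u M = inv_into (dual_space K M) (t M)" for M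
  define D where "D M = transport_module (t M) (dual_module K C M)" for M
  define T where "T N f \<phi> = (\<lambda>x\<in>carrier N. \<phi> (f x))" for N :: "('k, 'c, 'm) comodule" and f :: "'m \<Rightarrow> 'm" and \<phi> :: "'m \<Rightarrow> 'k"
  \<comment> \<open>On arrows: decode by \<open>u\<close>, transpose, encode by
    \<open>t\<close>.\<close>
  define G where "G = \<lparr>on_ob = D, on_ar = (\<lambda>M N f. \<lambda>z\<in>carrier (D M). t N (T N f (u M z)))\<rparr>"
  have cm: "comod K C M" if "M \<in> Ob ?B" for M
    using that by (simp add: comod.intro[OF coalgebra_axioms])
  have lm: "left_module R (dual_module K C M)" if "M \<in> Ob ?B" for M
    by (rule comod.dual_left_module[OF cm[OF that]])
  have fg: "fin_gen_module R (dual_module K C M)" if "M \<in> Ob ?B" for M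
    using that comod.artinian_iff_noetherian[OF cm[OF that]] left_module.noetherian_imp_fin_gen[OF lm[OF that]] by simp
  have tinj: "inj_on (t M) (dual_space K M)" if "M \<in> Ob ?B" for M
    using left_module.fin_gen_inj_lists[OF lm[OF that] fg[OF that] \<iota>]
    unfolding t_def dual_module_sel by (rule someI_ex[of "\<lambda>t. inj_on t (dual_space K M)"])
  have tinj': "inj_on (t M) (carrier (dual_module K C M))" if "M \<in> Ob ?B" for M using tinj[OF that] by simp
  have Dc: "carrier (D M) = t M ` dual_space K M" for M by (simp add: D_def)
  have lD: "left_module R (D M)" if "M \<in> Ob ?B" for M
    unfolding D_def by (rule transport_left_module[OF lm[OF that] tinj'[OF that]])
  have tlin: "linear_map R (dual_module K C M) (D M) (t M)" and ulin: "linear_map R (D M) (dual_module K C M) (u M)"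
    if "M \<in> Ob ?B" for M
    using transport_linear[OF lm[OF that] tinj'[OF that]] by (simp_all add: D_def u_def)
  have ut: "u M (t M \<phi>) = \<phi>" if "M \<in> Ob ?B" "\<phi> \<in> dual_space K M" for M \<phi>
    unfolding u_def by (rule inv_into_f_f[OF tinj[OF that(1)] that(2)])
  have tu: "t M (u M z) = z" and uc: "u M z \<in> dual_space K M" if "z \<in> carrier (D M)" for M z
    using that f_inv_into_f[of z "t M" "dual_space K M"] inv_into_into[of z "t M" "dual_space K M"]
    by (simp_all add: Dc u_def)
  have Tlin: "linear_map R (dual_module K C M) (dual_module K C N) (T N f)"
    if "M \<in> Ob ?B" "N \<in> Ob ?B" "comodule_map K C N M f" for M N f
    unfolding T_def by (rule transpose_linear[OF cm[OF that(2)] cm[OF that(1)] that(3)])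
  have Tc: "T N f \<phi> \<in> dual_space K N"
    if "M \<in> Ob ?B" "N \<in> Ob ?B" "comodule_map K C N M f" "\<phi> \<in> dual_space K M" for M N f \<phi>
    using linear_map_closed[OF Tlin[OF that(1-3)], of \<phi>] that(4) by simp
  have Gob: "on_ob G = D" and Gar: "on_ar G M N f = (\<lambda>z\<in>carrier (D M). t N (T N f (u M z)))" for M N f
    by (simp_all add: G_def)
  have DA: "D M \<in> Ob ?A" if M: "M \<in> Ob ?B" for M
  proof -
    have "fin_gen_module R (D M)"
      by (rule fin_gen_image[OF lm[OF M] lD[OF M] tlin[OF M] _ fg[OF M]]) (simp add: Dc)
    then show ?thesis using lD[OF M] left_module.fin_gen_imp_noetherian[OF lD[OF M] noeth] by simp
  qed
  note carr = comodule_map_funcset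
  have GH: "on_ar G M N f \<in> Hom ?A (D M) (D N)"
    if M: "M \<in> Ob ?B" and N: "N \<in> Ob ?B" and f: "f \<in> Hom ?B N M" for M N f
  proof -
    have "comodule_map K C N M f" using f by simp
    note l = linear_map_compose[OF linear_map_compose[OF ulin[OF M] Tlin[OF M N this]] tlin[OF N]]
    show ?thesis unfolding Gar left_module_cat_sel
      by (simp add: left_module.linear_map_restrict_iff[OF lD[OF M]] l)
  qed
  have Gfunctor: "is_functor (op_cat ?B) ?A G"
    unfolding is_functor_def op_cat_sel Gob
  proof (intro conjI ballI)
    fix M assume M: "M \<in> Ob ?B"
    show "D M \<in> Ob ?A" by (rule DA[OF M])
    show "on_ar G M M (Idn ?B M) = Idn ?A (D M)"
      unfolding Gar left_module_cat_sel left_comodule_cat_sel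
    proof (rule restrict_ext)
      fix z assume z: "z \<in> carrier (D M)"
      have "T M (\<lambda>x\<in>carrier M. x) (u M z) = restrict (u M z) (carrier M)"
        unfolding T_def by (rule restrict_ext) simp
      also have "\<dots> = u M z" using uc[OF z] by (simp add: dual_space_def extensional_restrict)
      finally show "t M (T M (\<lambda>x\<in>carrier M. x) (u M z)) = z" using tu[OF z] by simp
    qed
    fix N f assume N: "N \<in> Ob ?B" and f: "f \<in> Hom ?B N M"
    show "on_ar G M N f \<in> Hom ?A (D M) (D N)" by (rule GH[OF M N f])
  next
    fix L M N f g assume L: "L \<in> Ob ?B" and M: "M \<in> Ob ?B" and N: "N \<in> Ob ?B"
      and f: "f \<in> Hom ?B M L" and g: "g \<in> Hom ?B N M"
    have f': "comodule_map K C M L f" and g': "comodule_map K C N M g" using f g by simp_all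
    show "on_ar G L N (Cmp ?B N M L f g) = Cmp ?A (D L) (D M) (D N) (on_ar G M N g) (on_ar G L M f)"
      unfolding Gar left_module_cat_sel left_comodule_cat_sel compose_def[of "carrier (D L)"]
    proof (rule restrict_ext)
      fix z assume z: "z \<in> carrier (D L)"
      note c = Tc[OF L M f' uc[OF z]]
      have "T N (compose (carrier N) f g) (u L z) = T N g (T M f (u L z))"
        unfolding T_def by (rule restrict_ext) (use carr[OF g'] in \<open>auto simp: compose_def\<close>)
      then show "t N (T N (compose (carrier N) f g) (u L z)) =
        (\<lambda>z\<in>carrier (D M). t N (T N g (u M z))) ((\<lambda>z\<in>carrier (D L). t M (T M f (u L z))) z)"
        using z c by (simp add: ut[OF M c] Dc)
    qed
  qed
  \<comment> \<open>Faithful because functionals separate the points of \<open>M\<close>; full by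
    \<open>dual_full\<close>, applied to the homomorphism between the duals themselves.\<close>
  have ff: "bij_betw (on_ar G M N) (Hom (op_cat ?B) M N) (Hom ?A (on_ob G M) (on_ob G N))"
    if "M \<in> Ob (op_cat ?B)" "N \<in> Ob (op_cat ?B)" for M N
  proof -
    have M: "M \<in> Ob ?B" and N: "N \<in> Ob ?B" using that by simp_all
    interpret CM: comod K C M by (rule cm[OF M])
    interpret CN: comod K C N by (rule cm[OF N])
    show ?thesis
      unfolding Gob op_cat_sel bij_betw_def
    proof (intro conjI inj_onI equalityI subsetI)
      fix f f' assume f: "f \<in> Hom ?B N M" and f': "f' \<in> Hom ?B N M" and eq: "on_ar G M N f = on_ar G M N f'"
      have m: "comodule_map K C N M f" "comodule_map K C N M f'"
        and e: "f \<in> extensional (carrier N)" "f' \<in> extensional (carrier N)" using f f' by simp_all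
      show "f = f'"
      proof (rule extensionalityI[OF e])
        fix x assume x: "x \<in> carrier N"
        show "f x = f' x"
        proof (rule CM.CM.WW.dual_separates)
          show "f x \<in> carrier M" "f' x \<in> carrier M" using carr[OF m(1)] carr[OF m(2)] x by auto
          fix \<phi> assume \<phi>: "\<phi> \<in> dual_space K M"
          have "t N (T N f \<phi>) = t N (T N f' \<phi>)"
            using fun_cong[OF eq, of "t M \<phi>"] \<phi> by (simp add: Gar Dc ut[OF M \<phi>])
          then have "T N f \<phi> = T N f' \<phi>"
            by (rule inj_onD[OF tinj[OF N] _ Tc[OF M N m(1) \<phi>] Tc[OF M N m(2) \<phi>]])
          from fun_cong[OF this, of x] show "\<phi> (f x) = \<phi> (f' x)" using x by (simp add: T_def)
        qed
      qed
    next
      fix \<Psi> assume "\<Psi> \<in> on_ar G M N ` Hom ?B N M"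
      then show "\<Psi> \<in> Hom ?A (D M) (D N)" using GH[OF M N] by blast
    next
      fix \<Psi> assume "\<Psi> \<in> Hom ?A (D M) (D N)"
      then have e: "\<Psi> \<in> extensional (carrier (D M))" and \<Psi>: "linear_map R (D M) (D N) \<Psi>" by simp_all
      note \<Phi> = linear_map_compose[OF linear_map_compose[OF tlin[OF M] \<Psi>] ulin[OF N]]
      obtain h where h: "comodule_map K C N M h"
        and hv: "\<forall>\<psi>\<in>dual_space K M. \<forall>m\<in>carrier N. u N (\<Psi> (t M \<psi>)) m = \<psi> (h m)"
        using dual_full[OF cm[OF N] cm[OF M] fg[OF M] \<Phi>] by blast
      have r: "restrict h (carrier N) \<in> Hom ?B N M"
        using CN.comodule_map_restrict_iff[OF cm[OF M]] h by simp
      have "\<Psi> = on_ar G M N (restrict h (carrier N))"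
      proof (rule extensionalityI[OF e])
        show "on_ar G M N (restrict h (carrier N)) \<in> extensional (carrier (D M))" by (simp add: Gar)
        fix z assume z: "z \<in> carrier (D M)"
        note zN = linear_map_closed[OF \<Psi> z]
        have "T N (restrict h (carrier N)) (u M z) = u N (\<Psi> z)"
        proof (rule dual_space_ext[where K = K and V = N])
          show "T N (restrict h (carrier N)) (u M z) \<in> dual_space K N"
            by (rule Tc[OF M N _ uc[OF z]]) (use r in simp)
          show "u N (\<Psi> z) \<in> dual_space K N" by (rule uc[OF zN])
          fix x assume x: "x \<in> carrier N"
          show "T N (restrict h (carrier N)) (u M z) x = u N (\<Psi> z) x"
            using bspec[OF bspec[OF hv uc[OF z]] x] tu[OF z] x by (simp add: T_def)
        qed
        then show "\<Psi> z = on_ar G M N (restrict h (carrier N)) z" using tu[OF zN] z by (simp add: Gar)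
      qed
      then show "\<Psi> \<in> on_ar G M N ` Hom ?B N M" using r by (rule image_eqI)
    qed
  qed
  have es: "\<exists>M\<in>Ob (op_cat ?B). \<exists>f. iso_arrow ?A X (on_ob G M) f" if "X \<in> Ob ?A" for X
  proof -
    have X: "left_module R X" and n: "noetherian_module R X" using that by simp_all
    note fX = left_module.noetherian_imp_fin_gen[OF X n]
    obtain M :: "('k, 'c, 'm) comodule" and \<alpha> where M: "left_comodule K C M"
      and \<alpha>: "linear_map R X (dual_module K C M) \<alpha>" "bij_betw \<alpha> (carrier X) (dual_space K M)"
      using dual_essentially_surjective[OF art \<kappa> X fX] by blast
    interpret CM: comod K C M by (rule comod.intro[OF coalgebra_axioms M])
    \<comment> \<open>The comodule obtained has to be an object: its dual is an image of
      \<open>X\<close>, hence finitely generated and Noetherian, so the comodule is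
      Artinian.\<close>
    have "fin_gen_module R (dual_module K C M)"
      by (rule fin_gen_image[OF X CM.dual_left_module \<alpha>(1) _ fX]) (simp add: bij_betw_imp_surj_on[OF \<alpha>(2)])
    then have "artinian_comodule K C M"
      unfolding CM.artinian_iff_noetherian by (rule left_module.fin_gen_imp_noetherian[OF CM.dual_left_module noeth])
    then have MB: "M \<in> Ob ?B" using M by simp
    have "bij_betw (t M) (dual_space K M) (carrier (D M))"
      unfolding Dc by (rule inj_on_imp_bij_betw[OF tinj[OF MB]])
    then have "bij_betw (\<lambda>x. t M (\<alpha> x)) (carrier X) (carrier (D M))"
      using bij_betw_trans[OF \<alpha>(2)] by (simp add: comp_def)
    from iso_arrow_left_module_cat[OF X lD[OF MB] linear_map_compose[OF \<alpha>(1) tlin[OF MB]] this]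
    show ?thesis unfolding Gob op_cat_sel using MB by blast
  qed
  show ?thesis
    unfolding dual_categories_def
    by (rule equivalent_categoriesI[OF category_left_module_cat category_op_cat[OF category_left_comodule_cat] Gfunctor ff es])
qed

theorem corollary2p4:
  fixes K :: "'k ring" and C :: "('k, 'c) coalgebra"
    and \<iota> :: "('c \<Rightarrow> 'k) list \<Rightarrow> 'n" and \<kappa> :: "'c list \<Rightarrow> 'm"
  assumes "coalgebra K C"
    and "inj_on \<iota> (lists (carrier (dual_algebra K C)))"
    and "inj_on \<kappa> (lists (carrier C))"
  shows "(left_artinian_coalgebra K C \<longleftrightarrow> left_noetherian_ring (dual_algebra K C)) \<and>
    (left_artinian_coalgebra K C \<longrightarrow>
      (\<forall>X :: ('c \<Rightarrow> 'k, 'n) module. left_module (dual_algebra K C) X \<longrightarrow>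
         (noetherian_module (dual_algebra K C) X \<longleftrightarrow> fin_gen_module (dual_algebra K C) X)) \<and>
      (\<forall>M :: ('k, 'c, 'm) comodule. left_comodule K C M \<longrightarrow>
         (artinian_comodule K C M \<longleftrightarrow> fin_cogen_comodule K C M)) \<and>
      dual_categories
        (left_module_cat (dual_algebra K C) (noetherian_module (dual_algebra K C)) ::
           (('c \<Rightarrow> 'k, 'n) module, 'n \<Rightarrow> 'n) cat)
        (left_comodule_cat K C (artinian_comodule K C) ::
           (('k, 'c, 'm) comodule, 'm \<Rightarrow> 'm) cat))"
proof -
  interpret coalgebra K C by (rule assms(1))
  show ?thesis
  proof (intro conjI impI allI)
    show "left_artinian_coalgebra K C \<longleftrightarrow> left_noetherian_ring R"
      by (rule left_artinian_iff_left_noetherian)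
    assume art: "left_artinian_coalgebra K C"
    then have noeth: "left_noetherian_ring R" using left_artinian_iff_left_noetherian by simp
    show "noetherian_module R X \<longleftrightarrow> fin_gen_module R X" if "left_module R X"
      for X :: "('c \<Rightarrow> 'k, 'n) module"
      by (rule left_module.noetherian_iff_fin_gen[OF that noeth])
    show "artinian_comodule K C M \<longleftrightarrow> fin_cogen_comodule K C M" if "left_comodule K C M"
      for M :: "('k, 'c, 'm) comodule"
    proof -
      interpret M: comod K C M by (rule comod.intro[OF coalgebra_axioms that])
      \<comment> \<open>Both properties are read on the dual module, where they become the
        Noetherian property and finite generation over a left Noetherian ring.\<close>
      show ?thesis
        unfolding M.artinian_iff_noetherian M.fin_cogen_iff_fin_gen
        by (rule left_module.noetherian_iff_fin_gen[OF M.dual_left_module noeth])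
    qed
    show "dual_categories
        (left_module_cat R (noetherian_module R) :: (('c \<Rightarrow> 'k, 'n) module, 'n \<Rightarrow> 'n) cat)
        (left_comodule_cat K C (artinian_comodule K C) :: (('k, 'c, 'm) comodule, 'm \<Rightarrow> 'm) cat)"
      by (rule duality[OF assms(2,3) art])
  qed
qed

end
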